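(* Let $n\ge2$, let $\boldsymbol a=(a_1,\dots,a_{n-1}),\boldsymbol b=(b_1,\dots,b_{n-1})\in\mathbb Z_{\ge0}^{n-1}$, and let $p'\neq p$ be integers such that $a_n:=p'-1-\sum_{i=1}^{n-1}(a_i+1)$ and $b_n:=p-1-\sum_{i=1}^{n-1}(b_i+1)$ belong to $\mathbb Z_{\ge0}$. Assume the resonance $q_1^{p'}q_3^p=1$, in the precise sense that for $x,y\in\mathbb Z$ one has $q_1^xq_3^y=1$ if and only if $x=p'\kappa$, $y=p\kappa$ for some $\kappa\in\mathbb Z$; let $u\in\mathbb C^\times$, $u_1=u$, $u_i=u_{i+1}q_1^{a_i+1}q_3^{b_i+1}$ for $i=1,\dots,n-1$. Assume in addition that $p>n$. Then the $\mathcal E$-module $\mathcal M^{p',p}_{\boldsymbol a,\boldsymbol b}(u)$ is an irreducible, tame, highest weight $\mathcal E$-module with highest weight $\prod_{i=1}^n\psi^\pm_\emptyset(u_i/z)$.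
   Context: **Algebra.** $q_1,q_2,q_3\in\mathbb C^\times$ satisfy $q_1q_2q_3=1$ and none of them is a root of unity. Put $g(z,w)=(z-q_1w)(z-q_2w)(z-q_3w)$, $\delta(z)=\sum_{k\in\mathbb Z}z^k$. The algebra $\mathcal E$ is the associative algebra generated by $e_i,f_i$ ($i\in\mathbb Z$), $\psi^+_i,\psi^-_{-i}$ ($i\ge0$) and $(\psi_0^\pm)^{-1}$; with $e(z)=\sum_i e_iz^{-i}$, $f(z)=\sum_i f_iz^{-i}$, $\psi^\pm(z)=\sum_{\pm i\ge0}\psi^\pm_iz^{-i}$ the relations are: $g(z,w)e(z)e(w)=-g(w,z)e(w)e(z)$; $g(w,z)f(z)f(w)=-g(z,w)f(w)f(z)$; $g(z,w)\psi^\pm(z)e(w)=-g(w,z)e(w)\psi^\pm(z)$; $g(w,z)\psi^\pm(z)f(w)=-g(z,w)f(w)\psi^\pm(z)$; $[e(z),f(w)]=\frac{\delta(z/w)}{g(1,1)}(\psi^+(z)-\psi^-(z))$; all $\psi^\pm_i$ commute with each other; $\psi^\pm_0(\psi^\pm_0)^{-1}=(\psi^\pm_0)^{-1}\psi^\pm_0=1$; $[e_0,[e_1,e_{-1}]]=0=[f_0,[f_1,f_{-1}]]$. A module is tame if the operators $\psi^+_i,\psi^-_{-i}$ ($i\ge0$) are diagonalizable with simple joint spectrum. It is a highest weight module with highest vector $v$ and highest weight $\phi^\pm(z)\in\mathbb C[[z^{\mp1}]]$ if $v$ generates it, $f(z)v=0$ and $\psi^\pm(z)v=\phi^\pm(z)v$.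 **Fock spaces.** $\mathcal P^+$ is the set of finite partitions $\lambda=(\lambda_1\ge\lambda_2\ge\cdots)$ (integers, finitely many nonzero), $\emptyset$ the empty partition. $\mathcal F(u)$ has basis $|\lambda\rangle$, $\lambda\in\mathcal P^+$. Set $$\psi_{\lambda,j}(x)=\frac{(1-q_1^{\lambda_j}q_3^{j}x)(1-q_1^{\lambda_j}q_2q_3^{j-1}x)}{(1-q_1^{\lambda_j}q_3^{j-1}x)(1-q_1^{\lambda_j-1}q_3^{j-1}x)},\qquad \psi_\lambda(x)=\frac{1-q_2x}{1-x}\prod_{j\ge1}\frac{\psi_{\lambda,j}(x)}{\psi_{\emptyset,j}(x)}$$ (all but finitely many factors are 1). $\psi_\emptyset^+(x)=\frac{1-q_2x}{1-x}$ expanded in powers of $x$, and $\psi^-_\emptyset(x)=q_2\frac{1-q_2^{-1}x^{-1}}{1-x^{-1}}$ expanded in powers of $x^{-1}$. **Tensor product action (independent parameters $q_1,q_3,u_1,\dots,u_n$).** The basis is $|\boldsymbol\lambda\rangle=|\lambda^{(1)}\rangle\otimes\dots\otimes|\lambda^{(n)}\rangle$, $\lambda^{(i)}\in\mathcal P^+$; $\boldsymbol\lambda+\mathbf 1^{(i)}_s$ is $\boldsymbol\lambda$ with $\lambda^{(i)}_s$ increased by 1. $\psi^\pm(z)|\boldsymbol\lambda\rangle=\prod_i\psi_{\lambda^{(i)}}(u_i/z)|\boldsymbol\lambda\rangle$ (expanded in $z^{\mp1}$). For $\boldsymbol\lambda,\boldsymbol\lambda+\mathbf 1_s^{(i)}$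 both $n$-tuples of finite partitions and $v=q_1^{\lambda^{(i)}_s}q_3^{s-1}u_i$, $$\langle\boldsymbol\lambda+\mathbf1_s^{(i)}|e(z)|\boldsymbol\lambda\rangle=\frac{\delta(v/z)}{1-q_1}\prod_{j<i}\psi_{\lambda^{(j)}}(u_j/v)\prod_{t<s}\psi_{\lambda^{(i)},t}(u_i/v),$$ $$\langle\boldsymbol\lambda|f(z)|\boldsymbol\lambda+\mathbf1_s^{(i)}\rangle=\frac{q_1\delta(v/z)}{1-q_1}\cdot\frac{1-q_2q_3^{s}u_i/v}{1-q_3^su_i/v}\prod_{t>s}\frac{\psi_{\lambda^{(i)},t}(u_i/v)}{\psi_{\emptyset,t}(u_i/v)}\prod_{j>i}\psi_{\lambda^{(j)}}(u_j/v);$$ all other matrix coefficients of $e(z),f(z)$ are zero. **The space $\mathcal M_{\boldsymbol a,\boldsymbol b}(u)$ for generic $q_1,q_3,u$.** Specialize $u_1=u$, $u_i=u_{i+1}q_1^{a_i+1}q_3^{b_i+1}$ for $i=1,\dots,n-1$, and let $\mathcal M_{\boldsymbol a,\boldsymbol b}(u)$ be the span of the $|\lambda^{(1)},\dots,\lambda^{(n)}\rangle$ with $\lambda^{(i)}_s\ge\lambda^{(i+1)}_{s+b_i}-a_i$ for $s\ge1$, $i=1,\dots,n-1$. Its matrix coefficients between basis vectors are obtained from those of the tensor product (rational functions of independent $q_1,q_3,u_1,\dots,u_n$, $q_2=(q_1q_3)^{-1}$, times delta functions) by cancelling common factors and then substituting the special $u_i$; they are regular and become rational functions of $q_1,q_3,u$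 times delta functions. **The module $\mathcal M^{p',p}_{\boldsymbol a,\boldsymbol b}(u)$.** With $\lambda^{(n+1)}=\lambda^{(1)}$, $$\mathcal M^{p',p}_{\boldsymbol a,\boldsymbol b}(u)=\operatorname{span}\{|\lambda^{(1)},\dots,\lambda^{(n)}\rangle:\ \lambda^{(i)}\in\mathcal P^+,\ \lambda^{(i)}_s\ge\lambda^{(i+1)}_{s+b_i}-a_i,\ s\in\mathbb Z_{\ge1},\ i=1,\dots,n\}.$$ The matrix coefficients of $\psi^\pm(z),e(z),f(z)$ on it between its basis vectors are the corresponding matrix coefficients of $\mathcal M_{\boldsymbol a,\boldsymbol b}(u)$, where in the rational functions of $q_1,q_3,u$ one first cancels common factors and then substitutes values with $q_1^{p'}q_3^p=1$; these values are well-defined and define an $\mathcal E$-module structure. *)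

theory Defs
  imports
    Complex_Main
    "HOL-Library.Function_Algebras"
    "HOL-Library.Poly_Mapping"
    "HOL-Computational_Algebra.Fraction_Field"
    "HOL-Computational_Algebra.Formal_Laurent_Series"
begin

section \<open>The algebra and its modules\<close>

text \<open>
  \<open>Gen_e i\<close>, \<open>Gen_f i\<close> are the modes of \<open>e(z) = \<Sum> e_i z^(-i)\<close> and \<open>f(z)\<close>;
  \<open>Gen_psip i\<close> is \<open>\<psi>^+_i\<close> and \<open>Gen_psim i\<close> is \<open>\<psi>^-_(-i)\<close>, for natural \<open>i\<close>;
  the last two are the inverses of \<open>\<psi>^+_0\<close> and \<open>\<psi>^-_0\<close>.
\<close>

datatype gen =
  Gen_e int | Gen_f int | Gen_psip nat | Gen_psim nat | Gen_psip0_inv | Gen_psim0_inv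

text \<open>
  A module over the algebra given by these generators and the relations below is a complex vector
  space with one linear operator per generator such that the relations hold. The space is a subspace
  \<open>V\<close> of an ambient type, with scalar multiplication \<open>sc\<close>; operators are only relevant on \<open>V\<close>.

  A formal series in \<open>z, w\<close> is the family \<open>A i j\<close> of the coefficients of \<open>z^(-i) w^(-j)\<close>, so that
  multiplication by \<open>z\<close> (by \<open>w\<close>) raises the index \<open>i\<close> (the index \<open>j\<close>) by one.
\<close>

type_synonym 'v operator = "'v \<Rightarrow> 'v"

definition mul_z_minus ::
  "(complex \<Rightarrow> 'v \<Rightarrow> 'v) \<Rightarrow> complex \<Rightarrow> (int \<Rightarrow> int \<Rightarrow> 'v operator) \<Rightarrow> int \<Rightarrow> int \<Rightarrow> 'v::ab_group_add operator"
  \<comment> \<open>multiplication by \<open>z - q w\<close>\<close>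
  where "mul_z_minus sc q A = (\<lambda>i j v. A (i + 1) j v - sc q (A i (j + 1) v))"

definition mul_w_minus ::
  "(complex \<Rightarrow> 'v \<Rightarrow> 'v) \<Rightarrow> complex \<Rightarrow> (int \<Rightarrow> int \<Rightarrow> 'v operator) \<Rightarrow> int \<Rightarrow> int \<Rightarrow> 'v::ab_group_add operator"
  \<comment> \<open>multiplication by \<open>w - q z\<close>\<close>
  where "mul_w_minus sc q A = (\<lambda>i j v. A i (j + 1) v - sc q (A (i + 1) j v))"

locale toroidal_action =
  fixes q1 q2 q3 :: complex
    and sc :: "complex \<Rightarrow> 'v::ab_group_add \<Rightarrow> 'v"
    and V :: "'v set"
    and \<rho> :: "gen \<Rightarrow> 'v operator"
begin

definition mul_g_zw :: "(int \<Rightarrow> int \<Rightarrow> 'v operator) \<Rightarrow> int \<Rightarrow> int \<Rightarrow> 'v operator"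
  \<comment> \<open>multiplication by \<open>g(z,w)\<close>\<close>
  where "mul_g_zw A = mul_z_minus sc q1 (mul_z_minus sc q2 (mul_z_minus sc q3 A))"

definition mul_g_wz :: "(int \<Rightarrow> int \<Rightarrow> 'v operator) \<Rightarrow> int \<Rightarrow> int \<Rightarrow> 'v operator"
  \<comment> \<open>multiplication by \<open>g(w,z)\<close>\<close>
  where "mul_g_wz A = mul_w_minus sc q1 (mul_w_minus sc q2 (mul_w_minus sc q3 A))"

definition g11 :: complex
  where "g11 = (1 - q1) * (1 - q2) * (1 - q3)"

definition e :: "int \<Rightarrow> 'v operator" where "e i = \<rho> (Gen_e i)"

definition f :: "int \<Rightarrow> 'v operator" where "f i = \<rho> (Gen_f i)"

definition psi_plus :: "int \<Rightarrow> 'v operator"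
  where "psi_plus i = (if i \<ge> 0 then \<rho> (Gen_psip (nat i)) else (\<lambda>v. 0))"

definition psi_minus :: "int \<Rightarrow> 'v operator"
  where "psi_minus i = (if i \<le> 0 then \<rho> (Gen_psim (nat (- i))) else (\<lambda>v. 0))"

definition commutator :: "'v operator \<Rightarrow> 'v operator \<Rightarrow> 'v operator"
  where "commutator A B = (\<lambda>v. A (B v) - B (A v))"

definition relations :: bool where
  "relations \<longleftrightarrow> (\<forall>v\<in>V.
     (\<forall>i j. mul_g_zw (\<lambda>i j. e i \<circ> e j) i j v = - mul_g_wz (\<lambda>i j. e j \<circ> e i) i j v) \<and>
     (\<forall>i j. mul_g_wz (\<lambda>i j. f i \<circ> f j) i j v = - mul_g_zw (\<lambda>i j. f j \<circ> f i) i j v) \<and>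
     (\<forall>psi\<in>{psi_plus, psi_minus}. \<forall>i j.
        mul_g_zw (\<lambda>i j. psi i \<circ> e j) i j v = - mul_g_wz (\<lambda>i j. e j \<circ> psi i) i j v \<and>
        mul_g_wz (\<lambda>i j. psi i \<circ> f j) i j v = - mul_g_zw (\<lambda>i j. f j \<circ> psi i) i j v) \<and>
     (\<forall>i j. commutator (e i) (f j) v = sc (1 / g11) (psi_plus (i + j) v - psi_minus (i + j) v)) \<and>
     (\<forall>psi\<in>{psi_plus, psi_minus}. \<forall>psi'\<in>{psi_plus, psi_minus}. \<forall>i j.
        commutator (psi i) (psi' j) v = 0) \<and>
     \<rho> Gen_psip0_inv (psi_plus 0 v) = v \<and> psi_plus 0 (\<rho> Gen_psip0_inv v) = v \<and>
     \<rho> Gen_psim0_inv (psi_minus 0 v) = v \<and> psi_minus 0 (\<rho> Gen_psim0_inv v) = v \<and>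
     commutator (e 0) (commutator (e 1) (e (-1))) v = 0 \<and>
     commutator (f 0) (commutator (f 1) (f (-1))) v = 0)"

definition E_module :: bool where
  "E_module \<longleftrightarrow> vector_space sc \<and> module.subspace sc V \<and>
     (\<forall>g. (\<forall>v\<in>V. \<rho> g v \<in> V) \<and>
          (\<forall>v\<in>V. \<forall>w\<in>V. \<rho> g (v + w) = \<rho> g v + \<rho> g w) \<and>
          (\<forall>c. \<forall>v\<in>V. \<rho> g (sc c v) = sc c (\<rho> g v))) \<and>
     relations"

definition submodule :: "'v set \<Rightarrow> bool" where
  "submodule W \<longleftrightarrow> module.subspace sc W \<and> W \<subseteq> V \<and> (\<forall>g. \<forall>v\<in>W. \<rho> g v \<in> W)"

definition irreducible_module :: bool where
  "irreducible_module \<longleftrightarrow> V \<noteq> {0} \<and> (\<forall>W. submodule W \<longrightarrow> W = {0} \<or> W = V)"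

definition joint_eigenspace :: "(nat \<Rightarrow> complex) \<Rightarrow> (nat \<Rightarrow> complex) \<Rightarrow> 'v set" where
  "joint_eigenspace cp cm =
     {v \<in> V. \<forall>i. \<rho> (Gen_psip i) v = sc (cp i) v \<and> \<rho> (Gen_psim i) v = sc (cm i) v}"

text \<open>Tame: the joint eigenvectors span \<open>V\<close>, and every joint eigenspace is at most one-dimensional.\<close>

definition tame :: bool where
  "tame \<longleftrightarrow>
     module.span sc (\<Union>cp cm. joint_eigenspace cp cm) = V \<and>
     (\<forall>cp cm. \<forall>v\<in>joint_eigenspace cp cm. \<forall>w\<in>joint_eigenspace cp cm. v \<noteq> 0 \<longrightarrow> (\<exists>c. w = sc c v))"

text \<open>
  \<open>\<phi>p\<close> is a power series in \<open>z^(-1)\<close> and \<open>\<phi>m\<close> a power series in \<open>z\<close>.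
\<close>

definition highest_weight_vector :: "complex fps \<Rightarrow> complex fps \<Rightarrow> 'v \<Rightarrow> bool" where
  "highest_weight_vector \<phi>p \<phi>m v \<longleftrightarrow> v \<in> V \<and>
     (\<forall>W. submodule W \<and> v \<in> W \<longrightarrow> W = V) \<and>
     (\<forall>i. \<rho> (Gen_f i) v = 0) \<and>
     (\<forall>i. \<rho> (Gen_psip i) v = sc (fps_nth \<phi>p i) v \<and> \<rho> (Gen_psim i) v = sc (fps_nth \<phi>m i) v)"

definition highest_weight_module :: "complex fps \<Rightarrow> complex fps \<Rightarrow> bool" where
  "highest_weight_module \<phi>p \<phi>m \<longleftrightarrow> (\<exists>v. highest_weight_vector \<phi>p \<phi>m v)"

end


section \<open>Tuples of partitions\<close>

text \<open>
  Parts of a partition and components of a tuple are numbered from 1. Unused entries are set to zero,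
  so that equal tuples are equal functions.
\<close>

definition is_partition :: "(nat \<Rightarrow> nat) \<Rightarrow> bool" where
  "is_partition l \<longleftrightarrow> l 0 = 0 \<and> (\<forall>s\<ge>1. l (Suc s) \<le> l s) \<and> finite {s. l s \<noteq> 0}"

type_synonym ptuple = "nat \<Rightarrow> nat \<Rightarrow> nat"

definition is_ptuple :: "nat \<Rightarrow> ptuple \<Rightarrow> bool" where
  "is_ptuple n lam \<longleftrightarrow> (\<forall>i\<in>{1..n}. is_partition (lam i)) \<and> (\<forall>i. i \<notin> {1..n} \<longrightarrow> lam i = (\<lambda>_. 0))"

definition add_box :: "ptuple \<Rightarrow> nat \<Rightarrow> nat \<Rightarrow> ptuple" where
  "add_box lam i s = lam(i := (lam i)(s := lam i s + 1))"


section \<open>Matrix coefficients of the tensor product of Fock spaces\<close>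

text \<open>
  All formulas are polymorphic in the field of parameters. They are used over the field of rational
  functions in independent \<open>q1, q3, u_1, u_2, ...\<close>, and, for \<open>\<psi>(x)\<close>, over Laurent
  series with \<open>x\<close> a multiple of the series variable or of its inverse.
\<close>

abbreviation q2_of :: "'k::field \<Rightarrow> 'k \<Rightarrow> 'k" where
  "q2_of q1 q3 \<equiv> inverse (q1 * q3)"

definition psi_row :: "'k::field \<Rightarrow> 'k \<Rightarrow> int \<Rightarrow> int \<Rightarrow> 'k \<Rightarrow> 'k" where
  "psi_row q1 q3 m j x =
     ((1 - q1 powi m * q3 powi j * x) * (1 - q1 powi m * q2_of q1 q3 * q3 powi (j - 1) * x)) /
     ((1 - q1 powi m * q3 powi (j - 1) * x) * (1 - q1 powi (m - 1) * q3 powi (j - 1) * x))"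

definition psi_ratio :: "'k::field \<Rightarrow> 'k \<Rightarrow> (nat \<Rightarrow> nat) \<Rightarrow> nat \<Rightarrow> 'k \<Rightarrow> 'k" where
  "psi_ratio q1 q3 l j x = psi_row q1 q3 (int (l j)) (int j) x / psi_row q1 q3 0 (int j) x"

text \<open>The infinite products over \<open>j\<close> are restricted to \<open>l j \<noteq> 0\<close>: the other factors are 1.\<close>

definition psi :: "'k::field \<Rightarrow> 'k \<Rightarrow> (nat \<Rightarrow> nat) \<Rightarrow> 'k \<Rightarrow> 'k" where
  "psi q1 q3 l x =
     (1 - q2_of q1 q3 * x) / (1 - x) * (\<Prod>j\<in>{j. j \<ge> 1 \<and> l j \<noteq> 0}. psi_ratio q1 q3 l j x)"

text \<open>
  Eigenvalue \<open>\<Prod>i \<psi>_(\<lambda>^(i))(u_i/z)\<close> as a Laurent series in \<open>z^(-1)\<close> if \<open>zinv = fls_X\<close> and in \<open>z\<close> if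
  \<open>zinv = fls_X_inv\<close>.
\<close>

definition psi_series :: "'k::field \<Rightarrow> 'k \<Rightarrow> (nat \<Rightarrow> 'k) \<Rightarrow> nat \<Rightarrow> ptuple \<Rightarrow> 'k fls \<Rightarrow> 'k fls" where
  "psi_series q1 q3 u n lam zinv =
     (\<Prod>i\<in>{1..n}. psi (fls_const q1) (fls_const q3) (lam i) (fls_const (u i) * zinv))"

definition psi_plus_coeff :: "'k::field \<Rightarrow> 'k \<Rightarrow> (nat \<Rightarrow> 'k) \<Rightarrow> nat \<Rightarrow> ptuple \<Rightarrow> nat \<Rightarrow> 'k" where
  "psi_plus_coeff q1 q3 u n lam k = fls_nth (psi_series q1 q3 u n lam fls_X) (int k)"

definition psi_minus_coeff :: "'k::field \<Rightarrow> 'k \<Rightarrow> (nat \<Rightarrow> 'k) \<Rightarrow> nat \<Rightarrow> ptuple \<Rightarrow> nat \<Rightarrow> 'k" where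
  "psi_minus_coeff q1 q3 u n lam k = fls_nth (psi_series q1 q3 u n lam fls_X_inv) (int k)"

definition box_weight :: "'k::field \<Rightarrow> 'k \<Rightarrow> (nat \<Rightarrow> 'k) \<Rightarrow> ptuple \<Rightarrow> nat \<Rightarrow> nat \<Rightarrow> 'k" where
  "box_weight q1 q3 u lam i s = q1 powi int (lam i s) * q3 powi (int s - 1) * u i"

text \<open>
  Coefficients of \<open>z^(-k)\<close> in the matrix coefficients of \<open>e(z)\<close> (from \<open>lam\<close> to \<open>add_box lam i s\<close>) and of
  \<open>f(z)\<close> (back); \<open>\<delta>(v/z)\<close> contributes \<open>v^k\<close>.
\<close>

definition e_coeff :: "'k::field \<Rightarrow> 'k \<Rightarrow> (nat \<Rightarrow> 'k) \<Rightarrow> ptuple \<Rightarrow> nat \<Rightarrow> nat \<Rightarrow> int \<Rightarrow> 'k" where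
  "e_coeff q1 q3 u lam i s k =
     (let v = box_weight q1 q3 u lam i s in
        v powi k / (1 - q1)
        * (\<Prod>j\<in>{1..<i}. psi q1 q3 (lam j) (u j / v))
        * (\<Prod>t\<in>{1..<s}. psi_row q1 q3 (int (lam i t)) (int t) (u i / v)))"

definition f_coeff :: "'k::field \<Rightarrow> 'k \<Rightarrow> (nat \<Rightarrow> 'k) \<Rightarrow> nat \<Rightarrow> ptuple \<Rightarrow> nat \<Rightarrow> nat \<Rightarrow> int \<Rightarrow> 'k" where
  "f_coeff q1 q3 u n lam i s k =
     (let v = box_weight q1 q3 u lam i s in
        q1 * v powi k / (1 - q1)
        * ((1 - q2_of q1 q3 * q3 powi int s * (u i / v)) / (1 - q3 powi int s * (u i / v)))
        * (\<Prod>t\<in>{t. t > s \<and> lam i t \<noteq> 0}. psi_ratio q1 q3 (lam i) t (u i / v))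
        * (\<Prod>j\<in>{i<..n}. psi q1 q3 (lam j) (u j / v)))"

text \<open>
  \<open>tensor_coeff q1 q3 u n mu g lam\<close> is the coefficient of \<open>|mu>\<close> in \<open>g |lam>\<close>. The sums have at most one term.
\<close>

fun tensor_coeff :: "'k::field \<Rightarrow> 'k \<Rightarrow> (nat \<Rightarrow> 'k) \<Rightarrow> nat \<Rightarrow> ptuple \<Rightarrow> gen \<Rightarrow> ptuple \<Rightarrow> 'k" where
  "tensor_coeff q1 q3 u n mu (Gen_e k) lam =
     (\<Sum>(i, s)\<in>{(i, s). i \<in> {1..n} \<and> s \<ge> 1 \<and> mu = add_box lam i s}. e_coeff q1 q3 u lam i s k)"
| "tensor_coeff q1 q3 u n mu (Gen_f k) lam =
     (\<Sum>(i, s)\<in>{(i, s). i \<in> {1..n} \<and> s \<ge> 1 \<and> lam = add_box mu i s}. f_coeff q1 q3 u n mu i s k)"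
| "tensor_coeff q1 q3 u n mu (Gen_psip k) lam = (if mu = lam then psi_plus_coeff q1 q3 u n lam k else 0)"
| "tensor_coeff q1 q3 u n mu (Gen_psim k) lam = (if mu = lam then psi_minus_coeff q1 q3 u n lam k else 0)"
| "tensor_coeff q1 q3 u n mu Gen_psip0_inv lam =
     (if mu = lam then inverse (psi_plus_coeff q1 q3 u n lam 0) else 0)"
| "tensor_coeff q1 q3 u n mu Gen_psim0_inv lam =
     (if mu = lam then inverse (psi_minus_coeff q1 q3 u n lam 0) else 0)"


section \<open>Rational functions and their specialization\<close>

type_synonym mpoly = "(nat \<Rightarrow>\<^sub>0 nat) \<Rightarrow>\<^sub>0 complex"

type_synonym ratfun = "mpoly fract"

definition ratfun_const :: "complex \<Rightarrow> ratfun" where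
  "ratfun_const c = Fraction_Field.Fract (Poly_Mapping.single 0 c) 1"

definition ratfun_var :: "nat \<Rightarrow> ratfun" where
  "ratfun_var i = Fraction_Field.Fract (Poly_Mapping.single (Poly_Mapping.single i 1) 1) 1"

text \<open>\<open>emb\<close> embeds the constants into the field to which the values \<open>x i\<close> of the variables belong.\<close>

definition mpoly_eval :: "(complex \<Rightarrow> 'k::field) \<Rightarrow> (nat \<Rightarrow> 'k) \<Rightarrow> mpoly \<Rightarrow> 'k" where
  "mpoly_eval emb x P =
     (\<Sum>m\<in>Poly_Mapping.keys P. emb (Poly_Mapping.lookup P m) *
        (\<Prod>i\<in>Poly_Mapping.keys m. x i ^ Poly_Mapping.lookup m i))"

text \<open>
  Cancelling common factors and then substituting \<open>x\<close>: the function \<open>r\<close> is regular at \<open>x\<close> if it has a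
  representation as a fraction whose denominator survives the substitution, and the value does not
  depend on that representation. As polynomials form a unique factorization domain, such a
  representation exists if and only if the reduced fraction is one.
\<close>

definition has_value_at :: "(complex \<Rightarrow> 'k::field) \<Rightarrow> (nat \<Rightarrow> 'k) \<Rightarrow> ratfun \<Rightarrow> 'k \<Rightarrow> bool" where
  "has_value_at emb x r y \<longleftrightarrow>
     (\<exists>P Q. r = Fraction_Field.Fract P Q \<and> mpoly_eval emb x Q \<noteq> 0 \<and> y = mpoly_eval emb x P / mpoly_eval emb x Q)"

definition regular_at :: "(complex \<Rightarrow> 'k::field) \<Rightarrow> (nat \<Rightarrow> 'k) \<Rightarrow> ratfun \<Rightarrow> bool" where
  "regular_at emb x r \<longleftrightarrow> (\<exists>y. has_value_at emb x r y)"

definition value_at :: "(complex \<Rightarrow> 'k::field) \<Rightarrow> (nat \<Rightarrow> 'k) \<Rightarrow> ratfun \<Rightarrow> 'k" where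
  "value_at emb x r = (THE y. has_value_at emb x r y)"


section \<open>The module at resonance\<close>

text \<open>\<open>u_1 = u\<close> and \<open>u_i = u_(i+1) q1^(a_i+1) q3^(b_i+1)\<close>; index 0 is unused.\<close>

fun special_u :: "'k::field \<Rightarrow> 'k \<Rightarrow> (nat \<Rightarrow> nat) \<Rightarrow> (nat \<Rightarrow> nat) \<Rightarrow> 'k \<Rightarrow> nat \<Rightarrow> 'k" where
  "special_u q1 q3 a b u 0 = u"
| "special_u q1 q3 a b u (Suc 0) = u"
| "special_u q1 q3 a b u (Suc (Suc i)) =
     special_u q1 q3 a b u (Suc i) / (q1 ^ (a (Suc i) + 1) * q3 ^ (b (Suc i) + 1))"

text \<open>
  Variable 0 is \<open>q1\<close>, variable 1 is \<open>q3\<close>, and variable \<open>i + 1\<close> is \<open>u_i\<close> for \<open>i \<ge> 1\<close>. After the first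
  specialization only the variables 0, 1 and 2 (that is, \<open>u = u_1\<close>) remain.
\<close>

definition generic_coeff :: "nat \<Rightarrow> ptuple \<Rightarrow> gen \<Rightarrow> ptuple \<Rightarrow> ratfun" where
  "generic_coeff n mu g lam =
     tensor_coeff (ratfun_var 0) (ratfun_var 1) (\<lambda>i. ratfun_var (i + 1)) n mu g lam"

definition first_point :: "(nat \<Rightarrow> nat) \<Rightarrow> (nat \<Rightarrow> nat) \<Rightarrow> nat \<Rightarrow> ratfun" where
  "first_point a b k =
     (if k \<le> 1 then ratfun_var k
      else special_u (ratfun_var 0) (ratfun_var 1) a b (ratfun_var 2) (k - 1))"

definition M_coeff :: "nat \<Rightarrow> (nat \<Rightarrow> nat) \<Rightarrow> (nat \<Rightarrow> nat) \<Rightarrow> ptuple \<Rightarrow> gen \<Rightarrow> ptuple \<Rightarrow> ratfun" where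
  "M_coeff n a b mu g lam = value_at ratfun_const (first_point a b) (generic_coeff n mu g lam)"

definition second_point :: "complex \<Rightarrow> complex \<Rightarrow> complex \<Rightarrow> nat \<Rightarrow> complex" where
  "second_point q1 q3 u k = (if k = 0 then q1 else if k = 1 then q3 else u)"

definition resonant_coeff ::
  "complex \<Rightarrow> complex \<Rightarrow> complex \<Rightarrow> nat \<Rightarrow> (nat \<Rightarrow> nat) \<Rightarrow> (nat \<Rightarrow> nat) \<Rightarrow> ptuple \<Rightarrow> gen \<Rightarrow> ptuple \<Rightarrow> complex" where
  "resonant_coeff q1 q3 u n a b mu g lam =
     value_at (\<lambda>c. c) (second_point q1 q3 u) (M_coeff n a b mu g lam)"

text \<open>Here \<open>a n\<close> and \<open>b n\<close> are the additional numbers determined by \<open>p'\<close> and \<open>p\<close>.\<close>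

definition resonant_basis :: "nat \<Rightarrow> (nat \<Rightarrow> nat) \<Rightarrow> (nat \<Rightarrow> nat) \<Rightarrow> ptuple set" where
  "resonant_basis n a b =
     {lam. is_ptuple n lam \<and>
        (\<forall>i\<in>{1..n}. \<forall>s\<ge>1.
           int (lam i s) \<ge> int (lam (if i = n then 1 else i + 1) (s + b i)) - int (a i))}"

definition resonant_coeffs_well_defined ::
  "complex \<Rightarrow> complex \<Rightarrow> complex \<Rightarrow> nat \<Rightarrow> (nat \<Rightarrow> nat) \<Rightarrow> (nat \<Rightarrow> nat) \<Rightarrow> bool" where
  "resonant_coeffs_well_defined q1 q3 u n a b \<longleftrightarrow>
     (\<forall>mu\<in>resonant_basis n a b. \<forall>lam\<in>resonant_basis n a b. \<forall>g.
        regular_at ratfun_const (first_point a b) (generic_coeff n mu g lam) \<and>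
        regular_at (\<lambda>c. c) (second_point q1 q3 u) (M_coeff n a b mu g lam))"

text \<open>Vectors are finitely supported functions on the basis.\<close>

definition fun_scale :: "complex \<Rightarrow> ('b \<Rightarrow> complex) \<Rightarrow> 'b \<Rightarrow> complex" where
  "fun_scale c x = (\<lambda>lam. c * x lam)"

definition free_space :: "'b set \<Rightarrow> ('b \<Rightarrow> complex) set" where
  "free_space B = {x. finite {lam. x lam \<noteq> 0} \<and> {lam. x lam \<noteq> 0} \<subseteq> B}"

definition matrix_operator :: "'b set \<Rightarrow> ('b \<Rightarrow> 'b \<Rightarrow> complex) \<Rightarrow> ('b \<Rightarrow> complex) operator" where
  "matrix_operator B C x =
     (\<lambda>mu. if mu \<in> B then (\<Sum>lam\<in>{lam \<in> B. x lam \<noteq> 0}. C mu lam * x lam) else 0)"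

definition resonant_space :: "nat \<Rightarrow> (nat \<Rightarrow> nat) \<Rightarrow> (nat \<Rightarrow> nat) \<Rightarrow> (ptuple \<Rightarrow> complex) set" where
  "resonant_space n a b = free_space (resonant_basis n a b)"

definition resonant_action ::
  "complex \<Rightarrow> complex \<Rightarrow> complex \<Rightarrow> nat \<Rightarrow> (nat \<Rightarrow> nat) \<Rightarrow> (nat \<Rightarrow> nat) \<Rightarrow> gen \<Rightarrow> (ptuple \<Rightarrow> complex) operator" where
  "resonant_action q1 q3 u n a b g =
     matrix_operator (resonant_basis n a b) (\<lambda>mu lam. resonant_coeff q1 q3 u n a b mu g lam)"


section \<open>The highest weight\<close>

text \<open>
  \<open>\<psi>^+\<close> of the empty partition as a series in \<open>x\<close>, \<open>\<psi>^-\<close> as a series in \<open>x^(-1)\<close>. With \<open>x = u/z\<close> they become series in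
  \<open>z^(-1)\<close> and \<open>z\<close>.
\<close>

definition psi_empty_plus :: "complex \<Rightarrow> complex fps" where
  "psi_empty_plus q2 = (1 - fps_const q2 * fps_X) / (1 - fps_X)"

definition psi_empty_minus :: "complex \<Rightarrow> complex fps" where
  "psi_empty_minus q2 = fps_const q2 * ((1 - fps_const (inverse q2) * fps_X) / (1 - fps_X))"

definition hw_plus :: "complex \<Rightarrow> (nat \<Rightarrow> complex) \<Rightarrow> nat \<Rightarrow> complex fps" where
  "hw_plus q2 u n = (\<Prod>i\<in>{1..n}. fps_compose (psi_empty_plus q2) (fps_const (u i) * fps_X))"

definition hw_minus :: "complex \<Rightarrow> (nat \<Rightarrow> complex) \<Rightarrow> nat \<Rightarrow> complex fps" where
  "hw_minus q2 u n = (\<Prod>i\<in>{1..n}. fps_compose (psi_empty_minus q2) (fps_const (inverse (u i)) * fps_X))"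

end

theory Submission
  imports Defs "HOL-Computational_Algebra.Polynomial_FPS"
begin

text \<open>
  A row of a basis vector is a pair \<open>r = (i, s)\<close>: the \<open>s\<close>-th part of the
  \<open>i\<close>-th partition. Everything is expressed through its weight \<open>w = q1^(\<lambda>^(i)_s)
  q3^(s-1) u_i\<close>, the argument of the delta function with which a box is added to that row. Because
  \<open>u_i/u_(i+1)\<close> is a monomial in \<open>q1, q3\<close>, all weights have the form \<open>u q1^x
  q3^y\<close>, and the resonance identifies \<open>(x, y)\<close> with \<open>(x + p', y + p)\<close>: rows
  live on a cylinder. There the inequalities that define the basis, including the one that ties the last
  partition to the first, all have one shape. Unrolling the cylinder turns a basis vector into a periodic
  family of row ends that decreases along each partition and drops by at least one from each partition to
  the next, one level up (\<open>row_end_descent\<close>). From this inequality follow the three facts that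
  drive the proof: different rows of a basis vector have different weights and the set of weights determines
  the vector (\<open>wt_inject\<close>, \<open>wt_determines_tuple\<close>); a row cannot be lengthened
  exactly when its weight is \<open>q2\<close> or \<open>q3\<close> times another weight
  (\<open>plus_box_in_B_iff\<close>, \<open>tight_iff_wt\<close>), and similarly for shortening; two weights
  with quotient \<open>q1\<close> always come with a weight above and a weight below them
  (\<open>adjacent_columns\<close>).

  The infinite products in the matrix coefficients telescope. What remains is, for \<open>e\<close>, a
  product over the rows before \<open>r\<close> and, for \<open>f\<close>, over the rows after
  \<open>r\<close>, of one rational function \<open>row_factor\<close> of the quotient of two weights, whose
  zeros and poles sit at quotients that the three facts exclude on edges between basis vectors. Hence the
  coefficients are regular at the resonance and do not vanish there, and substitution may be carried out
  factor by factor.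

  Lengthening a row multiplies its factor by \<open>-g(v,z)/g(z,v)\<close>
  (\<open>row_factor_shift\<close>). This exchange rule gives the quadratic relations by antisymmetrization,
  the relations between \<open>\<psi>\<close> and \<open>e\<close>, \<open>f\<close>, and the vanishing of
  the off-diagonal part of \<open>[e, f]\<close>. The cubic relations reduce, for each set of three boxes,
  to an identity in which all six orders of adding them are multiples of one order
  (\<open>serre_six_terms\<close>); some order with this property exists because the weights of boxes that
  can be added one after the other never form a cycle of zeros of \<open>g\<close>. The diagonal part of
  \<open>[e, f]\<close> is the partial fraction expansion of \<open>\<psi>\<close>: the difference of its
  expansions at zero and at infinity is the sum of its residues, which sit at the weights where a box can be
  added or removed (\<open>diagonal_commutator\<close>).

  Finally, the eigenvalue of \<open>\<psi>\<^sup>+\<close>, as a rational function, determines the set of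
  weights, because, up to sign and a contribution common to all tuples, its divisor is that set convolved
  with \<open>(1 - [q2])(1 - [q3])\<close>, and this convolution is injective on finite sets since
  \<open>q2, q3\<close> are not roots of unity. So the spectrum is simple, every submodule is spanned by
  basis vectors, and irreducibility becomes connectedness of the graph of basis vectors. It is connected
  because every nonempty tuple has a removable box, found with a height function on rows that is monotone
  because \<open>p > n\<close> (\<open>tight_height\<close>, \<open>ex_removable_row\<close>); the empty
  tuple is the highest weight vector.
\<close>

section \<open>Substitution into rational functions\<close>

definition monomial_value :: "(nat \<Rightarrow> 'k::field) \<Rightarrow> (nat \<Rightarrow>\<^sub>0 nat) \<Rightarrow> 'k" where
  "monomial_value x m = (\<Prod>i\<in>Poly_Mapping.keys m. x i ^ Poly_Mapping.lookup m i)"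

lemma monomial_value_superset:
  assumes "finite S" "Poly_Mapping.keys m \<subseteq> S"
  shows "monomial_value x m = (\<Prod>i\<in>S. x i ^ Poly_Mapping.lookup m i)"
  unfolding monomial_value_def
  by (rule prod.mono_neutral_left) (use assms in \<open>auto simp: in_keys_iff\<close>)

lemma monomial_value_add: "monomial_value x (m + m') = monomial_value x m * monomial_value x m'"
proof -
  define S where "S = Poly_Mapping.keys m \<union> Poly_Mapping.keys m'"
  have S: "finite S" "Poly_Mapping.keys m \<subseteq> S" "Poly_Mapping.keys m' \<subseteq> S"
    "Poly_Mapping.keys (m + m') \<subseteq> S"
    using keys_add[of m m'] by (auto simp: S_def)
  show ?thesis
    using S by (simp add: monomial_value_superset[where S = S] lookup_add power_add prod.distrib)
qed

locale ring_embedding =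
  fixes emb :: "complex \<Rightarrow> 'k::field"
  assumes emb_0: "emb 0 = 0" and emb_1: "emb 1 = 1"
    and emb_add: "emb (c + d) = emb c + emb d" and emb_mult: "emb (c * d) = emb c * emb d"
begin

lemma mpoly_eval_superset:
  assumes "finite S" "Poly_Mapping.keys P \<subseteq> S"
  shows "mpoly_eval emb x P = (\<Sum>m\<in>S. emb (Poly_Mapping.lookup P m) * monomial_value x m)"
  unfolding mpoly_eval_def monomial_value_def
  by (rule sum.mono_neutral_left) (use assms in \<open>auto simp: in_keys_iff emb_0\<close>)

lemma mpoly_eval_single: "mpoly_eval emb x (Poly_Mapping.single m c) = emb c * monomial_value x m"
  by (subst mpoly_eval_superset[where S = "{m}"]) (auto simp: emb_0)

lemma mpoly_eval_0: "mpoly_eval emb x 0 = 0"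
  by (simp add: mpoly_eval_def)

lemma mpoly_eval_1: "mpoly_eval emb x 1 = 1"
  using mpoly_eval_single[of x 0 1] by (simp add: monomial_value_def emb_1)

lemma mpoly_eval_add: "mpoly_eval emb x (P + Q) = mpoly_eval emb x P + mpoly_eval emb x Q"
proof -
  define S where "S = Poly_Mapping.keys P \<union> Poly_Mapping.keys Q"
  have S: "finite S" "Poly_Mapping.keys P \<subseteq> S" "Poly_Mapping.keys Q \<subseteq> S"
    "Poly_Mapping.keys (P + Q) \<subseteq> S"
    using keys_add[of P Q] by (auto simp: S_def)
  show ?thesis
    using S by (simp add: mpoly_eval_superset[where S = S] lookup_add emb_add sum.distrib algebra_simps)
qed

text \<open>
  Additivity reduces multiplicativity of the evaluation to monomials, which is what this induction is for.
\<close>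

lemma mpoly_induct [case_names zero add_monomial]:
  fixes P :: mpoly
  assumes "R 0" "\<And>m c P. R P \<Longrightarrow> R (Poly_Mapping.single m c + P)"
  shows "R P"
proof (induction P rule: Poly_Mapping.update_induct)
  case const
  then show ?case by (rule assms(1))
next
  case (update f a b)
  have "Poly_Mapping.update a b f = Poly_Mapping.single a b + f"
    using update(1) by (intro poly_mapping_eqI)
      (auto simp: lookup_update lookup_add lookup_single in_keys_iff)
  then show ?case using assms(2) update by simp
qed

lemma mpoly_eval_mult: "mpoly_eval emb x (P * Q) = mpoly_eval emb x P * mpoly_eval emb x Q"
proof (induction P rule: mpoly_induct)
  case (add_monomial m c P)
  have "mpoly_eval emb x (Poly_Mapping.single m c * Q)
      = mpoly_eval emb x (Poly_Mapping.single m c) * mpoly_eval emb x Q"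
    by (induction Q rule: mpoly_induct)
      (simp_all add: mpoly_eval_0 distrib_left mpoly_eval_add mult_single mpoly_eval_single emb_mult monomial_value_add)
  then show ?case using add_monomial by (simp add: distrib_right mpoly_eval_add)
qed (simp add: mpoly_eval_0)

lemma has_value_at_unique:
  assumes "has_value_at emb x r y" "has_value_at emb x r y'"
  shows "y = y'"
proof -
  obtain P Q where PQ: "r = Fraction_Field.Fract P Q" "mpoly_eval emb x Q \<noteq> 0"
      "y = mpoly_eval emb x P / mpoly_eval emb x Q"
    using assms(1) unfolding has_value_at_def by blast
  obtain P' Q' where PQ': "r = Fraction_Field.Fract P' Q'" "mpoly_eval emb x Q' \<noteq> 0"
      "y' = mpoly_eval emb x P' / mpoly_eval emb x Q'"
    using assms(2) unfolding has_value_at_def by blast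
  have "Q \<noteq> 0" "Q' \<noteq> 0" using PQ PQ' by (auto simp: mpoly_eval_0)
  then have "P * Q' = P' * Q" using PQ(1) PQ'(1) by (simp add: eq_fract)
  then have "mpoly_eval emb x P * mpoly_eval emb x Q' = mpoly_eval emb x P' * mpoly_eval emb x Q"
    by (metis mpoly_eval_mult)
  then show ?thesis unfolding PQ(3) PQ'(3) using PQ(2) PQ'(2) by (simp add: frac_eq_eq)
qed

lemma value_at_eqI: "has_value_at emb x r y \<Longrightarrow> value_at emb x r = y"
  unfolding value_at_def using has_value_at_unique by blast

lemma has_value_at_const: "emb c = y \<Longrightarrow> has_value_at emb x (ratfun_const c) y"
  unfolding has_value_at_def ratfun_const_def
  by (rule exI[of _ "Poly_Mapping.single 0 c"], rule exI[of _ 1])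
    (simp add: mpoly_eval_single mpoly_eval_1 monomial_value_def emb_1)

lemma has_value_at_var: "has_value_at emb x (ratfun_var i) (x i)"
  unfolding has_value_at_def ratfun_var_def
  by (rule exI[of _ "Poly_Mapping.single (Poly_Mapping.single i 1) 1"], rule exI[of _ 1])
    (simp add: mpoly_eval_single mpoly_eval_1 monomial_value_def emb_1)

lemma has_value_at_add:
  assumes "has_value_at emb x r y" "has_value_at emb x r' y'"
  shows "has_value_at emb x (r + r') (y + y')"
proof -
  obtain P Q where PQ: "r = Fraction_Field.Fract P Q" "mpoly_eval emb x Q \<noteq> 0"
      "y = mpoly_eval emb x P / mpoly_eval emb x Q"
    using assms(1) unfolding has_value_at_def by blast
  obtain P' Q' where PQ': "r' = Fraction_Field.Fract P' Q'" "mpoly_eval emb x Q' \<noteq> 0"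
      "y' = mpoly_eval emb x P' / mpoly_eval emb x Q'"
    using assms(2) unfolding has_value_at_def by blast
  have "Q \<noteq> 0" "Q' \<noteq> 0" using PQ PQ' by (auto simp: mpoly_eval_0)
  then have "r + r' = Fraction_Field.Fract (P * Q' + P' * Q) (Q * Q')"
    using PQ PQ' by simp
  moreover have "y + y' = mpoly_eval emb x (P * Q' + P' * Q) / mpoly_eval emb x (Q * Q')"
    unfolding PQ(3) PQ'(3) using PQ(2) PQ'(2)
    by (simp add: mpoly_eval_mult mpoly_eval_add add_frac_eq)
  moreover have "mpoly_eval emb x (Q * Q') \<noteq> 0"
    using PQ(2) PQ'(2) by (simp add: mpoly_eval_mult)
  ultimately show ?thesis unfolding has_value_at_def by blast
qed

lemma has_value_at_mult:
  assumes "has_value_at emb x r y" "has_value_at emb x r' y'"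
  shows "has_value_at emb x (r * r') (y * y')"
proof -
  obtain P Q where PQ: "r = Fraction_Field.Fract P Q" "mpoly_eval emb x Q \<noteq> 0"
      "y = mpoly_eval emb x P / mpoly_eval emb x Q"
    using assms(1) unfolding has_value_at_def by blast
  obtain P' Q' where PQ': "r' = Fraction_Field.Fract P' Q'" "mpoly_eval emb x Q' \<noteq> 0"
      "y' = mpoly_eval emb x P' / mpoly_eval emb x Q'"
    using assms(2) unfolding has_value_at_def by blast
  with PQ have "r * r' = Fraction_Field.Fract (P * P') (Q * Q')"
      "y * y' = mpoly_eval emb x (P * P') / mpoly_eval emb x (Q * Q')" "mpoly_eval emb x (Q * Q') \<noteq> 0"
    by (simp_all add: mpoly_eval_mult)
  then show ?thesis unfolding has_value_at_def by blast
qed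

lemma has_value_at_inverse:
  assumes "has_value_at emb x r y" "y \<noteq> 0"
  shows "has_value_at emb x (inverse r) (inverse y)"
proof -
  obtain P Q where PQ: "r = Fraction_Field.Fract P Q" "mpoly_eval emb x Q \<noteq> 0"
      "y = mpoly_eval emb x P / mpoly_eval emb x Q"
    using assms(1) unfolding has_value_at_def by blast
  then have "inverse r = Fraction_Field.Fract Q P"
      "inverse y = mpoly_eval emb x Q / mpoly_eval emb x P" "mpoly_eval emb x P \<noteq> 0"
    using assms(2) by auto
  then show ?thesis unfolding has_value_at_def by blast
qed

lemma has_value_at_minus_1: "has_value_at emb x (- 1) (- 1)"
proof -
  have "emb (-1) + emb 1 = 0" unfolding emb_add[symmetric] by (simp add: emb_0)
  then have e: "emb (-1) = - 1" by (simp add: add_eq_0_iff2 emb_1)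
  have "ratfun_const (-1) = - 1"
    unfolding ratfun_const_def One_fract_def single_uminus by simp
  then show ?thesis using has_value_at_const[OF e] by metis
qed

end

interpretation ratfun_const: ring_embedding ratfun_const
proof
  show "ratfun_const 0 = 0" "ratfun_const 1 = 1"
    unfolding ratfun_const_def Zero_fract_def One_fract_def by simp_all
  fix c d
  show "ratfun_const (c + d) = ratfun_const c + ratfun_const d"
      "ratfun_const (c * d) = ratfun_const c * ratfun_const d"
    unfolding ratfun_const_def by (simp_all add: single_add mult_single)
qed

interpretation complex_id: ring_embedding "\<lambda>c::complex. c"
  by unfold_locales simp_all

text \<open>
  A partially defined ring homomorphism between fields, given by its graph, that extends to a reciprocal as
  soon as the image is nonzero. Substitution after cancelling common factors is of this kind, and so is the
  composite of two substitutions; thus a value can be computed factor by factor once no factor of a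
  denominator vanishes.
\<close>

locale place =
  fixes R :: "'a::field \<Rightarrow> 'b::field \<Rightarrow> bool"
  assumes unique: "R x x' \<Longrightarrow> R x x'' \<Longrightarrow> x' = x''"
    and one: "R 1 1" and minus_one: "R (-1) (-1)"
    and add: "R x x' \<Longrightarrow> R y y' \<Longrightarrow> R (x + y) (x' + y')"
    and mult: "R x x' \<Longrightarrow> R y y' \<Longrightarrow> R (x * y) (x' * y')"
    and inv: "R x x' \<Longrightarrow> x' \<noteq> 0 \<Longrightarrow> R (inverse x) (inverse x')"
begin

lemma zero: "R 0 0"
  using add[OF one minus_one] by simp

lemma minus: "R x x' \<Longrightarrow> R (- x) (- x')"
  using mult[OF minus_one, of x x'] by simp

lemma diff: "R x x' \<Longrightarrow> R y y' \<Longrightarrow> R (x - y) (x' - y')"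
  using add[OF _ minus, of x x' y y'] by simp

lemma divide: "R x x' \<Longrightarrow> R y y' \<Longrightarrow> y' \<noteq> 0 \<Longrightarrow> R (x / y) (x' / y')"
  using mult[OF _ inv, of x x' y y'] by (simp add: divide_inverse)

lemma power: "R x x' \<Longrightarrow> R (x ^ k) (x' ^ k)"
  by (induction k) (auto intro: one mult)

lemma powi: "R x x' \<Longrightarrow> x' \<noteq> 0 \<Longrightarrow> R (x powi k) (x' powi k)"
  unfolding power_int_def by (auto intro: power inv)

lemma sum: "(\<And>i. i \<in> A \<Longrightarrow> R (f i) (g i)) \<Longrightarrow> R (\<Sum>i\<in>A. f i) (\<Sum>i\<in>A. g i)"
  by (induction A rule: infinite_finite_induct) (auto intro: zero add)

lemma prod: "(\<And>i. i \<in> A \<Longrightarrow> R (f i) (g i)) \<Longrightarrow> R (\<Prod>i\<in>A. f i) (\<Prod>i\<in>A. g i)"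
  by (induction A rule: infinite_finite_induct) (auto intro: one mult)

end

lemma (in ring_embedding) place_has_value_at: "place (has_value_at emb x)"
proof
  show "has_value_at emb x 1 1"
    using has_value_at_const[OF emb_1, of x] unfolding ratfun_const.emb_1 .
  show "has_value_at emb x (- 1) (- 1)"
    by (rule has_value_at_minus_1)
  fix r r' y y' y2
  assume r: "has_value_at emb x r y"
  show "has_value_at emb x r y2 \<Longrightarrow> y = y2"
    using r by (rule has_value_at_unique)
  show "y \<noteq> 0 \<Longrightarrow> has_value_at emb x (inverse r) (inverse y)"
    using r by (rule has_value_at_inverse)
  assume r': "has_value_at emb x r' y'"
  show "has_value_at emb x (r + r') (y + y')"
    using r r' by (rule has_value_at_add)
  show "has_value_at emb x (r * r') (y * y')"
    using r r' by (rule has_value_at_mult)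
qed

lemma place_comp:
  assumes "place R" "place S"
  shows "place (\<lambda>x z. \<exists>y. R x y \<and> S y z)"
proof -
  interpret R: place R by fact
  interpret S: place S by fact
  show ?thesis
  proof
    show "\<exists>y. R 1 y \<and> S y 1" using R.one S.one by (intro exI conjI)
    show "\<exists>y. R (- 1) y \<and> S y (- 1)" using R.minus_one S.minus_one by (intro exI conjI)
  next
    fix x x' assume "\<exists>y. R x y \<and> S y x'"
    then obtain m where m: "R x m" "S m x'" by (elim exE conjE)
    show "x' = x''" if x'': "\<exists>y. R x y \<and> S y x''" for x''
    proof -
      obtain k where "R x k" "S k x''" using x'' by (elim exE conjE)
      then show ?thesis using R.unique[OF m(1), of k] S.unique[OF m(2), of x''] by simp
    qed
    show "\<exists>y. R (inverse x) y \<and> S y (inverse x')" if "x' \<noteq> 0"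
    proof -
      have "m \<noteq> 0" using S.unique[OF m(2), of 0] S.zero that by auto
      then show ?thesis using R.inv[OF m(1)] S.inv[OF m(2) that] by (intro exI conjI)
    qed
    fix y y' assume "\<exists>k. R y k \<and> S k y'"
    then obtain k where k: "R y k" "S k y'" by (elim exE conjE)
    show "\<exists>k. R (x + y) k \<and> S k (x' + y')"
      using R.add[OF m(1) k(1)] S.add[OF m(2) k(2)] by (intro exI conjI)
    show "\<exists>k. R (x * y) k \<and> S k (x' * y')"
      using R.mult[OF m(1) k(1)] S.mult[OF m(2) k(2)] by (intro exI conjI)
  qed
qed

section \<open>Matrix coefficients as products over rows\<close>

definition tail_factor :: "'k::field \<Rightarrow> 'k \<Rightarrow> 'k \<Rightarrow> 'k" where
  "tail_factor q1 q3 w = (1 - q2_of q1 q3 * w) / (1 - w)"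

text \<open>
  The contribution of a row to \<open>\<psi>(u/v)\<close>; it depends only on the quotient \<open>w\<close>
  of the weight of the row by \<open>v\<close>. Its poles are \<open>1, q1\<close> and its zeros
  \<open>1/q3, 1/q2\<close>. \<open>tail_factor\<close> accounts for all rows from some point on that have
  length zero.
\<close>

definition row_factor :: "'k::field \<Rightarrow> 'k \<Rightarrow> 'k \<Rightarrow> 'k" where
  "row_factor q1 q3 w = ((1 - q3 * w) * (1 - q2_of q1 q3 * w)) / ((1 - w) * (1 - w / q1))"

lemma psi_row_eq_row_factor:
  assumes "q1 \<noteq> 0" "q3 \<noteq> 0"
  shows "psi_row q1 q3 m j x = row_factor q1 q3 (q1 powi m * q3 powi (j - 1) * x)"
proof -
  have "q3 powi j = q3 * q3 powi (j - 1)" "q1 powi (m - 1) = q1 powi m / q1"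
    using assms power_int_add_1'[of q3 "j - 1"] by (simp_all add: power_int_diff)
  then show ?thesis by (simp add: psi_row_def row_factor_def algebra_simps)
qed

text \<open>
  The one-step cancellation behind the convergence of the infinite product over empty rows.
\<close>

lemma psi_row_0_eq:
  assumes "q1 \<noteq> 0" "q3 \<noteq> 0"
    and "1 - q3 powi j * x \<noteq> 0" "1 - q2_of q1 q3 * (q3 powi j * x) \<noteq> 0"
  shows "psi_row q1 q3 0 j x * tail_factor q1 q3 (q3 powi j * x) = tail_factor q1 q3 (q3 powi (j - 1) * x)"
proof -
  define w where "w = q3 powi (j - 1) * x"
  have w: "q3 powi j * x = q3 * w"
    using assms(2) power_int_add_1'[of q3 "j - 1"] by (simp add: w_def)
  have q: "q2_of q1 q3 * (q3 * w) = w / q1" using assms(1,2) by (simp add: field_simps)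
  have "psi_row q1 q3 0 j x = row_factor q1 q3 w"
    using assms(1,2) by (simp add: psi_row_eq_row_factor w_def)
  then show ?thesis using assms(3,4) unfolding w w_def[symmetric] q tail_factor_def row_factor_def by simp
qed

lemma prod_telescope:
  fixes f r :: "nat \<Rightarrow> 'a::comm_monoid_mult"
  assumes "s \<le> T" "\<And>t. s < t \<Longrightarrow> t \<le> T \<Longrightarrow> r t * f t = f (t - 1)"
  shows "(\<Prod>t\<in>{s<..T}. r t) * f T = f s"
  using assms
proof (induction T rule: dec_induct)
  case (step k)
  have "{s<..Suc k} = insert (Suc k) {s<..k}" using step.hyps by auto
  then have "(\<Prod>t\<in>{s<..Suc k}. r t) * f (Suc k) = (\<Prod>t\<in>{s<..k}. r t) * (r (Suc k) * f (Suc k))"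
    by (simp add: mult_ac)
  also have "r (Suc k) * f (Suc k) = f k"
    using step.prems[of "Suc k"] step.hyps by simp
  also have "(\<Prod>t\<in>{s<..k}. r t) * f k = f s"
    by (rule step.IH) (use step.prems in simp)
  finally show ?case .
qed simp

text \<open>
  The factors of the empty partition in the denominators of \<open>psi_ratio\<close> telescope against the
  tail, so the product over all rows beyond \<open>s\<close> becomes a plain product over the rows up to any
  bound \<open>T\<close> and one tail.
\<close>

lemma telescope_psi_ratio:
  assumes q: "q1 \<noteq> 0" "q3 \<noteq> 0" and "s \<le> T" and l: "\<And>t. t > T \<Longrightarrow> l t = 0"
    and nz: "\<And>t. s \<le> t \<Longrightarrow> t \<le> T \<Longrightarrow>
      1 - q3 powi int t * x \<noteq> 0 \<and> 1 - q2_of q1 q3 * (q3 powi int t * x) \<noteq> 0"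
  shows "tail_factor q1 q3 (q3 powi int s * x) * (\<Prod>t\<in>{t. t > s \<and> l t \<noteq> 0}. psi_ratio q1 q3 l t x)
    = (\<Prod>t\<in>{s<..T}. row_factor q1 q3 (q1 powi int (l t) * q3 powi (int t - 1) * x))
      * tail_factor q1 q3 (q3 powi int T * x)"
proof -
  let ?r0 = "\<lambda>t. psi_row q1 q3 0 (int t) x"
  have tail_nz: "tail_factor q1 q3 (q3 powi int t * x) \<noteq> 0" if "s \<le> t" "t \<le> T" for t
    using nz[OF that] by (simp add: tail_factor_def)
  have step: "?r0 t * tail_factor q1 q3 (q3 powi int t * x) = tail_factor q1 q3 (q3 powi (int t - 1) * x)"
    if "s \<le> t" "t \<le> T" for t
    using psi_row_0_eq[OF q, of "int t" x] nz[OF that] by simp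
  have r0_nz: "?r0 t \<noteq> 0" if "s < t" "t \<le> T" for t
  proof -
    have "int t - 1 = int (t - 1)" using that by simp
    then have "tail_factor q1 q3 (q3 powi (int t - 1) * x) \<noteq> 0"
      using tail_nz[of "t - 1"] that by simp
    then show ?thesis using step[of t] that by auto
  qed
  define F where "F = (\<lambda>t::nat. tail_factor q1 q3 (q3 powi int t * x))"
  have F_step: "?r0 t * F t = F (t - 1)" if "s < t" "t \<le> T" for t
  proof -
    have "int t - 1 = int (t - 1)" using \<open>s < t\<close> by simp
    then show ?thesis using step[of t] that unfolding F_def by simp
  qed
  have tele: "(\<Prod>t\<in>{s<..T}. ?r0 t) * tail_factor q1 q3 (q3 powi int T * x)
      = tail_factor q1 q3 (q3 powi int s * x)"
    using prod_telescope[of s T ?r0 F, OF \<open>s \<le> T\<close> F_step] unfolding F_def by simp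
  have "(\<Prod>t\<in>{t. t > s \<and> l t \<noteq> 0}. psi_ratio q1 q3 l t x) = (\<Prod>t\<in>{s<..T}. psi_ratio q1 q3 l t x)"
  proof (rule prod.mono_neutral_left)
    show "{t. s < t \<and> l t \<noteq> 0} \<subseteq> {s<..T}"
    proof safe
      fix t assume "s < t" "l t > 0"
      then show "t \<in> {s<..T}" using l[of t] by (cases "t \<le> T") auto
    qed
    show "\<forall>t\<in>{s<..T} - {t. s < t \<and> l t \<noteq> 0}. psi_ratio q1 q3 l t x = 1"
      using r0_nz by (auto simp: psi_ratio_def)
  qed simp
  also have "\<dots> = (\<Prod>t\<in>{s<..T}. row_factor q1 q3 (q1 powi int (l t) * q3 powi (int t - 1) * x))
      / (\<Prod>t\<in>{s<..T}. ?r0 t)"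
    using q by (simp add: psi_ratio_def prod_dividef psi_row_eq_row_factor)
  finally have ratio: "(\<Prod>t\<in>{t. t > s \<and> l t \<noteq> 0}. psi_ratio q1 q3 l t x)
    = (\<Prod>t\<in>{s<..T}. row_factor q1 q3 (q1 powi int (l t) * q3 powi (int t - 1) * x))
      / (\<Prod>t\<in>{s<..T}. ?r0 t)" .
  have nz0: "(\<Prod>t\<in>{s<..T}. ?r0 t) \<noteq> 0" using r0_nz by simp
  have cancel: "A * B * (C / A) = C * B" if "A \<noteq> 0" for A B C :: 'a
    using that by simp
  show ?thesis
    by (simp only: ratio tele[symmetric] cancel[OF nz0])
qed

lemma psi_eq_row_product:
  assumes q: "q1 \<noteq> 0" "q3 \<noteq> 0" and l: "\<And>t. t > T \<Longrightarrow> l t = 0"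
    and nz: "\<And>t. t \<le> T \<Longrightarrow>
      1 - q3 powi int t * x \<noteq> 0 \<and> 1 - q2_of q1 q3 * (q3 powi int t * x) \<noteq> 0"
  shows "psi q1 q3 l x = (\<Prod>t\<in>{1..T}. row_factor q1 q3 (q1 powi int (l t) * q3 powi (int t - 1) * x))
      * tail_factor q1 q3 (q3 powi int T * x)"
proof -
  have "{t. t > 0 \<and> l t \<noteq> 0} = {j. j \<ge> 1 \<and> l j \<noteq> 0}" "{0<..T} = {1..T}" by auto
  then show ?thesis using telescope_psi_ratio[where s = 0 and T = T and l = l and x = x, OF q _ l nz]
    by (simp add: psi_def tail_factor_def)
qed

text \<open>
  The common shape of the coefficients of \<open>e\<close> and \<open>f\<close>: \<open>S\<close> is the set
  of rows and \<open>J\<close> the set of partitions whose tails contribute. For \<open>e\<close> these are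
  the rows before the one that changes, for \<open>f\<close> those after it.
\<close>

definition edge_product ::
  "'k::field \<Rightarrow> 'k \<Rightarrow> (nat \<Rightarrow> 'k) \<Rightarrow> nat \<Rightarrow> ptuple \<Rightarrow> (nat \<times> nat) set \<Rightarrow> nat set \<Rightarrow> 'k \<Rightarrow> 'k" where
  "edge_product q1 q3 u T lam S J v =
     (\<Prod>(j, t)\<in>S. row_factor q1 q3 (box_weight q1 q3 u lam j t / v))
     * (\<Prod>j\<in>J. tail_factor q1 q3 (q3 powi int T * (u j / v)))"

definition rows_before :: "nat \<Rightarrow> nat \<Rightarrow> nat \<Rightarrow> (nat \<times> nat) set" where
  "rows_before T i s = {1..<i} \<times> {1..T} \<union> {i} \<times> {1..<s}"

definition rows_after :: "nat \<Rightarrow> nat \<Rightarrow> nat \<Rightarrow> nat \<Rightarrow> (nat \<times> nat) set" where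
  "rows_after n T i s = {i} \<times> {s<..T} \<union> {i<..n} \<times> {1..T}"

lemma e_coeff_eq_edge_product:
  assumes q: "q1 \<noteq> 0" "q3 \<noteq> 0" and l: "\<And>j t. t > T \<Longrightarrow> lam j t = 0"
    and v: "v = box_weight q1 q3 u lam i s"
    and nz: "\<And>j t. 1 \<le> j \<Longrightarrow> j < i \<Longrightarrow> t \<le> T \<Longrightarrow> 1 - q3 powi int t * (u j / v) \<noteq> 0 \<and>
      1 - q2_of q1 q3 * (q3 powi int t * (u j / v)) \<noteq> 0"
  shows "e_coeff q1 q3 u lam i s k =
    v powi k / (1 - q1) * edge_product q1 q3 u T lam (rows_before T i s) {1..<i} v"
proof -
  have "psi q1 q3 (lam j) (u j / v) = (\<Prod>t\<in>{1..T}. row_factor q1 q3 (box_weight q1 q3 u lam j t / v))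
      * tail_factor q1 q3 (q3 powi int T * (u j / v))" if "j \<in> {1..<i}" for j
    using psi_eq_row_product[where T = T and l = "lam j" and x = "u j / v", OF q] l nz that
    by (simp add: box_weight_def)
  moreover have "psi_row q1 q3 (int (lam i t)) (int t) (u i / v) = row_factor q1 q3 (box_weight q1 q3 u lam i t / v)" for t
    using q by (simp add: psi_row_eq_row_factor box_weight_def)
  moreover have "(\<Prod>(j, t)\<in>rows_before T i s. row_factor q1 q3 (box_weight q1 q3 u lam j t / v))
      = (\<Prod>j\<in>{1..<i}. \<Prod>t\<in>{1..T}. row_factor q1 q3 (box_weight q1 q3 u lam j t / v))
        * (\<Prod>t\<in>{1..<s}. row_factor q1 q3 (box_weight q1 q3 u lam i t / v))"
    unfolding rows_before_def
    by (subst prod.union_disjoint) (auto simp flip: prod.cartesian_product)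
  ultimately show ?thesis
    by (simp add: e_coeff_def Let_def v[symmetric] edge_product_def prod.distrib mult_ac)
qed

lemma f_coeff_eq_edge_product:
  assumes q: "q1 \<noteq> 0" "q3 \<noteq> 0" and l: "\<And>j t. t > T \<Longrightarrow> lam j t = 0"
    and v: "v = box_weight q1 q3 u lam i s" and "s \<le> T" "i \<le> n"
    and nz: "\<And>t. s \<le> t \<Longrightarrow> t \<le> T \<Longrightarrow> 1 - q3 powi int t * (u i / v) \<noteq> 0 \<and>
      1 - q2_of q1 q3 * (q3 powi int t * (u i / v)) \<noteq> 0"
    and nz': "\<And>j t. i < j \<Longrightarrow> j \<le> n \<Longrightarrow> t \<le> T \<Longrightarrow> 1 - q3 powi int t * (u j / v) \<noteq> 0 \<and>
      1 - q2_of q1 q3 * (q3 powi int t * (u j / v)) \<noteq> 0"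
  shows "f_coeff q1 q3 u n lam i s k =
    q1 * v powi k / (1 - q1) * edge_product q1 q3 u T lam (rows_after n T i s) {i..n} v"
proof -
  have "psi q1 q3 (lam j) (u j / v) = (\<Prod>t\<in>{1..T}. row_factor q1 q3 (box_weight q1 q3 u lam j t / v))
      * tail_factor q1 q3 (q3 powi int T * (u j / v))" if "j \<in> {i<..n}" for j
    using psi_eq_row_product[where T = T and l = "lam j" and x = "u j / v", OF q] l nz' that
    by (simp add: box_weight_def)
  moreover have "tail_factor q1 q3 (q3 powi int s * (u i / v))
        * (\<Prod>t\<in>{t. t > s \<and> lam i t \<noteq> 0}. psi_ratio q1 q3 (lam i) t (u i / v))
      = (\<Prod>t\<in>{s<..T}. row_factor q1 q3 (box_weight q1 q3 u lam i t / v))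
        * tail_factor q1 q3 (q3 powi int T * (u i / v))"
    using telescope_psi_ratio[where l = "lam i" and x = "u i / v", OF q \<open>s \<le> T\<close> l nz]
    by (simp add: box_weight_def)
  moreover have "(\<Prod>(j, t)\<in>rows_after n T i s. row_factor q1 q3 (box_weight q1 q3 u lam j t / v))
      = (\<Prod>t\<in>{s<..T}. row_factor q1 q3 (box_weight q1 q3 u lam i t / v))
      * (\<Prod>j\<in>{i<..n}. \<Prod>t\<in>{1..T}. row_factor q1 q3 (box_weight q1 q3 u lam j t / v))"
    unfolding rows_after_def
    by (subst prod.union_disjoint) (auto simp flip: prod.cartesian_product)
  moreover have "{i..n} = insert i {i<..n}" using \<open>i \<le> n\<close> by auto
  moreover have "(1 - q2_of q1 q3 * q3 powi int s * (u i / v)) / (1 - q3 powi int s * (u i / v))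
      = tail_factor q1 q3 (q3 powi int s * (u i / v))"
    by (simp add: tail_factor_def mult_ac)
  ultimately show ?thesis
    by (simp only: f_coeff_def Let_def v[symmetric] edge_product_def prod.distrib)
      (simp add: mult_ac prod.distrib)
qed

lemma (in place) tail_factor:
  assumes "R q1 q1'" "R q3 q3'" "R w w'" "q1' \<noteq> 0" "q3' \<noteq> 0" "1 - w' \<noteq> 0"
  shows "R (tail_factor q1 q3 w) (tail_factor q1' q3' w')"
  unfolding tail_factor_def by (intro divide mult diff inv one assms no_zero_divisors)

lemma (in place) row_factor:
  assumes "R q1 q1'" "R q3 q3'" "R w w'" "q1' \<noteq> 0" "q3' \<noteq> 0" "1 - w' \<noteq> 0" "1 - w' / q1' \<noteq> 0"
  shows "R (row_factor q1 q3 w) (row_factor q1' q3' w')"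
  unfolding row_factor_def by (intro divide mult diff inv one assms no_zero_divisors)

lemma (in place) box_weight:
  assumes "R q1 q1'" "R q3 q3'" "R (u i) (u' i)" "q1' \<noteq> 0" "q3' \<noteq> 0"
  shows "R (box_weight q1 q3 u lam i s) (box_weight q1' q3' u' lam i s)"
  unfolding box_weight_def by (intro mult powi assms)

lemma (in place) edge_product:
  assumes q: "R q1 q1'" "R q3 q3'" "q1' \<noteq> 0" "q3' \<noteq> 0" and v: "R v v'" "v' \<noteq> 0"
    and u: "\<And>j t. (j, t) \<in> S \<Longrightarrow> R (u j) (u' j)" "\<And>j. j \<in> J \<Longrightarrow> R (u j) (u' j)"
    and S: "\<And>j t. (j, t) \<in> S \<Longrightarrow> box_weight q1' q3' u' lam j t \<noteq> v' \<and> box_weight q1' q3' u' lam j t \<noteq> q1' * v'"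
    and J: "\<And>j. j \<in> J \<Longrightarrow> q3' powi int T * u' j \<noteq> v'"
  shows "R (edge_product q1 q3 u T lam S J v) (edge_product q1' q3' u' T lam S J v')"
  unfolding edge_product_def
proof (intro mult prod; clarify?)
  fix j t assume jt: "(j, t) \<in> S"
  show "R (row_factor q1 q3 (box_weight q1 q3 u lam j t / v)) (row_factor q1' q3' (box_weight q1' q3' u' lam j t / v'))"
    using S[OF jt] q v by (intro row_factor divide box_weight u(1)[OF jt]) (auto simp: field_simps)
next
  fix j assume j: "j \<in> J"
  show "R (tail_factor q1 q3 (q3 powi int T * (u j / v))) (tail_factor q1' q3' (q3' powi int T * (u' j / v')))"
    using J[OF j] q v by (intro tail_factor divide mult powi u(2)[OF j]) (auto simp: field_simps)
qed

section \<open>Rows on a cylinder\<close>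

abbreviation row_length :: "ptuple \<Rightarrow> nat \<times> nat \<Rightarrow> nat" where
  "row_length lam r \<equiv> lam (fst r) (snd r)"

definition plus_box :: "ptuple \<Rightarrow> nat \<times> nat \<Rightarrow> ptuple" where
  "plus_box lam r = add_box lam (fst r) (snd r)"

lemma plus_box_apply: "plus_box lam r i s = (if r = (i, s) then lam i s + 1 else lam i s)"
  by (cases r) (auto simp: plus_box_def add_box_def)

lemma plus_box_commute: "plus_box (plus_box lam r) r' = plus_box (plus_box lam r') r"
  by (intro ext) (simp add: plus_box_apply)

lemma plus_box_inject': "plus_box lam r = plus_box lam r' \<longleftrightarrow> r = r'"
proof
  assume "plus_box lam r = plus_box lam r'"
  then have "plus_box lam r (fst r) (snd r) = plus_box lam r' (fst r) (snd r)" by simp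
  then show "r = r'" by (cases r) (auto simp: plus_box_apply split: if_splits)
qed simp

lemma power_int_diff_nat:
  fixes x :: "'a::field"
  assumes "x \<noteq> 0" shows "x powi (m - int k) = x powi m / x ^ k"
  using assms by (simp add: power_int_diff)

text \<open>
  The equations \<open>a_last\<close> and \<open>b_last\<close> say that going once around all partitions is
  a translation by the period \<open>(p', p)\<close>, so that the step from the \<open>n\<close>-th to the
  first partition looks like every other step on the cylinder.
\<close>

locale resonance =
  fixes q1 q2 q3 u :: complex and n :: nat and a b :: "nat \<Rightarrow> nat" and p' p :: int
  assumes q1_nz: "q1 \<noteq> 0" and q3_nz: "q3 \<noteq> 0" and q_prod: "q1 * q2 * q3 = 1"
    and not_root_of_unity: "\<And>q k. q \<in> {q1, q2, q3} \<Longrightarrow> k > 0 \<Longrightarrow> q ^ k \<noteq> 1"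
    and u_nz: "u \<noteq> 0" and n_ge_2: "n \<ge> 2"
    and a_last: "int (a n) = p' - 1 - (\<Sum>i = 1..n - 1. int (a i) + 1)"
    and b_last: "int (b n) = p - 1 - (\<Sum>i = 1..n - 1. int (b i) + 1)"
    and resonance_iff: "\<And>x y :: int. q1 powi x * q3 powi y = 1 \<longleftrightarrow> (\<exists>\<kappa>::int. x = p' * \<kappa> \<and> y = p * \<kappa>)"
    and p_gt: "p > int n"
begin

definition rows :: "(nat \<times> nat) set" where "rows = {1..n} \<times> {1..}"

definition B :: "ptuple set" where "B = resonant_basis n a b"

definition next_comp :: "nat \<Rightarrow> nat" where "next_comp i = (if i = n then 1 else i + 1)"

definition us :: "nat \<Rightarrow> complex" where "us = special_u q1 q3 a b u"

definition wt :: "ptuple \<Rightarrow> nat \<times> nat \<Rightarrow> complex" where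
  "wt lam r = box_weight q1 q3 us lam (fst r) (snd r)"

subsection \<open>Constraints between rows\<close>

text \<open>
  Both the monotonicity of a partition and the interlacing conditions say that the length of
  \<open>r\<close> is at least \<open>c\<close> plus the length of \<open>r'\<close>. Treating them alike
  avoids a case distinction in everything that follows.
\<close>

definition constraint :: "nat \<times> nat \<Rightarrow> nat \<times> nat \<Rightarrow> int \<Rightarrow> bool" where
  "constraint r r' c \<longleftrightarrow> r \<in> rows \<and>
     (fst r' = fst r \<and> snd r' = snd r + 1 \<and> c = 0 \<or>
      fst r' = next_comp (fst r) \<and> snd r' = snd r + b (fst r) \<and> c = - int (a (fst r)))"

definition tight :: "ptuple \<Rightarrow> nat \<times> nat \<Rightarrow> nat \<times> nat \<Rightarrow> bool" where
  "tight lam r r' \<longleftrightarrow> (\<exists>c. constraint r r' c \<and> int (row_length lam r) = int (row_length lam r') + c)"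

lemma next_comp_in: "i \<in> {1..n} \<Longrightarrow> next_comp i \<in> {1..n}" "i \<in> {1..n} \<Longrightarrow> next_comp i \<noteq> i"
  using n_ge_2 by (auto simp: next_comp_def)

lemma constraint_rows:
  assumes "constraint r r' c"
  shows "r \<in> rows" "r' \<in> rows" "r \<noteq> r'"
  using assms next_comp_in[of "fst r"]
  by (cases r; cases r'; auto simp: constraint_def rows_def)+

lemma B_iff:
  "lam \<in> B \<longleftrightarrow> (\<forall>i s. (i, s) \<notin> rows \<longrightarrow> lam i s = 0) \<and> finite {r. row_length lam r \<noteq> 0} \<and>
     (\<forall>r r' c. constraint r r' c \<longrightarrow> int (row_length lam r) \<ge> int (row_length lam r') + c)"
  (is "_ \<longleftrightarrow> ?S \<and> ?F \<and> ?C")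
proof
  assume lam: "lam \<in> B"
  then have pt: "is_ptuple n lam" and c2: "\<And>i s. i \<in> {1..n} \<Longrightarrow> s \<ge> 1 \<Longrightarrow>
      int (lam i s) \<ge> int (lam (next_comp i) (s + b i)) - int (a i)"
    by (auto simp: B_def resonant_basis_def next_comp_def)
  have S: ?S
  proof (intro allI impI)
    fix i s assume "(i, s) \<notin> rows"
    then have "i \<notin> {1..n} \<or> i \<in> {1..n} \<and> s = 0" by (auto simp: rows_def not_le)
    then show "lam i s = 0" using pt by (auto simp: is_ptuple_def is_partition_def)
  qed
  have "{r. row_length lam r \<noteq> 0} \<subseteq> Sigma {1..n} (\<lambda>i. {s. lam i s \<noteq> 0})"
  proof clarsimp
    fix i s assume "0 < lam i s"
    then have "(i, s) \<in> rows" using S by (metis less_not_refl)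
    then show "Suc 0 \<le> i \<and> i \<le> n" by (simp add: rows_def)
  qed
  moreover have "finite (Sigma {1..n} (\<lambda>i. {s. lam i s \<noteq> 0}))"
    using pt by (auto simp: is_ptuple_def is_partition_def)
  ultimately have F: ?F by (rule finite_subset)
  have ?C
    using pt c2 by (fastforce simp: constraint_def rows_def is_ptuple_def is_partition_def)
  with S F show "?S \<and> ?F \<and> ?C" by blast
next
  assume *: "?S \<and> ?F \<and> ?C"
  have C1: "lam i (Suc s) \<le> lam i s" if "i \<in> {1..n}" "s \<ge> 1" for i s
  proof -
    have "constraint (i, s) (i, Suc s) 0" using that by (simp add: constraint_def rows_def)
    with * have "int (lam i s) \<ge> int (lam i (Suc s)) + 0" by fastforce
    then show ?thesis by simp
  qed
  have C2: "int (lam i s) \<ge> int (lam (next_comp i) (s + b i)) - int (a i)" if "i \<in> {1..n}" "s \<ge> 1" for i s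
  proof -
    have "constraint (i, s) (next_comp i, s + b i) (- int (a i))" using that by (simp add: constraint_def rows_def)
    with * have "int (lam i s) \<ge> int (lam (next_comp i) (s + b i)) + (- int (a i))" by fastforce
    then show ?thesis by simp
  qed
  have "finite {s. lam i s \<noteq> 0}" for i
  proof -
    have "finite (snd ` {r. row_length lam r \<noteq> 0})" using * by blast
    moreover have "{s. lam i s \<noteq> 0} \<subseteq> snd ` {r. row_length lam r \<noteq> 0}"
    proof
      fix s assume "s \<in> {s. lam i s \<noteq> 0}"
      then show "s \<in> snd ` {r. row_length lam r \<noteq> 0}"
        by (intro image_eqI[of _ _ "(i, s)"]) auto
    qed
    ultimately show ?thesis by (rule finite_subset[rotated])
  qed
  moreover have "lam i 0 = 0" for i using * by (auto simp: rows_def)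
  moreover have "lam i = (\<lambda>_. 0)" if "i \<notin> {1..n}" for i
    using * that by (auto simp: rows_def)
  ultimately have "is_ptuple n lam" using C1 by (simp add: is_ptuple_def is_partition_def)
  then show "lam \<in> B" using C2 by (simp add: B_def resonant_basis_def next_comp_def)
qed

lemma B_constraint: "lam \<in> B \<Longrightarrow> constraint r r' c \<Longrightarrow> int (row_length lam r) \<ge> int (row_length lam r') + c"
  using B_iff by blast

lemma row_length_plus_box: "row_length (plus_box lam r) r' = (if r' = r then row_length lam r' + 1 else row_length lam r')"
  by (cases r, cases r') (auto simp: plus_box_apply)

lemma finite_support_plus_box: "finite {r'. row_length (plus_box lam r) r' \<noteq> 0} \<longleftrightarrow> finite {r'. row_length lam r' \<noteq> 0}"
proof
  show "finite {r'. row_length lam r' \<noteq> 0}" if "finite {r'. row_length (plus_box lam r) r' \<noteq> 0}"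
    using that by (rule finite_subset[rotated]) (auto simp: row_length_plus_box)
  show "finite {r'. row_length (plus_box lam r) r' \<noteq> 0}" if "finite {r'. row_length lam r' \<noteq> 0}"
    using finite_insert[of r "{r'. row_length lam r' \<noteq> 0}"] that
    by (rule_tac finite_subset[of _ "insert r {r'. row_length lam r' \<noteq> 0}"]) (auto simp: row_length_plus_box)
qed

lemma plus_box_in_B_iff:
  assumes lam: "lam \<in> B" and r: "r \<in> rows"
  shows "plus_box lam r \<in> B \<longleftrightarrow> (\<forall>r'. \<not> tight lam r' r)"
proof
  assume P: "plus_box lam r \<in> B"
  show "\<forall>r'. \<not> tight lam r' r"
  proof (intro allI notI)
    fix r' assume "tight lam r' r"
    then obtain c where c: "constraint r' r c" "int (row_length lam r') = int (row_length lam r) + c"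
      by (auto simp: tight_def)
    show False using B_constraint[OF P c(1)] c(2) constraint_rows(3)[OF c(1)]
      by (simp add: row_length_plus_box)
  qed
next
  assume nt: "\<forall>r'. \<not> tight lam r' r"
  have "int (row_length (plus_box lam r) r1) \<ge> int (row_length (plus_box lam r) r2) + c" if c: "constraint r1 r2 c" for r1 r2 c
  proof (cases "r2 = r")
    case True
    have "int (row_length lam r1) \<noteq> int (row_length lam r2) + c" using nt c True by (auto simp: tight_def)
    then show ?thesis using B_constraint[OF lam c] True constraint_rows(3)[OF c]
      by (simp add: row_length_plus_box)
  next
    case False
    then show ?thesis using B_constraint[OF lam c] by (auto simp: row_length_plus_box)
  qed
  moreover have "plus_box lam r i s = 0" if "(i, s) \<notin> rows" for i s
    using that r lam B_iff by (auto simp: plus_box_apply)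
  ultimately show "plus_box lam r \<in> B" using lam finite_support_plus_box unfolding B_iff by blast
qed

lemma minus_box_in_B_iff:
  assumes r: "r \<in> rows" and P: "plus_box mu r \<in> B"
  shows "mu \<in> B \<longleftrightarrow> (\<forall>r'. \<not> tight (plus_box mu r) r r')"
proof
  assume mu: "mu \<in> B"
  show "\<forall>r'. \<not> tight (plus_box mu r) r r'"
  proof (intro allI notI)
    fix r' assume "tight (plus_box mu r) r r'"
    then obtain c where c: "constraint r r' c"
        "int (row_length (plus_box mu r) r) = int (row_length (plus_box mu r) r') + c"
      by (auto simp: tight_def)
    show False using B_constraint[OF mu c(1)] c(2) constraint_rows(3)[OF c(1)]
      by (simp add: row_length_plus_box split: if_splits)
  qed
next
  assume nt: "\<forall>r'. \<not> tight (plus_box mu r) r r'"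
  have "int (row_length mu r1) \<ge> int (row_length mu r2) + c" if c: "constraint r1 r2 c" for r1 r2 c
  proof (cases "r1 = r")
    case True
    have "int (row_length (plus_box mu r) r1) \<noteq> int (row_length (plus_box mu r) r2) + c"
      using nt c True by (auto simp: tight_def)
    then show ?thesis using B_constraint[OF P c] True constraint_rows(3)[OF c]
      by (simp add: row_length_plus_box)
  next
    case False
    then show ?thesis using B_constraint[OF P c] by (simp add: row_length_plus_box split: if_splits)
  qed
  moreover have "mu i s = 0" if "(i, s) \<notin> rows" for i s
  proof -
    have "plus_box mu r i s = 0" using that P B_iff by blast
    then show ?thesis using that r by (auto simp: plus_box_apply split: if_splits)
  qed
  ultimately show "mu \<in> B" using P finite_support_plus_box unfolding B_iff by blast
qed

text \<open>
  A constraint violated by \<open>mu\<close> is violated by whichever of the two given tuples leaves its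
  left-hand row alone; one violated by the tuple with both boxes is violated by the given tuple in which its
  right-hand row has grown. This is the reason why the two orders of adding two boxes, or of adding one and
  removing another, are both visible inside the basis.
\<close>

lemma diamond:
  assumes "r \<noteq> r'" "r \<in> rows" "r' \<in> rows" and P: "plus_box mu r \<in> B" and P': "plus_box mu r' \<in> B"
  shows "mu \<in> B" "plus_box (plus_box mu r) r' \<in> B"
proof -
  show mu: "mu \<in> B"
    unfolding minus_box_in_B_iff[OF \<open>r \<in> rows\<close> P]
  proof (intro allI notI)
    fix r2 assume "tight (plus_box mu r) r r2"
    then obtain c where c: "constraint r r2 c"
        "int (row_length (plus_box mu r) r) = int (row_length (plus_box mu r) r2) + c"
      by (auto simp: tight_def)
    show False using B_constraint[OF P' c(1)] c(2) \<open>r \<noteq> r'\<close> constraint_rows(3)[OF c(1)]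
      by (simp add: row_length_plus_box split: if_splits)
  qed
  show "plus_box (plus_box mu r) r' \<in> B"
    unfolding plus_box_in_B_iff[OF P \<open>r' \<in> rows\<close>]
  proof (intro allI notI)
    fix r2 assume "tight (plus_box mu r) r2 r'"
    then obtain c where c: "constraint r2 r' c"
        "int (row_length (plus_box mu r) r2) = int (row_length (plus_box mu r) r') + c"
      by (auto simp: tight_def)
    show False using B_constraint[OF P' c(1)] c(2) \<open>r \<noteq> r'\<close> constraint_rows(3)[OF c(1)]
      by (simp add: row_length_plus_box split: if_splits)
  qed
qed

subsection \<open>Lifting the cylinder to the plane\<close>

text \<open>
  Exponents of \<open>q1\<close> and \<open>q3\<close> in \<open>u_i/u\<close>; \<open>xpos\<close> and
  \<open>ypos\<close> below are the exponents in the weight of a row.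
\<close>

definition column_offset :: "nat \<Rightarrow> int" where "column_offset i = - (\<Sum>k = 1..<i. int (a k) + 1)"
definition level_offset :: "nat \<Rightarrow> int" where "level_offset i = - (\<Sum>k = 1..<i. int (b k) + 1)"

definition xpos :: "ptuple \<Rightarrow> nat \<times> nat \<Rightarrow> int" where
  "xpos lam r = column_offset (fst r) + int (row_length lam r)"
definition ypos :: "nat \<times> nat \<Rightarrow> int" where
  "ypos r = level_offset (fst r) + int (snd r) - 1"

lemma column_offset_Suc: "i \<ge> 1 \<Longrightarrow> column_offset (Suc i) = column_offset i - int (a i) - 1"
  and level_offset_Suc: "i \<ge> 1 \<Longrightarrow> level_offset (Suc i) = level_offset i - int (b i) - 1"
  by (simp_all add: column_offset_def level_offset_def)

lemma column_offset_1 [simp]: "column_offset (Suc 0) = 0" "level_offset (Suc 0) = 0"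
  by (simp_all add: column_offset_def level_offset_def)

lemma column_offset_last: "column_offset n - int (a n) - 1 = - p'" and level_offset_last: "level_offset n - int (b n) - 1 = - p"
proof -
  have "{1..n - 1} = {1..<n}" using n_ge_2 by auto
  then show "column_offset n - int (a n) - 1 = - p'" "level_offset n - int (b n) - 1 = - p"
    using a_last b_last by (simp_all add: column_offset_def level_offset_def)
qed

lemma us_Suc_eq: "us (Suc k) = u * q1 powi column_offset (Suc k) * q3 powi level_offset (Suc k)"
proof (induction k)
  case 0
  have "us (Suc 0) = u" unfolding us_def by (rule special_u.simps)
  then show ?case by (simp only: column_offset_1 power_int_0_right mult_1_right)
next
  case (Suc k)
  have u_step: "us (Suc (Suc k)) = us (Suc k) / (q1 ^ (a (Suc k) + 1) * q3 ^ (b (Suc k) + 1))"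
    by (simp only: us_def special_u.simps)
  have X: "q1 powi column_offset (Suc (Suc k)) = q1 powi column_offset (Suc k) / q1 ^ (a (Suc k) + 1)"
    using power_int_diff_nat[OF q1_nz, of "column_offset (Suc k)" "a (Suc k) + 1"] column_offset_Suc[of "Suc k"]
    by (simp only: of_nat_add of_nat_1 diff_diff_eq le_add1 plus_1_eq_Suc[symmetric])
  have Y: "q3 powi level_offset (Suc (Suc k)) = q3 powi level_offset (Suc k) / q3 ^ (b (Suc k) + 1)"
    using power_int_diff_nat[OF q3_nz, of "level_offset (Suc k)" "b (Suc k) + 1"] level_offset_Suc[of "Suc k"]
    by (simp only: of_nat_add of_nat_1 diff_diff_eq le_add1 plus_1_eq_Suc[symmetric])
  have alg: "u * A * C / (A' * C') = u * (A / A') * (C / C')" for A C A' C' :: complex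
    by simp
  show ?case unfolding u_step X Y Suc.IH by (rule alg)
qed

lemma us_eq: "i \<ge> 1 \<Longrightarrow> us i = u * q1 powi column_offset i * q3 powi level_offset i"
  using us_Suc_eq[of "i - 1"] by simp

lemma wt_eq:
  assumes "r \<in> rows"
  shows "wt lam r = u * q1 powi xpos lam r * q3 powi ypos r"
proof -
  have "us (fst r) = u * q1 powi column_offset (fst r) * q3 powi level_offset (fst r)"
    using assms by (intro us_eq) (auto simp: rows_def)
  moreover have "ypos r = level_offset (fst r) + (int (snd r) - 1)" by (simp add: ypos_def)
  ultimately show ?thesis
    using q1_nz q3_nz by (simp add: wt_def box_weight_def xpos_def power_int_add)
qed

lemma wt_nz: "r \<in> rows \<Longrightarrow> wt lam r \<noteq> 0"
  using u_nz q1_nz q3_nz by (simp add: wt_eq)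

text \<open>
  The exact form of the resonance turns a monomial relation between two weights into a relation between
  points of the plane up to the period \<open>(p', p)\<close>.
\<close>

lemma wt_ratio_iff:
  assumes "r \<in> rows" "r' \<in> rows"
  shows "wt mu r' = q1 powi i * q3 powi j * wt lam r \<longleftrightarrow>
    (\<exists>\<kappa>. xpos mu r' - p' * \<kappa> = xpos lam r + i \<and> ypos r' - p * \<kappa> = ypos r + j)"
proof -
  let ?x = "xpos mu r' - xpos lam r - i" and ?y = "ypos r' - ypos r - j"
  have "wt mu r' = q1 powi i * q3 powi j * wt lam r \<longleftrightarrow>
      u * (q1 powi (xpos lam r + i) * q3 powi (ypos r + j)) * (q1 powi ?x * q3 powi ?y)
    = u * (q1 powi (xpos lam r + i) * q3 powi (ypos r + j)) * 1"
  proof -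
    have X: "q1 powi xpos mu r' = q1 powi (xpos lam r + i) * q1 powi ?x"
      using power_int_add[of q1 "xpos lam r + i" ?x] q1_nz by simp
    have Y: "q3 powi ypos r' = q3 powi (ypos r + j) * q3 powi ?y"
      using power_int_add[of q3 "ypos r + j" ?y] q3_nz by simp
    have "wt mu r' = u * (q1 powi (xpos lam r + i) * q3 powi (ypos r + j)) * (q1 powi ?x * q3 powi ?y)"
      unfolding wt_eq[OF assms(2)] X Y by (simp only: mult_ac)
    moreover have "q1 powi i * q3 powi j * wt lam r = u * (q1 powi (xpos lam r + i) * q3 powi (ypos r + j)) * 1"
      using wt_eq[OF assms(1), of lam] q1_nz q3_nz by (simp add: power_int_add mult_ac)
    ultimately show ?thesis by (simp only:)
  qed
  also have "\<dots> \<longleftrightarrow> q1 powi ?x * q3 powi ?y = 1"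
    using u_nz q1_nz q3_nz by (subst mult_cancel_left) simp
  also have "\<dots> \<longleftrightarrow> (\<exists>\<kappa>. ?x = p' * \<kappa> \<and> ?y = p * \<kappa>)" by (rule resonance_iff)
  also have "\<dots> \<longleftrightarrow> (\<exists>\<kappa>. xpos mu r' - p' * \<kappa> = xpos lam r + i \<and> ypos r' - p * \<kappa> = ypos r + j)"
    by (intro ex_cong1) auto
  finally show ?thesis .
qed

text \<open>
  The universal cover: the copy \<open>I \<in> \<int>\<close> lies over the partition \<open>comp_of
  I\<close>, with rows shifted by multiples of the period, so that copy \<open>I + n\<close> is copy
  \<open>I\<close> translated by \<open>(-p', -p)\<close>. The value \<open>row_end lam I y\<close> is the
  horizontal position of the end of the row at level \<open>y\<close> in copy \<open>I\<close>; it is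
  meaningful for \<open>level_shift I \<le> y\<close>.
\<close>

definition comp_of :: "int \<Rightarrow> nat" where "comp_of I = nat (I mod int n) + 1"
definition column_shift :: "int \<Rightarrow> int" where "column_shift I = column_offset (comp_of I) - p' * (I div int n)"
definition level_shift :: "int \<Rightarrow> int" where "level_shift I = level_offset (comp_of I) - p * (I div int n)"
definition row_end :: "ptuple \<Rightarrow> int \<Rightarrow> int \<Rightarrow> int" where
  "row_end lam I y = column_shift I + int (lam (comp_of I) (nat (y - level_shift I + 1)))"

lemma comp_of_in: "comp_of I \<in> {1..n}"
proof -
  have "0 \<le> I mod int n" "I mod int n < int n" using n_ge_2 by simp_all
  then show ?thesis unfolding comp_of_def by auto
qed

lemma lift_Suc:
  "comp_of (I + 1) = next_comp (comp_of I)" "column_shift (I + 1) = column_shift I - int (a (comp_of I)) - 1"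
  "level_shift (I + 1) = level_shift I - int (b (comp_of I)) - 1"
proof -
  define N where "N = int n"
  define k where "k = I div N"
  define j where "j = I mod N"
  have N: "N \<ge> 2" using n_ge_2 by (simp add: N_def)
  have I: "I = N * k + j" by (simp add: k_def j_def)
  have j: "0 \<le> j" "j < N" using N by (auto simp: j_def)
  have c: "comp_of I = nat j + 1" by (simp add: comp_of_def j_def N_def)
  have "comp_of (I + 1) = next_comp (comp_of I) \<and> column_shift (I + 1) = column_shift I - int (a (comp_of I)) - 1
      \<and> level_shift (I + 1) = level_shift I - int (b (comp_of I)) - 1"
  proof (cases "j = N - 1")
    case True
    then have "I + 1 = N * (k + 1) + 0" using I by (simp add: algebra_simps)
    then have dm: "(I + 1) div N = k + 1" "(I + 1) mod N = 0" using N by simp_all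
    have cn: "comp_of I = n" using True N c by (simp add: N_def nat_diff_distrib)
    show ?thesis using dm cn column_offset_last level_offset_last
      by (simp add: comp_of_def next_comp_def column_shift_def level_shift_def N_def[symmetric] k_def[symmetric] algebra_simps)
  next
    case False
    have e: "I + 1 = (j + 1) + N * k" using I by simp
    have dm: "(I + 1) div N = k" "(I + 1) mod N = j + 1"
      unfolding e using False j N by (simp_all add: div_pos_pos_trivial)
    have c1: "comp_of (I + 1) = Suc (comp_of I)"
      using dm c j by (simp add: comp_of_def N_def nat_add_distrib)
    have "comp_of I \<noteq> n" using False c j by (auto simp: N_def)
    then have "next_comp (comp_of I) = Suc (comp_of I)" by (simp add: next_comp_def)
    then show ?thesis using c1 dm column_offset_Suc[of "comp_of I"] level_offset_Suc[of "comp_of I"] comp_of_in[of I]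
      by (simp add: column_shift_def level_shift_def N_def[symmetric] k_def[symmetric])
  qed
  then show "comp_of (I + 1) = next_comp (comp_of I)" "column_shift (I + 1) = column_shift I - int (a (comp_of I)) - 1"
    "level_shift (I + 1) = level_shift I - int (b (comp_of I)) - 1" by auto
qed

lemma level_shift_antimono: "level_shift (I + int d) \<le> level_shift I - int d"
proof (induction d)
  case (Suc d)
  have e: "I + int (Suc d) = (I + int d) + 1" by simp
  show ?case using Suc lift_Suc(3)[of "I + int d"] unfolding e by simp
qed simp

definition lift :: "nat \<times> nat \<Rightarrow> int \<Rightarrow> int" where "lift r \<kappa> = int (fst r) - 1 + int n * \<kappa>"

text \<open>
  The \<open>\<kappa>\<close>-th translate of a row as a row of the cover.
\<close>

lemma lift_facts:
  assumes "r \<in> rows"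
  shows "comp_of (lift r \<kappa>) = fst r" "level_shift (lift r \<kappa>) = level_offset (fst r) - p * \<kappa>" "column_shift (lift r \<kappa>) = column_offset (fst r) - p' * \<kappa>"
    "level_shift (lift r \<kappa>) \<le> ypos r - p * \<kappa>" "row_end lam (lift r \<kappa>) (ypos r - p * \<kappa>) = xpos lam r - p' * \<kappa>"
proof -
  have i: "fst r \<ge> 1" "fst r \<le> n" "snd r \<ge> 1" using assms by (auto simp: rows_def)
  have dm: "lift r \<kappa> div int n = \<kappa>" "lift r \<kappa> mod int n = int (fst r) - 1"
    using i n_ge_2 by (simp_all add: lift_def div_pos_pos_trivial)
  show c: "comp_of (lift r \<kappa>) = fst r" using dm i by (simp add: comp_of_def nat_diff_distrib)
  show Y: "level_shift (lift r \<kappa>) = level_offset (fst r) - p * \<kappa>" and X: "column_shift (lift r \<kappa>) = column_offset (fst r) - p' * \<kappa>"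
    using c dm by (simp_all add: column_shift_def level_shift_def)
  show "level_shift (lift r \<kappa>) \<le> ypos r - p * \<kappa>" using Y i by (simp add: ypos_def)
  show "row_end lam (lift r \<kappa>) (ypos r - p * \<kappa>) = xpos lam r - p' * \<kappa>"
    using X Y c by (simp add: row_end_def xpos_def ypos_def)
qed

lemma row_end_antimono:
  assumes lam: "lam \<in> B" and "level_shift I \<le> y" "y \<le> y'"
  shows "row_end lam I y' \<le> row_end lam I y"
proof -
  have step: "row_end lam I (z + 1) \<le> row_end lam I z" if "level_shift I \<le> z" for z
  proof -
    define s where "s = nat (z - level_shift I + 1)"
    have s: "s \<ge> 1" "nat (z + 1 - level_shift I + 1) = s + 1" using that by (simp_all add: s_def nat_add_distrib[symmetric])
    have "constraint (comp_of I, s) (comp_of I, s + 1) 0"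
      using s comp_of_in[of I] by (simp add: constraint_def rows_def)
    from B_constraint[OF lam this] show ?thesis using s by (simp add: row_end_def s_def[symmetric])
  qed
  have "row_end lam I (y + int k) \<le> row_end lam I y" for k
  proof (induction k)
    case (Suc k)
    have e: "y + int (Suc k) = y + int k + 1" by simp
    show ?case using Suc step[of "y + int k"] assms(2) unfolding e by simp
  qed simp
  from this[of "nat (y' - y)"] show ?thesis using assms(3) by simp
qed

text \<open>
  The master inequality. Going from copy \<open>I\<close> to copy \<open>I + 1\<close> one level higher up
  in the plane (level \<open>y - 1\<close>) the row end drops by at least one, and within a copy it does not
  increase with the level; iterating gives a drop of \<open>d\<close> over \<open>d\<close> copies for every
  level from \<open>y - d\<close> on. The statements about coinciding or neighbouring weights below compare
  instances for the two directions between the copies.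
\<close>

lemma row_end_descent:
  assumes lam: "lam \<in> B"
  shows "level_shift I \<le> y \<Longrightarrow> y - int d \<le> y' \<Longrightarrow> row_end lam (I + int d) y' + int d \<le> row_end lam I y"
proof (induction d arbitrary: y')
  case 0
  then show ?case using row_end_antimono[OF lam, of I y y'] by simp
next
  case (Suc d)
  define J where "J = I + int d"
  define z where "z = y - int d"
  have J: "level_shift J \<le> z" using level_shift_antimono[of I d] Suc.prems by (simp add: J_def z_def)
  have IH: "row_end lam J z + int d \<le> row_end lam I y" using Suc.IH[of z] Suc.prems by (simp add: J_def z_def)
  define s where "s = nat (z - level_shift J + 1)"
  have s: "s \<ge> 1" "nat (z - 1 - level_shift (J + 1) + 1) = s + b (comp_of J)"
    using J by (simp_all add: s_def lift_Suc(3) nat_add_distrib[symmetric])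
  have "constraint (comp_of J, s) (comp_of (J + 1), s + b (comp_of J)) (- int (a (comp_of J)))"
    using s comp_of_in[of J] by (simp add: constraint_def rows_def lift_Suc(1))
  from B_constraint[OF lam this] have "row_end lam (J + 1) (z - 1) + 1 \<le> row_end lam J z"
    using s by (simp add: row_end_def s_def[symmetric] lift_Suc(2))
  moreover have "row_end lam (J + 1) y' \<le> row_end lam (J + 1) (z - 1)"
    using level_shift_antimono[of J 1] J Suc.prems by (intro row_end_antimono[OF lam]) (auto simp: z_def)
  moreover have e: "I + int (Suc d) = J + 1" by (simp add: J_def)
  ultimately show ?case using IH unfolding e by simp
qed

lemma row_end_descent':
  assumes "lam \<in> B" "I \<le> J" "level_shift I \<le> y" "y - (J - I) \<le> y'"
  shows "row_end lam J y' + (J - I) \<le> row_end lam I y"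
  using row_end_descent[of lam I y "nat (J - I)" y'] assms by simp

lemma row_end_eq_same_level:
  assumes lam: "lam \<in> B" and "level_shift I \<le> y" "level_shift J \<le> y" "row_end lam J y = row_end lam I y"
  shows "J = I"
  using row_end_descent'[OF lam, of I J y y] row_end_descent'[OF lam, of J I y y] assms by linarith

lemma row_end_eq_level_below:
  assumes lam: "lam \<in> B" and "level_shift I \<le> y" "level_shift J \<le> y - 1" "row_end lam J (y - 1) = row_end lam I y"
  shows "J = I"
  using row_end_descent'[OF lam, of I J y "y - 1"] row_end_descent'[OF lam, of J I "y - 1" y] assms by linarith

lemma row_end_eq_diagonal:
  assumes lam: "lam \<in> B" and "level_shift I \<le> y" "level_shift J \<le> y + 1" "row_end lam J (y + 1) = row_end lam I y + 1"
  shows "J = I - 1"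
proof -
  have "\<not> I \<le> J" using row_end_descent'[OF lam, of I J y "y + 1"] assms by linarith
  then show ?thesis using row_end_descent'[OF lam, of J I "y + 1" y] assms by linarith
qed

lemma row_end_eq_right:
  assumes lam: "lam \<in> B" and I: "level_shift I \<le> y" and J: "level_shift J \<le> y" and eq: "row_end lam J y = row_end lam I y + 1"
  shows "J = I - 1" "level_shift I \<le> y - 1" "row_end lam I (y - 1) = row_end lam I y" "row_end lam J (y + 1) = row_end lam J y"
proof -
  have "\<not> I \<le> J" using row_end_descent'[OF lam, of I J y y] assms by linarith
  then show JI: "J = I - 1" using row_end_descent'[OF lam, of J I y y] assms by linarith
  show I1: "level_shift I \<le> y - 1" using level_shift_antimono[of J 1] JI J by simp
  show "row_end lam I (y - 1) = row_end lam I y"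
    using row_end_descent'[OF lam, of J I y "y - 1"] row_end_antimono[OF lam I1, of y] JI J eq by simp
  show "row_end lam J (y + 1) = row_end lam J y"
    using row_end_descent'[OF lam, of J I "y + 1" y] row_end_antimono[OF lam J, of "y + 1"] JI J eq by simp
qed

subsection \<open>Neighbours of a row\<close>

lemma q2_eq: "q2 = inverse (q1 * q3)"
  using q_prod q1_nz q3_nz by (simp add: field_simps)

lemma q2_nz: "q2 \<noteq> 0"
  using q_prod by auto

lemma q2_powi: "q2 = q1 powi (- 1) * q3 powi (- 1)"
  by (simp add: q2_eq power_int_minus)

lemmas lift_0 = lift_facts[where \<kappa> = 0, simplified mult_zero_right diff_0_right]

text \<open>
  Chooses the translate of \<open>r'\<close> that stands in the prescribed position relative to
  \<open>r\<close>, so that \<open>row_end_descent\<close> applies.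
\<close>

lemma wt_ratio_lift:
  assumes r: "r \<in> rows" "r' \<in> rows" and eq: "wt mu r' = q1 powi i * q3 powi j * wt lam r"
  obtains J where "comp_of J = fst r'" "int (snd r') = ypos r + j - level_shift J + 1"
    "level_shift J \<le> ypos r + j" "row_end mu J (ypos r + j) = xpos lam r + i"
    "column_shift J + int (row_length mu r') = xpos lam r + i"
proof -
  obtain \<kappa> where k: "xpos mu r' - p' * \<kappa> = xpos lam r + i" "ypos r' - p * \<kappa> = ypos r + j"
    using eq unfolding wt_ratio_iff[OF r] by blast
  note L = lift_facts(1-4)[OF r(2), of \<kappa>, unfolded k]
  have "int (snd r') = ypos r + j - level_shift (lift r' \<kappa>) + 1"
    using L(2) k(2) unfolding ypos_def by linarith
  moreover have "column_shift (lift r' \<kappa>) + int (row_length mu r') = xpos lam r + i"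
    using L(3) k(1) unfolding xpos_def by linarith
  moreover have "row_end mu (lift r' \<kappa>) (ypos r + j) = xpos lam r + i"
    using lift_facts(5)[OF r(2), of mu \<kappa>] unfolding k .
  ultimately show ?thesis using that L(1,4) by blast
qed

lemma wt_inject:
  assumes lam: "lam \<in> B" and r: "r \<in> rows" "r' \<in> rows" and eq: "wt lam r' = wt lam r"
  shows "r' = r"
proof -
  have "wt lam r' = q1 powi 0 * q3 powi 0 * wt lam r" using eq by simp
  then obtain J where J: "comp_of J = fst r'" "int (snd r') = ypos r + 0 - level_shift J + 1"
    "level_shift J \<le> ypos r + 0" "row_end lam J (ypos r + 0) = xpos lam r + 0"
    by (rule wt_ratio_lift[OF r])
  have "J = lift r 0"
    using J(3,4) lift_0(4,5)[OF r(1)] by - (rule row_end_eq_same_level[OF lam, of _ "ypos r"]; simp)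
  then show ?thesis using J(1,2) lift_0(1,2)[OF r(1)] by (simp add: ypos_def prod_eq_iff)
qed

text \<open>
  A quotient \<open>q3\<close> or \<open>q2\<close> of weights puts the two row ends, on the cover, one
  level apart or one diagonal step apart. The master inequality leaves only one copy for the second row, and
  this is the row on the other side of a constraint, with equality.
\<close>

lemma tight_if_wt:
  assumes lam: "lam \<in> B" and r: "r \<in> rows" "r' \<in> rows"
    and eq: "wt lam r' = q3 * wt lam r \<or> wt lam r' = q2 * wt lam r"
  shows "tight lam r r'"
proof (cases "wt lam r' = q3 * wt lam r")
  case True
  then have "wt lam r' = q1 powi 0 * q3 powi 1 * wt lam r" by simp
  then obtain J where J: "comp_of J = fst r'" "int (snd r') = ypos r + 1 - level_shift J + 1"
    "level_shift J \<le> ypos r + 1" "row_end lam J (ypos r + 1) = xpos lam r + 0"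
    "column_shift J + int (row_length lam r') = xpos lam r + 0"
    by (rule wt_ratio_lift[OF r])
  have "lift r 0 = J"
    using J(3,4) lift_0(4,5)[OF r(1)] by - (rule row_end_eq_level_below[OF lam, of _ "ypos r + 1"]; simp)
  then have "constraint r r' 0" "int (row_length lam r) = int (row_length lam r') + 0"
    using J(1,2,5) lift_0(1-3)[OF r(1)] r(1) by (auto simp add: constraint_def xpos_def ypos_def)
  then show ?thesis unfolding tight_def by blast
next
  case False
  with eq have "wt lam r' = q1 powi (- 1) * q3 powi (- 1) * wt lam r" by (simp add: q2_powi)
  then obtain J where J: "comp_of J = fst r'" "int (snd r') = ypos r + (- 1) - level_shift J + 1"
    "level_shift J \<le> ypos r + (- 1)" "row_end lam J (ypos r + (- 1)) = xpos lam r + (- 1)"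
    "column_shift J + int (row_length lam r') = xpos lam r + (- 1)"
    by (rule wt_ratio_lift[OF r])
  have "lift r 0 = J - 1"
    using J(3,4) lift_0(4,5)[OF r(1)] by - (rule row_end_eq_diagonal[OF lam, of _ "ypos r - 1"]; simp)
  then have "J = lift r 0 + 1" by simp
  then have "constraint r r' (- int (a (fst r)))"
      "int (row_length lam r) = int (row_length lam r') + (- int (a (fst r)))"
    using J(1,2,5) lift_0(1-3)[OF r(1)] lift_Suc[of "lift r 0"] r(1)
    by (auto simp add: constraint_def xpos_def ypos_def)
  then show ?thesis unfolding tight_def by blast
qed

lemma tight_cases:
  assumes "tight lam r r'"
  shows "snd r' = snd r + 1 \<and> wt lam r' = q3 * wt lam r \<or> snd r \<le> snd r' \<and> wt lam r' = q2 * wt lam r"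
proof -
  obtain c where c: "constraint r r' c" "int (row_length lam r) = int (row_length lam r') + c"
    using assms by (auto simp: tight_def)
  note r = constraint_rows(1,2)[OF c(1)]
  consider (below) "fst r' = fst r" "snd r' = snd r + 1" "c = 0"
    | (diagonal) "fst r' = next_comp (fst r)" "snd r' = snd r + b (fst r)" "c = - int (a (fst r))"
    using c(1) by (auto simp: constraint_def)
  then show ?thesis
  proof cases
    case below
    then have "xpos lam r' - p' * 0 = xpos lam r + 0 \<and> ypos r' - p * 0 = ypos r + 1"
      using c by (simp add: xpos_def ypos_def)
    then have "wt lam r' = q1 powi 0 * q3 powi 1 * wt lam r"
      unfolding wt_ratio_iff[OF r] by blast
    then show ?thesis using below by simp
  next
    case diagonal
    have "\<exists>\<kappa>. column_offset (fst r') - p' * \<kappa> = column_offset (fst r) - int (a (fst r)) - 1 \<and>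
        level_offset (fst r') - p * \<kappa> = level_offset (fst r) - int (b (fst r)) - 1"
    proof (cases "fst r = n")
      case True
      then show ?thesis using diagonal column_offset_last level_offset_last by (intro exI[of _ 1]) (simp add: next_comp_def)
    next
      case False
      have "fst r \<ge> 1" using r by (auto simp: rows_def)
      then show ?thesis using diagonal False column_offset_Suc[of "fst r"] level_offset_Suc[of "fst r"]
        by (intro exI[of _ 0]) (simp add: next_comp_def)
    qed
    then obtain \<kappa> where "xpos lam r' - p' * \<kappa> = xpos lam r + - 1 \<and> ypos r' - p * \<kappa> = ypos r + - 1"
      using c diagonal by (auto simp: xpos_def ypos_def algebra_simps)
    then have "wt lam r' = q1 powi (- 1) * q3 powi (- 1) * wt lam r"
      unfolding wt_ratio_iff[OF r] by blast
    then show ?thesis using diagonal by (simp add: q2_powi)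
  qed
qed

lemma wt_if_tight:
  assumes "tight lam r r'"
  shows "wt lam r' = q3 * wt lam r \<or> wt lam r' = q2 * wt lam r"
  using tight_cases[OF assms] by blast

lemma tight_iff_wt:
  assumes "lam \<in> B" "r \<in> rows" "r' \<in> rows"
  shows "tight lam r r' \<longleftrightarrow> wt lam r' = q3 * wt lam r \<or> wt lam r' = q2 * wt lam r"
  using tight_if_wt[OF assms] wt_if_tight by blast

text \<open>
  If the ends of two rows are horizontal neighbours, then the second row lies in the previous copy, and the
  master inequality forces the row above the first and the row below the second to end in the same columns.
  The two new weights are what excludes wheel configurations and cancels double poles later on.
\<close>

lemma adjacent_columns:
  assumes lam: "lam \<in> B" and r: "r \<in> rows" "r' \<in> rows" and eq: "wt lam r' = q1 * wt lam r"
  shows "snd r \<ge> 2" "wt lam r = q3 * wt lam (fst r, snd r - 1)" "wt lam r = q2 * wt lam (fst r', snd r' + 1)"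
proof -
  have "wt lam r' = q1 powi 1 * q3 powi 0 * wt lam r" using eq by simp
  then obtain J where J: "comp_of J = fst r'" "int (snd r') = ypos r + 0 - level_shift J + 1"
    "level_shift J \<le> ypos r + 0" "row_end lam J (ypos r + 0) = xpos lam r + 1"
    "column_shift J + int (row_length lam r') = xpos lam r + 1"
    by (rule wt_ratio_lift[OF r])
  note I = lift_0(1-4)[OF r(1)] lift_0(5)[OF r(1), of lam]
  have "row_end lam J (ypos r) = row_end lam (lift r 0) (ypos r) + 1" "level_shift J \<le> ypos r" using J I by simp_all
  note N = row_end_eq_right(2-4)[OF lam I(4) this(2,1)]
  show s: "snd r \<ge> 2" using N(1) I(2) by (simp add: ypos_def)
  have below: "wt lam (fst x, snd x + 1) = q3 * wt lam x"
    if "x \<in> rows" "lam (fst x) (snd x + 1) = row_length lam x" for x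
  proof -
    have x: "(fst x, snd x + 1) \<in> rows" using that(1) by (auto simp: rows_def)
    have "xpos lam (fst x, snd x + 1) - p' * 0 = xpos lam x + 0 \<and> ypos (fst x, snd x + 1) - p * 0 = ypos x + 1"
      using that by (simp add: xpos_def ypos_def)
    then have "wt lam (fst x, snd x + 1) = q1 powi 0 * q3 powi 1 * wt lam x"
      unfolding wt_ratio_iff[OF that(1) x] by blast
    then show ?thesis by simp
  qed
  have c: "(fst r, snd r - 1) \<in> rows" using r(1) s by (auto simp: rows_def)
  have y: "nat (ypos r - 1 - level_shift (lift r 0) + 1) = snd r - 1" "nat (ypos r - level_shift (lift r 0) + 1) = snd r"
    using I(2) s by (simp_all add: ypos_def nat_diff_distrib)
  have "lam (fst r) (snd r - 1) = row_length lam r"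
    using N(2) I(1) unfolding row_end_def y by simp
  then show "wt lam r = q3 * wt lam (fst r, snd r - 1)" using below[OF c] s by simp
  have y: "nat (ypos r + 1 - level_shift J + 1) = snd r' + 1" "nat (ypos r - level_shift J + 1) = snd r'"
    using J(2) by simp_all
  have "lam (fst r') (snd r' + 1) = row_length lam r'"
    using N(3) J(1) unfolding row_end_def y by simp
  then show "wt lam r = q2 * wt lam (fst r', snd r' + 1)"
    using below[OF r(2)] eq q1_nz q3_nz by (simp add: q2_eq field_simps)
qed

text \<open>
  Together with \<open>wt_inject\<close> this excludes all quotients at which a factor in the coefficients
  of \<open>e\<close> and \<open>f\<close> vanishes or has a pole.
\<close>

lemma addable_row:
  assumes lam: "lam \<in> B" and P: "plus_box lam r \<in> B" and r: "r \<in> rows" "r' \<in> rows"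
  shows "wt lam r \<noteq> q3 * wt lam r'" "wt lam r \<noteq> q2 * wt lam r'" "wt lam r' \<noteq> q1 * wt lam r"
proof -
  have nt: "\<not> tight lam \<rho> r" for \<rho> using plus_box_in_B_iff[OF lam r(1)] P by blast
  have q3: "wt lam r \<noteq> q3 * wt lam \<rho>" if "\<rho> \<in> rows" for \<rho>
    using nt[of \<rho>] tight_iff_wt[OF lam that r(1)] by blast
  then show "wt lam r \<noteq> q3 * wt lam r'" using r by blast
  show "wt lam r \<noteq> q2 * wt lam r'" using nt[of r'] tight_iff_wt[OF lam r(2,1)] by blast
  show "wt lam r' \<noteq> q1 * wt lam r"
  proof
    assume "wt lam r' = q1 * wt lam r"
    note A = adjacent_columns(1,2)[OF lam r this]
    moreover have "(fst r, snd r - 1) \<in> rows" using r(1) A(1) by (auto simp: rows_def)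
    ultimately show False using q3 by blast
  qed
qed

text \<open>
  A potential on rows that grows along every constraint. One step down in a partition raises it by
  \<open>n\<close>, a step to the next partition by \<open>p - n\<close>, also across the seam from the
  \<open>n\<close>-th to the first partition.
\<close>

definition height :: "nat \<times> nat \<Rightarrow> int" where "height r = p * int (fst r) + int n * ypos r"

lemma tight_height:
  assumes "tight lam r r'" "row_length lam r > 0"
  shows "row_length lam r' > 0" "height r' > height r"
proof -
  obtain c where c: "constraint r r' c" "int (row_length lam r) = int (row_length lam r') + c"
    using assms by (auto simp: tight_def)
  note r = constraint_rows(1,2)[OF c(1)]
  show "row_length lam r' > 0" using c assms(2) by (auto simp: constraint_def)
  consider (below) "fst r' = fst r" "snd r' = snd r + 1"
    | (diagonal) "fst r' = next_comp (fst r)" "snd r' = snd r + b (fst r)"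
    using c(1) by (auto simp: constraint_def)
  then show "height r' > height r"
  proof cases
    case below
    then show ?thesis using n_ge_2 by (simp add: height_def ypos_def algebra_simps)
  next
    case diagonal
    show ?thesis
    proof (cases "fst r = n")
      case True
      have "level_offset n = int (b n) + 1 - p" using level_offset_last by simp
      then have "int n * level_offset n = int n * (int (b n) + 1 - p)" by simp
      \<comment> \<open>the seam of the cylinder, where the level offset jumps by the period\<close>
      then have "height r' - height r = p - int n"
        using diagonal True by (simp add: height_def ypos_def next_comp_def algebra_simps)
      then show ?thesis using p_gt by simp
    next
      case False
      have "fst r \<ge> 1" using r by (auto simp: rows_def)
      then have "int n * level_offset (Suc (fst r)) = int n * (level_offset (fst r) - int (b (fst r)) - 1)"
        using level_offset_Suc[of "fst r"] by simp
      then have "height r' - height r = p - int n"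
        using diagonal False by (simp add: height_def ypos_def next_comp_def algebra_simps)
      then show ?thesis using p_gt by simp
    qed
  qed
qed

text \<open>
  A nonempty row of maximal height can be shortened: a row to which it is bound by a tight constraint would
  be nonempty and higher.
\<close>

lemma ex_removable_row:
  assumes lam: "lam \<in> B" and ne: "lam \<noteq> (\<lambda>_ _. 0)"
  shows "\<exists>mu r. r \<in> rows \<and> mu \<in> B \<and> plus_box mu r = lam"
proof -
  define S where "S = {r. row_length lam r \<noteq> 0}"
  have fin: "finite S" using lam by (auto simp: S_def B_iff)
  obtain i s where "lam i s \<noteq> 0" using ne by (auto simp: fun_eq_iff)
  then have "S \<noteq> {}" by (auto simp: S_def)
  \<comment> \<open>a nonempty row of maximal height\<close>
  with fin have "Max (height ` S) \<in> height ` S" by simp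
  then obtain r where r: "r \<in> S" "height r = Max (height ` S)" by (metis imageE)
  have max: "height r' \<le> height r" if "r' \<in> S" for r' using r(2) fin that by simp
  have r0: "row_length lam r > 0" using r by (simp add: S_def)
  then have "(fst r, snd r) \<in> rows" using lam B_iff by (metis less_not_refl)
  then have rr: "r \<in> rows" by simp
  define mu where "mu = lam(fst r := (lam (fst r))(snd r := lam (fst r) (snd r) - 1))"
  have P: "plus_box mu r = lam"
    using r0 by (cases r) (auto simp: mu_def plus_box_apply fun_eq_iff)
  have "\<not> tight lam r r'" for r'
    using tight_height[of lam r r'] r0 max[of r'] by (auto simp: S_def)
  then have "mu \<in> B" using minus_box_in_B_iff[OF rr, of mu] lam P by simp
  with rr P show ?thesis by blast
qed

lemma level_shift_le_imp: "level_shift I \<le> y \<Longrightarrow> - \<bar>y\<bar> \<le> I"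
proof (cases "I < 0")
  case True
  have "level_shift 0 = 0" by (simp add: level_shift_def comp_of_def)
  moreover have "level_shift (I + int (nat (- I))) \<le> level_shift I - int (nat (- I))" by (rule level_shift_antimono)
  ultimately show "level_shift I \<le> y \<Longrightarrow> - \<bar>y\<bar> \<le> I" using True by simp
qed simp

text \<open>
  At a fixed level the row ends of the copies form a strictly decreasing sequence, so the set of their
  values determines the sequence; only finitely many copies reach a given level from the left, which makes
  the comparison an induction on the copy.
\<close>

lemma wt_determines_row_end:
  assumes lam: "lam \<in> B" and mu: "mu \<in> B" and eq: "wt lam ` rows = wt mu ` rows"
  shows "level_shift I \<le> y \<Longrightarrow> row_end lam I y = row_end mu I y"
proof (induction "nat (I + \<bar>y\<bar>)" arbitrary: I rule: less_induct)
  case less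
  have transfer: "\<exists>J. level_shift J \<le> y \<and> row_end \<beta> J y = row_end \<alpha> I y" if e: "wt \<alpha> ` rows = wt \<beta> ` rows" for \<alpha> \<beta>
  proof -
    define K where "K = I div int n"
    define r where "r = (comp_of I, nat (y - level_shift I + 1))"
    have r: "r \<in> rows" using comp_of_in[of I] less.prems by (simp add: r_def rows_def)
    have "lift r K = I" using n_ge_2 by (simp add: lift_def r_def K_def comp_of_def)
    moreover have "ypos r - p * K = y" using less.prems by (simp add: ypos_def r_def level_shift_def K_def)
    ultimately have hI: "row_end \<alpha> I y = xpos \<alpha> r - p' * K" using lift_facts(5)[OF r, of \<alpha> K] by simp
    obtain r' where r': "r' \<in> rows" "wt \<beta> r' = wt \<alpha> r" using e r by (metis imageE imageI)
    then have "wt \<beta> r' = q1 powi 0 * q3 powi 0 * wt \<alpha> r" by simp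
    then obtain \<kappa> where k: "xpos \<beta> r' - p' * \<kappa> = xpos \<alpha> r + 0" "ypos r' - p * \<kappa> = ypos r + 0"
      unfolding wt_ratio_iff[OF r r'(1)] by blast
    have y: "ypos r' - p * (\<kappa> + K) = y" "xpos \<beta> r' - p' * (\<kappa> + K) = xpos \<alpha> r - p' * K"
      using k \<open>ypos r - p * K = y\<close> unfolding distrib_left by linarith+
    show ?thesis using lift_facts(4)[OF r'(1), of "\<kappa> + K"] lift_facts(5)[OF r'(1), of \<beta> "\<kappa> + K"]
      unfolding y hI by blast
  qed
  \<comment> \<open>copies to the left of \<open>I\<close> already agree, so neither \<open>J\<close> nor \<open>K\<close> can be one of them\<close>
  have below: "row_end lam J y = row_end mu J y" if "J < I" "level_shift J \<le> y" for J
    using that less.hyps[of J] level_shift_le_imp[of J y] less.prems by simp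
  obtain J where J: "level_shift J \<le> y" "row_end mu J y = row_end lam I y" using transfer[OF eq] by blast
  obtain K where K: "level_shift K \<le> y" "row_end lam K y = row_end mu I y" using transfer[OF eq[symmetric]] by blast
  have "I \<le> J"
  proof (rule ccontr)
    assume "\<not> I \<le> J"
    then have "row_end lam J y = row_end lam I y" using below[of J] J by simp
    then show False using row_end_eq_same_level[OF lam less.prems J(1)] \<open>\<not> I \<le> J\<close> by simp
  qed
  then have 1: "row_end lam I y \<le> row_end mu I y" using row_end_descent'[OF mu, of I J y y] J less.prems by simp
  have "I \<le> K"
  proof (rule ccontr)
    assume "\<not> I \<le> K"
    then have "row_end mu K y = row_end mu I y" using below[of K] K by simp
    then show False using row_end_eq_same_level[OF mu less.prems K(1)] \<open>\<not> I \<le> K\<close> by simp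
  qed
  then have 2: "row_end mu I y \<le> row_end lam I y" using row_end_descent'[OF lam, of I K y y] K less.prems by simp
  show ?case using 1 2 by simp
qed

lemma wt_determines_tuple:
  assumes lam: "lam \<in> B" and mu: "mu \<in> B" and eq: "wt lam ` rows = wt mu ` rows"
  shows "lam = mu"
proof (intro ext)
  fix i s
  show "lam i s = mu i s"
  proof (cases "(i, s) \<in> rows")
    case True
    have "row_end lam (lift (i, s) 0) (ypos (i, s)) = row_end mu (lift (i, s) 0) (ypos (i, s))"
      using lift_facts(4)[OF True, of 0] by (intro wt_determines_row_end[OF lam mu eq]) simp
    then show ?thesis using lift_facts(5)[OF True, of lam 0] lift_facts(5)[OF True, of mu 0] by (simp add: xpos_def)
  next
    case False
    then show ?thesis using lam mu by (simp add: B_iff)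
  qed
qed

end

section \<open>Matrix coefficients at resonance\<close>

lemma (in place) special_u:
  assumes q: "R q1 q1'" "R q3 q3'" "R u u'" "q1' \<noteq> 0" "q3' \<noteq> 0"
  shows "R (special_u q1 q3 a b u i) (special_u q1' q3' a b u' i)"
proof (induction i)
  case (Suc i)
  then show ?case
    using q by (cases i) (auto intro!: divide mult power)
qed (use q in simp)

lemma (in place) nonzeroI: "R x x' \<Longrightarrow> x' \<noteq> 0 \<Longrightarrow> x \<noteq> 0"
  using unique[OF zero] by blast

abbreviation gen_q1 :: ratfun where "gen_q1 \<equiv> ratfun_var 0"
abbreviation gen_q3 :: ratfun where "gen_q3 \<equiv> ratfun_var 1"
abbreviation gen_u :: "nat \<Rightarrow> ratfun" where "gen_u \<equiv> (\<lambda>i. ratfun_var (i + 1))"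
abbreviation gen_weight :: "ptuple \<Rightarrow> nat \<Rightarrow> nat \<Rightarrow> ratfun" where
  "gen_weight \<equiv> box_weight gen_q1 gen_q3 gen_u"

abbreviation point_value :: "(nat \<Rightarrow> complex) \<Rightarrow> ratfun \<Rightarrow> complex \<Rightarrow> bool" where
  "point_value x \<equiv> has_value_at (\<lambda>c. c) x"

lemma place_point_value: "place (point_value x)"
  by (rule complex_id.place_has_value_at)

lemma ratfun_var_nz: "ratfun_var k \<noteq> 0"
  using place.nonzeroI[OF place_point_value complex_id.has_value_at_var[of "\<lambda>_. 1" k]] by simp

text \<open>
  In the generic field a denominator that is a rational function is shown to be nonzero by evaluating it at
  one well-chosen point.
\<close>

lemma generic_factor_values:
  fixes x :: "nat \<Rightarrow> complex"
  assumes x: "x 0 \<noteq> 0" "x 1 \<noteq> 0" "x (i + 1) \<noteq> 0"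
    and y: "y = x 1 powi t * (x (j + 1) / box_weight (x 0) (x 1) (\<lambda>i. x (i + 1)) lam i s)"
  shows "y \<noteq> 1 \<Longrightarrow> 1 - gen_q3 powi t * (gen_u j / gen_weight lam i s) \<noteq> 0"
    "inverse (x 0 * x 1) * y \<noteq> 1 \<Longrightarrow>
      1 - q2_of gen_q1 gen_q3 * (gen_q3 powi t * (gen_u j / gen_weight lam i s)) \<noteq> 0"
proof -
  interpret V: place "point_value x" by (rule place_point_value)
  note var = complex_id.has_value_at_var[of x]
  have bw: "point_value x (gen_weight lam i s) (box_weight (x 0) (x 1) (\<lambda>i. x (i + 1)) lam i s)"
    using var x by (intro V.box_weight)
  have bw_nz: "box_weight (x 0) (x 1) (\<lambda>i. x (i + 1)) lam i s \<noteq> 0"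
    using x by (simp add: box_weight_def)
  have py: "point_value x (gen_q3 powi t * (gen_u j / gen_weight lam i s)) y"
    unfolding y by (intro V.mult V.powi V.divide var bw bw_nz x)
  show "1 - gen_q3 powi t * (gen_u j / gen_weight lam i s) \<noteq> 0" if "y \<noteq> 1"
    by (rule V.nonzeroI[OF V.diff[OF V.one py]]) (use that in simp)
  have "point_value x (q2_of gen_q1 gen_q3) (inverse (x 0 * x 1))"
    by (intro V.inv V.mult var) (use x in simp)
  from V.mult[OF this py]
  show "1 - q2_of gen_q1 gen_q3 * (gen_q3 powi t * (gen_u j / gen_weight lam i s)) \<noteq> 0"
    if "inverse (x 0 * x 1) * y \<noteq> 1"
    by (intro V.nonzeroI[OF V.diff[OF V.one]]) (use that in auto)
qed

lemma generic_nonzero_other: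
  assumes "i \<noteq> j" "i \<ge> 1" "j \<ge> 1"
  shows "1 - gen_q3 powi t * (gen_u j / gen_weight lam i s) \<noteq> 0"
    "1 - q2_of gen_q1 gen_q3 * (gen_q3 powi t * (gen_u j / gen_weight lam i s)) \<noteq> 0"
  using generic_factor_values[OF _ _ _ refl, where x = "\<lambda>k. if k = j + 1 then 2 else 1" and i = i and j = j and t = t and s = s and lam = lam]
    assms by (simp_all add: box_weight_def)

text \<open>
  At \<open>q3 = 2\<close> and all other variables 1, respectively at \<open>q1 = 2\<close> and all other
  variables 1, the two expressions become differences of 1 and a nontrivial power of 2 or its inverse.
\<close>

lemma generic_nonzero_same:
  assumes "i \<ge> 1" "s \<le> t"
  shows "1 - gen_q3 powi int t * (gen_u i / gen_weight lam i s) \<noteq> 0"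
    "1 - q2_of gen_q1 gen_q3 * (gen_q3 powi int t * (gen_u i / gen_weight lam i s)) \<noteq> 0"
proof -
  define k where "k = t + 1 - s"
  have k: "int t = int k + (int s - 1)" "k \<noteq> 0" using assms by (auto simp: k_def)
  have "(2::complex) powi int t / 2 powi (int s - 1) = 2 ^ k" by (simp add: k(1) power_int_add)
  moreover have "(2::complex) ^ k \<noteq> 1"
  proof
    assume "(2::complex) ^ k = 1"
    then have "norm ((2::complex) ^ k) = 1" by simp
    then have "(2::real) ^ k = 1" by (simp add: norm_power)
    then show False using k(2) one_less_power[of "2::real" k] by simp
  qed
  ultimately show "1 - gen_q3 powi int t * (gen_u i / gen_weight lam i s) \<noteq> 0"
    using assms by (intro generic_factor_values(1)[OF _ _ _ refl, where x = "\<lambda>k. if k = 1 then 2 else 1"])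
      (simp_all add: box_weight_def)
  have "(2::complex) * 2 ^ m \<noteq> 1" for m
  proof
    assume "(2::complex) * 2 ^ m = 1"
    then have "norm ((2::complex) * 2 ^ m) = 1" by simp
    moreover have "(2::real) * 2 ^ m \<ge> 2" by simp
    ultimately show False by (simp add: norm_power norm_mult)
  qed
  then show "1 - q2_of gen_q1 gen_q3 * (gen_q3 powi int t * (gen_u i / gen_weight lam i s)) \<noteq> 0"
    using assms by (intro generic_factor_values(2)[OF _ _ _ refl, where x = "\<lambda>k. if k = 0 then 2 else 1"])
      (simp_all add: box_weight_def field_simps)
qed

text \<open>
  A bound on the number of rows makes all products finite. Any larger bound works as well, which gives the
  freedom to use one bound for several neighbouring tuples.
\<close>

definition bounded_by :: "nat \<Rightarrow> ptuple \<Rightarrow> bool" where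
  "bounded_by T lam \<longleftrightarrow> (\<forall>j t. t > T \<longrightarrow> lam j t = 0)"

lemma bounded_by_mono: "bounded_by T lam \<Longrightarrow> T \<le> T' \<Longrightarrow> bounded_by T' lam"
  by (auto simp: bounded_by_def)

lemma bounded_by_plus_box: "bounded_by T (plus_box lam r) \<longleftrightarrow> bounded_by T lam \<and> snd r \<le> T"
proof
  assume *: "bounded_by T (plus_box lam r)"
  have "lam j t = 0" if "t > T" for j t
    using * that unfolding bounded_by_def by (auto simp: plus_box_apply split: if_splits)
  moreover have "snd r \<le> T"
  proof (rule ccontr)
    assume "\<not> snd r \<le> T"
    then have "plus_box lam r (fst r) (snd r) = 0" using * by (simp add: bounded_by_def)
    then show False by (simp add: plus_box_apply)
  qed
  ultimately show "bounded_by T lam \<and> snd r \<le> T" by (simp add: bounded_by_def)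
qed (auto simp: bounded_by_def plus_box_apply)

text \<open>
  The structure function \<open>g(z, w)\<close> of the algebra, over any field because it is also needed for
  Laurent series.
\<close>

definition g_poly :: "'k::field \<Rightarrow> 'k \<Rightarrow> 'k \<Rightarrow> 'k \<Rightarrow> 'k \<Rightarrow> 'k" where
  "g_poly q1 q2 q3 z w = (z - q1 * w) * (z - q2 * w) * (z - q3 * w)"

text \<open>
  Lengthening a row multiplies its weight by \<open>q1\<close>; in the quotient of the new factor by the old
  one a linear factor cancels, and the three left above and below form the structure function at \<open>(v,
  z)\<close> and \<open>(z, v)\<close>.
\<close>

lemma row_factor_shift:
  fixes v z :: "'k::field"
  assumes q: "q1 * q2 * q3 = 1" and nz: "z \<noteq> 0" "v \<noteq> z" "v \<noteq> q1 * z" "q1 * v \<noteq> z"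
  shows "row_factor q1 q3 (q1 * v / z) * g_poly q1 q2 q3 z v = - g_poly q1 q2 q3 v z * row_factor q1 q3 (v / z)"
proof -
  have q_nz: "q1 \<noteq> 0" "q2 \<noteq> 0" "q3 \<noteq> 0" using q by auto
  have q2: "q2_of q1 q3 = q2" using q q_nz by (simp add: field_simps)
  have d: "z - v \<noteq> 0" "z - q1 * v \<noteq> 0" "q1 * z - v \<noteq> 0" using nz by auto
  have frac: "(A / z * (B / z)) / (C / z * (D / (q1 * z))) = q1 * (A * B) / (C * D)"
    and frac': "(A / z * (B / z)) / (C / z * (D / z)) = (A * B) / (C * D)" for A B C D
    using q_nz nz(1) by simp_all
  have e: "1 - c * (v / z) = (z - c * v) / z" "1 - v / z = (z - v) / z"
    "1 - c * (q1 * v / z) = (z - c * q1 * v) / z" "1 - q1 * v / z = (z - q1 * v) / z"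
    "1 - v / z / q1 = (q1 * z - v) / (q1 * z)" "1 - q1 * v / z / q1 = (z - v) / z" for c
    using q_nz nz(1) by (simp_all add: field_simps)
  have r1: "row_factor q1 q3 (v / z) = q1 * ((z - q3 * v) * (z - q2 * v)) / ((z - v) * (q1 * z - v))"
    unfolding row_factor_def q2 e by (rule frac)
  have r2: "row_factor q1 q3 (q1 * v / z) = ((z - q3 * q1 * v) * (z - q2 * q1 * v)) / ((z - q1 * v) * (z - v))"
    unfolding row_factor_def q2 e by (rule frac')
  have s: "(z - q3 * q1 * v) * (z - q2 * q1 * v) = q1 * ((v - q2 * z) * (v - q3 * z))"
    using q by algebra
  show ?thesis unfolding r1 r2 s g_poly_def using d nz by (simp add: divide_simps) (simp add: algebra_simps)
qed

lemma row_factor_nonzero: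
  assumes q: "q1 * q2 * q3 = 1" "z \<noteq> 0" "v \<noteq> z" "v \<noteq> q1 * z" "z \<noteq> q3 * v" "z \<noteq> q2 * v"
  shows "row_factor q1 q3 (v / z) \<noteq> 0"
proof -
  have q_nz: "q1 \<noteq> 0" "q2 \<noteq> 0" "q3 \<noteq> 0" using q by auto
  have q2: "q2_of q1 q3 = q2" using q q_nz by (simp add: field_simps)
  have "1 - q3 * (v / z) \<noteq> 0" "1 - q2 * (v / z) \<noteq> 0" "1 - v / z \<noteq> 0" "1 - v / z / q1 \<noteq> 0"
    using assms(2-) q_nz by (simp_all add: field_simps)
  then show ?thesis unfolding row_factor_def q2 by simp
qed

context resonance
begin

text \<open>
  The value after the two successive substitutions. As this is a place, it can be computed factor by factor
  from the field of independent variables, without looking at the rational function between the two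
  substitutions.
\<close>

definition spec :: "ratfun \<Rightarrow> complex \<Rightarrow> bool" where
  "spec r y \<longleftrightarrow> (\<exists>m. has_value_at ratfun_const (first_point a b) r m \<and> point_value (second_point q1 q3 u) m y)"

sublocale spec: place spec
  unfolding spec_def[abs_def]
  by (rule place_comp[OF ratfun_const.place_has_value_at place_point_value])

lemma spec_q1: "spec gen_q1 q1"
  unfolding spec_def using ratfun_const.has_value_at_var[of "first_point a b" 0]
    complex_id.has_value_at_var[of "second_point q1 q3 u" 0]
  by (auto simp: first_point_def second_point_def)

lemma spec_q3: "spec gen_q3 q3"
  unfolding spec_def using ratfun_const.has_value_at_var[of "first_point a b" 1]
    complex_id.has_value_at_var[of "second_point q1 q3 u" 1]
  by (auto simp: first_point_def second_point_def)

lemma spec_u: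
  assumes "i \<ge> 1" shows "spec (gen_u i) (us i)"
proof -
  interpret V: place "point_value (second_point q1 q3 u)" by (rule place_point_value)
  note var = complex_id.has_value_at_var[of "second_point q1 q3 u"]
  have "point_value (second_point q1 q3 u) (special_u gen_q1 gen_q3 a b (ratfun_var 2) i) (us i)"
    unfolding us_def using var[of 0] var[of 1] var[of 2] q1_nz q3_nz
    by (intro V.special_u) (simp_all add: second_point_def)
  moreover have "first_point a b (i + 1) = special_u gen_q1 gen_q3 a b (ratfun_var 2) i"
    using assms by (simp add: first_point_def)
  ultimately show ?thesis unfolding spec_def
    using ratfun_const.has_value_at_var[of "first_point a b" "i + 1"] by auto
qed

lemma spec_coefficient:
  assumes "spec (generic_coeff n mu g lam) y"
  shows "resonant_coeff q1 q3 u n a b mu g lam = y"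
    "regular_at ratfun_const (first_point a b) (generic_coeff n mu g lam)"
    "regular_at (\<lambda>c. c) (second_point q1 q3 u) (M_coeff n a b mu g lam)"
proof -
  obtain m where m: "has_value_at ratfun_const (first_point a b) (generic_coeff n mu g lam) m"
      "point_value (second_point q1 q3 u) m y"
    using assms by (auto simp: spec_def)
  have M: "M_coeff n a b mu g lam = m"
    unfolding M_coeff_def by (rule ratfun_const.value_at_eqI[OF m(1)])
  show "resonant_coeff q1 q3 u n a b mu g lam = y"
    unfolding resonant_coeff_def M by (rule complex_id.value_at_eqI[OF m(2)])
  show "regular_at ratfun_const (first_point a b) (generic_coeff n mu g lam)"
    "regular_at (\<lambda>c. c) (second_point q1 q3 u) (M_coeff n a b mu g lam)"
    using m M by (auto simp: regular_at_def)
qed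

lemma B_bounded: "lam \<in> B \<Longrightarrow> \<exists>T. bounded_by T lam"
proof -
  assume "lam \<in> B"
  then have fin: "finite (snd ` {r. row_length lam r \<noteq> 0})" by (auto simp: B_iff)
  define T where "T = Max (insert 0 (snd ` {r. row_length lam r \<noteq> 0}))"
  have "lam j t = 0" if "t > T" for j t
  proof (rule ccontr)
    assume "lam j t \<noteq> 0"
    then have "t \<in> snd ` {r. row_length lam r \<noteq> 0}"
      by (intro image_eqI[of _ _ "(j, t)"]) auto
    then have "t \<le> T" using fin by (simp add: T_def)
    then show False using that by simp
  qed
  then show ?thesis by (auto simp: bounded_by_def)
qed

lemma addable_bound:
  assumes "lam \<in> B" "plus_box lam r \<in> B" "r \<in> rows" "bounded_by T lam"
  shows "snd r \<le> T + 1"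
proof (rule ccontr)
  assume T: "\<not> snd r \<le> T + 1"
  have "constraint (fst r, snd r - 1) r 0" using assms(3) T by (auto simp: constraint_def rows_def)
  moreover have "row_length lam r = 0" "lam (fst r) (snd r - 1) = 0"
    using assms(4) T by (auto simp: bounded_by_def)
  ultimately have "tight lam (fst r, snd r - 1) r" by (auto simp: tight_def)
  then show False using plus_box_in_B_iff assms by blast
qed

lemma wt_plus_box: "wt (plus_box lam r) r' = (if r' = r then q1 * wt lam r else wt lam r')"
  using q1_nz by (cases r; cases r') (auto simp: wt_def box_weight_def plus_box_apply power_int_add)

definition edge :: "nat \<Rightarrow> ptuple \<Rightarrow> (nat \<times> nat) set \<Rightarrow> nat set \<Rightarrow> nat \<times> nat \<Rightarrow> complex" where
  "edge T lam S J r = edge_product q1 q3 us T lam S J (wt lam r)"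

lemma edge_factor:
  assumes lam: "lam \<in> B" "plus_box lam r \<in> B" and r: "r \<in> rows" "r' \<in> rows" "r' \<noteq> r"
  shows "wt lam r' \<noteq> wt lam r" "wt lam r' \<noteq> q1 * wt lam r" "row_factor q1 q3 (wt lam r' / wt lam r) \<noteq> 0"
proof -
  show 1: "wt lam r' \<noteq> wt lam r" using wt_inject[OF lam(1) r(1,2)] r(3) by blast
  show 2: "wt lam r' \<noteq> q1 * wt lam r" using addable_row(3)[OF lam r(1,2)] .
  show "row_factor q1 q3 (wt lam r' / wt lam r) \<noteq> 0"
    using row_factor_nonzero[OF q_prod wt_nz[OF r(1)] 1 2] addable_row[OF lam r(1,2)] by blast
qed

text \<open>
  The tail of a partition is evaluated at the weight of its first row beyond the bound, so facts about
  weights of rows apply to it.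
\<close>

lemma tail_weight:
  assumes "bounded_by T lam" "j \<in> {1..n}"
  shows "q3 powi int T * us j = wt lam (j, T + 1)" "(j, T + 1) \<in> rows"
  using assms by (auto simp: wt_def box_weight_def bounded_by_def rows_def)

lemma spec_edge_product:
  assumes lam: "lam \<in> B" "plus_box lam r \<in> B" and r: "r \<in> rows" and T: "bounded_by T lam" "snd r \<le> T"
    and S: "S \<subseteq> {1..n} \<times> {1..T}" "r \<notin> S" and J: "J \<subseteq> {1..n}"
  shows "spec (edge_product gen_q1 gen_q3 gen_u T lam S J (gen_weight lam (fst r) (snd r))) (edge T lam S J r)"
  unfolding edge_def
proof (rule spec.edge_product)
  have "fst r \<ge> 1" using r by (auto simp: rows_def)
  then show "spec (gen_weight lam (fst r) (snd r)) (wt lam r)"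
    unfolding wt_def by (intro spec.box_weight spec_q1 spec_q3 spec_u q1_nz q3_nz)
  show "wt lam r \<noteq> 0" using wt_nz[OF r] .
  show "spec (gen_u j) (us j)" if "(j, t) \<in> S" for j t using that S by (intro spec_u) auto
  show "spec (gen_u j) (us j)" if "j \<in> J" for j using that J by (intro spec_u) auto
  show "box_weight q1 q3 us lam j t \<noteq> wt lam r \<and> box_weight q1 q3 us lam j t \<noteq> q1 * wt lam r" if "(j, t) \<in> S" for j t
  proof -
    have "(j, t) \<in> rows" "(j, t) \<noteq> r" using that S by (auto simp: rows_def)
    from edge_factor[OF lam r this] show ?thesis by (simp add: wt_def)
  qed
  show "q3 powi int T * us j \<noteq> wt lam r" if "j \<in> J" for j
  proof -
    note t = tail_weight[OF T(1), of j]
    have "(j, T + 1) \<noteq> r" using T(2) by auto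
    then show ?thesis using t edge_factor(1)[OF lam r, of "(j, T + 1)"] that J by auto
  qed
qed (rule spec_q1 spec_q3 q1_nz q3_nz)+

lemma edge_nonzero:
  assumes lam: "lam \<in> B" "plus_box lam r \<in> B" and r: "r \<in> rows" and T: "bounded_by T lam" "snd r \<le> T"
    and S: "S \<subseteq> {1..n} \<times> {1..T}" "r \<notin> S" and J: "J \<subseteq> {1..n}"
  shows "edge T lam S J r \<noteq> 0"
proof -
  have finS: "finite S" using S(1) by (rule finite_subset) simp
  have finJ: "finite J" using J by (rule finite_subset) simp
  have "row_factor q1 q3 (box_weight q1 q3 us lam j t / wt lam r) \<noteq> 0" if "(j, t) \<in> S" for j t
  proof -
    have "(j, t) \<in> rows" "(j, t) \<noteq> r" using that S by (auto simp: rows_def)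
    from edge_factor(3)[OF lam r this] show ?thesis by (simp add: wt_def)
  qed
  moreover have "tail_factor q1 q3 (q3 powi int T * (us j / wt lam r)) \<noteq> 0" if "j \<in> J" for j
  proof -
    note t = tail_weight[OF T(1), of j]
    have j: "(j, T + 1) \<noteq> r" "(j, T + 1) \<in> rows" "q3 powi int T * us j = wt lam (j, T + 1)"
      using T(2) t that J by auto
    have "q3 powi int T * (us j / wt lam r) = wt lam (j, T + 1) / wt lam r" using j(3) by simp
    then show ?thesis using edge_factor(1)[OF lam r j(2,1)] addable_row(2)[OF lam r j(2)] wt_nz[OF r]
      unfolding tail_factor_def q2_eq[symmetric] by auto
  qed
  ultimately show ?thesis using finS finJ by (auto simp: edge_def edge_product_def)
qed

definition e_edge :: "nat \<Rightarrow> ptuple \<Rightarrow> nat \<times> nat \<Rightarrow> complex" where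
  "e_edge T lam r = 1 / (1 - q1) * edge T lam (rows_before T (fst r) (snd r)) {1..<fst r} r"

definition f_edge :: "nat \<Rightarrow> ptuple \<Rightarrow> nat \<times> nat \<Rightarrow> complex" where
  "f_edge T lam r = q1 / (1 - q1) * edge T lam (rows_after n T (fst r) (snd r)) {fst r..n} r"

lemma q1_neq_1: "q1 \<noteq> 1" using not_root_of_unity[of q1 1] by auto

lemma row_sets:
  assumes "r \<in> rows" "snd r \<le> T"
  shows "rows_before T (fst r) (snd r) \<subseteq> {1..n} \<times> {1..T}" "r \<notin> rows_before T (fst r) (snd r)" "{1..<fst r} \<subseteq> {1..n}"
    "rows_after n T (fst r) (snd r) \<subseteq> {1..n} \<times> {1..T}" "r \<notin> rows_after n T (fst r) (snd r)" "{fst r..n} \<subseteq> {1..n}"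
  using assms by (auto simp: rows_def rows_before_def rows_after_def)

lemma edges_nonzero:
  assumes "lam \<in> B" "plus_box lam r \<in> B" "r \<in> rows" "bounded_by T lam" "snd r \<le> T"
  shows "e_edge T lam r \<noteq> 0" "f_edge T lam r \<noteq> 0"
  unfolding e_edge_def f_edge_def using q1_neq_1 q1_nz
    edge_nonzero[OF assms row_sets(1-3)[OF assms(3,5)]] edge_nonzero[OF assms row_sets(4-6)[OF assms(3,5)]]
  by auto

lemma box_set_singleton:
  assumes "r \<in> rows"
  shows "{(i, s). i \<in> {1..n} \<and> s \<ge> 1 \<and> plus_box lam r = add_box lam i s} = {r}"
proof -
  have "plus_box lam r = add_box lam i s \<longleftrightarrow> r = (i, s)" for i s
    using plus_box_inject'[of lam r "(i, s)"] by (simp add: plus_box_def)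
  then show ?thesis using assms by (auto simp: rows_def)
qed

lemma spec_e_edge:
  assumes "lam \<in> B" "plus_box lam r \<in> B" "r \<in> rows" "bounded_by T lam" "snd r \<le> T"
  shows "spec (generic_coeff n (plus_box lam r) (Gen_e k) lam) (wt lam r powi k * e_edge T lam r)"
proof -
  let ?v = "gen_weight lam (fst r) (snd r)"
  have r: "fst r \<in> {1..n}" "snd r \<ge> 1" using assms(3) by (auto simp: rows_def)
  have nz: "1 - gen_q3 powi int t * (gen_u j / ?v) \<noteq> 0 \<and>
      1 - q2_of gen_q1 gen_q3 * (gen_q3 powi int t * (gen_u j / ?v)) \<noteq> 0" if "1 \<le> j" "j \<noteq> fst r" for j t
    by (intro conjI generic_nonzero_other) (use that r in auto)
  have "generic_coeff n (plus_box lam r) (Gen_e k) lam = e_coeff gen_q1 gen_q3 gen_u lam (fst r) (snd r) k"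
    unfolding generic_coeff_def tensor_coeff.simps box_set_singleton[OF assms(3)] by (simp add: case_prod_beta)
  also have "\<dots> = ?v powi k / (1 - gen_q1)
      * edge_product gen_q1 gen_q3 gen_u T lam (rows_before T (fst r) (snd r)) {1..<fst r} ?v"
  proof (rule e_coeff_eq_edge_product[OF ratfun_var_nz ratfun_var_nz _ refl])
    show "lam j t = 0" if "T < t" for j t using that assms(4) by (simp add: bounded_by_def)
    fix j t assume "1 \<le> j" "j < fst r" "t \<le> T"
    then show "1 - gen_q3 powi int t * (gen_u j / ?v) \<noteq> 0 \<and>
      1 - q2_of gen_q1 gen_q3 * (gen_q3 powi int t * (gen_u j / ?v)) \<noteq> 0" by (intro nz) auto
  qed
  finally have eq: "generic_coeff n (plus_box lam r) (Gen_e k) lam = \<dots>" .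
  have v: "spec ?v (wt lam r)"
    using r unfolding wt_def by (intro spec.box_weight spec_q1 spec_q3 spec_u q1_nz q3_nz) auto
  have "spec (?v powi k / (1 - gen_q1)
      * edge_product gen_q1 gen_q3 gen_u T lam (rows_before T (fst r) (snd r)) {1..<fst r} ?v)
    (wt lam r powi k / (1 - q1) * edge T lam (rows_before T (fst r) (snd r)) {1..<fst r} r)"
    using q1_neq_1 by (intro spec.mult spec.divide spec.powi spec.diff spec.one v spec_q1 wt_nz[OF assms(3)]
      spec_edge_product[OF assms row_sets(1-3)[OF assms(3,5)]]) auto
  then show ?thesis unfolding eq e_edge_def by (simp add: mult_ac)
qed

lemma spec_f_edge:
  assumes "lam \<in> B" "plus_box lam r \<in> B" "r \<in> rows" "bounded_by T lam" "snd r \<le> T"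
  shows "spec (generic_coeff n lam (Gen_f k) (plus_box lam r)) (wt lam r powi k * f_edge T lam r)"
proof -
  let ?v = "gen_weight lam (fst r) (snd r)"
  have r: "fst r \<in> {1..n}" "snd r \<ge> 1" using assms(3) by (auto simp: rows_def)
  have nz: "1 - gen_q3 powi int t * (gen_u j / ?v) \<noteq> 0 \<and>
      1 - q2_of gen_q1 gen_q3 * (gen_q3 powi int t * (gen_u j / ?v)) \<noteq> 0" if "1 \<le> j" "j \<noteq> fst r" for j t
    by (intro conjI generic_nonzero_other) (use that r in auto)
  have nz': "1 - gen_q3 powi int t * (gen_u (fst r) / ?v) \<noteq> 0 \<and>
      1 - q2_of gen_q1 gen_q3 * (gen_q3 powi int t * (gen_u (fst r) / ?v)) \<noteq> 0" if "snd r \<le> t" for t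
    by (intro conjI generic_nonzero_same) (use that r in auto)
  have "generic_coeff n lam (Gen_f k) (plus_box lam r) = f_coeff gen_q1 gen_q3 gen_u n lam (fst r) (snd r) k"
    unfolding generic_coeff_def tensor_coeff.simps box_set_singleton[OF assms(3)] by (simp add: case_prod_beta)
  also have "\<dots> = gen_q1 * ?v powi k / (1 - gen_q1)
      * edge_product gen_q1 gen_q3 gen_u T lam (rows_after n T (fst r) (snd r)) {fst r..n} ?v"
  proof (rule f_coeff_eq_edge_product[OF ratfun_var_nz ratfun_var_nz _ refl])
    show "lam j t = 0" if "T < t" for j t using that assms(4) by (simp add: bounded_by_def)
    show "snd r \<le> T" "fst r \<le> n" using assms(5) r by auto
    show "1 - gen_q3 powi int t * (gen_u (fst r) / ?v) \<noteq> 0 \<and>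
      1 - q2_of gen_q1 gen_q3 * (gen_q3 powi int t * (gen_u (fst r) / ?v)) \<noteq> 0"
      if "snd r \<le> t" "t \<le> T" for t
      by (rule nz') fact
    fix j t assume "fst r < j" "j \<le> n" "t \<le> T"
    then show "1 - gen_q3 powi int t * (gen_u j / ?v) \<noteq> 0 \<and>
      1 - q2_of gen_q1 gen_q3 * (gen_q3 powi int t * (gen_u j / ?v)) \<noteq> 0" by (intro nz) auto
  qed
  finally have eq: "generic_coeff n lam (Gen_f k) (plus_box lam r) = \<dots>" .
  have v: "spec ?v (wt lam r)"
    using r unfolding wt_def by (intro spec.box_weight spec_q1 spec_q3 spec_u q1_nz q3_nz) auto
  have "spec (gen_q1 * ?v powi k / (1 - gen_q1)
      * edge_product gen_q1 gen_q3 gen_u T lam (rows_after n T (fst r) (snd r)) {fst r..n} ?v)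
    (q1 * wt lam r powi k / (1 - q1) * edge T lam (rows_after n T (fst r) (snd r)) {fst r..n} r)"
    using q1_neq_1 by (intro spec.mult spec.divide spec.powi spec.diff spec.one v spec_q1 wt_nz[OF assms(3)]
      spec_edge_product[OF assms row_sets(4-6)[OF assms(3,5)]]) auto
  then show ?thesis unfolding eq f_edge_def by (simp add: mult_ac)
qed

lemma generic_e_eq_0:
  assumes "\<And>r. r \<in> rows \<Longrightarrow> mu \<noteq> plus_box lam r"
  shows "generic_coeff n mu (Gen_e k) lam = 0"
proof -
  have "{(i, s). i \<in> {1..n} \<and> s \<ge> 1 \<and> mu = add_box lam i s} = {}"
    using assms by (fastforce simp: rows_def plus_box_def)
  then show ?thesis unfolding generic_coeff_def tensor_coeff.simps by (simp only: sum.empty)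
qed

lemma generic_f_eq_0:
  assumes "\<And>r. r \<in> rows \<Longrightarrow> lam \<noteq> plus_box mu r"
  shows "generic_coeff n mu (Gen_f k) lam = 0"
proof -
  have "{(i, s). i \<in> {1..n} \<and> s \<ge> 1 \<and> lam = add_box mu i s} = {}"
    using assms by (fastforce simp: rows_def plus_box_def)
  then show ?thesis unfolding generic_coeff_def tensor_coeff.simps by (simp only: sum.empty)
qed

end

section \<open>Exchange and Serre relations of matrix coefficients\<close>

text \<open>
  The antisymmetrization identity behind the cubic relation, with \<open>s\<close> and \<open>t\<close> the
  first two elementary symmetric functions of \<open>q1, q2, q3\<close>, whose product is 1.
\<close>

lemma serre_polynomial_identity:
  fixes x y z s t :: complex
  defines "g \<equiv> \<lambda>z w. z^3 - s * z^2 * w + t * z * w^2 - w^3"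
    and "P \<equiv> \<lambda>x y z. y^2 * z - x^2 * z - z^2 * x + y^2 * x"
  shows "P x y z * g x y * g x z * g y z - P y x z * g y x * g x z * g y z
    - P x z y * g x y * g x z * g z y + P z x y * g x y * g z x * g z y
    + P y z x * g y x * g z x * g y z - P z y x * g y x * g z x * g z y = 0"
  unfolding g_def P_def by algebra

lemma g_poly_expand:
  fixes z w :: "'k::field"
  assumes "q1 * q2 * q3 = 1"
  shows "g_poly q1 q2 q3 z w =
    z^3 - (q1 + q2 + q3) * z^2 * w + (q1 * q2 + q1 * q3 + q2 * q3) * z * w^2 - w^3"
  unfolding g_poly_def using assms by algebra

text \<open>
  The factor that the modes in \<open>[e_0, [e_1, e_-1]]\<close> give to a path that adds boxes of weights
  \<open>x, y, z\<close> in this order; the same expression occurs for \<open>f\<close>.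
\<close>

definition serre_weight :: "complex \<Rightarrow> complex \<Rightarrow> complex \<Rightarrow> complex" where
  "serre_weight x y z = y / x - x / y - z / y + y / z"

text \<open>
  The exchange rules express the amplitudes of the other five orders through that of the order \<open>x, y,
  z\<close> as long as the three values of \<open>g\<close> that have to be divided by do not vanish.
\<close>

lemma serre_six_terms:
  fixes x y z :: complex
  assumes q: "q1 * q2 * q3 = 1" and nz: "x \<noteq> 0" "y \<noteq> 0" "z \<noteq> 0"
  defines "g \<equiv> g_poly q1 q2 q3"
  assumes g: "g x y \<noteq> 0" "g x z \<noteq> 0" "g y z \<noteq> 0"
    and r1: "g y x * Exyz + g x y * Eyxz = 0" and r2: "g z y * Exyz + g y z * Exzy = 0"
    and r3: "g z x * Exzy + g x z * Ezxy = 0" and r4: "g z x * Eyxz + g x z * Eyzx = 0"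
    and r5: "g z y * Eyzx + g y z * Ezyx = 0"
  shows "Exyz * serre_weight x y z + Eyxz * serre_weight y x z + Exzy * serre_weight x z y
    + Ezxy * serre_weight z x y + Eyzx * serre_weight y z x + Ezyx * serre_weight z y x = 0"
proof -
  define P :: "complex \<Rightarrow> complex \<Rightarrow> complex \<Rightarrow> complex"
    where "P = (\<lambda>x y z. y^2 * z - x^2 * z - z^2 * x + y^2 * x)"
  have sw: "serre_weight x y z = P x y z / (x * y * z)" if "x \<noteq> 0" "y \<noteq> 0" "z \<noteq> 0" for x y z
    using that by (simp add: serre_weight_def P_def field_simps power2_eq_square)
  have id: "P x y z * g x y * g x z * g y z - P y x z * g y x * g x z * g y z
    - P x z y * g x y * g x z * g z y + P z x y * g x y * g z x * g z y
    + P y z x * g y x * g z x * g y z - P z y x * g y x * g z x * g z y = 0"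
    unfolding g_def P_def g_poly_expand[OF q] by (rule serre_polynomial_identity)
  define D where "D = g x y * g x z * g y z"
  have D: "D \<noteq> 0" using g by (simp add: D_def)
  have e1: "Eyxz * D = - Exyz * (g y x * g x z * g y z)"
    using r1 unfolding D_def by algebra
  have e2: "Exzy * D = - Exyz * (g x y * g x z * g z y)"
    using r2 unfolding D_def by algebra
  have e3: "Ezxy * D = Exyz * (g x y * g z x * g z y)"
    using r2 r3 unfolding D_def by algebra
  have e4: "Eyzx * D = Exyz * (g y x * g z x * g y z)"
    using r1 r4 unfolding D_def by algebra
  have e5: "Ezyx * D = - Exyz * (g y x * g z x * g z y)"
    using r1 r4 r5 unfolding D_def by algebra
  define S where "S = Exyz * P x y z + Eyxz * P y x z + Exzy * P x z y
    + Ezxy * P z x y + Eyzx * P y z x + Ezyx * P z y x"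
  have "S * D = Exyz * D * P x y z + Eyxz * D * P y x z + Exzy * D * P x z y
    + Ezxy * D * P z x y + Eyzx * D * P y z x + Ezyx * D * P z y x"
    by (simp add: S_def algebra_simps)
  also have "\<dots> = Exyz * (P x y z * g x y * g x z * g y z - P y x z * g y x * g x z * g y z
    - P x z y * g x y * g x z * g z y + P z x y * g x y * g z x * g z y
    + P y z x * g y x * g z x * g y z - P z y x * g y x * g z x * g z y)"
    unfolding e1 e2 e3 e4 e5 by (simp add: D_def algebra_simps)
  finally have "S = 0" unfolding id using D by simp
  moreover have "Exyz * serre_weight x y z + Eyxz * serre_weight y x z + Exzy * serre_weight x z y
    + Ezxy * serre_weight z x y + Eyzx * serre_weight y z x + Ezyx * serre_weight z y x = S / (x * y * z)"
    using nz by (simp add: sw S_def add_divide_distrib mult_ac)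
  ultimately show ?thesis by simp
qed

context resonance
begin

abbreviation g :: "complex \<Rightarrow> complex \<Rightarrow> complex" where "g \<equiv> g_poly q1 q2 q3"

lemma g_eq_0_iff: "g z w = 0 \<longleftrightarrow> (\<exists>q\<in>{q1, q2, q3}. z = q * w)"
  by (auto simp: g_poly_def)

text \<open>
  Since \<open>p > n \<ge> 2\<close>, the resonance imposes no relation with small exponents of
  \<open>q3\<close>; in particular products of two or three of the parameters equal 1 only when they must.
\<close>

lemma resonance_small:
  assumes "q1 powi x * q3 powi y = 1" "\<bar>y\<bar> \<le> 2"
  shows "x = 0" "y = 0"
proof -
  obtain \<kappa> where k: "x = p' * \<kappa>" "y = p * \<kappa>" using assms(1) resonance_iff by blast
  have "\<kappa> = 0"
  proof (rule ccontr)
    assume "\<kappa> \<noteq> 0"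
    then have "1 \<le> \<bar>\<kappa>\<bar>" by simp
    then have "p * 1 \<le> p * \<bar>\<kappa>\<bar>" using p_gt by (intro mult_left_mono) auto
    also have "\<dots> = \<bar>y\<bar>" using p_gt by (simp add: k abs_mult)
    finally show False using assms(2) p_gt n_ge_2 by simp
  qed
  then show "x = 0" "y = 0" using k by auto
qed

lemma q_distinct: "q1 \<noteq> q2" "q2 \<noteq> q3" "q1 \<noteq> q3"
proof -
  show "q1 \<noteq> q2"
  proof
    assume "q1 = q2"
    then have "q1 powi 2 * q3 powi 1 = 1" using q_prod by (simp add: power2_eq_square)
    from resonance_small[OF this] show False by simp
  qed
  show "q2 \<noteq> q3"
  proof
    assume "q2 = q3"
    then have "q1 powi 1 * q3 powi 2 = 1" using q_prod by (simp add: power2_eq_square mult_ac)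
    from resonance_small[OF this] show False by simp
  qed
  show "q1 \<noteq> q3"
  proof
    assume "q1 = q3"
    then have "q1 powi 1 * q3 powi (- 1) = 1" using q1_nz by (simp add: power_int_minus)
    from resonance_small[OF this] show False by simp
  qed
qed

lemma product_of_two: "q \<in> {q1, q2, q3} \<Longrightarrow> r \<in> {q1, q2, q3} \<Longrightarrow> q * r \<noteq> 1"
proof
  assume qr: "q \<in> {q1, q2, q3}" "r \<in> {q1, q2, q3}" "q * r = 1"
  show False
  proof (cases "q = r")
    case True
    then show False using qr not_root_of_unity[of q 2] by (simp add: power2_eq_square)
  next
    case False
    have 12: "q3 = 1" if "q1 * q2 = 1" using q_prod that by simp
    have 23: "q1 = 1" if "q2 * q3 = 1"
    proof -
      have "q1 * (q2 * q3) = 1" using q_prod by (simp only: mult.assoc)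
      then show ?thesis using that by simp
    qed
    have 13: "q2 = 1" if "q1 * q3 = 1"
    proof -
      have "(q1 * q3) * q2 = 1" using q_prod by (simp only: mult_ac)
      then show ?thesis using that by simp
    qed
    have sym: "r * q = 1" using qr(3) by (simp only: mult.commute)
    have "q1 = 1 \<or> q2 = 1 \<or> q3 = 1"
      using qr(1,2) False qr(3) sym 12 23 13 by (elim insertE emptyE; hypsubst; blast)
    then show False using not_root_of_unity[of _ 1] by auto
  qed
qed

lemma product_of_three:
  assumes "q \<in> {q1, q2, q3}" "r \<in> {q1, q2, q3}" "s \<in> {q1, q2, q3}" "q * r * s = 1"
  shows "q = q1 \<or> r = q1 \<or> s = q1" "q = q1 \<Longrightarrow> r \<in> {q2, q3} \<and> s \<in> {q2, q3} \<and> r \<noteq> s"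
proof -
  have two: "x = y" if h: "x * x * y = 1 \<or> x * y * x = 1 \<or> y * x * x = 1" "x \<in> {q1, q2, q3}" "y \<in> {q1, q2, q3}" for x y
  proof -
    have xxy: "x * x * y = 1" using h(1) by (auto simp: mult_ac)
    have x0: "x \<noteq> 0" using xxy by auto
    show ?thesis
    proof (rule ccontr)
      assume "x \<noteq> y"
      have perms: "q1 * q3 * q2 = 1" "q2 * q1 * q3 = 1" "q2 * q3 * q1 = 1" "q3 * q1 * q2 = 1" "q3 * q2 * q1 = 1"
        using q_prod by (simp_all add: mult_ac)
      have "\<exists>w\<in>{q1, q2, q3}. w \<noteq> x \<and> x * y * w = 1"
        using h(2,3) \<open>x \<noteq> y\<close> q_distinct q_prod perms by auto
      then obtain w where "w \<noteq> x" "x * y * w = 1" by blast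
      then have "x * y * w = x * y * x" using xxy by (simp add: mult_ac)
      then show False using \<open>w \<noteq> x\<close> xxy by auto
    qed
  qed
  have cube: "x * x * x \<noteq> 1" if "x \<in> {q1, q2, q3}" for x
    using not_root_of_unity[OF that, of 3] by (simp add: power3_eq_cube)
  have d: "q \<noteq> r" "r \<noteq> s" "q \<noteq> s" using two[of q s] two[of r q] two[of q r] cube[of q] cube[of r] assms by auto
  show "q = q1 \<or> r = q1 \<or> s = q1" "q = q1 \<Longrightarrow> r \<in> {q2, q3} \<and> s \<in> {q2, q3} \<and> r \<noteq> s"
    using d assms(1-3) by auto
qed

text \<open>
  For each pair of weights at least one of the two orders may be divided by; an order of three weights is a
  linear order compatible with these choices.
\<close>

lemma g_no_two_cycle: "z \<noteq> 0 \<Longrightarrow> g z w \<noteq> 0 \<or> g w z \<noteq> 0"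
proof (rule ccontr)
  assume z: "z \<noteq> 0" and "\<not> (g z w \<noteq> 0 \<or> g w z \<noteq> 0)"
  then have "g z w = 0" "g w z = 0" by simp_all
  then obtain q r where qr: "q \<in> {q1, q2, q3}" "z = q * w" "r \<in> {q1, q2, q3}" "w = r * z"
    unfolding g_eq_0_iff by blast
  then have "z = (q * r) * z" by (metis mult.assoc)
  then show False using product_of_two[OF qr(1,3)] z by simp
qed

text \<open>
  If neither cyclic orientation of \<open>x, y, z\<close> consists of zeros of \<open>g\<close>, the
  admissible divisions contain a linear order of the three, and \<open>serre_six_terms\<close> applies to
  it.
\<close>

lemma serre_orders:
  assumes nz: "x \<noteq> 0" "y \<noteq> 0" "z \<noteq> 0"
    and r1: "g y x * Exyz + g x y * Eyxz = 0" and r2: "g z y * Exyz + g y z * Exzy = 0"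
    and r3: "g z x * Exzy + g x z * Ezxy = 0" and r4: "g z x * Eyxz + g x z * Eyzx = 0"
    and r5: "g z y * Eyzx + g y z * Ezyx = 0" and r6: "g y x * Ezxy + g x y * Ezyx = 0"
    and c1: "\<not> (g y x = 0 \<and> g z y = 0 \<and> g x z = 0)"
    and c2: "\<not> (g x y = 0 \<and> g y z = 0 \<and> g z x = 0)"
  shows "Exyz * serre_weight x y z + Eyxz * serre_weight y x z + Exzy * serre_weight x z y
    + Ezxy * serre_weight z x y + Eyzx * serre_weight y z x + Ezyx * serre_weight z y x = 0"
proof -
  consider "g x y \<noteq> 0" "g x z \<noteq> 0" "g y z \<noteq> 0" | "g y x \<noteq> 0" "g y z \<noteq> 0" "g x z \<noteq> 0"
    | "g x z \<noteq> 0" "g x y \<noteq> 0" "g z y \<noteq> 0" | "g z x \<noteq> 0" "g z y \<noteq> 0" "g x y \<noteq> 0"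
    | "g y z \<noteq> 0" "g y x \<noteq> 0" "g z x \<noteq> 0" | "g z y \<noteq> 0" "g z x \<noteq> 0" "g y x \<noteq> 0"
    using g_no_two_cycle[OF nz(1), of y] g_no_two_cycle[OF nz(1), of z] g_no_two_cycle[OF nz(2), of z] c1 c2
    by blast
  then show ?thesis
  proof cases
    case 1
    show ?thesis using serre_six_terms[OF q_prod nz 1 r1 r2 r3 r4 r5] .
  next
    case 2
    have "Eyxz * serre_weight y x z + Exyz * serre_weight x y z + Eyzx * serre_weight y z x
      + Ezyx * serre_weight z y x + Exzy * serre_weight x z y + Ezxy * serre_weight z x y = 0"
      by (rule serre_six_terms[OF q_prod nz(2,1,3) 2]) (use r1 r2 r3 r4 r5 r6 in \<open>simp_all add: add.commute\<close>)
    then show ?thesis by (simp add: add_ac)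
  next
    case 3
    have "Exzy * serre_weight x z y + Ezxy * serre_weight z x y + Exyz * serre_weight x y z
      + Eyxz * serre_weight y x z + Ezyx * serre_weight z y x + Eyzx * serre_weight y z x = 0"
      by (rule serre_six_terms[OF q_prod nz(1,3,2) 3]) (use r1 r2 r3 r4 r5 r6 in \<open>simp_all add: add.commute\<close>)
    then show ?thesis by (simp add: add_ac)
  next
    case 4
    have "Ezxy * serre_weight z x y + Exzy * serre_weight x z y + Ezyx * serre_weight z y x
      + Eyzx * serre_weight y z x + Exyz * serre_weight x y z + Eyxz * serre_weight y x z = 0"
      by (rule serre_six_terms[OF q_prod nz(3,1,2) 4]) (use r1 r2 r3 r4 r5 r6 in \<open>simp_all add: add.commute\<close>)
    then show ?thesis by (simp add: add_ac)
  next
    case 5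
    have "Eyzx * serre_weight y z x + Ezyx * serre_weight z y x + Eyxz * serre_weight y x z
      + Exyz * serre_weight x y z + Ezxy * serre_weight z x y + Exzy * serre_weight x z y = 0"
      by (rule serre_six_terms[OF q_prod nz(2,3,1) 5]) (use r1 r2 r3 r4 r5 r6 in \<open>simp_all add: add.commute\<close>)
    then show ?thesis by (simp add: add_ac)
  next
    case 6
    have "Ezyx * serre_weight z y x + Eyzx * serre_weight y z x + Ezxy * serre_weight z x y
      + Exzy * serre_weight x z y + Eyxz * serre_weight y x z + Exyz * serre_weight x y z = 0"
      by (rule serre_six_terms[OF q_prod nz(3,2,1) 6]) (use r1 r2 r3 r4 r5 r6 in \<open>simp_all add: add.commute\<close>)
    then show ?thesis by (simp add: add_ac)
  qed
qed

text \<open>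
  The coefficients of \<open>e\<close> and of \<open>f\<close> enter the relations only through two
  properties: they live on edges of the basis, and they obey the exchange rule. The quadratic and cubic
  relations are derived for any such \<open>G\<close>.
\<close>

definition supported :: "(ptuple \<Rightarrow> nat \<times> nat \<Rightarrow> complex) \<Rightarrow> bool" where
  "supported G \<longleftrightarrow> (\<forall>lam r. \<not> (lam \<in> B \<and> plus_box lam r \<in> B \<and> r \<in> rows) \<longrightarrow> G lam r = 0)"

definition exchange :: "(ptuple \<Rightarrow> nat \<times> nat \<Rightarrow> complex) \<Rightarrow> bool" where
  "exchange G \<longleftrightarrow> (\<forall>lam r r'. r \<noteq> r' \<longrightarrow> r \<in> rows \<longrightarrow> r' \<in> rows \<longrightarrow> 
     g (wt lam r') (wt lam r) * (G lam r * G (plus_box lam r) r')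
   + g (wt lam r) (wt lam r') * (G lam r' * G (plus_box lam r') r) = 0)"

lemma supportedD: "supported G \<Longrightarrow> G lam r \<noteq> 0 \<Longrightarrow> lam \<in> B \<and> plus_box lam r \<in> B \<and> r \<in> rows"
  unfolding supported_def by blast

text \<open>
  If only one of the two orders stays inside the basis, its product is killed by \<open>g\<close>: the row
  that had to be lengthened first blocks the other one, so the quotient of their weights is
  \<open>q2\<close> or \<open>q3\<close>.
\<close>

lemma exchangeI:
  assumes supp: "supported G"
    and main: "\<And>lam r r'. r \<noteq> r' \<Longrightarrow> r \<in> rows \<Longrightarrow> r' \<in> rows \<Longrightarrow> lam \<in> B \<Longrightarrow> plus_box lam r \<in> B \<Longrightarrow>
      plus_box lam r' \<in> B \<Longrightarrow>
      g (wt lam r') (wt lam r) * (G lam r * G (plus_box lam r) r')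
      + g (wt lam r) (wt lam r') * (G lam r' * G (plus_box lam r') r) = 0"
  shows "exchange G"
  unfolding exchange_def
proof (intro allI impI)
  fix lam r r' assume r: "r \<noteq> r'" "r \<in> rows" "r' \<in> rows"
  have one: "g (wt lam r') (wt lam r) * (G lam r * G (plus_box lam r) r') = 0"
    if r: "r \<noteq> r'" "r \<in> rows" "r' \<in> rows" and n: "plus_box lam r' \<notin> B" for r r'
  proof (cases "lam \<in> B \<and> plus_box lam r \<in> B \<and> plus_box (plus_box lam r) r' \<in> B")
    case True
    then obtain \<rho> where rho: "tight lam \<rho> r'" using plus_box_in_B_iff[of lam r'] n r by blast
    have nt: "\<not> tight (plus_box lam r) \<rho> r'" using plus_box_in_B_iff[of "plus_box lam r" r'] True r by blast
    have "\<rho> = r"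
    proof (rule ccontr)
      assume "\<rho> \<noteq> r"
      then show False using nt rho r by (auto simp: tight_def row_length_plus_box)
    qed
    then have "wt lam r' = q3 * wt lam r \<or> wt lam r' = q2 * wt lam r" using wt_if_tight[OF rho] by simp
    then show ?thesis by (auto simp: g_poly_def)
  next
    case False
    then have "G lam r = 0 \<or> G (plus_box lam r) r' = 0" using supportedD[OF supp] by blast
    then show ?thesis by auto
  qed
  show "g (wt lam r') (wt lam r) * (G lam r * G (plus_box lam r) r')
      + g (wt lam r) (wt lam r') * (G lam r' * G (plus_box lam r') r) = 0"
  proof (cases "lam \<in> B \<and> plus_box lam r \<in> B \<and> plus_box lam r' \<in> B")
    case True
    then show ?thesis using main r by blast
  next
    case False
    have "G lam r * G (plus_box lam r) r' = 0" if "plus_box lam r \<notin> B \<or> lam \<notin> B"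
      using supportedD[OF supp] that by fastforce
    moreover have "G lam r' * G (plus_box lam r') r = 0" if "plus_box lam r' \<notin> B \<or> lam \<notin> B"
      using supportedD[OF supp] that by fastforce
    ultimately show ?thesis using False one[of r r'] one[of r' r] r by auto
  qed
qed

text \<open>
  A row with a \<open>q1\<close>-neighbour is blocked by two rows \<open>c\<close> and \<open>d\<close>, one
  from each kind of constraint. Lengthening the row in \<open>mu\<close> therefore requires that both have
  changed, but \<open>mu\<close> differs from \<open>lam\<close> in only one row besides \<open>r'\<close>.
\<close>

lemma raised_not_q1_neighbour:
  assumes lam: "lam \<in> B" and mu: "mu \<in> B" "plus_box mu r \<in> B" and r: "r \<in> rows" "r' \<in> rows"
    and eq: "wt lam r' = q1 * wt lam r"
    and diff: "\<And>\<rho>. \<rho> \<noteq> x \<Longrightarrow> \<rho> \<noteq> r' \<Longrightarrow> wt mu \<rho> = wt lam \<rho>" "wt mu r = wt lam r"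
  shows False
proof -
  \<comment> \<open>the two rows that block \<open>r\<close>\<close>
  let ?c = "(fst r, snd r - 1)" and ?d = "(fst r', snd r' + 1)"
  note A = adjacent_columns[OF lam r eq]
  have rows: "?c \<in> rows" "?d \<in> rows" using A(1) r by (auto simp: rows_def)
  have wc: "wt lam r' = q1 * q3 * wt lam ?c" and wd: "wt lam r' = q1 * q2 * wt lam ?d"
    using A(2,3) eq by simp_all
  have "?c \<noteq> r'"
    using wc product_of_two[of q1 q3] wt_nz[OF r(2), of lam] by force
  moreover have "?d \<noteq> r'"
    using wd product_of_two[of q1 q2] wt_nz[OF r(2), of lam] by force
  moreover have "?c \<noteq> ?d"
  proof
    assume "?c = ?d"
    then have "q3 * wt lam ?d = q2 * wt lam ?d" using A(2,3) by metis
    then show False using q_distinct(2) wt_nz[OF rows(2), of lam] by simp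
  qed
  ultimately have "wt mu ?c = wt lam ?c \<or> wt mu ?d = wt lam ?d" using diff(1)[of ?c] diff(1)[of ?d]
    by (cases "?c = x") auto
  moreover have "wt mu ?c \<noteq> wt lam ?c"
    using addable_row(1)[OF mu r(1) rows(1)] A(2) unfolding diff(2) by auto
  moreover have "wt mu ?d \<noteq> wt lam ?d"
    using addable_row(2)[OF mu r(1) rows(2)] A(3) unfolding diff(2) by auto
  ultimately show False by blast
qed

definition path_term :: "(ptuple \<Rightarrow> nat \<times> nat \<Rightarrow> complex) \<Rightarrow> ptuple \<Rightarrow> nat \<times> nat \<Rightarrow> nat \<times> nat \<Rightarrow> nat \<times> nat \<Rightarrow> complex" where
  "path_term G lam r1 r2 r3 = G lam r1 * G (plus_box lam r1) r2 * G (plus_box (plus_box lam r1) r2) r3"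

definition serre_term :: "(ptuple \<Rightarrow> nat \<times> nat \<Rightarrow> complex) \<Rightarrow> ptuple \<Rightarrow> nat \<times> nat \<Rightarrow> nat \<times> nat \<Rightarrow> nat \<times> nat \<Rightarrow> complex" where
  "serre_term G lam r1 r2 r3 = path_term G lam r1 r2 r3 *
     serre_weight (wt lam r1) (wt (plus_box lam r1) r2) (wt (plus_box (plus_box lam r1) r2) r3)"

lemma path_term_nonzero:
  assumes "supported G" "path_term G lam r1 r2 r3 \<noteq> 0"
  shows "lam \<in> B" "plus_box lam r1 \<in> B" "plus_box (plus_box lam r1) r2 \<in> B"
    "plus_box (plus_box (plus_box lam r1) r2) r3 \<in> B"
  using supportedD[OF assms(1), of lam r1] supportedD[OF assms(1), of "plus_box lam r1" r2]
    supportedD[OF assms(1), of "plus_box (plus_box lam r1) r2" r3] assms(2) by (simp_all add: path_term_def)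

lemma path_exchange_first:
  assumes "exchange G" "r1 \<noteq> r2" "r1 \<in> rows" "r2 \<in> rows"
  shows "g (wt lam r2) (wt lam r1) * path_term G lam r1 r2 r3 + g (wt lam r1) (wt lam r2) * path_term G lam r2 r1 r3 = 0"
proof -
  have "g (wt lam r2) (wt lam r1) * (G lam r1 * G (plus_box lam r1) r2)
   + g (wt lam r1) (wt lam r2) * (G lam r2 * G (plus_box lam r2) r1) = 0"
    using assms unfolding exchange_def by blast
  then have "(g (wt lam r2) (wt lam r1) * (G lam r1 * G (plus_box lam r1) r2)
   + g (wt lam r1) (wt lam r2) * (G lam r2 * G (plus_box lam r2) r1)) * G (plus_box (plus_box lam r1) r2) r3 = 0"
    by simp
  then show ?thesis unfolding path_term_def plus_box_commute[of lam r2 r1] by (simp add: algebra_simps)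
qed

lemma path_exchange_last:
  assumes "exchange G" "r2 \<noteq> r3" "r2 \<in> rows" "r3 \<in> rows"
  shows "g (wt (plus_box lam r1) r3) (wt (plus_box lam r1) r2) * path_term G lam r1 r2 r3
    + g (wt (plus_box lam r1) r2) (wt (plus_box lam r1) r3) * path_term G lam r1 r3 r2 = 0"
proof -
  let ?m = "plus_box lam r1"
  have "g (wt ?m r3) (wt ?m r2) * (G ?m r2 * G (plus_box ?m r2) r3)
   + g (wt ?m r2) (wt ?m r3) * (G ?m r3 * G (plus_box ?m r3) r2) = 0"
    using assms unfolding exchange_def by blast
  then have "G lam r1 * (g (wt ?m r3) (wt ?m r2) * (G ?m r2 * G (plus_box ?m r2) r3)
   + g (wt ?m r2) (wt ?m r3) * (G ?m r3 * G (plus_box ?m r3) r2)) = 0" by simp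
  then show ?thesis unfolding path_term_def by (simp add: algebra_simps)
qed

text \<open>
  Going once around a cycle of zeros of \<open>g\<close> multiplies a weight by three of the parameters,
  whose product must then be 1. Such a cycle is called a wheel.
\<close>

lemma g_three_cycle:
  assumes nz: "x \<noteq> 0" and "g y x = 0" "g z y = 0" "g x z = 0"
  obtains q r s where "y = q * x" "z = r * y" "x = s * z" "{q, r, s} \<subseteq> {q1, q2, q3}" "q * r * s = 1"
proof -
  obtain q r s where *: "q \<in> {q1, q2, q3}" "r \<in> {q1, q2, q3}" "s \<in> {q1, q2, q3}"
      "y = q * x" "z = r * y" "x = s * z"
    using assms unfolding g_eq_0_iff by blast
  then have "x = (q * r * s) * x" by (simp add: mult_ac)
  then have "q * r * s = 1" using nz by simp
  then show ?thesis using that * by blast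
qed

text \<open>
  A wheel contains a quotient \<open>q1\<close>, which is impossible among three rows that can be lengthened
  one after the other.
\<close>

lemma no_wheel_distinct:
  assumes supp: "supported G" and r: "r1 \<in> rows" "r2 \<in> rows" "r3 \<in> rows"
    and d: "r1 \<noteq> r2" "r1 \<noteq> r3" "r2 \<noteq> r3"
    and nz: "path_term G lam r1 r2 r3 \<noteq> 0"
    and ab: "s \<in> {r1, r2, r3}" "s' \<in> {r1, r2, r3}"
  shows "wt lam s' \<noteq> q1 * wt lam s"
proof
  assume eq: "wt lam s' = q1 * wt lam s"
  note path = path_term_nonzero[OF supp nz]
  have s: "s \<in> rows" "s' \<in> rows" using ab r by auto
  have "s \<noteq> s'" using eq q1_neq_1 wt_nz[OF s(1), of lam] by auto
  define x where "x = (if s' = r1 then r2 else r1)"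
  have keep: "wt (plus_box (plus_box lam r1) r2) \<rho> = wt lam \<rho>" if "\<rho> \<noteq> r1" "\<rho> \<noteq> r2" for \<rho>
    using that by (simp add: wt_plus_box)
  consider "s = r1" | "s = r2" | "s = r3" using ab by blast
  then show False
  proof cases
    case 1
    show False using raised_not_q1_neighbour[OF path(1) path(1) _ s eq, of s] path(2) 1 by auto
  next
    case 2
    show False using raised_not_q1_neighbour[OF path(1) path(2) _ s eq, of r1] path(3) 2 d
      by (auto simp: wt_plus_box)
  next
    case 3
    have "s' = r1 \<or> s' = r2" using ab 3 \<open>s \<noteq> s'\<close> by auto
    then show False
    proof
      assume "s' = r1"
      then show False using raised_not_q1_neighbour[OF path(1) path(3) _ s eq, of r2] path(4) 3 d
        by (auto simp: wt_plus_box)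
    next
      assume "s' = r2"
      then show False using raised_not_q1_neighbour[OF path(1) path(3) _ s eq, of r1] path(4) 3 d
        by (auto simp: wt_plus_box)
    qed
  qed
qed

abbreviation serre_sum :: "(ptuple \<Rightarrow> nat \<times> nat \<Rightarrow> complex) \<Rightarrow> ptuple \<Rightarrow> nat \<times> nat \<Rightarrow> nat \<times> nat \<Rightarrow> nat \<times> nat \<Rightarrow> complex" where
  "serre_sum G lam r1 r2 r3 \<equiv> serre_term G lam r1 r2 r3 + serre_term G lam r2 r1 r3 + serre_term G lam r1 r3 r2
    + serre_term G lam r3 r1 r2 + serre_term G lam r2 r3 r1 + serre_term G lam r3 r2 r1"

lemma serre_distinct:
  assumes G: "supported G" "exchange G" and r: "r1 \<in> rows" "r2 \<in> rows" "r3 \<in> rows"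
    and d: "r1 \<noteq> r2" "r1 \<noteq> r3" "r2 \<noteq> r3"
  shows "serre_sum G lam r1 r2 r3 = 0"
proof (cases "\<forall>s1 s2 s3. {s1, s2, s3} = {r1, r2, r3} \<longrightarrow> path_term G lam s1 s2 s3 = 0")
  case True
  have *: "path_term G lam s1 s2 s3 = 0" if "{s1, s2, s3} = {r1, r2, r3}" for s1 s2 s3
    using True that by blast
  have "path_term G lam r1 r2 r3 = 0" "path_term G lam r2 r1 r3 = 0" "path_term G lam r1 r3 r2 = 0"
    "path_term G lam r3 r1 r2 = 0" "path_term G lam r2 r3 r1 = 0" "path_term G lam r3 r2 r1 = 0"
    by (rule *, blast)+
  then show ?thesis by (simp add: serre_term_def)
next
  case False
  then obtain s1 s2 s3 where s: "{s1, s2, s3} = {r1, r2, r3}" "path_term G lam s1 s2 s3 \<noteq> 0" by blast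
  have "card {s1, s2, s3} = 3" unfolding s(1) using d by simp
  then have "s1 \<noteq> s2 \<and> s1 \<noteq> s3 \<and> s2 \<noteq> s3" by (simp add: card_insert_if split: if_splits)
  moreover have "{s1, s2, s3} \<subseteq> rows" unfolding s(1) using r by simp
  ultimately have ds: "s1 \<noteq> s2" "s1 \<noteq> s3" "s2 \<noteq> s3" "s1 \<in> rows" "s2 \<in> rows" "s3 \<in> rows" by simp_all
  have nq1: "wt lam x \<noteq> q1 * wt lam y" if "x \<in> {r1, r2, r3}" "y \<in> {r1, r2, r3}" for x y
    using no_wheel_distinct[OF G(1) ds(4,5,6,1,2,3) s(2)] that unfolding s(1) by blast
  have cyc: "\<not> (g (wt lam b) (wt lam a) = 0 \<and> g (wt lam c) (wt lam b) = 0 \<and> g (wt lam a) (wt lam c) = 0)"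
    if abc: "a \<in> {r1, r2, r3}" "b \<in> {r1, r2, r3}" "c \<in> {r1, r2, r3}" for a b c
  proof
    assume cyc: "g (wt lam b) (wt lam a) = 0 \<and> g (wt lam c) (wt lam b) = 0 \<and> g (wt lam a) (wt lam c) = 0"
    have "a \<in> rows" using abc r by auto
    from wt_nz[OF this, of lam] obtain x y z where *: "wt lam b = x * wt lam a" "wt lam c = y * wt lam b" "wt lam a = z * wt lam c"
      "{x, y, z} \<subseteq> {q1, q2, q3}" "x * y * z = 1"
      using g_three_cycle[of "wt lam a" "wt lam b" "wt lam c"] cyc by metis
    then have "x = q1 \<or> y = q1 \<or> z = q1" using product_of_three(1)[of x y z] by blast
    then show False using nq1[OF abc(2,1)] nq1[OF abc(3,2)] nq1[OF abc(1,3)] *(1-3) by metis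
  qed
  have w: "wt (plus_box lam x) y = wt lam y" if "x \<noteq> y" for x y using that by (simp add: wt_plus_box)
  note first = path_exchange_first[OF G(2)] and last = path_exchange_last[OF G(2)]
  have "path_term G lam r1 r2 r3 * serre_weight (wt lam r1) (wt lam r2) (wt lam r3)
    + path_term G lam r2 r1 r3 * serre_weight (wt lam r2) (wt lam r1) (wt lam r3)
    + path_term G lam r1 r3 r2 * serre_weight (wt lam r1) (wt lam r3) (wt lam r2)
    + path_term G lam r3 r1 r2 * serre_weight (wt lam r3) (wt lam r1) (wt lam r2)
    + path_term G lam r2 r3 r1 * serre_weight (wt lam r2) (wt lam r3) (wt lam r1)
    + path_term G lam r3 r2 r1 * serre_weight (wt lam r3) (wt lam r2) (wt lam r1) = 0"
  proof (rule serre_orders)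
    show "g (wt lam r2) (wt lam r1) * path_term G lam r1 r2 r3 + g (wt lam r1) (wt lam r2) * path_term G lam r2 r1 r3 = 0"
      "g (wt lam r3) (wt lam r1) * path_term G lam r1 r3 r2 + g (wt lam r1) (wt lam r3) * path_term G lam r3 r1 r2 = 0"
      "g (wt lam r3) (wt lam r2) * path_term G lam r2 r3 r1 + g (wt lam r2) (wt lam r3) * path_term G lam r3 r2 r1 = 0"
      using first d r by auto
    show "g (wt lam r3) (wt lam r2) * path_term G lam r1 r2 r3 + g (wt lam r2) (wt lam r3) * path_term G lam r1 r3 r2 = 0"
      "g (wt lam r3) (wt lam r1) * path_term G lam r2 r1 r3 + g (wt lam r1) (wt lam r3) * path_term G lam r2 r3 r1 = 0"
      "g (wt lam r2) (wt lam r1) * path_term G lam r3 r1 r2 + g (wt lam r1) (wt lam r2) * path_term G lam r3 r2 r1 = 0"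
      using last[OF d(3) r(2,3), of lam r1] last[OF d(2) r(1,3), of lam r2] last[OF d(1) r(1,2), of lam r3] d w by auto
  qed (use wt_nz r cyc[of r1 r2 r3] cyc[of r1 r3 r2] in auto)
  then show ?thesis using d by (simp add: serre_term_def wt_plus_box)
qed

text \<open>
  With \<open>r\<close> used twice the orders that would need the weight \<open>q1 v\<close> before
  \<open>v\<close> do not exist. Giving them amplitude 0 is consistent with the exchange rules because
  \<open>g(q1 v, v) = 0\<close>, so the six-term identity still applies.
\<close>

lemma serre_double:
  assumes G: "supported G" "exchange G" and r: "r \<in> rows" "s \<in> rows" and d: "r \<noteq> s"
  shows "serre_term G lam r r s + serre_term G lam r s r + serre_term G lam s r r = 0"
proof (cases "path_term G lam r r s = 0 \<and> path_term G lam r s r = 0 \<and> path_term G lam s r r = 0")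
  case True
  then show ?thesis by (simp add: serre_term_def)
next
  case False
  define v w where "v = wt lam r" and "w = wt lam s"
  have nz: "v \<noteq> 0" "q1 * v \<noteq> 0" "w \<noteq> 0" using wt_nz r q1_nz by (auto simp: v_def w_def)
  \<comment> \<open>if \<open>s\<close> blocked \<open>r\<close>, then after one box in each row it would block \<open>r\<close> again\<close>
  have not_below: "v \<noteq> q * w" if q: "q \<in> {q2, q3}" for q
  proof
    assume vw: "v = q * w"
    have 1: "\<not> (mu \<in> B \<and> plus_box mu r \<in> B \<and> wt mu r = q * wt mu s)" for mu
      using addable_row(1,2)[of mu r s] r q by auto
    have 2: "wt lam r = q * wt lam s" using vw by (simp add: v_def w_def)
    have 3: "wt (plus_box (plus_box lam s) r) r = q * wt (plus_box (plus_box lam s) r) s" "wt (plus_box (plus_box lam r) s) r = q * wt (plus_box (plus_box lam r) s) s" 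
      using 2 d by (simp_all add: wt_plus_box)
    show False using False 1[of lam] 2 1[of "plus_box lam s"] 1[of "plus_box (plus_box lam s) r"] 3
      path_term_nonzero[OF G(1), of lam r r s] path_term_nonzero[OF G(1), of lam r s r] path_term_nonzero[OF G(1), of lam s r r]
      by auto
  qed
  have r1: "g w (q1 * v) * path_term G lam r r s + g (q1 * v) w * path_term G lam r s r = 0"
    using path_exchange_last[OF G(2) d r, of lam r] d by (simp add: wt_plus_box v_def w_def)
  have r2: "g w v * path_term G lam r s r + g v w * path_term G lam s r r = 0"
    using path_exchange_first[OF G(2) d r, of lam r] by (simp add: v_def w_def)
  have gq: "g (q1 * v) v = 0" by (simp add: g_poly_def)
  have gn: "g v (q1 * v) \<noteq> 0" using g_no_two_cycle[OF nz(1), of "q1 * v"] gq by simp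
  \<comment> \<open>the three zeros stand for the orders that do not exist\<close>
  have "path_term G lam r r s * serre_weight v (q1 * v) w + 0 * serre_weight (q1 * v) v w
    + path_term G lam r s r * serre_weight v w (q1 * v) + path_term G lam s r r * serre_weight w v (q1 * v)
    + 0 * serre_weight (q1 * v) w v + 0 * serre_weight w (q1 * v) v = 0"
  proof (rule serre_orders[OF nz])
    show "\<not> (g (q1 * v) v = 0 \<and> g w (q1 * v) = 0 \<and> g v w = 0)"
    proof
      assume "g (q1 * v) v = 0 \<and> g w (q1 * v) = 0 \<and> g v w = 0"
      then obtain x y z where *: "q1 * v = x * v" "w = y * (q1 * v)" "v = z * w"
        "{x, y, z} \<subseteq> {q1, q2, q3}" "x * y * z = 1"
        using g_three_cycle[OF nz(1), of "q1 * v" w] by metis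
      have "x = q1" using *(1) nz(1) by simp
      then have "z \<in> {q2, q3}" using product_of_three(2)[of x y z] *(4,5) by simp
      then show False using not_below *(3) by blast
    qed
  qed (use r1 r2 gq gn in auto)
  then show ?thesis using d by (simp add: serre_term_def wt_plus_box v_def w_def)
qed

text \<open>
  The mode factor itself vanishes for weights \<open>v, q1 v, q1^2 v\<close>.
\<close>

lemma serre_triple: "r \<in> rows \<Longrightarrow> serre_term G lam r r r = 0"
  using wt_nz[of r lam] q1_nz
  by (simp add: serre_term_def serre_weight_def wt_plus_box)

lemma serre_symmetric:
  assumes G: "supported G" "exchange G" and r: "r1 \<in> rows" "r2 \<in> rows" "r3 \<in> rows"
  shows "serre_sum G lam r1 r2 r3 = 0"
proof -
  have double: "serre_sum G lam x x y = 0 \<and> serre_sum G lam x y x = 0 \<and> serre_sum G lam y x x = 0"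
    if "x \<in> rows" "y \<in> rows" "x \<noteq> y" for x y
  proof -
    have "2 * (serre_term G lam x x y + serre_term G lam x y x + serre_term G lam y x x) = 0"
      using serre_double[OF G that] by simp
    then show ?thesis by (simp add: algebra_simps)
  qed
  consider "r1 = r2" "r2 = r3" | "r1 = r2" "r2 \<noteq> r3" | "r1 = r3" "r1 \<noteq> r2" | "r2 = r3" "r1 \<noteq> r2"
    | "r1 \<noteq> r2" "r1 \<noteq> r3" "r2 \<noteq> r3" by blast
  then show ?thesis
  proof cases
    case 1
    then show ?thesis using serre_triple[OF r(1)] by simp
  next
    case 2
    then show ?thesis using double[of r1 r3] r by metis
  next
    case 3
    then show ?thesis using double[of r1 r2] r by metis
  next
    case 4
    then show ?thesis using double[of r2 r1] r by metis
  next
    case 5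
    then show ?thesis using serre_distinct[OF G r] by blast
  qed
qed

end

section \<open>Edges between basis vectors\<close>

context resonance
begin

definition entry :: "ptuple \<Rightarrow> gen \<Rightarrow> ptuple \<Rightarrow> complex" where
  "entry mu x lam = resonant_coeff q1 q3 u n a b mu x lam"

text \<open>
  The coefficients at mode 0 along the edge that lengthens \<open>r\<close>; mode \<open>k\<close> only
  multiplies them by the \<open>k\<close>-th power of the weight.
\<close>

definition ee :: "ptuple \<Rightarrow> nat \<times> nat \<Rightarrow> complex" where
  "ee lam r = (if lam \<in> B \<and> plus_box lam r \<in> B \<and> r \<in> rows then entry (plus_box lam r) (Gen_e 0) lam else 0)"

definition ff :: "ptuple \<Rightarrow> nat \<times> nat \<Rightarrow> complex" where
  "ff lam r = (if lam \<in> B \<and> plus_box lam r \<in> B \<and> r \<in> rows then entry lam (Gen_f 0) (plus_box lam r) else 0)"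

lemma supported_ee: "supported ee" and supported_ff: "supported ff"
  by (auto simp: supported_def ee_def ff_def)

lemma ee_eq:
  assumes "lam \<in> B" "plus_box lam r \<in> B" "r \<in> rows" "bounded_by T lam" "snd r \<le> T"
  shows "ee lam r = e_edge T lam r"
  using assms spec_coefficient(1)[OF spec_e_edge[OF assms, of 0]] by (simp add: ee_def entry_def)

lemma ff_eq:
  assumes "lam \<in> B" "plus_box lam r \<in> B" "r \<in> rows" "bounded_by T lam" "snd r \<le> T"
  shows "ff lam r = f_edge T lam r"
  using assms spec_coefficient(1)[OF spec_f_edge[OF assms, of 0]] by (simp add: ff_def entry_def)

lemma ex_bound:
  assumes "lam \<in> B"
  obtains T where "bounded_by T lam" "N \<le> T"
  using B_bounded[OF assms] bounded_by_mono[of _ lam] by (meson max.cobounded1 max.cobounded2)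

lemma entry_e:
  assumes "lam \<in> B" "plus_box lam r \<in> B" "r \<in> rows"
  shows "entry (plus_box lam r) (Gen_e k) lam = wt lam r powi k * ee lam r"
proof -
  obtain T where T: "bounded_by T lam" "snd r \<le> T" using ex_bound[OF assms(1)] by blast
  show ?thesis using spec_coefficient(1)[OF spec_e_edge[OF assms T, of k]] ee_eq[OF assms T] by (simp add: entry_def)
qed

lemma entry_f:
  assumes "lam \<in> B" "plus_box lam r \<in> B" "r \<in> rows"
  shows "entry lam (Gen_f k) (plus_box lam r) = wt lam r powi k * ff lam r"
proof -
  obtain T where T: "bounded_by T lam" "snd r \<le> T" using ex_bound[OF assms(1)] by blast
  show ?thesis using spec_coefficient(1)[OF spec_f_edge[OF assms T, of k]] ff_eq[OF assms T] by (simp add: entry_def)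
qed

lemma entry_e_0: "(\<And>r. r \<in> rows \<Longrightarrow> mu \<noteq> plus_box lam r) \<Longrightarrow> entry mu (Gen_e k) lam = 0"
  unfolding entry_def by (rule spec_coefficient(1)) (simp add: generic_e_eq_0 spec.zero)

lemma entry_f_0: "(\<And>r. r \<in> rows \<Longrightarrow> lam \<noteq> plus_box mu r) \<Longrightarrow> entry mu (Gen_f k) lam = 0"
  unfolding entry_def by (rule spec_coefficient(1)) (simp add: generic_f_eq_0 spec.zero)

lemma ee_nonzero: "lam \<in> B \<Longrightarrow> plus_box lam r \<in> B \<Longrightarrow> r \<in> rows \<Longrightarrow> ee lam r \<noteq> 0"
  and ff_nonzero: "lam \<in> B \<Longrightarrow> plus_box lam r \<in> B \<Longrightarrow> r \<in> rows \<Longrightarrow> ff lam r \<noteq> 0"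
proof -
  assume *: "lam \<in> B" "plus_box lam r \<in> B" "r \<in> rows"
  obtain T where T: "bounded_by T lam" "snd r \<le> T" using ex_bound[OF *(1)] by blast
  show "ee lam r \<noteq> 0" "ff lam r \<noteq> 0" using edges_nonzero[OF * T] ee_eq[OF * T] ff_eq[OF * T] by simp_all
qed

lemma edge_eq: "edge T lam S J r = (\<Prod>\<rho>\<in>S. row_factor q1 q3 (wt lam \<rho> / wt lam r))
    * (\<Prod>j\<in>J. tail_factor q1 q3 (q3 powi int T * (us j / wt lam r)))"
  by (simp add: edge_def edge_product_def wt_def case_prod_beta)

lemma edge_unaffected:
  assumes "r \<notin> S" "r \<noteq> r'"
  shows "edge T (plus_box lam r) S J r' = edge T lam S J r'"
proof -
  have "(\<Prod>\<rho>\<in>S. row_factor q1 q3 (wt (plus_box lam r) \<rho> / wt lam r')) = (\<Prod>\<rho>\<in>S. row_factor q1 q3 (wt lam \<rho> / wt lam r'))"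
    using assms by (intro prod.cong) (auto simp: wt_plus_box)
  then show ?thesis using assms by (simp add: edge_eq wt_plus_box)
qed

lemma edge_affected:
  assumes "finite S" "r \<in> S" "r \<noteq> r'"
  shows "edge T (plus_box lam r) S J r' * row_factor q1 q3 (wt lam r / wt lam r')
    = edge T lam S J r' * row_factor q1 q3 (q1 * wt lam r / wt lam r')"
proof -
  have "(\<Prod>\<rho>\<in>S - {r}. row_factor q1 q3 (wt (plus_box lam r) \<rho> / wt lam r')) = (\<Prod>\<rho>\<in>S - {r}. row_factor q1 q3 (wt lam \<rho> / wt lam r'))"
    by (intro prod.cong) (auto simp: wt_plus_box)
  then show ?thesis using assms(3)
    by (simp add: edge_eq prod.remove[OF assms(1,2)] wt_plus_box)
qed

text \<open>
  When both rows can be lengthened, none of the quantities that the shift rule divides by vanishes.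
\<close>

lemma addable_pair_shift:
  assumes lam: "lam \<in> B" "plus_box lam r \<in> B" "plus_box lam r' \<in> B" and r: "r \<in> rows" "r' \<in> rows" "r \<noteq> r'"
  shows "row_factor q1 q3 (q1 * wt lam r / wt lam r') * g (wt lam r') (wt lam r)
      = - g (wt lam r) (wt lam r') * row_factor q1 q3 (wt lam r / wt lam r')"
    "row_factor q1 q3 (wt lam r / wt lam r') \<noteq> 0" "g (wt lam r') (wt lam r) \<noteq> 0"
proof -
  note E = edge_factor[OF lam(1,3) r(2,1,3)]
  have 1: "q1 * wt lam r \<noteq> wt lam r'" using addable_row(3)[OF lam(1,2) r(1,2)] by simp
  show "row_factor q1 q3 (q1 * wt lam r / wt lam r') * g (wt lam r') (wt lam r)
      = - g (wt lam r) (wt lam r') * row_factor q1 q3 (wt lam r / wt lam r')"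
    by (rule row_factor_shift[OF q_prod wt_nz[OF r(2)] E(1,2) 1])
  show "row_factor q1 q3 (wt lam r / wt lam r') \<noteq> 0" using E(3) .
  show "g (wt lam r') (wt lam r) \<noteq> 0"
    using 1 addable_row(1,2)[OF lam(1,3) r(2,1)] by (auto simp: g_poly_def)
qed

text \<open>
  When \<open>r\<close> is lengthened first, the coefficient at \<open>r'\<close> contains its factor, which
  is shifted by a quotient of values of \<open>g\<close>; when \<open>r'\<close> is lengthened first, the
  coefficient at \<open>r\<close> does not see it.
\<close>

lemma edge_exchange:
  assumes lam: "lam \<in> B" "plus_box lam r \<in> B" "plus_box lam r' \<in> B" and r: "r \<in> rows" "r' \<in> rows" "r \<noteq> r'"
    and S: "finite S'" "r \<in> S'" "r' \<notin> S"
  shows "g (wt lam r') (wt lam r) * (edge T lam S J r * edge T (plus_box lam r) S' J' r')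
    + g (wt lam r) (wt lam r') * (edge T lam S' J' r' * edge T (plus_box lam r') S J r) = 0"
proof -
  note sh = addable_pair_shift[OF lam r]
  let ?f = "row_factor q1 q3 (wt lam r / wt lam r')" and ?f' = "row_factor q1 q3 (q1 * wt lam r / wt lam r')"
  have 1: "edge T (plus_box lam r) S' J' r' * ?f = edge T lam S' J' r' * ?f'"
    by (rule edge_affected[OF S(1,2) r(3)])
  have 2: "edge T (plus_box lam r') S J r = edge T lam S J r"
    using S(3) r(3) by (intro edge_unaffected) auto
  have "(g (wt lam r') (wt lam r) * (edge T lam S J r * edge T (plus_box lam r) S' J' r')) * ?f
      = edge T lam S J r * g (wt lam r') (wt lam r) * (edge T (plus_box lam r) S' J' r' * ?f)"
    by (simp only: mult_ac)
  also have "\<dots> = edge T lam S J r * edge T lam S' J' r' * (?f' * g (wt lam r') (wt lam r))"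
    unfolding 1 by (simp only: mult_ac)
  also have "\<dots> = - (g (wt lam r) (wt lam r') * (edge T lam S' J' r' * edge T (plus_box lam r') S J r)) * ?f"
    unfolding sh(1) 2 by simp
  finally have "g (wt lam r') (wt lam r) * (edge T lam S J r * edge T (plus_box lam r) S' J' r')
    = - (g (wt lam r) (wt lam r') * (edge T lam S' J' r' * edge T (plus_box lam r') S J r))"
    unfolding mult_right_cancel[OF sh(2)] .
  then show ?thesis by simp
qed

lemma rows_before_cases:
  assumes "r \<in> rows" "r' \<in> rows" "r \<noteq> r'" "snd r \<le> T" "snd r' \<le> T"
  shows "r \<in> rows_before T (fst r') (snd r') \<and> r' \<notin> rows_before T (fst r) (snd r) \<or>
    r' \<in> rows_before T (fst r) (snd r) \<and> r \<notin> rows_before T (fst r') (snd r')"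
  using assms by (cases r; cases r') (auto simp: rows_before_def rows_def)

lemma rows_after_iff:
  assumes "r \<in> rows" "r' \<in> rows" "snd r \<le> T" "snd r' \<le> T"
  shows "r' \<in> rows_after n T (fst r) (snd r) \<longleftrightarrow> r \<in> rows_before T (fst r') (snd r')"
  using assms by (cases r; cases r') (auto simp: rows_before_def rows_after_def rows_def)

lemma finite_row_sets: "finite (rows_before T i s)" "finite (rows_after n T i s)"
  by (auto simp: rows_before_def rows_after_def)

lemma exchange_of_edges:
  assumes supp: "supported G"
    and G: "\<And>lam r T. lam \<in> B \<Longrightarrow> plus_box lam r \<in> B \<Longrightarrow> r \<in> rows \<Longrightarrow> bounded_by T lam \<Longrightarrow> snd r \<le> T \<Longrightarrow>
      G lam r = K * edge T lam (S T r) (J r) r"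
    and S: "\<And>T r. finite (S T r)" "\<And>T r r'. r \<in> rows \<Longrightarrow> r' \<in> rows \<Longrightarrow> r \<noteq> r' \<Longrightarrow> snd r \<le> T \<Longrightarrow> snd r' \<le> T \<Longrightarrow>
      r \<in> S T r' \<and> r' \<notin> S T r \<or> r' \<in> S T r \<and> r \<notin> S T r'"
  shows "exchange G"
proof (rule exchangeI[OF supp])
  fix lam r r' assume r: "r \<noteq> r'" "r \<in> rows" "r' \<in> rows" and lam: "lam \<in> B" "plus_box lam r \<in> B" "plus_box lam r' \<in> B"
  have both: "plus_box (plus_box lam r) r' \<in> B" "plus_box (plus_box lam r') r \<in> B"
    using diamond(2)[OF r lam(2,3)] diamond(2)[OF r(1)[symmetric] r(3,2) lam(3,2)] by auto
  obtain T where T: "bounded_by T lam" "snd r + snd r' \<le> T" using ex_bound[OF lam(1)] by blast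
  then have bd: "bounded_by T (plus_box lam r)" "bounded_by T (plus_box lam r')" "snd r \<le> T" "snd r' \<le> T"
    by (simp_all add: bounded_by_plus_box)
  have eqs: "G lam r = K * edge T lam (S T r) (J r) r" "G lam r' = K * edge T lam (S T r') (J r') r'"
    "G (plus_box lam r) r' = K * edge T (plus_box lam r) (S T r') (J r') r'"
    "G (plus_box lam r') r = K * edge T (plus_box lam r') (S T r) (J r) r"
    using r lam both bd T(1) by (auto intro!: G)
  have KK: "x * (K * A * (K * A')) + y * (K * C * (K * C')) = K * K * (x * (A * A') + y * (C * C'))" for x y A A' C C' :: complex
    by (simp add: algebra_simps)
  have "g (wt lam r') (wt lam r) * (edge T lam (S T r) (J r) r * edge T (plus_box lam r) (S T r') (J r') r')
    + g (wt lam r) (wt lam r') * (edge T lam (S T r') (J r') r' * edge T (plus_box lam r') (S T r) (J r) r) = 0"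
    using S(2)[OF r(2,3,1) bd(3,4)]
  proof
    assume "r \<in> S T r' \<and> r' \<notin> S T r"
    then show ?thesis using edge_exchange[OF lam r(2,3,1) S(1)] by blast
  next
    assume *: "r' \<in> S T r \<and> r \<notin> S T r'"
    show ?thesis using edge_exchange[OF lam(1,3,2) r(3,2) r(1)[symmetric] S(1)] * by (simp only: add.commute) blast
  qed
  then show "g (wt lam r') (wt lam r) * (G lam r * G (plus_box lam r) r')
      + g (wt lam r) (wt lam r') * (G lam r' * G (plus_box lam r') r) = 0"
    unfolding eqs KK by simp
qed

lemma exchange_ee: "exchange ee"
proof (rule exchange_of_edges[OF supported_ee])
  show "ee lam r = 1 / (1 - q1) * edge T lam (rows_before T (fst r) (snd r)) {1..<fst r} r"
    if "lam \<in> B" "plus_box lam r \<in> B" "r \<in> rows" "bounded_by T lam" "snd r \<le> T" for lam r T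
    using ee_eq[OF that] by (simp add: e_edge_def)
qed (rule finite_row_sets rows_before_cases; assumption)+

lemma exchange_ff: "exchange ff"
proof (rule exchange_of_edges[OF supported_ff])
  show "ff lam r = q1 / (1 - q1) * edge T lam (rows_after n T (fst r) (snd r)) {fst r..n} r"
    if "lam \<in> B" "plus_box lam r \<in> B" "r \<in> rows" "bounded_by T lam" "snd r \<le> T" for lam r T
    using ff_eq[OF that] by (simp add: f_edge_def)
  show "r \<in> rows_after n T (fst r') (snd r') \<and> r' \<notin> rows_after n T (fst r) (snd r) \<or>
      r' \<in> rows_after n T (fst r) (snd r) \<and> r \<notin> rows_after n T (fst r') (snd r')"
    if "r \<in> rows" "r' \<in> rows" "r \<noteq> r'" "snd r \<le> T" "snd r' \<le> T" for T r r'
    using rows_before_cases[OF that] rows_after_iff that by blast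
qed (rule finite_row_sets)

text \<open>
  If \<open>r'\<close> precedes \<open>r\<close>, lengthening \<open>r'\<close> shifts a factor of
  \<open>e\<close> at \<open>r\<close>, and lengthening \<open>r\<close> shifts a factor of \<open>f\<close>
  at \<open>r'\<close>; the shifts are inverse to each other. Otherwise neither product sees the other row.
\<close>

lemma mixed_edges_commute:
  assumes r: "r \<noteq> r'" "r \<in> rows" "r' \<in> rows" and B: "plus_box mu r \<in> B" "plus_box mu r' \<in> B"
  shows "ee (plus_box mu r') r * ff (plus_box mu r) r' = ff mu r' * ee mu r"
proof -
  have mu: "mu \<in> B" "plus_box (plus_box mu r) r' \<in> B" "plus_box (plus_box mu r') r \<in> B"
    using diamond[OF r B] diamond(2)[OF r(1)[symmetric] r(3,2) B(2,1)] by auto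
  obtain T where T: "bounded_by T mu" "snd r + snd r' \<le> T" using ex_bound[OF mu(1)] by blast
  then have bd: "bounded_by T (plus_box mu r)" "bounded_by T (plus_box mu r')" "snd r \<le> T" "snd r' \<le> T"
    by (simp_all add: bounded_by_plus_box)
  let ?S = "rows_before T (fst r) (snd r)" and ?S' = "rows_after n T (fst r') (snd r')"
  let ?J = "{1..<fst r}" and ?J' = "{fst r'..n}"
  let ?G = "edge T mu ?S ?J r" and ?G1 = "edge T (plus_box mu r') ?S ?J r"
  let ?H = "edge T mu ?S' ?J' r'" and ?H1 = "edge T (plus_box mu r) ?S' ?J' r'"
  have main: "?G1 * ?H1 = ?H * ?G"
  proof (cases "r' \<in> ?S")
    case False
    then have "r \<notin> ?S'" using rows_after_iff[OF r(3,2) bd(4,3)] by blast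
    then show ?thesis using False r edge_unaffected[of r' ?S r] edge_unaffected[of r ?S' r'] by simp
  next
    case True
    then have r': "r \<in> ?S'" using rows_after_iff[OF r(3,2) bd(4,3)] by blast
    note sh = addable_pair_shift[OF mu(1) B r(2,3,1)] and sh' = addable_pair_shift[OF mu(1) B(2,1) r(3,2) r(1)[symmetric]]
    let ?f = "row_factor q1 q3 (wt mu r / wt mu r')" and ?f1 = "row_factor q1 q3 (q1 * wt mu r / wt mu r')"
    let ?h = "row_factor q1 q3 (wt mu r' / wt mu r)" and ?h1 = "row_factor q1 q3 (q1 * wt mu r' / wt mu r)"
    let ?x = "g (wt mu r') (wt mu r)" and ?y = "g (wt mu r) (wt mu r')"
    have 1: "?H1 * ?f = ?H * ?f1" by (rule edge_affected[OF finite_row_sets(2) r' r(1)])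
    have 2: "?G1 * ?h = ?G * ?h1" by (rule edge_affected[OF finite_row_sets(1) True r(1)[symmetric]])
    have "(?f1 * ?x) * (?h1 * ?y) = (?f * ?x) * (?h * ?y)" unfolding sh(1) sh'(1) by (simp add: mult_ac)
    then have "(?f1 * ?h1) * (?x * ?y) = (?f * ?h) * (?x * ?y)" by (simp only: mult_ac)
    then have fh: "?f1 * ?h1 = ?f * ?h" using sh(3) sh'(3) by simp
    have "(?G1 * ?H1) * (?f * ?h) = (?H1 * ?f) * (?G1 * ?h)" by (simp only: mult_ac)
    also have "\<dots> = (?H * ?G) * (?f1 * ?h1)" unfolding 1 2 by (simp only: mult_ac)
    finally show ?thesis unfolding fh using sh(2) sh'(2) by simp
  qed
  show ?thesis
    unfolding ee_eq[OF B(2) mu(3) r(2) bd(2,3)] ff_eq[OF B(1) mu(2) r(3) bd(1,4)]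
      ee_eq[OF mu(1) B(1) r(2) T(1) bd(3)] ff_eq[OF mu(1) B(2) r(3) T(1) bd(4)] e_edge_def f_edge_def
    using main by (simp add: mult_ac)
qed

end

section \<open>Eigenvalue series\<close>

text \<open>
  The series variable for the two expansions: \<open>s = True\<close> stands for
  \<open>\<psi>\<^sup>+\<close>, expanded in \<open>z^(-1)\<close>, and \<open>s = False\<close> for
  \<open>\<psi>\<^sup>-\<close>, expanded in \<open>z\<close>. Treating both at once halves the number of
  statements.
\<close>

definition zinv :: "bool \<Rightarrow> 'k::field fls" where "zinv s = (if s then fls_X else fls_X_inv)"

definition geometric :: "'k::field \<Rightarrow> 'k fps" where "geometric c = Abs_fps (\<lambda>k. c ^ k)"

text \<open>
  The expansion of \<open>(1 - d/z)/(1 - c/z)\<close> selected by \<open>s\<close>, as an explicit power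
  series. Its coefficients are polynomial in \<open>d\<close>, \<open>c\<close> and their inverses, which is
  what specialization of eigenvalues needs.
\<close>

definition mobius_series :: "bool \<Rightarrow> 'k::field \<Rightarrow> 'k \<Rightarrow> 'k fps" where
  "mobius_series s d c = (if s then (1 - fps_const d * fps_X) * geometric c
     else fps_const (d / c) * (1 - fps_const (inverse d) * fps_X) * geometric (inverse c))"

lemma geometric_mult: "(1 - fps_const c * fps_X) * geometric c = 1"
proof (rule fps_ext)
  fix k
  show "fps_nth ((1 - fps_const c * fps_X) * geometric c) k = fps_nth 1 k"
    by (cases k) (simp_all add: geometric_def left_diff_distrib mult.assoc)
qed

lemma fls_1_minus_nonzero: "1 - fls_const c * zinv s \<noteq> 0"
proof
  assume "1 - fls_const c * zinv s = 0"
  then have "fls_nth (1 - fls_const c * zinv s) 0 = 0" by simp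
  then show False by (cases s) (simp_all add: zinv_def)
qed

lemma mobius_series_eq:
  assumes "c \<noteq> 0" "d \<noteq> 0"
  shows "(1 - fls_const d * zinv s) / (1 - fls_const c * zinv s) = fps_to_fls (mobius_series s d c)"
proof -
  have lin: "fps_to_fls (1 - fps_const e * fps_X) = 1 - fls_const e * fls_X" for e :: 'a
    by (simp add: fls_times_fps_to_fls fps_to_fls_minus)
  have "fps_to_fls (mobius_series s d c) * (1 - fls_const c * zinv s) = 1 - fls_const d * zinv s"
  proof (cases s)
    case True
    have "fps_to_fls ((1 - fps_const d * fps_X) * geometric c) * fps_to_fls (1 - fps_const c * fps_X)
        = fps_to_fls (1 - fps_const d * fps_X)"
      by (simp only: fls_times_fps_to_fls[symmetric] mult.assoc mult.commute[of "geometric c"] geometric_mult mult_1_right)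
    then show ?thesis using True by (simp only: mobius_series_def zinv_def lin if_True)
  next
    case False
    have X: "fls_X * fls_X_inv = (1 :: 'a fls)"
      unfolding fls_inverse_X[symmetric] by (rule right_inverse) simp
    have e: "1 - fls_const e * fls_X_inv = - fls_const e * fls_X_inv * fps_to_fls (1 - fps_const (inverse e) * fps_X)" if "e \<noteq> 0" for e :: 'a
    proof -
      have "- fls_const e * fls_X_inv * fps_to_fls (1 - fps_const (inverse e) * fps_X)
          = - fls_const e * fls_X_inv + (fls_const e * fls_const (inverse e)) * (fls_X * fls_X_inv)"
        unfolding lin by (simp only: right_diff_distrib mult_1_right mult_ac) (simp add: mult.commute)
      also have "fls_const e * fls_const (inverse e) = 1"
        using that by (simp add: fls_const_mult_const)
      finally show ?thesis unfolding X by simp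
    qed
    have const: "fps_to_fls (fps_const e) = fls_const e" for e :: 'a
      by (rule fls_eqI) simp
    have geo: "fps_to_fls (1 - fps_const (inverse c) * fps_X) * fps_to_fls (geometric (inverse c)) = 1"
      unfolding fls_times_fps_to_fls[symmetric] geometric_mult by simp
    have dc: "fls_const (d / c) * fls_const c = fls_const d"
      using assms by (simp add: fls_const_mult_const)
    have regroup: "D * L * G * (- C * x * L') = - (D * C) * x * L * (L' * G)" for D L G C x L' :: "'a fls"
      by (simp add: mult_ac)
    have "fps_to_fls (mobius_series s d c) = fls_const (d / c)
        * fps_to_fls (1 - fps_const (inverse d) * fps_X) * fps_to_fls (geometric (inverse c))"
      using False by (simp only: mobius_series_def if_False fls_times_fps_to_fls const)
    then have "fps_to_fls (mobius_series s d c) * (1 - fls_const c * zinv s)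
        = - fls_const d * fls_X_inv * fps_to_fls (1 - fps_const (inverse d) * fps_X)"
      using False by (simp only: zinv_def if_False e[OF assms(1)] regroup dc geo mult_1_right)
    also have "\<dots> = 1 - fls_const d * zinv s" using False e[OF assms(2)] by (simp add: zinv_def)
    finally show ?thesis .
  qed
  then show ?thesis using fls_1_minus_nonzero[of c s] by (simp add: field_simps)
qed

lemma fls_const_inverse: "fls_const (inverse c) = inverse (fls_const (c :: 'k::field))"
  by (simp add: fls_inverse_const)

lemma fls_const_mult: "fls_const (c * d) = fls_const c * fls_const (d :: 'k::field)"
  by (simp add: fls_const_mult_const)

lemma fls_const_powi: "fls_const (c powi k) = fls_const (c :: 'k::field) powi k"
  by (simp add: power_int_def fls_const_power fls_const_inverse)

lemma row_factor_fls:
  assumes "q1 \<noteq> 0" "q3 \<noteq> 0" "W \<noteq> 0"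
  shows "row_factor (fls_const q1) (fls_const q3) (fls_const W * zinv s)
    = fps_to_fls (mobius_series s (q3 * W) W * mobius_series s (q2_of q1 q3 * W) (W / q1))"
proof -
  have e: "fls_const q3 * (fls_const W * zinv s) = fls_const (q3 * W) * zinv s"
    "q2_of (fls_const q1) (fls_const q3) * (fls_const W * zinv s) = fls_const (q2_of q1 q3 * W) * zinv s"
    "fls_const W * zinv s / fls_const q1 = fls_const (W / q1) * zinv s"
    by (simp_all only: fls_const_mult fls_const_inverse divide_inverse mult_ac)
  show ?thesis
    unfolding row_factor_def e fls_times_fps_to_fls
    using mobius_series_eq[of W "q3 * W" s] mobius_series_eq[of "W / q1" "q2_of q1 q3 * W" s] assms
    by (simp add: times_divide_times_eq[symmetric] del: times_divide_times_eq)
qed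

lemma tail_factor_fls:
  assumes "q1 \<noteq> 0" "q3 \<noteq> 0" "W \<noteq> 0"
  shows "tail_factor (fls_const q1) (fls_const q3) (fls_const W * zinv s)
    = fps_to_fls (mobius_series s (q2_of q1 q3 * W) W)"
proof -
  have e: "q2_of (fls_const q1) (fls_const q3) * (fls_const W * zinv s) = fls_const (q2_of q1 q3 * W) * zinv s"
    by (simp only: fls_const_mult fls_const_inverse mult_ac)
  show ?thesis
    unfolding tail_factor_def e using mobius_series_eq[of W "q2_of q1 q3 * W" s] assms by simp
qed

lemma fps_to_fls_prod: "fps_to_fls (\<Prod>i\<in>A. f i) = (\<Prod>i\<in>A. fps_to_fls (f i :: 'k::field fps))"
  by (induction A rule: infinite_finite_induct) (simp_all add: fls_times_fps_to_fls)

text \<open>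
  The eigenvalue as a product of explicit expansions; every \<open>T\<close> that bounds the number of rows
  gives the same series.
\<close>

definition psi_fps :: "bool \<Rightarrow> 'k::field \<Rightarrow> 'k \<Rightarrow> (nat \<Rightarrow> 'k) \<Rightarrow> nat \<Rightarrow> nat \<Rightarrow> ptuple \<Rightarrow> 'k fps" where
  "psi_fps s q1 q3 u n T lam =
    (\<Prod>i\<in>{1..n}. (\<Prod>t\<in>{1..T}. mobius_series s (q3 * box_weight q1 q3 u lam i t) (box_weight q1 q3 u lam i t)
        * mobius_series s (q2_of q1 q3 * box_weight q1 q3 u lam i t) (box_weight q1 q3 u lam i t / q1))
      * mobius_series s (q2_of q1 q3 * (q3 powi int T * u i)) (q3 powi int T * u i))"

lemma psi_series_rows:
  assumes q: "q1 \<noteq> 0" "q3 \<noteq> 0" and T: "bounded_by T lam"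
  shows "psi_series q1 q3 u n lam (zinv s) =
    (\<Prod>i\<in>{1..n}. (\<Prod>t\<in>{1..T}. row_factor (fls_const q1) (fls_const q3) (fls_const (box_weight q1 q3 u lam i t) * zinv s))
      * tail_factor (fls_const q1) (fls_const q3) (fls_const (q3 powi int T * u i) * zinv s))"
  unfolding psi_series_def
proof (rule prod.cong[OF refl])
  fix i assume "i \<in> {1..n}"
  let ?x = "fls_const (u i) * zinv s"
  have e1: "fls_const q3 powi int t * ?x = fls_const (q3 powi int t * u i) * zinv s" for t
    by (simp only: fls_const_mult fls_const_powi mult_ac)
  have e2: "q2_of (fls_const q1) (fls_const q3) * (fls_const c * zinv s) = fls_const (q2_of q1 q3 * c) * zinv s" for c
    by (simp only: fls_const_mult fls_const_inverse mult_ac)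
  have e3: "fls_const q1 powi int (lam i t) * fls_const q3 powi (int t - 1) * ?x = fls_const (box_weight q1 q3 u lam i t) * zinv s" for t
    by (simp only: box_weight_def fls_const_mult fls_const_powi mult_ac)
  have "psi (fls_const q1) (fls_const q3) (lam i) ?x
    = (\<Prod>t\<in>{1..T}. row_factor (fls_const q1) (fls_const q3) (fls_const q1 powi int (lam i t) * fls_const q3 powi (int t - 1) * ?x))
      * tail_factor (fls_const q1) (fls_const q3) (fls_const q3 powi int T * ?x)"
  proof (rule psi_eq_row_product)
    show "lam i t = 0" if "t > T" for t using that T by (simp add: bounded_by_def)
    show "1 - fls_const q3 powi int t * ?x \<noteq> 0 \<and> 1 - q2_of (fls_const q1) (fls_const q3) * (fls_const q3 powi int t * ?x) \<noteq> 0" for t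
      unfolding e1 e2 using fls_1_minus_nonzero by blast
  qed (use q in simp_all)
  then show "psi (fls_const q1) (fls_const q3) (lam i) ?x =
      (\<Prod>t\<in>{1..T}. row_factor (fls_const q1) (fls_const q3) (fls_const (box_weight q1 q3 u lam i t) * zinv s))
      * tail_factor (fls_const q1) (fls_const q3) (fls_const (q3 powi int T * u i) * zinv s)"
    unfolding e1 e3 .
qed

lemma psi_series_eq:
  assumes q: "q1 \<noteq> 0" "q3 \<noteq> 0" and u: "\<And>i. i \<in> {1..n} \<Longrightarrow> u i \<noteq> 0" and T: "bounded_by T lam"
  shows "psi_series q1 q3 u n lam (zinv s) = fps_to_fls (psi_fps s q1 q3 u n T lam)"
proof -
  have "box_weight q1 q3 u lam i t \<noteq> 0" "q3 powi int T * u i \<noteq> 0" if "i \<in> {1..n}" for i t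
    using q u[OF that] by (simp_all add: box_weight_def)
  then show ?thesis unfolding psi_series_rows[OF q T] psi_fps_def fps_to_fls_prod fls_times_fps_to_fls
    by (intro prod.cong arg_cong2[of _ _ _ _ "(*)"] refl)
      (simp_all add: row_factor_fls tail_factor_fls q fls_times_fps_to_fls)
qed

lemma mobius_series_nth_0: "fps_nth (mobius_series s d c) 0 = (if s then 1 else d / c)"
  by (simp add: mobius_series_def geometric_def)

lemma psi_fps_nth_0:
  assumes q: "q1 \<noteq> 0" "q3 \<noteq> 0" and u: "\<And>i. i \<in> {1..n} \<Longrightarrow> u i \<noteq> 0"
  shows "fps_nth (psi_fps s q1 q3 u n T lam) 0 \<noteq> 0"
proof -
  have 0: "fps_nth (\<Prod>i\<in>A. f i) 0 = (\<Prod>i\<in>A. fps_nth (f i) 0)" for A and f :: "nat \<Rightarrow> 'a fps"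
    by (induction A rule: infinite_finite_induct) simp_all
  have "box_weight q1 q3 u lam i t \<noteq> 0" if "i \<in> {1..n}" for i t
    using q u[OF that] by (simp add: box_weight_def)
  then show ?thesis using q u by (auto simp: psi_fps_def 0 mobius_series_nth_0)
qed

lemma psi_coeff_eq:
  assumes "q1 \<noteq> 0" "q3 \<noteq> 0" "\<And>i. i \<in> {1..n} \<Longrightarrow> u i \<noteq> 0" "bounded_by T lam"
  shows "psi_plus_coeff q1 q3 u n lam k = fps_nth (psi_fps True q1 q3 u n T lam) k"
    "psi_minus_coeff q1 q3 u n lam k = fps_nth (psi_fps False q1 q3 u n T lam) k"
  using psi_series_eq[where s = True, OF assms] psi_series_eq[where s = False, OF assms]
  by (simp_all add: psi_plus_coeff_def psi_minus_coeff_def zinv_def)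

context place
begin

text \<open>
  A place acts on power series coefficientwise; as the products above involve only ring operations and
  inverses of nonzero constants, it carries one eigenvalue series to the other.
\<close>

definition fps_rel :: "'a fps \<Rightarrow> 'b fps \<Rightarrow> bool" where
  "fps_rel f f' \<longleftrightarrow> (\<forall>k. R (fps_nth f k) (fps_nth f' k))"

lemma fps_rel_mult: "fps_rel f f' \<Longrightarrow> fps_rel h h' \<Longrightarrow> fps_rel (f * h) (f' * h')"
  unfolding fps_rel_def fps_mult_nth by (intro allI sum mult) auto

lemma fps_rel_const: "R c c' \<Longrightarrow> fps_rel (fps_const c) (fps_const c')"
  unfolding fps_rel_def using zero by (auto simp: fps_const_def)

lemma fps_rel_linear: "R c c' \<Longrightarrow> fps_rel (1 - fps_const c * fps_X) (1 - fps_const c' * fps_X)"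
  unfolding fps_rel_def using zero one minus[of c c'] by auto

lemma fps_rel_geometric: "R c c' \<Longrightarrow> fps_rel (geometric c) (geometric c')"
  unfolding fps_rel_def geometric_def by (auto intro: power)

lemma fps_rel_prod: "(\<And>i. i \<in> A \<Longrightarrow> fps_rel (f i) (f' i)) \<Longrightarrow> fps_rel (\<Prod>i\<in>A. f i) (\<Prod>i\<in>A. f' i)"
proof (induction A rule: infinite_finite_induct)
  case (insert x F)
  then show ?case by (simp add: fps_rel_mult)
qed (use one zero in \<open>auto simp: fps_rel_def\<close>)

lemma fps_rel_mobius:
  assumes "R d d'" "R c c'" "d' \<noteq> 0" "c' \<noteq> 0"
  shows "fps_rel (mobius_series s d c) (mobius_series s d' c')"
  unfolding mobius_series_def using assms
  by (auto intro!: fps_rel_mult fps_rel_const fps_rel_linear fps_rel_geometric divide inv)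

lemma fps_rel_psi:
  assumes "R q1 q1'" "R q3 q3'" "q1' \<noteq> 0" "q3' \<noteq> 0" "\<And>i. i \<in> {1..n} \<Longrightarrow> R (u i) (u' i) \<and> u' i \<noteq> 0"
  shows "fps_rel (psi_fps s q1 q3 u n T lam) (psi_fps s q1' q3' u' n T lam)"
proof -
  have nz: "box_weight q1' q3' u' lam i t \<noteq> 0" if "i \<in> {1..n}" for i t
    using assms that by (simp add: box_weight_def)
  show ?thesis unfolding psi_fps_def using assms nz
    by (intro fps_rel_prod fps_rel_mult fps_rel_mobius mult inv divide powi box_weight) auto
qed

end

context resonance
begin

definition eigenvalue :: "bool \<Rightarrow> ptuple \<Rightarrow> nat \<Rightarrow> complex" where
  "eigenvalue s lam k = (if s then psi_plus_coeff q1 q3 us n lam k else psi_minus_coeff q1 q3 us n lam k)"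

lemma us_nz: "i \<in> {1..n} \<Longrightarrow> us i \<noteq> 0"
  using u_nz q1_nz q3_nz by (simp add: us_eq)

lemma eigenvalue_eq: "bounded_by T lam \<Longrightarrow> eigenvalue s lam k = fps_nth (psi_fps s q1 q3 us n T lam) k"
  using psi_coeff_eq[OF q1_nz q3_nz us_nz] by (simp add: eigenvalue_def)

lemma spec_psi_coeff:
  assumes "bounded_by T lam"
  shows "spec (psi_plus_coeff gen_q1 gen_q3 gen_u n lam k) (eigenvalue True lam k)"
    "spec (psi_minus_coeff gen_q1 gen_q3 gen_u n lam k) (eigenvalue False lam k)"
  using spec.fps_rel_psi[where u = gen_u and u' = us, OF spec_q1 spec_q3 q1_nz q3_nz, of n] spec_u us_nz
  by (simp_all add: psi_coeff_eq[OF ratfun_var_nz ratfun_var_nz ratfun_var_nz assms] eigenvalue_eq[OF assms] spec.fps_rel_def)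

lemma eigenvalue_0_nz:
  assumes "lam \<in> B" shows "eigenvalue s lam 0 \<noteq> 0"
proof -
  obtain T where T: "bounded_by T lam" using B_bounded[OF assms] by blast
  show ?thesis unfolding eigenvalue_eq[OF T] using us_nz by (intro psi_fps_nth_0 q1_nz q3_nz)
qed

lemma entry_psi:
  assumes "lam \<in> B"
  shows "entry mu (Gen_psip k) lam = (if mu = lam then eigenvalue True lam k else 0)"
    "entry mu (Gen_psim k) lam = (if mu = lam then eigenvalue False lam k else 0)"
    "entry mu Gen_psip0_inv lam = (if mu = lam then inverse (eigenvalue True lam 0) else 0)"
    "entry mu Gen_psim0_inv lam = (if mu = lam then inverse (eigenvalue False lam 0) else 0)"
proof -
  obtain T where T: "bounded_by T lam" using B_bounded[OF assms] by blast
  note S = spec_psi_coeff[OF T] and nz = eigenvalue_0_nz[OF assms]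
  show "entry mu (Gen_psip k) lam = (if mu = lam then eigenvalue True lam k else 0)"
    unfolding entry_def
    by (rule spec_coefficient(1), unfold generic_coeff_def tensor_coeff.simps) (cases "mu = lam"; use S(1) spec.zero in simp)
  show "entry mu (Gen_psim k) lam = (if mu = lam then eigenvalue False lam k else 0)"
    unfolding entry_def
    by (rule spec_coefficient(1), unfold generic_coeff_def tensor_coeff.simps) (cases "mu = lam"; use S(2) spec.zero in simp)
  show "entry mu Gen_psip0_inv lam = (if mu = lam then inverse (eigenvalue True lam 0) else 0)"
    unfolding entry_def
    by (rule spec_coefficient(1), unfold generic_coeff_def tensor_coeff.simps)
      (cases "mu = lam"; use spec.inv[OF S(1) nz] spec.zero in simp)
  show "entry mu Gen_psim0_inv lam = (if mu = lam then inverse (eigenvalue False lam 0) else 0)"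
    unfolding entry_def
    by (rule spec_coefficient(1), unfold generic_coeff_def tensor_coeff.simps)
      (cases "mu = lam"; use spec.inv[OF S(2) nz] spec.zero in simp)
qed

lemma all_coefficients_regular:
  assumes "mu \<in> B" "lam \<in> B"
  shows "regular_at ratfun_const (first_point a b) (generic_coeff n mu x lam)"
    "regular_at (\<lambda>c. c) (second_point q1 q3 u) (M_coeff n a b mu x lam)"
proof -
  obtain T where T: "bounded_by T lam" using B_bounded[OF assms(2)] by blast
  note S = spec_psi_coeff[OF T] and nz = eigenvalue_0_nz[OF assms(2)]
  have "\<exists>y. spec (generic_coeff n mu x lam) y"
  proof (cases x)
    case (Gen_e k)
    show ?thesis
    proof (cases "\<exists>r\<in>rows. mu = plus_box lam r")
      case True
      then obtain r where r: "r \<in> rows" "mu = plus_box lam r" by blast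
      obtain T where "bounded_by T lam" "snd r \<le> T" using ex_bound[OF assms(2)] by blast
      then show ?thesis using spec_e_edge[OF assms(2) _ r(1), of T k] assms(1) unfolding Gen_e r(2) by blast
    next
      case False
      then show ?thesis using generic_e_eq_0[of mu lam k] spec.zero unfolding Gen_e by metis
    qed
  next
    case (Gen_f k)
    show ?thesis
    proof (cases "\<exists>r\<in>rows. lam = plus_box mu r")
      case True
      then obtain r where r: "r \<in> rows" "lam = plus_box mu r" by blast
      obtain T where "bounded_by T mu" "snd r \<le> T" using ex_bound[OF assms(1)] by blast
      then show ?thesis using spec_f_edge[OF assms(1) _ r(1), of T k] assms(2) unfolding Gen_f r(2) by blast
    next
      case False
      then show ?thesis using generic_f_eq_0[of lam mu k] spec.zero unfolding Gen_f by metis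
    qed
  next
    case (Gen_psip k)
    have "generic_coeff n mu (Gen_psip k) lam = (if mu = lam then psi_plus_coeff gen_q1 gen_q3 gen_u n lam k else 0)"
      by (simp add: generic_coeff_def)
    then show ?thesis using S(1)[of k] spec.zero unfolding Gen_psip by (cases "mu = lam") auto
  next
    case (Gen_psim k)
    have "generic_coeff n mu (Gen_psim k) lam = (if mu = lam then psi_minus_coeff gen_q1 gen_q3 gen_u n lam k else 0)"
      by (simp add: generic_coeff_def)
    then show ?thesis using S(2)[of k] spec.zero unfolding Gen_psim by (cases "mu = lam") auto
  next
    case Gen_psip0_inv
    have "generic_coeff n mu Gen_psip0_inv lam = (if mu = lam then inverse (psi_plus_coeff gen_q1 gen_q3 gen_u n lam 0) else 0)"
      by (simp add: generic_coeff_def)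
    then show ?thesis using spec.inv[OF S(1) nz] spec.zero unfolding Gen_psip0_inv by (cases "mu = lam") auto
  next
    case Gen_psim0_inv
    have "generic_coeff n mu Gen_psim0_inv lam = (if mu = lam then inverse (psi_minus_coeff gen_q1 gen_q3 gen_u n lam 0) else 0)"
      by (simp add: generic_coeff_def)
    then show ?thesis using spec.inv[OF S(2) nz] spec.zero unfolding Gen_psim0_inv by (cases "mu = lam") auto
  qed
  then show "regular_at ratfun_const (first_point a b) (generic_coeff n mu x lam)"
    "regular_at (\<lambda>c. c) (second_point q1 q3 u) (M_coeff n a b mu x lam)"
    using spec_coefficient(2,3) by blast+
qed

end

section \<open>Partial fractions\<close>

lemma prod_linear_poly:
  fixes \<alpha> :: "'i \<Rightarrow> 'k::field"
  assumes "finite I"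
  shows "degree (\<Prod>i\<in>I. [:1, - \<alpha> i:]) \<le> card I \<and> coeff (\<Prod>i\<in>I. [:1, - \<alpha> i:]) (card I) = (\<Prod>i\<in>I. - \<alpha> i)"
  using assms
proof (induction I)
  case (insert x F)
  let ?P = "\<Prod>i\<in>F. [:1, - \<alpha> i:]"
  have eq: "(\<Prod>i\<in>insert x F. [:1, - \<alpha> i:]) = ?P + pCons 0 (smult (- \<alpha> x) ?P)"
    using insert by (simp add: mult_pCons_left)
  have "degree (pCons 0 (smult (- \<alpha> x) ?P)) \<le> Suc (card F)"
    by (rule order_trans[OF degree_pCons_le]) (use insert.IH degree_smult_le[of "- \<alpha> x" ?P] in linarith)
  moreover have "degree ?P \<le> Suc (card F)" using insert.IH by simp
  ultimately have d: "degree (\<Prod>i\<in>insert x F. [:1, - \<alpha> i:]) \<le> Suc (card F)"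
    unfolding eq by (rule degree_add_le[rotated])
  have "coeff ?P (Suc (card F)) = 0" using insert.IH by (intro coeff_eq_0) simp
  then have c: "coeff (\<Prod>i\<in>insert x F. [:1, - \<alpha> i:]) (Suc (card F)) = (\<Prod>i\<in>insert x F. - \<alpha> i)"
    unfolding eq using insert by simp
  show ?case using c d insert by simp
qed simp

text \<open>
  After clearing denominators, the difference of the two sides is a polynomial \<open>Q\<close> of degree
  less than the number of poles (the constant term is chosen to cancel the leading coefficient) which
  vanishes at all of them.
\<close>

lemma partial_fractions:
  fixes \<alpha> :: "'i \<Rightarrow> 'k::field" and \<pi> :: "'j \<Rightarrow> 'k"
  assumes fin: "finite I" "finite J" and card: "card I = card J"
    and inj: "inj_on \<pi> J" and nz: "\<And>j. j \<in> J \<Longrightarrow> \<pi> j \<noteq> 0"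
    and x: "\<And>j. j \<in> J \<Longrightarrow> 1 - \<pi> j * x \<noteq> 0"
  shows "(\<Prod>i\<in>I. 1 - \<alpha> i * x) / (\<Prod>j\<in>J. 1 - \<pi> j * x) = (\<Prod>i\<in>I. \<alpha> i) / (\<Prod>j\<in>J. \<pi> j)
    + (\<Sum>j\<in>J. (\<Prod>i\<in>I. 1 - \<alpha> i / \<pi> j) / (\<Prod>j'\<in>J - {j}. 1 - \<pi> j' / \<pi> j) / (1 - \<pi> j * x))"
proof -
  define N where "N = card J"
  define c0 where "c0 = (\<Prod>i\<in>I. \<alpha> i) / (\<Prod>j\<in>J. \<pi> j)"
  define c where "c j = (\<Prod>i\<in>I. 1 - \<alpha> i / \<pi> j) / (\<Prod>j'\<in>J - {j}. 1 - \<pi> j' / \<pi> j)" for j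
  define D where "D S = (\<Prod>j\<in>S. [:1, - \<pi> j:])" for S
  define Q where "Q = (\<Prod>i\<in>I. [:1, - \<alpha> i:]) - smult c0 (D J) - (\<Sum>j\<in>J. smult (c j) (D (J - {j})))"
  have poly_D: "poly (D S) y = (\<Prod>j\<in>S. 1 - \<pi> j * y)" for S y
    by (simp add: D_def poly_prod mult.commute)
  have degD: "degree (D (J - {j})) < N" if "j \<in> J" for j
  proof -
    have "degree (D (J - {j})) \<le> card (J - {j})" using prod_linear_poly[of "J - {j}" \<pi>] fin by (simp add: D_def)
    also have "card (J - {j}) < card J" using that fin by (intro psubset_card_mono) auto
    finally show ?thesis by (simp add: N_def)
  qed
  have "degree (smult (c j) (D (J - {j}))) \<le> N" if "j \<in> J" for j
    using degD[OF that] degree_smult_le[of "c j" "D (J - {j})"] by linarith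
  then have sum1: "degree (\<Sum>j\<in>J. smult (c j) (D (J - {j}))) \<le> N"
    by (rule degree_sum_le[OF fin(2)])
  have sum2: "coeff (\<Sum>j\<in>J. smult (c j) (D (J - {j}))) N = 0"
    unfolding coeff_sum using degD by (intro sum.neutral ballI) (simp add: coeff_eq_0)
  have prodJ: "(\<Prod>j\<in>J. \<pi> j) \<noteq> 0" using nz fin by simp
  have sgn: "(\<Prod>i\<in>I. - \<alpha> i) = (-1) ^ N * (\<Prod>i\<in>I. \<alpha> i)" "(\<Prod>j\<in>J. - \<pi> j) = (-1) ^ N * (\<Prod>j\<in>J. \<pi> j)"
    using card by (simp_all add: prod_uminus N_def)
  have lead: "coeff (\<Prod>i\<in>I. [:1, - \<alpha> i:]) N = (\<Prod>i\<in>I. - \<alpha> i)" "coeff (D J) N = (\<Prod>j\<in>J. - \<pi> j)"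
    "degree (\<Prod>i\<in>I. [:1, - \<alpha> i:]) \<le> N" "degree (D J) \<le> N"
    using prod_linear_poly[OF fin(1), of \<alpha>] prod_linear_poly[OF fin(2), of \<pi>] card by (simp_all add: D_def N_def)
  \<comment> \<open>the choice of \<open>c0\<close> makes the degree drop below the number of roots\<close>
  have "coeff Q N = 0" unfolding Q_def using sum2 lead(1,2) prodJ by (simp add: sgn c0_def)
  moreover have "degree Q \<le> N" unfolding Q_def
    by (intro degree_diff_le lead sum1 order_trans[OF degree_smult_le])
  ultimately have small: "Q = 0 \<or> degree Q < N" using eq_zero_or_degree_less by blast
  have root: "poly Q (inverse (\<pi> j)) = 0" if j: "j \<in> J" for j
  proof -
    have e: "1 - a * inverse (\<pi> j) = 1 - a / \<pi> j" for a by (simp add: divide_inverse)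
    have "poly (D S) (inverse (\<pi> j)) = 0" if "j \<in> S" "finite S" for S
      unfolding poly_D using that nz[OF j] by (intro prod_zero) (auto intro!: bexI[of _ j])
    then have "(\<Sum>k\<in>J. c k * poly (D (J - {k})) (inverse (\<pi> j))) = (\<Sum>k\<in>J. if k = j then c j * poly (D (J - {j})) (inverse (\<pi> j)) else 0)"
      using j fin by (intro sum.cong) auto
    also have "\<dots> = c j * poly (D (J - {j})) (inverse (\<pi> j))" using fin j by simp
    also have "\<dots> = (\<Prod>i\<in>I. 1 - \<alpha> i / \<pi> j)"
    proof -
      have "(\<Prod>j'\<in>J - {j}. 1 - \<pi> j' / \<pi> j) \<noteq> 0"
        using fin nz[OF j] inj j by (auto simp: inj_on_def)
      then show ?thesis unfolding poly_D e c_def by simp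
    qed
    finally show ?thesis using \<open>\<And>S. j \<in> S \<Longrightarrow> finite S \<Longrightarrow> poly (D S) (inverse (\<pi> j)) = 0\<close>[OF j fin(2)]
      by (simp add: Q_def poly_sum poly_prod e mult.commute[of "inverse (\<pi> j)"])
  qed
  have "Q = 0"
  proof (rule ccontr)
    assume Q: "Q \<noteq> 0"
    have "card ((\<lambda>j. inverse (\<pi> j)) ` J) = N"
      unfolding N_def using inj by (intro card_image) (auto simp: inj_on_def)
    moreover have "card ((\<lambda>j. inverse (\<pi> j)) ` J) \<le> card {y. poly Q y = 0}"
      using root by (intro card_mono poly_roots_finite[OF Q]) auto
    moreover have "card {y. poly Q y = 0} \<le> degree Q" using Q by (rule card_poly_roots_bound)
    ultimately show False using small Q by simp
  qed
  then have "poly Q x = 0" by simp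
  then have "poly (\<Prod>i\<in>I. [:1, - \<alpha> i:]) x = c0 * poly (D J) x + (\<Sum>j\<in>J. c j * poly (D (J - {j})) x)"
    by (simp only: Q_def poly_diff poly_smult poly_sum diff_diff_eq eq_iff_diff_eq_0[symmetric])
      (simp add: poly_sum)
  then have main: "(\<Prod>i\<in>I. 1 - \<alpha> i * x) = c0 * (\<Prod>j\<in>J. 1 - \<pi> j * x) + (\<Sum>j\<in>J. c j * (\<Prod>j'\<in>J - {j}. 1 - \<pi> j' * x))"
    by (simp add: poly_D poly_prod mult.commute)
  have Px: "(\<Prod>j\<in>J. 1 - \<pi> j * x) \<noteq> 0" using fin x by simp
  have "c j * (\<Prod>j'\<in>J - {j}. 1 - \<pi> j' * x) / (\<Prod>j\<in>J. 1 - \<pi> j * x) = c j / (1 - \<pi> j * x)" if "j \<in> J" for j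
  proof -
    have "(\<Prod>j'\<in>J - {j}. 1 - \<pi> j' * x) \<noteq> 0" using fin x by auto
    then show ?thesis unfolding prod.remove[OF fin(2) that] by simp
  qed
  then have "(\<Prod>i\<in>I. 1 - \<alpha> i * x) / (\<Prod>j\<in>J. 1 - \<pi> j * x) = c0 + (\<Sum>j\<in>J. c j / (1 - \<pi> j * x))"
    unfolding main add_divide_distrib sum_divide_distrib using Px by simp
  then show ?thesis unfolding c0_def c_def .
qed

definition series_coeff :: "bool \<Rightarrow> 'k::field fls \<Rightarrow> int \<Rightarrow> 'k" where
  "series_coeff s F i = fls_nth F (if s then i else - i)"

lemma series_coeff_add: "series_coeff s (F + H) i = series_coeff s F i + series_coeff s H i"
  and series_coeff_diff: "series_coeff s (F - H) i = series_coeff s F i - series_coeff s H i"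
  and series_coeff_uminus: "series_coeff s (- F) i = - series_coeff s F i"
  and series_coeff_const_mult: "series_coeff s (fls_const c * F) i = c * series_coeff s F i"
  and series_coeff_const: "series_coeff s (fls_const c) i = (if i = 0 then c else 0)"
  by (simp_all add: series_coeff_def fls_mult_const_nth)

lemma series_coeff_sum: "series_coeff s (\<Sum>j\<in>J. F j) i = (\<Sum>j\<in>J. series_coeff s (F j) i)"
  by (induction J rule: infinite_finite_induct) (simp_all add: series_coeff_add, simp_all add: series_coeff_def)

lemma series_coeff_shift: "series_coeff s (inverse (zinv s) * F) i = series_coeff s F (i + 1)"
proof (cases s)
  case True
  then show ?thesis
    by (simp add: series_coeff_def zinv_def fls_inverse_X fls_X_inv_times_conv_shift)
next
  case False
  then show ?thesis
    by (simp add: series_coeff_def zinv_def fls_inverse_X_inv fls_X_times_conv_shift)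
qed

text \<open>
  A simple pole is where the two expansions differ, and they differ by a delta function.
\<close>

lemma delta_expansion:
  fixes c :: "'k::field"
  assumes c: "c \<noteq> 0"
  shows "series_coeff True (1 / (1 - fls_const c * zinv True)) k
    - series_coeff False (1 / (1 - fls_const c * zinv False)) k = c powi k"
proof -
  have lin: "fps_to_fls (1 - fps_const e * fps_X) = 1 - fls_const e * fls_X" for e :: 'k
    by (simp add: fls_times_fps_to_fls)
  have geo: "(1 - fls_const e * fls_X) * fps_to_fls (geometric e) = 1" for e :: 'k
    unfolding lin[symmetric] fls_times_fps_to_fls[symmetric] geometric_mult by simp
  have "1 - fls_const c * fls_X \<noteq> 0" using fls_1_minus_nonzero[of c True] by (simp add: zinv_def)
  then have P: "1 / (1 - fls_const c * zinv True) = fps_to_fls (geometric c)"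
    using geo[of c] by (simp add: zinv_def field_simps)
  have X: "fls_X * fls_X_inv = (1 :: 'k fls)"
    unfolding fls_inverse_X[symmetric] by (rule right_inverse) simp
  have cc: "fls_const c * fls_const (inverse c) = 1" using c by (simp add: fls_const_mult_const)
  have regroup: "(1 - C * x') * (- (C' * x)) = (C * C') * (x * x') - C' * x" for C C' x x' :: "'k fls"
    by (simp add: algebra_simps)
  have "(1 - fls_const c * fls_X_inv) * (- (fls_const (inverse c) * fls_X))
      = (fls_const c * fls_const (inverse c)) * (fls_X * fls_X_inv) - fls_const (inverse c) * fls_X"
    by (rule regroup)
  then have "(1 - fls_const c * fls_X_inv) * (- (fls_const (inverse c) * fls_X)) = 1 - fls_const (inverse c) * fls_X"
    unfolding cc X by simp
  then have "(1 - fls_const c * fls_X_inv) * (- (fls_const (inverse c) * fls_X) * fps_to_fls (geometric (inverse c))) = 1"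
    using geo[of "inverse c"] by (simp only: mult.assoc[symmetric])
  moreover have "1 - fls_const c * fls_X_inv \<noteq> 0" using fls_1_minus_nonzero[of c False] by (simp add: zinv_def)
  ultimately have M: "1 / (1 - fls_const c * zinv False) = - (fls_const (inverse c) * (fls_X * fps_to_fls (geometric (inverse c))))"
    by (simp add: zinv_def field_simps)
  have 1: "series_coeff True (1 / (1 - fls_const c * zinv True)) k = (if k \<ge> 0 then c powi k else 0)"
    unfolding P by (simp add: series_coeff_def geometric_def power_int_def)
  have 2: "series_coeff False (1 / (1 - fls_const c * zinv False)) k = (if k < 0 then - (c powi k) else 0)"
  proof (cases "k < 0")
    case True
    then have "nat (- k) = Suc (nat (- k - 1))" by simp
    then have "inverse c ^ nat (- k) = inverse c * inverse c ^ nat (- k - 1)" by (metis power_Suc)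
    then show ?thesis unfolding M series_coeff_uminus series_coeff_const_mult using True
      by (simp add: series_coeff_def fls_X_times_conv_shift geometric_def power_int_def)
  next
    case False
    then show ?thesis unfolding M series_coeff_uminus series_coeff_const_mult
      by (simp add: series_coeff_def fls_X_times_conv_shift)
  qed
  show ?thesis unfolding 1 2 by simp
qed

lemma fls_const_prod: "fls_const (\<Prod>i\<in>A. f i) = (\<Prod>i\<in>A. fls_const (f i :: 'k::field))"
  by (induction A rule: infinite_finite_induct) (simp_all add: fls_const_mult)

lemma fls_const_divide: "fls_const (c / d) = fls_const (c :: 'k::field) / fls_const d"
  by (simp add: divide_inverse fls_const_mult fls_const_inverse)

lemma fls_const_diff: "fls_const (c - d) = fls_const (c :: 'k::field) - fls_const d"
  by (rule fls_eqI) simp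

text \<open>
  The sum of residues: in the difference of the two expansions the constant of the partial fraction
  decomposition drops out.
\<close>

lemma series_difference:
  fixes \<alpha> :: "'i \<Rightarrow> 'k::field" and \<pi> :: "'j \<Rightarrow> 'k"
  assumes fin: "finite I" "finite J" and card: "card I = card J"
    and inj: "inj_on \<pi> J" and nz: "\<And>j. j \<in> J \<Longrightarrow> \<pi> j \<noteq> 0"
  defines "F \<equiv> \<lambda>s. (\<Prod>i\<in>I. 1 - fls_const (\<alpha> i) * zinv s) / (\<Prod>j\<in>J. 1 - fls_const (\<pi> j) * zinv s)"
  shows "series_coeff True (F True) k - series_coeff False (F False) k
    = (\<Sum>j\<in>J. (\<Prod>i\<in>I. 1 - \<alpha> i / \<pi> j) / (\<Prod>j'\<in>J - {j}. 1 - \<pi> j' / \<pi> j) * \<pi> j powi k)"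
proof -
  define c0 where "c0 = (\<Prod>i\<in>I. \<alpha> i) / (\<Prod>j\<in>J. \<pi> j)"
  define c where "c j = (\<Prod>i\<in>I. 1 - \<alpha> i / \<pi> j) / (\<Prod>j'\<in>J - {j}. 1 - \<pi> j' / \<pi> j)" for j
  have F: "F s = fls_const c0 + (\<Sum>j\<in>J. fls_const (c j) * (1 / (1 - fls_const (\<pi> j) * zinv s)))" for s
  proof -
    have inj': "inj_on (\<lambda>j. fls_const (\<pi> j)) J"
    proof (rule inj_onI)
      fix x y assume xy: "x \<in> J" "y \<in> J" "fls_const (\<pi> x) = fls_const (\<pi> y)"
      then have "\<pi> x = \<pi> y" by (metis fls_const_nth)
      then show "x = y" using inj xy by (simp add: inj_on_def)
    qed
    have "F s = (\<Prod>i\<in>I. fls_const (\<alpha> i)) / (\<Prod>j\<in>J. fls_const (\<pi> j))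
      + (\<Sum>j\<in>J. (\<Prod>i\<in>I. 1 - fls_const (\<alpha> i) / fls_const (\<pi> j)) / (\<Prod>j'\<in>J - {j}. 1 - fls_const (\<pi> j') / fls_const (\<pi> j))
          / (1 - fls_const (\<pi> j) * zinv s))"
      unfolding F_def using nz by (intro partial_fractions fin card inj' fls_1_minus_nonzero) simp
    moreover have "fls_const c0 = (\<Prod>i\<in>I. fls_const (\<alpha> i)) / (\<Prod>j\<in>J. fls_const (\<pi> j))"
      by (simp add: c0_def fls_const_divide fls_const_prod)
    moreover have "fls_const (c j) = (\<Prod>i\<in>I. 1 - fls_const (\<alpha> i) / fls_const (\<pi> j)) / (\<Prod>j'\<in>J - {j}. 1 - fls_const (\<pi> j') / fls_const (\<pi> j))" for j
      by (simp add: c_def fls_const_divide fls_const_prod fls_const_diff)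
    ultimately show ?thesis by simp
  qed
  have "series_coeff True (F True) k - series_coeff False (F False) k
    = (\<Sum>j\<in>J. c j * (series_coeff True (1 / (1 - fls_const (\<pi> j) * zinv True)) k
        - series_coeff False (1 / (1 - fls_const (\<pi> j) * zinv False)) k))"
    unfolding F series_coeff_add series_coeff_sum series_coeff_const_mult series_coeff_const
    by (simp add: sum_subtractf right_diff_distrib)
  also have "\<dots> = (\<Sum>j\<in>J. c j * \<pi> j powi k)"
    using delta_expansion[OF nz] by (intro sum.cong) auto
  finally show ?thesis unfolding c_def .
qed

text \<open>
  Used to cancel the common points of zeros and poles from a product indexed by rows.
\<close>

lemma prod_split_image:
  fixes h :: "'k \<Rightarrow> 'b::comm_monoid_mult"
  assumes "finite X" "inj_on \<phi> X" "I0 \<subseteq> \<phi> ` X"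
  shows "(\<Prod>\<rho>\<in>X. h (\<phi> \<rho>)) = (\<Prod>\<rho>\<in>{\<rho>\<in>X. \<phi> \<rho> \<notin> I0}. h (\<phi> \<rho>)) * (\<Prod>c\<in>I0. h c)"
    "card X = card {\<rho>\<in>X. \<phi> \<rho> \<notin> I0} + card I0"
proof -
  have X: "X = {\<rho>\<in>X. \<phi> \<rho> \<notin> I0} \<union> {\<rho>\<in>X. \<phi> \<rho> \<in> I0}" by auto
  have inj: "inj_on \<phi> {\<rho>\<in>X. \<phi> \<rho> \<in> I0}" using assms(2) by (rule inj_on_subset) auto
  have img: "\<phi> ` {\<rho>\<in>X. \<phi> \<rho> \<in> I0} = I0" using assms(3) by auto
  have p: "(\<Prod>\<rho>\<in>{\<rho>\<in>X. \<phi> \<rho> \<in> I0}. h (\<phi> \<rho>)) = (\<Prod>c\<in>I0. h c)"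
    using prod.reindex[OF inj, of h] unfolding img by simp
  have c: "card {\<rho>\<in>X. \<phi> \<rho> \<in> I0} = card I0" using card_image[OF inj] unfolding img by simp
  show "(\<Prod>\<rho>\<in>X. h (\<phi> \<rho>)) = (\<Prod>\<rho>\<in>{\<rho>\<in>X. \<phi> \<rho> \<notin> I0}. h (\<phi> \<rho>)) * (\<Prod>c\<in>I0. h c)"
    unfolding p[symmetric] using assms(1) by (subst X, intro prod.union_disjoint) auto
  show "card X = card {\<rho>\<in>X. \<phi> \<rho> \<notin> I0} + card I0"
    unfolding c[symmetric] using assms(1) by (subst X, intro card_Un_disjoint) auto
qed

context resonance
begin

definition row_set :: "nat \<Rightarrow> (nat \<times> nat) set" where "row_set T = {1..n} \<times> {1..T}"

lemma finite_row_set [simp]: "finite (row_set T)" by (simp add: row_set_def)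

definition psi_ser :: "bool \<Rightarrow> ptuple \<Rightarrow> complex fls" where
  "psi_ser s lam = psi_series q1 q3 us n lam (zinv s)"

text \<open>
  Coefficient of \<open>z^(-i)\<close> in \<open>\<psi>\<^sup>+\<close> or \<open>\<psi>\<^sup>-\<close>,
  for any integer \<open>i\<close>; working with Laurent series makes both series bi-infinite families
  without case distinctions.
\<close>

definition psi_mode :: "bool \<Rightarrow> ptuple \<Rightarrow> int \<Rightarrow> complex" where
  "psi_mode s lam i = series_coeff s (psi_ser s lam) i"

lemma psi_mode_eq:
  assumes "lam \<in> B"
  shows "psi_mode True lam i = (if i \<ge> 0 then eigenvalue True lam (nat i) else 0)"
    "psi_mode False lam i = (if i \<le> 0 then eigenvalue False lam (nat (- i)) else 0)"
proof -
  obtain T where T: "bounded_by T lam" using B_bounded[OF assms] by blast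
  have e: "psi_ser s lam = fps_to_fls (psi_fps s q1 q3 us n T lam)" for s
    unfolding psi_ser_def using us_nz by (intro psi_series_eq q1_nz q3_nz T)
  show "psi_mode True lam i = (if i \<ge> 0 then eigenvalue True lam (nat i) else 0)"
    "psi_mode False lam i = (if i \<le> 0 then eigenvalue False lam (nat (- i)) else 0)"
    unfolding psi_mode_def e series_coeff_def eigenvalue_eq[OF T] by simp_all
qed

lemma in_row_set: "r \<in> row_set T \<longleftrightarrow> r \<in> rows \<and> snd r \<le> T"
  by (cases r) (auto simp: row_set_def rows_def)

lemma psi_ser_rows:
  assumes T: "bounded_by T lam"
  shows "psi_ser s lam = (\<Prod>\<rho>\<in>row_set T. row_factor (fls_const q1) (fls_const q3) (fls_const (wt lam \<rho>) * zinv s))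
    * (\<Prod>j\<in>{1..n}. tail_factor (fls_const q1) (fls_const q3) (fls_const (q3 powi int T * us j) * zinv s))"
  unfolding psi_ser_def psi_series_rows[OF q1_nz q3_nz T] prod.distrib prod.cartesian_product row_set_def
  by (simp add: wt_def case_prod_beta)

text \<open>
  Only one factor changes, by the shift rule; here the point \<open>z\<close> is the series variable, so
  nothing can vanish.
\<close>

lemma psi_ser_plus_box:
  fixes s :: bool and lam :: ptuple
  assumes r: "r \<in> rows"
  defines "z \<equiv> inverse (zinv s)" and "v \<equiv> fls_const (wt lam r)"
  assumes T: "bounded_by T0 lam"
  shows "psi_ser s (plus_box lam r) * g_poly (fls_const q1) (fls_const q2) (fls_const q3) z v
    = - g_poly (fls_const q1) (fls_const q2) (fls_const q3) v z * psi_ser s lam"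
proof -
  define T where "T = T0 + snd r"
  have bd: "bounded_by T lam" "bounded_by T (plus_box lam r)"
    using bounded_by_mono[OF T, of T] by (simp_all add: T_def bounded_by_plus_box)
  have rT: "r \<in> row_set T" "finite (row_set T)" using r by (auto simp: in_row_set T_def)
  let ?f = "\<lambda>c. row_factor (fls_const q1) (fls_const q3) (fls_const c * zinv s)"
  define K where "K = (\<Prod>\<rho>\<in>row_set T - {r}. ?f (wt lam \<rho>))
    * (\<Prod>j\<in>{1..n}. tail_factor (fls_const q1) (fls_const q3) (fls_const (q3 powi int T * us j) * zinv s))"
  have 1: "psi_ser s lam = ?f (wt lam r) * K"
    unfolding psi_ser_rows[OF bd(1)] prod.remove[OF rT(2,1)] K_def by (simp only: mult.assoc)
  have rest: "(\<Prod>\<rho>\<in>row_set T - {r}. ?f (wt (plus_box lam r) \<rho>)) = (\<Prod>\<rho>\<in>row_set T - {r}. ?f (wt lam \<rho>))"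
    by (intro prod.cong) (auto simp: wt_plus_box)
  have wr: "wt (plus_box lam r) r = q1 * wt lam r" by (simp add: wt_plus_box)
  have 2: "psi_ser s (plus_box lam r) = ?f (q1 * wt lam r) * K"
    unfolding psi_ser_rows[OF bd(2)] prod.remove[OF rT(2,1)] rest wr K_def by (simp only: mult.assoc)
  have zi: "zinv s \<noteq> (0 :: complex fls)" by (simp add: zinv_def)
  have z: "z \<noteq> 0" "fls_const c / z = fls_const c * zinv s" for c using zi by (simp_all add: z_def divide_inverse)
  have ne: "fls_const c \<noteq> z" for c
  proof
    assume "fls_const c = z"
    then have "fls_const c * zinv s = 1" using zi by (simp add: z_def)
    then show False using fls_1_minus_nonzero[of c s] by simp
  qed
  have qq: "fls_const q1 * fls_const q2 * fls_const q3 = 1" using q_prod by simp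
  have nq: "v \<noteq> fls_const q1 * z"
  proof
    assume "v = fls_const q1 * z"
    then have "fls_const (inverse q1) * v = (fls_const (inverse q1) * fls_const q1) * z" by (simp only: mult.assoc)
    also have "fls_const (inverse q1) * fls_const q1 = 1" using q1_nz by simp
    finally show False using ne[of "inverse q1 * wt lam r"] by (simp add: v_def)
  qed
  have "row_factor (fls_const q1) (fls_const q3) (fls_const q1 * v / z) * g_poly (fls_const q1) (fls_const q2) (fls_const q3) z v
      = - g_poly (fls_const q1) (fls_const q2) (fls_const q3) v z * row_factor (fls_const q1) (fls_const q3) (v / z)"
    using ne[of "wt lam r"] ne[of "q1 * wt lam r"] nq
    by (intro row_factor_shift qq z(1)) (simp_all add: v_def)
  then have sh: "?f (q1 * wt lam r) * g_poly (fls_const q1) (fls_const q2) (fls_const q3) z v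
      = - g_poly (fls_const q1) (fls_const q2) (fls_const q3) v z * ?f (wt lam r)"
    unfolding v_def fls_const_mult[symmetric] z(2) .
  have "?f (q1 * wt lam r) * K * g_poly (fls_const q1) (fls_const q2) (fls_const q3) z v
      = (?f (q1 * wt lam r) * g_poly (fls_const q1) (fls_const q2) (fls_const q3) z v) * K"
    by (simp only: mult_ac)
  also have "\<dots> = - g_poly (fls_const q1) (fls_const q2) (fls_const q3) v z * (?f (wt lam r) * K)"
    unfolding sh by (simp only: mult.assoc)
  finally show ?thesis unfolding 1 2 .
qed

text \<open>
  Multiplication of a series by \<open>z - q v\<close> and by \<open>v - q z\<close>, on coefficients.
\<close>

definition z_minus :: "complex \<Rightarrow> complex \<Rightarrow> (int \<Rightarrow> complex) \<Rightarrow> int \<Rightarrow> complex" where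
  "z_minus v q P = (\<lambda>i. P (i + 1) - q * v * P i)"
definition v_minus :: "complex \<Rightarrow> complex \<Rightarrow> (int \<Rightarrow> complex) \<Rightarrow> int \<Rightarrow> complex" where
  "v_minus v q P = (\<lambda>i. v * P i - q * P (i + 1))"

lemma psi_mode_plus_box:
  fixes lam :: ptuple
  assumes "r \<in> rows" "lam \<in> B"
  defines "v \<equiv> wt lam r"
  shows "z_minus v q1 (z_minus v q2 (z_minus v q3 (psi_mode s (plus_box lam r)))) i
    = - v_minus v q1 (v_minus v q2 (v_minus v q3 (psi_mode s lam))) i"
proof -
  let ?z = "inverse (zinv s) :: complex fls"
  obtain T where T: "bounded_by T lam" using B_bounded[OF assms(2)] by blast
  have zm: "series_coeff s ((?z - fls_const q * fls_const v) * F) = z_minus v q (series_coeff s F)" for q F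
  proof
    fix i
    have "(?z - fls_const q * fls_const v) * F = ?z * F - fls_const (q * v) * F"
      by (simp add: left_diff_distrib)
    then show "series_coeff s ((?z - fls_const q * fls_const v) * F) i = z_minus v q (series_coeff s F) i"
      by (simp add: z_minus_def series_coeff_diff series_coeff_shift series_coeff_const_mult)
  qed
  have vm: "series_coeff s ((fls_const v - fls_const q * ?z) * F) = v_minus v q (series_coeff s F)" for q F
  proof
    fix i
    have "(fls_const v - fls_const q * ?z) * F = fls_const v * F - fls_const q * (?z * F)"
      by (simp add: left_diff_distrib mult.assoc)
    then show "series_coeff s ((fls_const v - fls_const q * ?z) * F) i = v_minus v q (series_coeff s F) i"
      by (simp add: v_minus_def series_coeff_diff series_coeff_shift series_coeff_const_mult)
  qed
  have "(?z - fls_const q1 * fls_const v) * ((?z - fls_const q2 * fls_const v) * ((?z - fls_const q3 * fls_const v) * psi_ser s (plus_box lam r)))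
    = - ((fls_const v - fls_const q1 * ?z) * ((fls_const v - fls_const q2 * ?z) * ((fls_const v - fls_const q3 * ?z) * psi_ser s lam)))"
    using psi_ser_plus_box[OF assms(1) T, of s] unfolding g_poly_def v_def by (simp add: mult_ac)
  then have "series_coeff s ((?z - fls_const q1 * fls_const v) * ((?z - fls_const q2 * fls_const v) * ((?z - fls_const q3 * fls_const v) * psi_ser s (plus_box lam r)))) i
    = - series_coeff s ((fls_const v - fls_const q1 * ?z) * ((fls_const v - fls_const q2 * ?z) * ((fls_const v - fls_const q3 * ?z) * psi_ser s lam))) i"
    by (simp add: series_coeff_uminus)
  moreover have "series_coeff s (psi_ser s mu) = psi_mode s mu" for mu by (rule ext) (simp add: psi_mode_def)
  ultimately show ?thesis unfolding zm vm by simp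
qed

end

section \<open>The diagonal part of the commutator\<close>

context resonance
begin

lemma row_set_Suc: "row_set (Suc T) = row_set T \<union> (\<lambda>j. (j, Suc T)) ` {1..n}"
  "row_set T \<inter> (\<lambda>j. (j, Suc T)) ` {1..n} = {}" "row_set T \<subseteq> row_set (Suc T)"
  by (auto simp: row_set_def)

text \<open>
  The eigenvalue with the tails absorbed: pairing the tail of each partition with its first row beyond
  \<open>T\<close> turns the product into one over \<open>row_set (Suc T)\<close> of factors with
  \<open>q2\<close> and one over \<open>row_set T\<close> of factors with \<open>q3\<close>. The set
  \<open>X\<close> of omitted rows is empty for the eigenvalue and a single row for a residue.
\<close>

definition other_rows :: "(complex \<Rightarrow> 'k::field) \<Rightarrow> nat \<Rightarrow> ptuple \<Rightarrow> (nat \<times> nat) set \<Rightarrow> 'k" where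
  "other_rows h T lam X = (\<Prod>\<rho>\<in>row_set (Suc T) - X. h (q2 * wt lam \<rho>) / h (wt lam \<rho>))
     * (\<Prod>\<rho>\<in>row_set T - X. h (q3 * wt lam \<rho>) / h (wt lam \<rho> / q1))"

lemma other_rows_alt:
  assumes "X \<subseteq> row_set T" "bounded_by T lam"
  shows "(\<Prod>\<rho>\<in>row_set T - X. h (q3 * wt lam \<rho>) * h (q2 * wt lam \<rho>) / (h (wt lam \<rho>) * h (wt lam \<rho> / q1)))
    * (\<Prod>j\<in>{1..n}. h (q2 * (q3 powi int T * us j)) / h (q3 powi int T * us j)) = other_rows h T lam X"
proof -
  let ?A = "\<lambda>\<rho>. h (q2 * wt lam \<rho>) / h (wt lam \<rho>)" and ?C = "\<lambda>\<rho>. h (q3 * wt lam \<rho>) / h (wt lam \<rho> / q1)"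
  have "row_set (Suc T) - X = (row_set T - X) \<union> (\<lambda>j. (j, Suc T)) ` {1..n}"
    using row_set_Suc assms(1) by blast
  then have "prod ?A (row_set (Suc T) - X) = prod ?A ((row_set T - X) \<union> (\<lambda>j. (j, Suc T)) ` {1..n})"
    by (simp only:)
  also have "\<dots> = prod ?A (row_set T - X) * prod ?A ((\<lambda>j. (j, Suc T)) ` {1..n})"
    using row_set_Suc(2) by (intro prod.union_disjoint) auto
  also have "prod ?A ((\<lambda>j. (j, Suc T)) ` {1..n}) = (\<Prod>j\<in>{1..n}. h (q2 * (q3 powi int T * us j)) / h (q3 powi int T * us j))"
    using tail_weight(1)[OF assms(2)] by (subst prod.reindex) (auto simp: inj_on_def intro!: prod.cong)
  finally have 1: "prod ?A (row_set (Suc T) - X) = prod ?A (row_set T - X)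
      * (\<Prod>j\<in>{1..n}. h (q2 * (q3 powi int T * us j)) / h (q3 powi int T * us j))" .
  have "(\<Prod>\<rho>\<in>row_set T - X. h (q3 * wt lam \<rho>) * h (q2 * wt lam \<rho>) / (h (wt lam \<rho>) * h (wt lam \<rho> / q1)))
      = prod ?A (row_set T - X) * prod ?C (row_set T - X)"
    unfolding prod.distrib[symmetric] by (intro prod.cong) (simp_all add: mult_ac)
  then show ?thesis unfolding other_rows_def 1 by (simp only: mult_ac)
qed

lemma psi_ser_eq_other_rows:
  assumes "bounded_by T lam"
  shows "psi_ser s lam = other_rows (\<lambda>c. 1 - fls_const c * zinv s) T lam {}"
proof -
  have q: "q2_of (fls_const q1) (fls_const q3) = fls_const q2"
    by (simp add: q2_eq flip: fls_const_inverse)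
  have rf: "row_factor (fls_const q1) (fls_const q3) (fls_const W * zinv s)
      = (1 - fls_const (q3 * W) * zinv s) * (1 - fls_const (q2 * W) * zinv s)
        / ((1 - fls_const W * zinv s) * (1 - fls_const (W / q1) * zinv s))" for W
    unfolding row_factor_def q by (simp only: fls_const_mult fls_const_divide times_divide_eq_left mult.assoc)
  have tf: "tail_factor (fls_const q1) (fls_const q3) (fls_const W * zinv s)
      = (1 - fls_const (q2 * W) * zinv s) / (1 - fls_const W * zinv s)" for W
    unfolding tail_factor_def q by (simp only: fls_const_mult mult.assoc)
  show ?thesis
    unfolding psi_ser_rows[OF assms] rf tf
    using other_rows_alt[of "{}" T lam "\<lambda>c. 1 - fls_const c * zinv s"] assms by simp
qed

text \<open>
  Up to a constant the product of the \<open>e\<close> and \<open>f\<close> coefficients of an edge is the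
  product over all other rows, as the rows before and after are complementary. Up to a constant this is the
  residue of \<open>\<psi>\<close> at the weight of the row.
\<close>

lemma edge_pair_product:
  assumes lam: "lam \<in> B" "plus_box lam r \<in> B" and r: "r \<in> rows" and T: "bounded_by T lam" "snd r \<le> T"
  shows "ee lam r * ff lam r = q1 / (1 - q1)^2 * other_rows (\<lambda>c. 1 - c / wt lam r) T lam {r}"
proof -
  let ?h = "\<lambda>c. 1 - c / wt lam r"
  let ?b = "rows_before T (fst r) (snd r)" and ?a = "rows_after n T (fst r) (snd r)"
  let ?rf = "\<lambda>\<rho>. row_factor q1 q3 (wt lam \<rho> / wt lam r)"
  let ?tf = "\<lambda>j. tail_factor q1 q3 (q3 powi int T * (us j / wt lam r))"
  have rr: "fst r \<in> {1..n}" "snd r \<ge> 1" using r by (auto simp: rows_def)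
  have ba: "row_set T - {r} = ?b \<union> ?a" "?b \<inter> ?a = {}"
    using rr T(2) by (cases r; auto simp: rows_before_def rows_after_def row_set_def)+
  have J: "{1..n} = {1..<fst r} \<union> {fst r..n}" using rr by auto
  have p1: "prod ?rf (row_set T - {r}) = prod ?rf ?b * prod ?rf ?a"
    unfolding ba(1) using ba(2) finite_row_sets by (intro prod.union_disjoint) auto
  have p2: "prod ?tf {1..n} = prod ?tf {1..<fst r} * prod ?tf {fst r..n}"
    unfolding J by (intro prod.union_disjoint) auto
  have rf: "?rf \<rho> = ?h (q3 * wt lam \<rho>) * ?h (q2 * wt lam \<rho>) / (?h (wt lam \<rho>) * ?h (wt lam \<rho> / q1))" for \<rho>
    unfolding row_factor_def q2_eq[symmetric] by (simp add: mult.commute)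
  have tf: "?tf j = ?h (q2 * (q3 powi int T * us j)) / ?h (q3 powi int T * us j)" for j
    unfolding tail_factor_def q2_eq[symmetric] by simp
  have "r \<in> row_set T" using r T(2) by (simp add: in_row_set)
  then have o: "prod ?rf (row_set T - {r}) * prod ?tf {1..n} = other_rows ?h T lam {r}"
    unfolding rf tf using T(1) by (intro other_rows_alt) auto
  have "ee lam r * ff lam r = q1 / (1 - q1)^2 * (prod ?rf (row_set T - {r}) * prod ?tf {1..n})"
    unfolding ee_eq[OF assms] ff_eq[OF assms] e_edge_def f_edge_def edge_eq p1 p2
    by (simp add: power2_eq_square mult_ac)
  then show ?thesis unfolding o .
qed

definition minus_box :: "ptuple \<Rightarrow> nat \<times> nat \<Rightarrow> ptuple" where
  "minus_box lam r = lam(fst r := (lam (fst r))(snd r := lam (fst r) (snd r) - 1))"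

lemma plus_minus_box: "row_length lam r > 0 \<Longrightarrow> plus_box (minus_box lam r) r = lam"
  by (cases r) (auto simp: minus_box_def plus_box_apply fun_eq_iff)

definition removal_weight :: "ptuple \<Rightarrow> nat \<times> nat \<Rightarrow> complex" where
  "removal_weight lam r = (if row_length lam r > 0 then ee (minus_box lam r) r * ff (minus_box lam r) r else 0)"

text \<open>
  If the row cannot be lengthened, its weight, which looks like a pole of \<open>\<psi>\<close>, is also one
  of the zeros.
\<close>

lemma blocked_by:
  assumes lam: "lam \<in> B" and r: "r \<in> row_set (Suc T)" and n: "plus_box lam r \<notin> B"
  shows "(\<exists>\<rho>\<in>row_set T. wt lam r = q3 * wt lam \<rho>) \<or> (\<exists>\<rho>\<in>row_set (Suc T). wt lam r = q2 * wt lam \<rho>)"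
proof -
  have rr: "r \<in> rows" using r by (simp add: in_row_set)
  obtain \<rho> where t: "tight lam \<rho> r" using plus_box_in_B_iff[OF lam rr] n by blast
  then have "\<rho> \<in> rows" using constraint_rows(1) unfolding tight_def by blast
  then show ?thesis using tight_cases[OF t] r by (auto simp: in_row_set)
qed

text \<open>
  The same for shortening. An empty row is blocked by the empty row below it.
\<close>

lemma removal_blocked_by:
  assumes lam: "lam \<in> B" and T: "bounded_by T lam" and r: "r \<in> row_set T"
    and n: "\<not> (row_length lam r > 0 \<and> minus_box lam r \<in> B)"
  shows "(\<exists>\<rho>\<in>row_set T. wt lam r / q1 = q3 * wt lam \<rho>) \<or> (\<exists>\<rho>\<in>row_set (Suc T). wt lam r / q1 = q2 * wt lam \<rho>)"
proof -
  have rr: "r \<in> rows" using r by (simp add: in_row_set)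
  have conv: "wt lam r / q1 = q2 * x" if "x = q3 * wt lam r" for x
    using that q_prod q1_nz by (simp add: field_simps)
  have conv': "wt lam r / q1 = q3 * x" if "x = q2 * wt lam r" for x
    using that q_prod q1_nz by (simp add: field_simps)
  show ?thesis
  proof (cases "row_length lam r > 0")
    case True
    then have P: "plus_box (minus_box lam r) r = lam" by (rule plus_minus_box)
    then obtain \<rho> where t: "tight lam r \<rho>"
      using minus_box_in_B_iff[OF rr, of "minus_box lam r"] lam n True by auto
    then have \<rho>: "\<rho> \<in> rows" using constraint_rows(2) unfolding tight_def by blast
    have pos: "row_length lam \<rho> > 0" using tight_height(1)[OF t True] .
    have "snd \<rho> \<le> T"
    proof (rule ccontr)
      assume "\<not> snd \<rho> \<le> T"
      then have "row_length lam \<rho> = 0" using T by (simp add: bounded_by_def)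
      then show False using pos by simp
    qed
    then have "\<rho> \<in> row_set T" "\<rho> \<in> row_set (Suc T)" using \<rho> by (auto simp: in_row_set)
    then show ?thesis using wt_if_tight[OF t] conv conv' by blast
  next
    case False
    let ?\<rho> = "(fst r, snd r + 1)"
    have c: "constraint r ?\<rho> 0" using rr by (simp add: constraint_def)
    have z: "row_length lam ?\<rho> = 0" using B_constraint[OF lam c] False by simp
    have t: "tight lam r ?\<rho>" unfolding tight_def by (rule exI[of _ 0]) (use c z False in simp)
    have in1: "?\<rho> \<in> row_set (Suc T)" using r by (auto simp: row_set_def)
    from tight_cases[OF t] show ?thesis
    proof
      assume "snd ?\<rho> = snd r + 1 \<and> wt lam ?\<rho> = q3 * wt lam r"
      then show ?thesis using conv in1 by blast
    next
      assume *: "snd r \<le> snd ?\<rho> \<and> wt lam ?\<rho> = q2 * wt lam r"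
      have "q3 ^ snd r = q3 * q3 powi (int (snd r) - 1)"
        using power_int_add_1'[of q3 "int (snd r) - 1"] q3_nz by simp
      then have "wt lam ?\<rho> = q3 * wt lam r"
        using False z by (simp add: wt_def box_weight_def)
      then show ?thesis using conv in1 by blast
    qed
  qed
qed

lemma removable_row:
  assumes lam: "lam \<in> B" and r: "r \<in> rows" "\<rho> \<in> rows" and m: "row_length lam r > 0" "minus_box lam r \<in> B"
  shows "wt lam r / q1 \<noteq> q3 * wt lam \<rho>" "wt lam r / q1 \<noteq> q2 * wt lam \<rho>" "wt lam r / q1 \<noteq> wt lam \<rho>"
proof -
  have P: "plus_box (minus_box lam r) r = lam" using m(1) by (rule plus_minus_box)
  have nt: "\<not> tight lam r \<rho>'" for \<rho>'
    using minus_box_in_B_iff[OF r(1), of "minus_box lam r"] m(2) lam unfolding P by blast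
  have 1: "wt lam \<rho>' \<noteq> q3 * wt lam r \<and> wt lam \<rho>' \<noteq> q2 * wt lam r" if "\<rho>' \<in> rows" for \<rho>'
    using tight_iff_wt[OF lam r(1) that] nt by blast
  show "wt lam r / q1 \<noteq> q3 * wt lam \<rho>"
  proof
    assume "wt lam r / q1 = q3 * wt lam \<rho>"
    then have "q2 * wt lam r = (q1 * q2 * q3) * wt lam \<rho>" using q1_nz by (simp add: field_simps)
    then show False using 1[OF r(2)] q_prod by simp
  qed
  show "wt lam r / q1 \<noteq> q2 * wt lam \<rho>"
  proof
    assume "wt lam r / q1 = q2 * wt lam \<rho>"
    then have "q3 * wt lam r = (q1 * q2 * q3) * wt lam \<rho>" using q1_nz by (simp add: field_simps)
    then show False using 1[OF r(2)] q_prod by simp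
  qed
  show "wt lam r / q1 \<noteq> wt lam \<rho>"
  proof
    assume "wt lam r / q1 = wt lam \<rho>"
    then have eq: "wt lam r = q1 * wt lam \<rho>" using q1_nz by (simp add: field_simps)
    let ?d = "(fst r, snd r + 1)"
    have d: "?d \<in> rows" using r(1) by (auto simp: rows_def)
    have "wt lam \<rho> = q2 * wt lam ?d" using adjacent_columns(3)[OF lam r(2,1) eq] .
    then have "q3 * wt lam r = (q1 * q2 * q3) * wt lam ?d" using eq by (simp add: mult_ac)
    then show False using 1[OF d] q_prod by simp
  qed
qed

definition g11 :: complex where "g11 = (1 - q1) * (1 - q2) * (1 - q3)"

lemma q_neq_1: "q1 \<noteq> 1" "q2 \<noteq> 1" "q3 \<noteq> 1"
  using not_root_of_unity[of _ 1] by auto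

text \<open>
  Written over all rows, \<open>\<psi>\<close> has poles at the weights \<open>w\<close> and at
  \<open>w/q1\<close>, zeros at \<open>q3 w\<close> and \<open>q2 w\<close>. A point lies in both families
  of poles only for neighbouring columns, and then \<open>adjacent_columns\<close> supplies two zeros there;
  after cancelling these points all poles are simple. Up to the constant \<open>g(1,1)\<close> and a sign,
  the residue at \<open>w\<close> is the amplitude for adding a box to that row and removing it, the residue
  at \<open>w/q1\<close> the amplitude for removing and adding it back, and a residue whose move is not
  possible inside the basis is zero because a zero of \<open>\<psi>\<close> sits at the pole.
\<close>

lemma diagonal_commutator:
  assumes lam: "lam \<in> B" and T0: "bounded_by T0 lam" and T: "T = Suc T0"
  shows "1 / g11 * (psi_mode True lam k - psi_mode False lam k)
    = (\<Sum>r\<in>row_set T. removal_weight lam r * (wt lam r / q1) powi k)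
      - (\<Sum>r\<in>row_set (Suc T). ee lam r * ff lam r * wt lam r powi k)"
proof -
  have bT: "bounded_by T lam" using bounded_by_mono[OF T0] T by simp
  let ?R = "row_set T" and ?R1 = "row_set (Suc T)"
  let ?W = "wt lam"
  have rowsR: "\<rho> \<in> rows" if "\<rho> \<in> ?R \<or> \<rho> \<in> ?R1" for \<rho> using that by (auto simp: in_row_set)
  have inj: "inj_on ?W rows" using wt_inject[OF lam] by (auto simp: inj_on_def)
  have inj1: "inj_on ?W ?R1" "inj_on (\<lambda>\<rho>. q2 * ?W \<rho>) ?R1" "inj_on (\<lambda>\<rho>. ?W \<rho> / q1) ?R" "inj_on (\<lambda>\<rho>. q3 * ?W \<rho>) ?R"
    using inj rowsR q1_nz q2_nz q3_nz by (auto simp: inj_on_def)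
  \<comment> \<open>the common points of the two families of poles\<close>
  define I0 where "I0 = ?W ` ?R1 \<inter> (\<lambda>\<rho>. ?W \<rho> / q1) ` ?R"
  have sub: "I0 \<subseteq> ?W ` ?R1" "I0 \<subseteq> (\<lambda>\<rho>. ?W \<rho> / q1) ` ?R" by (auto simp: I0_def)
  have both: "I0 \<subseteq> (\<lambda>\<rho>. q3 * ?W \<rho>) ` ?R \<and> I0 \<subseteq> (\<lambda>\<rho>. q2 * ?W \<rho>) ` ?R1"
  proof (intro conjI subsetI)
    fix x assume "x \<in> I0"
    then obtain a b where ab: "a \<in> ?R1" "x = ?W a" "b \<in> ?R" "x = ?W b / q1"
      unfolding I0_def by blast
    then have "?W a = ?W b / q1" by simp
    then have eq: "?W b = q1 * ?W a" using q1_nz by (simp add: field_simps)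
    note A = adjacent_columns[OF lam rowsR rowsR eq]
    have A': "snd a \<ge> 2" "?W a = q3 * ?W (fst a, snd a - 1)" "?W a = q2 * ?W (fst b, snd b + 1)"
      using A ab by blast+
    show "x \<in> (\<lambda>\<rho>. q3 * ?W \<rho>) ` ?R"
      by (rule image_eqI[of _ _ "(fst a, snd a - 1)"]) (use A' ab in \<open>auto simp: row_set_def\<close>)
    show "x \<in> (\<lambda>\<rho>. q2 * ?W \<rho>) ` ?R1"
      by (rule image_eqI[of _ _ "(fst b, snd b + 1)"]) (use A' ab in \<open>auto simp: row_set_def\<close>)
  qed
  define A' where "A' = {\<rho>\<in>?R1. ?W \<rho> \<notin> I0}"
  define B' where "B' = {\<rho>\<in>?R. ?W \<rho> / q1 \<notin> I0}"
  define C' where "C' = {\<rho>\<in>?R. q3 * ?W \<rho> \<notin> I0}"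
  define D' where "D' = {\<rho>\<in>?R1. q2 * ?W \<rho> \<notin> I0}"
  have fin: "finite A'" "finite B'" "finite C'" "finite D'" by (simp_all add: A'_def B'_def C'_def D'_def)
  note sA = prod_split_image[OF finite_row_set inj1(1) sub(1), folded A'_def]
    and sB = prod_split_image[OF finite_row_set inj1(3) sub(2), folded B'_def]
    and sC = prod_split_image[OF finite_row_set inj1(4) conjunct1[OF both], folded C'_def]
    and sD = prod_split_image[OF finite_row_set inj1(2) conjunct2[OF both], folded D'_def]
  \<comment> \<open>zeros and poles that remain after removing \<open>I0\<close>, as families over disjoint sums\<close>
  define \<alpha> where "\<alpha> = case_sum (\<lambda>\<rho>. q3 * ?W \<rho>) (\<lambda>\<rho>. q2 * ?W \<rho>)"
  define \<pi> where "\<pi> = case_sum ?W (\<lambda>\<rho>. ?W \<rho> / q1)"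
  have finIJ: "finite (C' <+> D')" "finite (A' <+> B')" using fin by simp_all
  have card: "card (C' <+> D') = card (A' <+> B')"
    using sA(2) sB(2) sC(2) sD(2) fin by (simp add: card_Plus)
  have inj\<pi>: "inj_on \<pi> (A' <+> B')"
  proof (rule inj_onI)
    fix x y assume xy: "x \<in> A' <+> B'" "y \<in> A' <+> B'" "\<pi> x = \<pi> y"
    have cross: "?W a \<noteq> ?W b / q1" if "a \<in> A'" "b \<in> B'" for a b
      using that by (auto simp: A'_def B'_def I0_def)
    show "x = y"
      using xy cross inj_onD[OF inj1(1)] inj_onD[OF inj1(3)]
      by (auto simp: \<pi>_def A'_def B'_def) metis+
  qed
  have nz\<pi>: "\<pi> j \<noteq> 0" if "j \<in> A' <+> B'" for j
    using that wt_nz rowsR q1_nz by (auto simp: \<pi>_def A'_def B'_def)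
  have plus: "(\<Prod>i\<in>C' <+> D'. h (\<alpha> i)) = (\<Prod>\<rho>\<in>C'. h (q3 * ?W \<rho>)) * (\<Prod>\<rho>\<in>D'. h (q2 * ?W \<rho>))"
    for h :: "complex \<Rightarrow> 'x::field"
    using fin by (simp add: prod.Plus \<alpha>_def)
  have plus': "(\<Prod>j\<in>X <+> Y. h (\<pi> j)) = (\<Prod>\<rho>\<in>X. h (?W \<rho>)) * (\<Prod>\<rho>\<in>Y. h (?W \<rho> / q1))"
    if "finite X" "finite Y" for h :: "complex \<Rightarrow> 'x::field" and X Y
    using that by (simp add: prod.Plus \<pi>_def)
  have ratio: "(\<Prod>i\<in>C' <+> D'. h (\<alpha> i)) / (\<Prod>j\<in>X <+> Y. h (\<pi> j))
    = (\<Prod>\<rho>\<in>?R. h (q3 * ?W \<rho>)) * (\<Prod>\<rho>\<in>?R1. h (q2 * ?W \<rho>)) / (NX * NY)"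
    if h: "\<And>c. c \<in> I0 \<Longrightarrow> h c \<noteq> 0" and XY: "finite X" "finite Y"
      and NX: "NX = (\<Prod>\<rho>\<in>X. h (?W \<rho>)) * (\<Prod>c\<in>I0. h c)" and NY: "NY = (\<Prod>\<rho>\<in>Y. h (?W \<rho> / q1)) * (\<Prod>c\<in>I0. h c)"
    for h :: "complex \<Rightarrow> 'x::field" and X Y NX NY
  proof -
    have finI: "finite I0" by (simp add: I0_def)
    define H where "H = (\<Prod>c\<in>I0. h c)"
    have H: "H \<noteq> 0" using h finI by (simp add: H_def)
    have alg: "(c * H) * (d * H) / ((x * H) * (y * H)) = c * d / (x * y)" for c d x y
      using H by simp
    show ?thesis unfolding plus plus'[OF XY] NX NY sC(1) sD(1) H_def[symmetric] alg ..
  qed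
  define F where "F s = (\<Prod>i\<in>C' <+> D'. 1 - fls_const (\<alpha> i) * zinv s) / (\<Prod>j\<in>A' <+> B'. 1 - fls_const (\<pi> j) * zinv s)" for s
  have F: "psi_ser s lam = F s" for s
  proof -
    let ?h = "\<lambda>c. 1 - fls_const c * zinv s"
    have "F s = (\<Prod>\<rho>\<in>?R. ?h (q3 * ?W \<rho>)) * (\<Prod>\<rho>\<in>?R1. ?h (q2 * ?W \<rho>)) / ((\<Prod>\<rho>\<in>?R1. ?h (?W \<rho>)) * (\<Prod>\<rho>\<in>?R. ?h (?W \<rho> / q1)))"
      unfolding F_def using fin fls_1_minus_nonzero by (intro ratio[of ?h] sA(1) sB(1)) auto
    also have "\<dots> = other_rows ?h T lam {}"
      unfolding other_rows_def prod_dividef by simp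
    finally show ?thesis unfolding psi_ser_eq_other_rows[OF bT] ..
  qed
  define res where "res j = (\<Prod>i\<in>C' <+> D'. 1 - \<alpha> i / \<pi> j) / (\<Prod>j'\<in>(A' <+> B') - {j}. 1 - \<pi> j' / \<pi> j)" for j
  have diff: "psi_mode True lam k - psi_mode False lam k = (\<Sum>j\<in>A' <+> B'. res j * \<pi> j powi k)"
    unfolding psi_mode_def F F_def res_def by (rule series_difference[OF finIJ card inj\<pi> nz\<pi>])
  have diff': "psi_mode True lam k - psi_mode False lam k = (\<Sum>r\<in>A'. res (Inl r) * ?W r powi k) + (\<Sum>r\<in>B'. res (Inr r) * (?W r / q1) powi k)"
    unfolding diff using fin by (simp add: sum.Plus \<pi>_def)
  have I0p: "1 - c / p \<noteq> 0" if "c \<in> I0" "p \<notin> I0" "p \<noteq> 0" for c p using that by auto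
  have frac_A: "c3 * P3 * (c2 * P2) / (Q1 * (cq * Qq)) = c2 * c3 / cq * (P2 / Q1 * (P3 / Qq))"
    and frac_B: "c3 * P3 * (c2 * P2) / (cq * Q1 * Qq) = c2 * c3 / cq * (P2 / Q1 * (P3 / Qq))"
    for c2 c3 cq P2 P3 Q1 Qq :: complex
    by (simp_all add: mult_ac)
  have resA: "res (Inl r) = (1 - q2) * (1 - q3) / (1 - inverse q1) * other_rows (\<lambda>c. 1 - c / ?W r) T lam {r}"
    if r: "r \<in> A'" "r \<in> ?R" for r
  proof -
    let ?h = "\<lambda>c. 1 - c / ?W r"
    have p: "?W r \<noteq> 0" "?W r \<notin> I0" "r \<in> ?R1" using r wt_nz rowsR by (auto simp: A'_def)
    have e: "(A' <+> B') - {Inl r} = (A' - {r}) <+> B'" by auto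
    have e2: "A' - {r} = {\<rho>\<in>?R1 - {r}. ?W \<rho> \<notin> I0}" by (auto simp: A'_def)
    have "I0 \<subseteq> ?W ` (?R1 - {r})" using sub(1) p(2) by auto
    from prod_split_image(1)[OF _ inj_on_subset[OF inj1(1)] this, of ?h, folded e2]
    have NX: "(\<Prod>\<rho>\<in>?R1 - {r}. ?h (?W \<rho>)) = (\<Prod>\<rho>\<in>A' - {r}. ?h (?W \<rho>)) * (\<Prod>c\<in>I0. ?h c)" by simp
    have "res (Inl r) = (\<Prod>\<rho>\<in>?R. ?h (q3 * ?W \<rho>)) * (\<Prod>\<rho>\<in>?R1. ?h (q2 * ?W \<rho>)) / ((\<Prod>\<rho>\<in>?R1 - {r}. ?h (?W \<rho>)) * (\<Prod>\<rho>\<in>?R. ?h (?W \<rho> / q1)))"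
      unfolding res_def e using fin
      by (simp only: \<pi>_def sum.case(1), fold \<pi>_def, intro ratio[of ?h] NX sB(1) I0p[OF _ p(2,1)]) auto
    also have "\<dots> = ?h (q2 * ?W r) * ?h (q3 * ?W r) / ?h (?W r / q1) * other_rows ?h T lam {r}"
      unfolding other_rows_def prod_dividef prod.remove[OF finite_row_set r(2)] prod.remove[OF finite_row_set p(3)]
      by (rule frac_A)
    also have "?h (q2 * ?W r) * ?h (q3 * ?W r) / ?h (?W r / q1) = (1 - q2) * (1 - q3) / (1 - inverse q1)"
    proof -
      have "q2 * ?W r / ?W r = q2" "q3 * ?W r / ?W r = q3" "?W r / q1 / ?W r = inverse q1"
        using p(1) q1_nz by (simp_all add: field_simps)
      then show ?thesis by (simp only:)
    qed
    finally show ?thesis .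
  qed
  have resB: "res (Inr r) = (1 - q1 * q2) * (1 - q1 * q3) / (1 - q1) * other_rows (\<lambda>c. 1 - c / (?W r / q1)) T lam {r}"
    if r: "r \<in> B'" for r
  proof -
    let ?p = "?W r / q1"
    let ?h = "\<lambda>c. 1 - c / ?p"
    have p: "?p \<noteq> 0" "?p \<notin> I0" "r \<in> ?R" "?W r \<noteq> 0" using r wt_nz rowsR q1_nz by (auto simp: B'_def)
    have r1: "r \<in> ?R1" using p(3) row_set_Suc(3) by blast
    have e: "(A' <+> B') - {Inr r} = A' <+> (B' - {r})" by auto
    have e2: "B' - {r} = {\<rho>\<in>?R - {r}. ?W \<rho> / q1 \<notin> I0}" by (auto simp: B'_def)
    have "I0 \<subseteq> (\<lambda>\<rho>. ?W \<rho> / q1) ` (?R - {r})" using sub(2) p(2) by auto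
    from prod_split_image(1)[OF _ inj_on_subset[OF inj1(3)] this, of ?h, folded e2]
    have NY: "(\<Prod>\<rho>\<in>?R - {r}. ?h (?W \<rho> / q1)) = (\<Prod>\<rho>\<in>B' - {r}. ?h (?W \<rho> / q1)) * (\<Prod>c\<in>I0. ?h c)" by simp
    have "res (Inr r) = (\<Prod>\<rho>\<in>?R. ?h (q3 * ?W \<rho>)) * (\<Prod>\<rho>\<in>?R1. ?h (q2 * ?W \<rho>)) / ((\<Prod>\<rho>\<in>?R1. ?h (?W \<rho>)) * (\<Prod>\<rho>\<in>?R - {r}. ?h (?W \<rho> / q1)))"
      unfolding res_def e using fin
      by (simp only: \<pi>_def sum.case(2), fold \<pi>_def, intro ratio[of ?h] NY sA(1) I0p[OF _ p(2,1)]) auto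
    also have "\<dots> = ?h (q2 * ?W r) * ?h (q3 * ?W r) / ?h (?W r) * other_rows ?h T lam {r}"
      unfolding other_rows_def prod_dividef prod.remove[OF finite_row_set p(3)] prod.remove[OF finite_row_set r1]
      by (rule frac_B)
    also have "?h (q2 * ?W r) * ?h (q3 * ?W r) / ?h (?W r) = (1 - q1 * q2) * (1 - q1 * q3) / (1 - q1)"
    proof -
      have "q2 * ?W r / ?p = q1 * q2" "q3 * ?W r / ?p = q1 * q3" "?W r / ?p = q1"
        using p(4) q1_nz by (simp_all add: field_simps)
      then show ?thesis by (simp only:)
    qed
    finally show ?thesis .
  qed
  \<comment> \<open>a zero of the numerator at the pole kills the residue\<close>
  have res0: "res j = 0" if "i \<in> C' <+> D'" "\<alpha> i = \<pi> j" "j \<in> A' <+> B'" for i j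
  proof -
    have "1 - \<alpha> i / \<pi> j = 0" using that nz\<pi> by simp
    then have "(\<Prod>i\<in>C' <+> D'. 1 - \<alpha> i / \<pi> j) = 0"
      using that(1) by (intro prod_zero[OF finIJ(1)]) blast
    then show ?thesis unfolding res_def by (simp only: div_0)
  qed
  \<comment> \<open>the residue at a weight: a box can be added, or a remaining zero cancels the pole\<close>
  have claimA: "(if r \<in> A' then res (Inl r) else 0) = - (g11 * (ee lam r * ff lam r))" if r: "r \<in> ?R1" for r
  proof (cases "plus_box lam r \<in> B")
    case True
    have rr: "r \<in> rows" using rowsR r by blast
    have sT: "snd r \<le> T" using addable_bound[OF lam True rr T0] T by simp
    have "?W r \<notin> I0"
    proof
      assume "?W r \<in> I0"
      then obtain \<rho> where "\<rho> \<in> ?R" "?W r = ?W \<rho> / q1" using sub(2) by blast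
      then show False using addable_row(3)[OF lam True rr, of \<rho>] rowsR q1_nz by (auto simp: field_simps)
    qed
    then have rA: "r \<in> A'" "r \<in> ?R" using r rr sT by (auto simp: A'_def in_row_set)
    have "(1 - q2) * (1 - q3) / (1 - inverse q1) = - (g11 * (q1 / (1 - q1)^2))"
    proof -
      define d where "d = 1 - q1"
      have d: "d \<noteq> 0" "1 - inverse q1 = - (d / q1)" using q_neq_1 q1_nz by (simp_all add: d_def field_simps)
      show ?thesis unfolding g11_def d(2) d_def[symmetric] using d(1) q1_nz
        by (simp add: power2_eq_square)
    qed
    then show ?thesis using rA(1) unfolding resA[OF rA] edge_pair_product[OF lam True rr bT sT] by simp
  next
    case False
    have "ee lam r = 0" using supported_ee False unfolding supported_def by blast
    moreover have "res (Inl r) = 0" if rA: "r \<in> A'"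
    proof -
      have n: "?W r \<notin> I0" using rA by (simp add: A'_def)
      from blocked_by[OF lam r False] show ?thesis
      proof (elim disjE bexE)
        fix \<rho> assume "\<rho> \<in> ?R" "?W r = q3 * ?W \<rho>"
        then show ?thesis using n rA by (intro res0[of "Inl \<rho>"]) (auto simp: C'_def \<alpha>_def \<pi>_def)
      next
        fix \<rho> assume "\<rho> \<in> ?R1" "?W r = q2 * ?W \<rho>"
        then show ?thesis using n rA by (intro res0[of "Inr \<rho>"]) (auto simp: D'_def \<alpha>_def \<pi>_def)
      qed
    qed
    ultimately show ?thesis by simp
  qed
  \<comment> \<open>the residue at a weight divided by \<open>q1\<close>: the last box of the row can be removed, or a zero cancels the pole\<close>
  have claimB: "(if r \<in> B' then res (Inr r) else 0) = g11 * removal_weight lam r" if r: "r \<in> ?R" for r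
  proof (cases "row_length lam r > 0 \<and> minus_box lam r \<in> B")
    case True
    have rr: "r \<in> rows" using rowsR r by blast
    let ?m = "minus_box lam r"
    have P: "plus_box ?m r = lam" using True by (simp add: plus_minus_box)
    have bm: "bounded_by T ?m" "snd r \<le> T" using bT bounded_by_plus_box[of T ?m r] unfolding P by simp_all
    have wm: "wt ?m r = ?W r / q1" "\<And>\<rho>. \<rho> \<noteq> r \<Longrightarrow> wt ?m \<rho> = ?W \<rho>"
      using wt_plus_box[of ?m r] q1_nz unfolding P by simp_all
    have "?W r / q1 \<notin> I0"
    proof
      assume "?W r / q1 \<in> I0"
      then obtain \<rho> where \<rho>: "\<rho> \<in> ?R1" "?W r / q1 = ?W \<rho>" using sub(1) by blast
      then have "\<rho> \<in> rows" using rowsR by simp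
      from removable_row(3)[OF lam rr this conjunct1[OF True] conjunct2[OF True]] \<rho>(2)
      show False by simp
    qed
    then have rB: "r \<in> B'" using r by (simp add: B'_def)
    have o: "other_rows h T ?m {r} = other_rows h T lam {r}" for h :: "complex \<Rightarrow> complex"
      unfolding other_rows_def using wm(2) by (intro arg_cong2[of _ _ _ _ "(*)"] prod.cong) auto
    have "(1 - q1 * q2) * (1 - q1 * q3) / (1 - q1) = g11 * (q1 / (1 - q1)^2)"
    proof -
      have "(1 - q1 * q2) * (1 - q1 * q3) = 1 - q1 * q2 - q1 * q3 + q1 * (q1 * q2 * q3)"
        by (simp add: algebra_simps)
      also have "\<dots> = q1 * q2 * q3 - q1 * q2 - q1 * q3 + q1" unfolding q_prod by simp
      also have "\<dots> = q1 * ((1 - q2) * (1 - q3))" by (simp add: algebra_simps)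
      finally show ?thesis using q_neq_1 by (simp add: g11_def power2_eq_square)
    qed
    moreover have "removal_weight lam r = q1 / (1 - q1)^2 * other_rows (\<lambda>c. 1 - c / (?W r / q1)) T lam {r}"
      using edge_pair_product[of ?m r T] True lam rr bm unfolding P removal_weight_def o wm(1) by simp
    ultimately show ?thesis using rB unfolding resB[OF rB] by simp
  next
    case False
    have "removal_weight lam r = 0"
      using False supportedD[OF supported_ee, of "minus_box lam r" r] unfolding removal_weight_def by auto
    moreover have "res (Inr r) = 0" if rB: "r \<in> B'"
    proof -
      have n: "?W r / q1 \<notin> I0" using rB by (simp add: B'_def)
      from removal_blocked_by[OF lam bT r False] show ?thesis
      proof (elim disjE bexE)
        fix \<rho> assume "\<rho> \<in> ?R" "?W r / q1 = q3 * ?W \<rho>"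
        then show ?thesis using n rB by (intro res0[of "Inl \<rho>"]) (auto simp: C'_def \<alpha>_def \<pi>_def)
      next
        fix \<rho> assume "\<rho> \<in> ?R1" "?W r / q1 = q2 * ?W \<rho>"
        then show ?thesis using n rB by (intro res0[of "Inr \<rho>"]) (auto simp: D'_def \<alpha>_def \<pi>_def)
      qed
    qed
    ultimately show ?thesis by simp
  qed
  have "(\<Sum>r\<in>A'. res (Inl r) * ?W r powi k) = (\<Sum>r\<in>?R1. (if r \<in> A' then res (Inl r) else 0) * ?W r powi k)"
    by (rule sum.mono_neutral_cong_left) (auto simp: A'_def)
  also have "\<dots> = - g11 * (\<Sum>r\<in>?R1. ee lam r * ff lam r * ?W r powi k)"
    unfolding sum_distrib_left by (intro sum.cong refl) (simp add: claimA mult.assoc)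
  finally have SA: "(\<Sum>r\<in>A'. res (Inl r) * ?W r powi k) = \<dots>" .
  have "(\<Sum>r\<in>B'. res (Inr r) * (?W r / q1) powi k) = (\<Sum>r\<in>?R. (if r \<in> B' then res (Inr r) else 0) * (?W r / q1) powi k)"
    by (rule sum.mono_neutral_cong_left) (auto simp: B'_def)
  also have "\<dots> = g11 * (\<Sum>r\<in>?R. removal_weight lam r * (?W r / q1) powi k)"
    unfolding sum_distrib_left by (intro sum.cong refl) (simp add: claimB mult.assoc)
  finally have SB: "(\<Sum>r\<in>B'. res (Inr r) * (?W r / q1) powi k) = \<dots>" .
  have "g11 \<noteq> 0" using q_neq_1 by (simp add: g11_def)
  moreover have cancel: "1 / x * (- x * a + x * b) = b - a" if "x \<noteq> 0" for x a b :: complex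
    using that by (simp add: field_simps)
  ultimately show ?thesis unfolding diff' SA SB by simp
qed

end

section \<open>The operators of the module\<close>

definition delta :: "ptuple \<Rightarrow> ptuple \<Rightarrow> complex" where
  "delta lam = (\<lambda>mu. if mu = lam then 1 else 0)"

text \<open>
  Operators are handled on all finitely supported functions; the module is the part supported on the basis.
\<close>

definition finitely_supported :: "(ptuple \<Rightarrow> complex) \<Rightarrow> bool" where
  "finitely_supported x \<longleftrightarrow> finite {lam. x lam \<noteq> 0}"

lemma finitely_supported_delta [simp]: "finitely_supported (delta lam)"
  by (simp add: finitely_supported_def delta_def)

lemma finitely_supported_add: "finitely_supported x \<Longrightarrow> finitely_supported y \<Longrightarrow> finitely_supported (x + y)"
  unfolding finitely_supported_def
  by (rule finite_subset[of _ "{lam. x lam \<noteq> 0} \<union> {lam. y lam \<noteq> 0}"]) auto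

lemma finitely_supported_scale: "finitely_supported x \<Longrightarrow> finitely_supported (fun_scale c x)"
  unfolding finitely_supported_def fun_scale_def by (rule finite_subset[rotated]) auto

lemma finitely_supported_sum: "(\<And>t. t \<in> S \<Longrightarrow> finitely_supported (x t)) \<Longrightarrow> finitely_supported (\<Sum>t\<in>S. x t)"
proof (induction S rule: infinite_finite_induct)
  case (insert t F)
  show ?case unfolding sum.insert[OF insert(1,2)]
    by (rule finitely_supported_add) (use insert in blast)+
qed (simp_all add: finitely_supported_def)

lemma sum_fun_apply: "(\<Sum>t\<in>S. x t) mu = (\<Sum>t\<in>S. x t mu)" for x :: "'t \<Rightarrow> ptuple \<Rightarrow> complex"
  by (induction S rule: infinite_finite_induct) simp_all

lemma vector_space_fun_scale: "vector_space (fun_scale :: complex \<Rightarrow> (ptuple \<Rightarrow> complex) \<Rightarrow> _)"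
  by unfold_locales (auto simp: fun_scale_def algebra_simps fun_eq_iff)

context resonance
begin

abbreviation V :: "(ptuple \<Rightarrow> complex) set" where "V \<equiv> free_space B"

definition act :: "gen \<Rightarrow> (ptuple \<Rightarrow> complex) \<Rightarrow> ptuple \<Rightarrow> complex" where
  "act x = resonant_action q1 q3 u n a b x"

lemma in_V: "x \<in> V \<longleftrightarrow> finitely_supported x \<and> (\<forall>lam. lam \<notin> B \<longrightarrow> x lam = 0)"
  by (auto simp: free_space_def finitely_supported_def)

lemma V_finitely_supported: "x \<in> V \<Longrightarrow> finitely_supported x"
  by (simp add: in_V)

lemma act_def': "act x y mu = (if mu \<in> B then \<Sum>lam\<in>{lam\<in>B. y lam \<noteq> 0}. entry mu x lam * y lam else 0)"
  by (simp add: act_def resonant_action_def matrix_operator_def entry_def B_def)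

lemma act_superset:
  assumes "finite S" "\<And>lam. lam \<in> B \<Longrightarrow> y lam \<noteq> 0 \<Longrightarrow> lam \<in> S" "mu \<in> B"
  shows "act x y mu = (\<Sum>lam\<in>{lam\<in>S. lam \<in> B}. entry mu x lam * y lam)"
proof -
  have "(\<Sum>lam\<in>{lam\<in>B. y lam \<noteq> 0}. entry mu x lam * y lam) = (\<Sum>lam\<in>{lam\<in>S. lam \<in> B}. entry mu x lam * y lam)"
    using assms by (intro sum.mono_neutral_left) auto
  then show ?thesis using assms(3) by (simp add: act_def')
qed

lemma act_add:
  assumes "finitely_supported y" "finitely_supported z"
  shows "act x (y + z) = act x y + act x z"
proof
  fix mu
  define S where "S = {lam. y lam \<noteq> 0} \<union> {lam. z lam \<noteq> 0}"
  have S: "finite S" using assms by (simp add: S_def finitely_supported_def)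
  show "act x (y + z) mu = (act x y + act x z) mu"
  proof (cases "mu \<in> B")
    case True
    have "act x (y + z) mu = (\<Sum>lam\<in>{lam\<in>S. lam \<in> B}. entry mu x lam * (y + z) lam)"
      by (rule act_superset[OF S _ True]) (auto simp: S_def)
    also have "\<dots> = (\<Sum>lam\<in>{lam\<in>S. lam \<in> B}. entry mu x lam * y lam) + (\<Sum>lam\<in>{lam\<in>S. lam \<in> B}. entry mu x lam * z lam)"
      by (simp add: sum.distrib distrib_left)
    also have "(\<Sum>lam\<in>{lam\<in>S. lam \<in> B}. entry mu x lam * y lam) = act x y mu"
      by (rule act_superset[OF S _ True, symmetric]) (auto simp: S_def)
    also have "(\<Sum>lam\<in>{lam\<in>S. lam \<in> B}. entry mu x lam * z lam) = act x z mu"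
      by (rule act_superset[OF S _ True, symmetric]) (auto simp: S_def)
    finally show ?thesis unfolding plus_fun_def .
  qed (simp add: act_def')
qed

lemma act_scale: "act x (fun_scale c y) = fun_scale c (act x y)"
proof (cases "c = 0")
  case False
  show ?thesis
  proof
    fix mu
    have "{lam \<in> B. fun_scale c y lam \<noteq> 0} = {lam \<in> B. y lam \<noteq> 0}" using False by (simp add: fun_scale_def)
    then show "act x (fun_scale c y) mu = fun_scale c (act x y) mu"
      unfolding act_def' by (simp add: fun_scale_def sum_distrib_left mult_ac)
  qed
qed (auto simp: act_def' fun_scale_def fun_eq_iff)

lemma act_delta: "act x (delta lam) mu = (if mu \<in> B \<and> lam \<in> B then entry mu x lam else 0)"
proof (cases "mu \<in> B")
  case True
  have "act x (delta lam) mu = (\<Sum>k\<in>{k\<in>{lam}. k \<in> B}. entry mu x k * delta lam k)"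
    using True by (intro act_superset) (auto simp: delta_def split: if_splits)
  also have "{k\<in>{lam}. k \<in> B} = (if lam \<in> B then {lam} else {})" by auto
  finally show ?thesis using True by (simp add: delta_def)
qed (simp add: act_def')

text \<open>
  An operator sends a basis vector to a finite combination: a tuple has finitely many addable rows.
\<close>

lemma column_finite:
  assumes "lam \<in> B"
  shows "finite {mu\<in>B. entry mu x lam \<noteq> 0}"
proof -
  obtain T where T: "bounded_by T lam" using B_bounded[OF assms] by blast
  have "{mu\<in>B. entry mu x lam \<noteq> 0} \<subseteq> {lam} \<union> plus_box lam ` row_set (Suc T) \<union> minus_box lam ` row_set (Suc T)"
  proof
    fix mu assume mu: "mu \<in> {mu\<in>B. entry mu x lam \<noteq> 0}"
    show "mu \<in> {lam} \<union> plus_box lam ` row_set (Suc T) \<union> minus_box lam ` row_set (Suc T)"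
    proof (cases x)
      case (Gen_e k)
      then obtain r where r: "r \<in> rows" "mu = plus_box lam r" using entry_e_0[of mu lam k] mu by auto
      then have "snd r \<le> Suc T" using addable_bound[OF assms _ r(1) T] mu by simp
      then show ?thesis using r by (simp add: in_row_set)
    next
      case (Gen_f k)
      then obtain r where r: "r \<in> rows" "lam = plus_box mu r" using entry_f_0[of lam mu k] mu by auto
      then have "snd r \<le> T" using T bounded_by_plus_box by blast
      moreover have "minus_box lam r = mu" unfolding r(2)
        by (cases r) (auto simp: minus_box_def plus_box_apply fun_eq_iff)
      ultimately show ?thesis using r(1) by (force simp: in_row_set)
    qed (use mu entry_psi[OF assms, of mu] in \<open>auto split: if_splits\<close>)
  qed
  then show ?thesis by (rule finite_subset) simp
qed

lemma act_in_V:
  assumes "finitely_supported y" shows "act x y \<in> V"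
proof -
  have "{mu. act x y mu \<noteq> 0} \<subseteq> (\<Union>lam\<in>{lam\<in>B. y lam \<noteq> 0}. {mu\<in>B. entry mu x lam \<noteq> 0})"
  proof
    fix mu assume "mu \<in> {mu. act x y mu \<noteq> 0}"
    then have "mu \<in> B" "(\<Sum>lam\<in>{lam\<in>B. y lam \<noteq> 0}. entry mu x lam * y lam) \<noteq> 0"
      by (auto simp: act_def' split: if_splits)
    then obtain lam where "lam \<in> B" "y lam \<noteq> 0" "entry mu x lam * y lam \<noteq> 0"
      using sum.neutral[of "{lam\<in>B. y lam \<noteq> 0}" "\<lambda>lam. entry mu x lam * y lam"] by blast
    then show "mu \<in> (\<Union>lam\<in>{lam\<in>B. y lam \<noteq> 0}. {mu\<in>B. entry mu x lam \<noteq> 0})" using \<open>mu \<in> B\<close> by auto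
  qed
  moreover have "finite (\<Union>lam\<in>{lam\<in>B. y lam \<noteq> 0}. {mu\<in>B. entry mu x lam \<noteq> 0})"
    using assms column_finite by (auto simp: finitely_supported_def)
  ultimately have "finitely_supported (act x y)" unfolding finitely_supported_def by (rule finite_subset)
  then show ?thesis by (simp add: in_V act_def')
qed

lemma delta_in_V: "lam \<in> B \<Longrightarrow> delta lam \<in> V"
  unfolding in_V using finitely_supported_delta by (auto simp: delta_def)

lemma V_expand:
  assumes "finitely_supported x"
  shows "x = (\<Sum>lam\<in>{lam. x lam \<noteq> 0}. fun_scale (x lam) (delta lam))"
proof
  fix mu
  have "(\<Sum>lam\<in>{lam. x lam \<noteq> 0}. fun_scale (x lam) (delta lam) mu) = (\<Sum>lam\<in>{lam. x lam \<noteq> 0}. if lam = mu then x mu else 0)"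
    by (intro sum.cong) (auto simp: fun_scale_def delta_def)
  also have "\<dots> = x mu" using assms by (simp add: finitely_supported_def)
  finally show "x mu = (\<Sum>lam\<in>{lam. x lam \<noteq> 0}. fun_scale (x lam) (delta lam)) mu"
    by (simp add: sum_fun_apply)
qed

subsection \<open>Reduction to basis vectors\<close>

definition linear_op :: "((ptuple \<Rightarrow> complex) \<Rightarrow> ptuple \<Rightarrow> complex) \<Rightarrow> bool" where
  "linear_op L \<longleftrightarrow> (\<forall>x. finitely_supported x \<longrightarrow> finitely_supported (L x)) \<and>
     (\<forall>x y. finitely_supported x \<longrightarrow> finitely_supported y \<longrightarrow> L (x + y) = L x + L y) \<and>
     (\<forall>c x. finitely_supported x \<longrightarrow> L (fun_scale c x) = fun_scale c (L x))"

lemma linear_op_act: "linear_op (act x)"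
  using act_in_V V_finitely_supported by (auto simp: linear_op_def act_add act_scale)

lemma linear_op_comp: "linear_op L \<Longrightarrow> linear_op M \<Longrightarrow> linear_op (\<lambda>v. L (M v))"
  by (simp add: linear_op_def)

lemma linear_op_zero: "linear_op (\<lambda>v. 0)"
  by (auto simp: linear_op_def finitely_supported_def fun_scale_def fun_eq_iff)

lemma linear_op_scale: "linear_op L \<Longrightarrow> linear_op (\<lambda>v. fun_scale c (L v))"
  unfolding linear_op_def using finitely_supported_scale
  by (auto simp: fun_scale_def fun_eq_iff algebra_simps)

lemma linear_op_add: "linear_op L \<Longrightarrow> linear_op M \<Longrightarrow> linear_op (\<lambda>v. L v + M v)"
  unfolding linear_op_def using finitely_supported_add
  by (auto simp: fun_scale_def fun_eq_iff algebra_simps)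

lemma linear_op_diff: "linear_op L \<Longrightarrow> linear_op M \<Longrightarrow> linear_op (\<lambda>v. L v - M v)"
proof -
  assume LM: "linear_op L" "linear_op M"
  have "(\<lambda>v. L v - M v) = (\<lambda>v. L v + fun_scale (-1) (M v))"
    by (auto simp: fun_scale_def fun_eq_iff)
  then show ?thesis using linear_op_add[OF LM(1) linear_op_scale[OF LM(2), of "-1"]] by simp
qed

text \<open>
  Relations between operators may be checked on basis vectors.
\<close>

lemma linear_op_eqI:
  assumes L: "linear_op L" and M: "linear_op M" and eq: "\<And>lam. lam \<in> B \<Longrightarrow> L (delta lam) = M (delta lam)"
    and x: "x \<in> V"
  shows "L x = M x"
proof -
  have ext: "L (\<Sum>t\<in>S. fun_scale (c t) (delta t)) = (\<Sum>t\<in>S. fun_scale (c t) (L (delta t)))"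
    if L: "linear_op L" and "finite S" for L S c
    using that(2)
  proof (induction S)
    case empty
    have "L (fun_scale 0 (delta undefined)) = fun_scale 0 (L (delta undefined))"
      using L by (simp add: linear_op_def)
    moreover have z: "fun_scale 0 y = 0" for y :: "ptuple \<Rightarrow> complex" by (auto simp: fun_scale_def)
    ultimately have "L 0 = 0" unfolding z by blast
    then show ?case unfolding sum.empty .
  next
    case (insert t F)
    have "finitely_supported (\<Sum>t\<in>F. fun_scale (c t) (delta t))"
      by (intro finitely_supported_sum finitely_supported_scale) simp
    then have "L (fun_scale (c t) (delta t) + (\<Sum>t\<in>F. fun_scale (c t) (delta t)))
        = L (fun_scale (c t) (delta t)) + L (\<Sum>t\<in>F. fun_scale (c t) (delta t))"
      using L finitely_supported_scale[OF finitely_supported_delta] unfolding linear_op_def by blast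
    moreover have "L (fun_scale (c t) (delta t)) = fun_scale (c t) (L (delta t))"
      using L by (simp add: linear_op_def)
    ultimately show ?case using insert.IH unfolding sum.insert[OF insert(1,2)] by (simp only:)
  qed
  have fin: "finitely_supported x" "finite {lam. x lam \<noteq> 0}" using x by (simp_all add: in_V finitely_supported_def)
  have "lam \<in> B" if "x lam \<noteq> 0" for lam using x that by (auto simp: in_V)
  then show ?thesis
    by (subst (1 2) V_expand[OF fin(1)]) (simp add: ext[OF L fin(2)] ext[OF M fin(2)] eq)
qed

subsection \<open>Explicit form of the raising and lowering operators\<close>

text \<open>
  Rows beyond the first empty one of each partition cannot be lengthened, so one finite set of rows serves
  for every mode.
\<close>

lemma act_e_delta:
  assumes "lam \<in> B \<Longrightarrow> bounded_by T lam"
  shows "act (Gen_e k) (delta lam) = (\<Sum>r\<in>row_set (Suc T). fun_scale (ee lam r * wt lam r powi k) (delta (plus_box lam r)))"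
proof
  fix mu
  have sum: "(\<Sum>r\<in>row_set (Suc T). fun_scale (ee lam r * wt lam r powi k) (delta (plus_box lam r))) mu
      = (\<Sum>r\<in>row_set (Suc T). if plus_box lam r = mu then ee lam r * wt lam r powi k else 0)"
    unfolding sum_fun_apply by (intro sum.cong) (auto simp: fun_scale_def delta_def)
  show "act (Gen_e k) (delta lam) mu = (\<Sum>r\<in>row_set (Suc T). fun_scale (ee lam r * wt lam r powi k) (delta (plus_box lam r))) mu"
  proof (cases "lam \<in> B \<and> mu \<in> B \<and> (\<exists>r\<in>rows. mu = plus_box lam r)")
    case True
    then obtain r where r: "r \<in> rows" "mu = plus_box lam r" "lam \<in> B" "plus_box lam r \<in> B" by blast
    have "snd r \<le> Suc T" using addable_bound[OF r(3,4,1) assms[OF r(3)]] by simp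
    then have "r \<in> row_set (Suc T)" using r(1) by (simp add: in_row_set)
    then have "(\<Sum>r'\<in>row_set (Suc T). if plus_box lam r' = mu then ee lam r' * wt lam r' powi k else 0) = ee lam r * wt lam r powi k"
      unfolding r(2) plus_box_inject' by simp
    moreover have "act (Gen_e k) (delta lam) mu = wt lam r powi k * ee lam r"
      unfolding act_delta r(2) using r(3,4) entry_e[OF r(3,4,1)] by simp
    ultimately show ?thesis unfolding sum by simp
  next
    case False
    have "(if plus_box lam r = mu then ee lam r * wt lam r powi k else 0) = 0" if "r \<in> row_set (Suc T)" for r
      using that False supportedD[OF supported_ee, of lam r] by (auto simp: in_row_set)
    then have "(\<Sum>r\<in>row_set (Suc T). if plus_box lam r = mu then ee lam r * wt lam r powi k else 0) = 0"
      by (intro sum.neutral) blast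
    moreover have "act (Gen_e k) (delta lam) mu = 0"
      unfolding act_delta using False entry_e_0[of mu lam k] by auto
    ultimately show ?thesis unfolding sum by simp
  qed
qed

text \<open>
  Read coordinatewise, \<open>f\<close> lengthens rows just as \<open>e\<close> does on basis vectors. In
  this form the relations for \<open>f\<close> follow from the same lemmas as those for \<open>e\<close>.
\<close>

lemma act_f:
  assumes T: "mu \<in> B \<Longrightarrow> bounded_by T mu" and x: "finitely_supported x"
  shows "act (Gen_f k) x mu = (\<Sum>r\<in>row_set (Suc T). ff mu r * wt mu r powi k * x (plus_box mu r))"
proof (cases "mu \<in> B")
  case True
  have supp: "finite {lam\<in>B. x lam \<noteq> 0}" using x by (simp add: finitely_supported_def)
  let ?R = "{r\<in>row_set (Suc T). plus_box mu r \<in> B \<and> x (plus_box mu r) \<noteq> 0}"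
  have inj: "inj_on (plus_box mu) ?R" by (auto simp: inj_on_def plus_box_inject')
  have "act (Gen_f k) x mu = (\<Sum>lam\<in>{lam\<in>B. x lam \<noteq> 0}. entry mu (Gen_f k) lam * x lam)" using True by (simp add: act_def')
  also have "\<dots> = (\<Sum>lam\<in>plus_box mu ` ?R. entry mu (Gen_f k) lam * x lam)"
  proof (rule sum.mono_neutral_right[OF supp])
    show "plus_box mu ` ?R \<subseteq> {lam\<in>B. x lam \<noteq> 0}" by auto
    show "\<forall>lam\<in>{lam\<in>B. x lam \<noteq> 0} - plus_box mu ` ?R. entry mu (Gen_f k) lam * x lam = 0"
    proof
      fix lam assume lam: "lam \<in> {lam\<in>B. x lam \<noteq> 0} - plus_box mu ` ?R"
      have "lam \<noteq> plus_box mu r" if "r \<in> rows" for r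
      proof
        assume eq: "lam = plus_box mu r"
        then have "snd r \<le> Suc T" using addable_bound[OF True _ that T[OF True]] lam by simp
        then have "r \<in> ?R" using lam eq that by (simp add: in_row_set)
        then show False using lam eq by blast
      qed
      then show "entry mu (Gen_f k) lam * x lam = 0" using entry_f_0[of lam mu k] by simp
    qed
  qed
  also have "\<dots> = (\<Sum>r\<in>?R. entry mu (Gen_f k) (plus_box mu r) * x (plus_box mu r))"
    by (simp add: sum.reindex[OF inj])
  also have "\<dots> = (\<Sum>r\<in>?R. ff mu r * wt mu r powi k * x (plus_box mu r))"
    using entry_f[OF True] by (intro sum.cong) (auto simp: in_row_set)
  also have "\<dots> = (\<Sum>r\<in>row_set (Suc T). ff mu r * wt mu r powi k * x (plus_box mu r))"
    using supportedD[OF supported_ff, of mu] by (intro sum.mono_neutral_left) auto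
  finally show ?thesis .
next
  case False
  then have "ff mu r = 0" for r using supportedD[OF supported_ff, of mu r] by blast
  then show ?thesis using False by (simp add: act_def')
qed

lemma act_psi:
  assumes "x \<in> V"
  shows "act (Gen_psip k) x mu = eigenvalue True mu k * x mu" "act (Gen_psim k) x mu = eigenvalue False mu k * x mu"
    "act Gen_psip0_inv x mu = inverse (eigenvalue True mu 0) * x mu"
    "act Gen_psim0_inv x mu = inverse (eigenvalue False mu 0) * x mu"
proof -
  have supp: "finite {lam\<in>B. x lam \<noteq> 0}" using assms by (simp add: in_V finitely_supported_def)
  have diag: "act g x mu = d mu * x mu" if "\<And>lam. lam \<in> B \<Longrightarrow> entry mu g lam = (if mu = lam then d lam else 0)" for g d
  proof (cases "mu \<in> B")
    case True
    have "act g x mu = (\<Sum>lam\<in>{lam\<in>B. x lam \<noteq> 0}. if mu = lam then d mu * x mu else 0)"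
      unfolding act_def' using True that by (auto intro!: sum.cong)
    then show ?thesis using True supp by simp
  next
    case False
    then show ?thesis using assms by (simp add: act_def' in_V)
  qed
  show "act (Gen_psip k) x mu = eigenvalue True mu k * x mu" "act (Gen_psim k) x mu = eigenvalue False mu k * x mu"
    "act Gen_psip0_inv x mu = inverse (eigenvalue True mu 0) * x mu"
    "act Gen_psim0_inv x mu = inverse (eigenvalue False mu 0) * x mu"
    using entry_psi by (auto intro!: diag)
qed

subsection \<open>Coefficients of products with the structure function\<close>

sublocale M: toroidal_action q1 q2 q3 fun_scale V act .

text \<open>
  If an operator product is a sum of delta functions in both variables, multiplication by a polynomial in
  \<open>z, w\<close> is multiplication of each term by its value at the support.
\<close>

lemma mul_z_minus_sum:
  assumes "\<And>i j. A i j v mu = (\<Sum>t\<in>S. K t * \<alpha> t powi i * \<beta> t powi j)" "\<And>t. t \<in> S \<Longrightarrow> \<alpha> t \<noteq> 0 \<and> \<beta> t \<noteq> 0"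
  shows "mul_z_minus fun_scale q A i j v mu = (\<Sum>t\<in>S. (K t * (\<alpha> t - q * \<beta> t)) * \<alpha> t powi i * \<beta> t powi j)"
proof -
  have "mul_z_minus fun_scale q A i j v mu = A (i + 1) j v mu - q * A i (j + 1) v mu"
    by (simp add: mul_z_minus_def fun_scale_def)
  also have "\<dots> = (\<Sum>t\<in>S. K t * \<alpha> t powi (i + 1) * \<beta> t powi j - q * (K t * \<alpha> t powi i * \<beta> t powi (j + 1)))"
    unfolding assms(1) by (simp only: sum_subtractf sum_distrib_left)
  also have "\<dots> = (\<Sum>t\<in>S. (K t * (\<alpha> t - q * \<beta> t)) * \<alpha> t powi i * \<beta> t powi j)"
  proof (intro sum.cong refl)
    fix t assume t: "t \<in> S"
    have p: "\<alpha> t powi (i + 1) = \<alpha> t powi i * \<alpha> t" "\<beta> t powi (j + 1) = \<beta> t powi j * \<beta> t"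
      using assms(2)[OF t] by (simp_all add: power_int_add_1)
    show "K t * \<alpha> t powi (i + 1) * \<beta> t powi j - q * (K t * \<alpha> t powi i * \<beta> t powi (j + 1))
      = K t * (\<alpha> t - q * \<beta> t) * \<alpha> t powi i * \<beta> t powi j"
      unfolding p by (simp only: algebra_simps)
  qed
  finally show ?thesis .
qed

lemma mul_w_minus_sum:
  assumes "\<And>i j. A i j v mu = (\<Sum>t\<in>S. K t * \<alpha> t powi i * \<beta> t powi j)" "\<And>t. t \<in> S \<Longrightarrow> \<alpha> t \<noteq> 0 \<and> \<beta> t \<noteq> 0"
  shows "mul_w_minus fun_scale q A i j v mu = (\<Sum>t\<in>S. (K t * (\<beta> t - q * \<alpha> t)) * \<alpha> t powi i * \<beta> t powi j)"
proof -
  have "mul_w_minus fun_scale q A i j v mu = A i (j + 1) v mu - q * A (i + 1) j v mu"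
    by (simp add: mul_w_minus_def fun_scale_def)
  also have "\<dots> = (\<Sum>t\<in>S. K t * \<alpha> t powi i * \<beta> t powi (j + 1) - q * (K t * \<alpha> t powi (i + 1) * \<beta> t powi j))"
    unfolding assms(1) by (simp only: sum_subtractf sum_distrib_left)
  also have "\<dots> = (\<Sum>t\<in>S. (K t * (\<beta> t - q * \<alpha> t)) * \<alpha> t powi i * \<beta> t powi j)"
  proof (intro sum.cong refl)
    fix t assume t: "t \<in> S"
    have p: "\<alpha> t powi (i + 1) = \<alpha> t powi i * \<alpha> t" "\<beta> t powi (j + 1) = \<beta> t powi j * \<beta> t"
      using assms(2)[OF t] by (simp_all add: power_int_add_1)
    show "K t * \<alpha> t powi i * \<beta> t powi (j + 1) - q * (K t * \<alpha> t powi (i + 1) * \<beta> t powi j)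
      = K t * (\<beta> t - q * \<alpha> t) * \<alpha> t powi i * \<beta> t powi j"
      unfolding p by (simp only: algebra_simps)
  qed
  finally show ?thesis .
qed

lemma mul_g_zw_sum:
  assumes A: "\<And>i j. A i j v mu = (\<Sum>t\<in>S. K t * \<alpha> t powi i * \<beta> t powi j)" and nz: "\<And>t. t \<in> S \<Longrightarrow> \<alpha> t \<noteq> 0 \<and> \<beta> t \<noteq> 0"
  shows "M.mul_g_zw A i j v mu = (\<Sum>t\<in>S. K t * g (\<alpha> t) (\<beta> t) * \<alpha> t powi i * \<beta> t powi j)"
proof -
  have "M.mul_g_zw A i j v mu = (\<Sum>t\<in>S. (K t * (\<alpha> t - q3 * \<beta> t) * (\<alpha> t - q2 * \<beta> t) * (\<alpha> t - q1 * \<beta> t)) * \<alpha> t powi i * \<beta> t powi j)"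
    unfolding M.mul_g_zw_def by (intro mul_z_minus_sum A nz)
  then show ?thesis by (simp add: g_poly_def mult_ac)
qed

lemma mul_g_wz_sum:
  assumes A: "\<And>i j. A i j v mu = (\<Sum>t\<in>S. K t * \<alpha> t powi i * \<beta> t powi j)" and nz: "\<And>t. t \<in> S \<Longrightarrow> \<alpha> t \<noteq> 0 \<and> \<beta> t \<noteq> 0"
  shows "M.mul_g_wz A i j v mu = (\<Sum>t\<in>S. K t * g (\<beta> t) (\<alpha> t) * \<alpha> t powi i * \<beta> t powi j)"
proof -
  have "M.mul_g_wz A i j v mu = (\<Sum>t\<in>S. (K t * (\<beta> t - q3 * \<alpha> t) * (\<beta> t - q2 * \<alpha> t) * (\<beta> t - q1 * \<alpha> t)) * \<alpha> t powi i * \<beta> t powi j)"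
    unfolding M.mul_g_wz_def by (intro mul_w_minus_sum A nz)
  then show ?thesis by (simp add: g_poly_def mult_ac)
qed

text \<open>
  The summand is antisymmetric under exchanging the two rows, by the exchange rule; on the diagonal the
  second box has weight \<open>q1\<close> times the first and \<open>g\<close> vanishes.
\<close>

lemma quadratic_sum_zero:
  assumes G: "exchange G" and R: "R \<subseteq> rows" "finite R"
  shows "(\<Sum>(r, r')\<in>R \<times> R. G lam r * G (plus_box lam r) r' * Y (plus_box (plus_box lam r) r')
    * g (wt (plus_box lam r) r') (wt lam r)
    * (wt (plus_box lam r) r' powi i * wt lam r powi j + wt lam r powi i * wt (plus_box lam r) r' powi j)) = (0 :: complex)"
proof -
  define H where "H r r' = G lam r * G (plus_box lam r) r' * Y (plus_box (plus_box lam r) r')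
    * g (wt (plus_box lam r) r') (wt lam r)
    * (wt (plus_box lam r) r' powi i * wt lam r powi j + wt lam r powi i * wt (plus_box lam r) r' powi j)" for r r'
  have anti: "H r' r = - H r r'" if "r \<in> R" "r' \<in> R" for r r'
  proof (cases "r = r'")
    case True
    have "g (wt (plus_box lam r) r) (wt lam r) = 0" by (simp add: wt_plus_box g_poly_def)
    then show ?thesis unfolding True H_def by simp
  next
    case False
    have w: "wt (plus_box lam r) r' = wt lam r'" "wt (plus_box lam r') r = wt lam r" using False by (simp_all add: wt_plus_box)
    have x: "g (wt lam r') (wt lam r) * (G lam r * G (plus_box lam r) r')
      + g (wt lam r) (wt lam r') * (G lam r' * G (plus_box lam r') r) = 0"
      using G False that R unfolding exchange_def by blast
    define Z where "Z = Y (plus_box (plus_box lam r) r')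
      * (wt lam r' powi i * wt lam r powi j + wt lam r powi i * wt lam r' powi j)"
    have "H r r' = g (wt lam r') (wt lam r) * (G lam r * G (plus_box lam r) r') * Z"
      unfolding H_def w Z_def by (simp only: mult_ac)
    moreover have "H r' r = g (wt lam r) (wt lam r') * (G lam r' * G (plus_box lam r') r) * Z"
      unfolding H_def w Z_def plus_box_commute[of lam r' r] by (simp only: mult_ac add.commute)
    ultimately have "H r r' + H r' r = 0" using x by (simp flip: distrib_right)
    then show ?thesis by (simp add: eq_neg_iff_add_eq_0 add.commute)
  qed
  have "(\<Sum>r\<in>R. \<Sum>r'\<in>R. H r r') = (\<Sum>r'\<in>R. \<Sum>r\<in>R. H r r')" by (rule sum.swap)
  also have "\<dots> = (\<Sum>r'\<in>R. \<Sum>r\<in>R. - H r' r)" by (intro sum.cong refl anti)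
  also have "\<dots> = - (\<Sum>r\<in>R. \<Sum>r'\<in>R. H r r')" by (simp only: sum_negf)
  finally have "(\<Sum>r\<in>R. \<Sum>r'\<in>R. H r r') = 0" by simp
  then show ?thesis unfolding H_def sum.cartesian_product .
qed

text \<open>
  Summing over all triples of rows, each of the six orders of a triple contributes equally, so six times the
  sum is a sum of the symmetrized terms.
\<close>

lemma cubic_sum_zero:
  assumes G: "supported G" "exchange G" and R: "R \<subseteq> rows"
  shows "(\<Sum>r1\<in>R. \<Sum>r2\<in>R. \<Sum>r3\<in>R. serre_term G lam r1 r2 r3 * Y (plus_box (plus_box (plus_box lam r1) r2) r3)) = (0 :: complex)"
proof -
  define f where "f r1 r2 r3 = serre_term G lam r1 r2 r3 * Y (plus_box (plus_box (plus_box lam r1) r2) r3)" for r1 r2 r3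
  define S where "S = (\<Sum>r1\<in>R. \<Sum>r2\<in>R. \<Sum>r3\<in>R. f r1 r2 r3)"
  have swap12: "(\<Sum>r1\<in>R. \<Sum>r2\<in>R. \<Sum>r3\<in>R. h r2 r1 r3) = (\<Sum>r1\<in>R. \<Sum>r2\<in>R. \<Sum>r3\<in>R. h r1 r2 r3)" for h :: "_ \<Rightarrow> _ \<Rightarrow> _ \<Rightarrow> complex"
    by (rule sum.swap)
  have swap23: "(\<Sum>r1\<in>R. \<Sum>r2\<in>R. \<Sum>r3\<in>R. h r1 r3 r2) = (\<Sum>r1\<in>R. \<Sum>r2\<in>R. \<Sum>r3\<in>R. h r1 r2 r3)" for h :: "_ \<Rightarrow> _ \<Rightarrow> _ \<Rightarrow> complex"
    by (rule sum.cong[OF refl], rule sum.swap)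
  have 1: "(\<Sum>r1\<in>R. \<Sum>r2\<in>R. \<Sum>r3\<in>R. f r2 r1 r3) = S" unfolding S_def by (rule swap12)
  have 2: "(\<Sum>r1\<in>R. \<Sum>r2\<in>R. \<Sum>r3\<in>R. f r1 r3 r2) = S" unfolding S_def by (rule swap23)
  have 3: "(\<Sum>r1\<in>R. \<Sum>r2\<in>R. \<Sum>r3\<in>R. f r3 r1 r2) = S"
    using swap23[of "\<lambda>r1 r2 r3. f r2 r1 r3"] 1 by simp
  have 4: "(\<Sum>r1\<in>R. \<Sum>r2\<in>R. \<Sum>r3\<in>R. f r2 r3 r1) = S"
    using swap12[of "\<lambda>r1 r2 r3. f r1 r3 r2"] 2 by simp
  have 5: "(\<Sum>r1\<in>R. \<Sum>r2\<in>R. \<Sum>r3\<in>R. f r3 r2 r1) = S"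
    using swap12[of "\<lambda>r1 r2 r3. f r3 r1 r2"] 3 by simp
  have com: "plus_box (plus_box (plus_box lam r1) r2) r3 = plus_box (plus_box (plus_box lam r2) r1) r3"
    "plus_box (plus_box (plus_box lam r1) r2) r3 = plus_box (plus_box (plus_box lam r1) r3) r2" for r1 r2 r3
    by (simp_all only: plus_box_commute[of lam r2 r1] plus_box_commute[of "plus_box lam r1" r3 r2])
  \<comment> \<open>the six orders of the same three boxes end in the same tuple\<close>
  have six: "f r1 r2 r3 + f r2 r1 r3 + f r1 r3 r2 + f r3 r1 r2 + f r2 r3 r1 + f r3 r2 r1 = 0"
    if "r1 \<in> R" "r2 \<in> R" "r3 \<in> R" for r1 r2 r3
  proof -
    let ?P = "\<lambda>r1 r2 r3. plus_box (plus_box (plus_box lam r1) r2) r3"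
    have P: "?P r2 r1 r3 = ?P r1 r2 r3" "?P r1 r3 r2 = ?P r1 r2 r3" "?P r3 r1 r2 = ?P r1 r2 r3"
      "?P r2 r3 r1 = ?P r1 r2 r3" "?P r3 r2 r1 = ?P r1 r2 r3"
      by (fact com(1), fact com(2), rule trans[OF com(1) com(2)], rule trans[OF com(2) com(1)],
        rule trans[OF com(1) trans[OF com(2) com(1)]])
    have "f r1 r2 r3 + f r2 r1 r3 + f r1 r3 r2 + f r3 r1 r2 + f r2 r3 r1 + f r3 r2 r1
      = serre_sum G lam r1 r2 r3 * Y (plus_box (plus_box (plus_box lam r1) r2) r3)"
      unfolding f_def P by (simp only: distrib_right)
    then show ?thesis using serre_symmetric[OF G, of r1 r2 r3 lam] that R by (simp only: mult_zero_left subset_iff)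
  qed
  have "6 * S = (\<Sum>r1\<in>R. \<Sum>r2\<in>R. \<Sum>r3\<in>R. f r1 r2 r3 + f r2 r1 r3 + f r1 r3 r2 + f r3 r1 r2 + f r2 r3 r1 + f r3 r2 r1)"
    unfolding sum.distrib 1 2 3 4 5 S_def[symmetric] by simp
  also have "\<dots> = 0" by (intro sum.neutral ballI six)
  finally show ?thesis unfolding S_def f_def by simp
qed

end

section \<open>The defining relations\<close>

context resonance
begin

lemma linear_op_diff_apply:
  assumes "linear_op L" "finitely_supported x" "finitely_supported y"
  shows "L (x - y) = L x - L y"
proof -
  have eq: "z - w = z + fun_scale (-1) w" for z w :: "ptuple \<Rightarrow> complex" by (auto simp: fun_scale_def fun_eq_iff)
  have "L (x + fun_scale (-1) y) = L x + fun_scale (-1) (L y)"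
    using assms finitely_supported_scale by (simp add: linear_op_def)
  then show ?thesis unfolding eq .
qed

lemma linear_op_mul_minus:
  assumes "\<And>i j. linear_op (A i j)"
  shows "linear_op (mul_z_minus fun_scale q A i j)" "linear_op (mul_w_minus fun_scale q A i j)"
  unfolding mul_z_minus_def mul_w_minus_def by (intro linear_op_diff linear_op_scale assms)+

lemma linear_op_mul_g:
  assumes "\<And>i j. linear_op (A i j)"
  shows "linear_op (M.mul_g_zw A i j)" "linear_op (M.mul_g_wz A i j)"
  unfolding M.mul_g_zw_def M.mul_g_wz_def by (intro linear_op_mul_minus assms)+

lemma linear_op_minus: "linear_op L \<Longrightarrow> linear_op (\<lambda>v. - L v)"
proof -
  assume "linear_op L"
  moreover have "(\<lambda>v. - L v) = (\<lambda>v. fun_scale (-1) (L v))" by (auto simp: fun_scale_def fun_eq_iff)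
  ultimately show ?thesis by (simp add: linear_op_scale)
qed

text \<open>
  Room for \<open>k\<close> further boxes: all rows touched while adding \<open>k + 1\<close> boxes to
  \<open>lam\<close> lie among the first \<open>Suc N\<close> of each partition. This fixes one finite index
  set for all sums in a relation.
\<close>

definition reach :: "nat \<Rightarrow> nat \<Rightarrow> ptuple \<Rightarrow> bool" where
  "reach N k lam \<longleftrightarrow> (lam \<in> B \<longrightarrow> (\<exists>T. bounded_by T lam \<and> T + k \<le> N))"

lemma ex_reach: "\<exists>N. reach N k lam"
proof (cases "lam \<in> B")
  case True
  then obtain T where "bounded_by T lam" using B_bounded by blast
  then show ?thesis unfolding reach_def by blast
qed (simp add: reach_def)

lemma reach_bounded:
  assumes "reach N k lam" "lam \<in> B"
  shows "bounded_by N lam"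
proof -
  obtain T where T: "bounded_by T lam" "T + k \<le> N" using assms unfolding reach_def by blast
  show ?thesis using T(2) by (intro bounded_by_mono[OF T(1)]) simp
qed

lemma reach_plus_box:
  assumes "reach N (Suc k) lam" "supported G" "G lam r \<noteq> 0"
  shows "reach N k (plus_box lam r)"
proof -
  have B: "lam \<in> B" "plus_box lam r \<in> B" "r \<in> rows" using supportedD[OF assms(2), of lam r] assms(3) by simp_all
  obtain T where T: "bounded_by T lam" "T + Suc k \<le> N" using assms(1) B(1) unfolding reach_def by blast
  have "snd r \<le> Suc T" using addable_bound[OF B T(1)] by simp
  then have "bounded_by (Suc T) (plus_box lam r)" using bounded_by_mono[OF T(1)] by (simp add: bounded_by_plus_box)
  then show ?thesis unfolding reach_def using T(2) by (intro impI exI[of _ "Suc T"]) simp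
qed

lemmas reach_edge = reach_plus_box[where G = ee, OF _ supported_ee] reach_plus_box[where G = ff, OF _ supported_ff]

lemma act_e_basis:
  assumes "reach N k lam"
  shows "act (Gen_e i) (delta lam) = (\<Sum>r\<in>row_set (Suc N). fun_scale (ee lam r * wt lam r powi i) (delta (plus_box lam r)))"
  using reach_bounded[OF assms] by (rule act_e_delta)

lemma act_f_coordinate:
  assumes "reach N k mu" "finitely_supported x"
  shows "act (Gen_f i) x mu = (\<Sum>r\<in>row_set (Suc N). ff mu r * wt mu r powi i * x (plus_box mu r))"
  using reach_bounded[OF assms(1)] assms(2) by (rule act_f)

lemma act_after_e:
  assumes "reach N k lam" "linear_op L"
  shows "L (act (Gen_e i) (delta lam)) mu
    = (\<Sum>r\<in>row_set (Suc N). ee lam r * wt lam r powi i * L (delta (plus_box lam r)) mu)"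
proof -
  have "L (\<Sum>t\<in>S. fun_scale (c t) (delta (P t))) = (\<Sum>t\<in>S. fun_scale (c t) (L (delta (P t))))"
    if "finite S" for S and c :: "nat \<times> nat \<Rightarrow> complex" and P
    using that
  proof (induction S)
    case empty
    have "L (0 - 0) = L 0 - L 0"
      by (rule linear_op_diff_apply[OF assms(2)]) (simp_all add: finitely_supported_def)
    then show ?case unfolding sum.empty diff_self .
  next
    case (insert t F)
    have fin: "finitely_supported (fun_scale (c t) (delta (P t)))" "finitely_supported (\<Sum>t\<in>F. fun_scale (c t) (delta (P t)))"
      by (intro finitely_supported_sum finitely_supported_scale, simp)+
    have "L (fun_scale (c t) (delta (P t)) + (\<Sum>t\<in>F. fun_scale (c t) (delta (P t))))
        = L (fun_scale (c t) (delta (P t))) + L (\<Sum>t\<in>F. fun_scale (c t) (delta (P t)))"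
      using assms(2) fin unfolding linear_op_def by blast
    moreover have "L (fun_scale (c t) (delta (P t))) = fun_scale (c t) (L (delta (P t)))"
      using assms(2) by (simp add: linear_op_def)
    ultimately show ?case using insert.IH unfolding sum.insert[OF insert(1,2)] by (simp only:)
  qed
  then show ?thesis unfolding act_e_basis[OF assms(1)]
    by (simp add: sum_fun_apply) (simp add: fun_scale_def)
qed

text \<open>
  The outer operator acts on the row \<open>r'\<close> that is lengthened second.
\<close>

lemma act_ee_coordinate:
  assumes "reach N 1 lam"
  shows "act (Gen_e i) (act (Gen_e j) (delta lam)) mu
    = (\<Sum>(r, r')\<in>row_set (Suc N) \<times> row_set (Suc N). ee lam r * ee (plus_box lam r) r' * delta (plus_box (plus_box lam r) r') mu
        * wt (plus_box lam r) r' powi i * wt lam r powi j)"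
proof -
  have "ee lam r * wt lam r powi j * act (Gen_e i) (delta (plus_box lam r)) mu
    = (\<Sum>r'\<in>row_set (Suc N). ee lam r * ee (plus_box lam r) r' * delta (plus_box (plus_box lam r) r') mu
        * wt (plus_box lam r) r' powi i * wt lam r powi j)" (is "?l = ?r") for r
  proof (cases "ee lam r = 0")
    case False
    have "reach N 0 (plus_box lam r)" using reach_edge(1)[OF _ False] assms by simp
    note act_after_e[OF this, of "\<lambda>v. v" i mu]
    moreover have "linear_op (\<lambda>v. v)" by (simp add: linear_op_def)
    ultimately show ?thesis by (simp add: sum_distrib_left mult_ac)
  qed simp
  then show ?thesis unfolding act_after_e[OF assms linear_op_act]
    by (simp only: sum.cartesian_product)
qed

text \<open>
  For \<open>f\<close>, which removes boxes, the outer operator sees the smaller tuple and its mode belongs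
  to \<open>r\<close>; the order of the modes is the reverse of that for \<open>e\<close>.
\<close>

lemma act_ff_coordinate:
  assumes "reach N 1 mu" "finitely_supported x"
  shows "act (Gen_f i) (act (Gen_f j) x) mu
    = (\<Sum>(r, r')\<in>row_set (Suc N) \<times> row_set (Suc N). ff mu r * ff (plus_box mu r) r' * x (plus_box (plus_box mu r) r')
        * wt mu r powi i * wt (plus_box mu r) r' powi j)"
proof -
  have "ff mu r * wt mu r powi i * act (Gen_f j) x (plus_box mu r)
    = (\<Sum>r'\<in>row_set (Suc N). ff mu r * ff (plus_box mu r) r' * x (plus_box (plus_box mu r) r')
        * wt mu r powi i * wt (plus_box mu r) r' powi j)" (is "?l = ?r") for r
  proof (cases "ff mu r = 0")
    case False
    have "reach N 0 (plus_box mu r)" using reach_edge(2)[OF _ False] assms by simp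
    note act_f_coordinate[OF this assms(2), of j]
    then show ?thesis by (simp add: sum_distrib_left mult_ac)
  qed simp
  then show ?thesis unfolding act_f_coordinate[OF assms(1) V_finitely_supported[OF act_in_V[OF assms(2)]]]
    by (simp only: sum.cartesian_product)
qed

lemma act_eee_coordinate:
  assumes "reach N 2 lam"
  shows "act (Gen_e i) (act (Gen_e j) (act (Gen_e k) (delta lam))) mu
    = (\<Sum>r1\<in>row_set (Suc N). \<Sum>r2\<in>row_set (Suc N). \<Sum>r3\<in>row_set (Suc N).
        path_term ee lam r1 r2 r3 * delta (plus_box (plus_box (plus_box lam r1) r2) r3) mu
        * (wt (plus_box (plus_box lam r1) r2) r3 powi i * wt (plus_box lam r1) r2 powi j * wt lam r1 powi k))"
proof -
  have "ee lam r1 * wt lam r1 powi k * act (Gen_e i) (act (Gen_e j) (delta (plus_box lam r1))) mu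
    = (\<Sum>r2\<in>row_set (Suc N). \<Sum>r3\<in>row_set (Suc N).
        path_term ee lam r1 r2 r3 * delta (plus_box (plus_box (plus_box lam r1) r2) r3) mu
        * (wt (plus_box (plus_box lam r1) r2) r3 powi i * wt (plus_box lam r1) r2 powi j * wt lam r1 powi k))" for r1
  proof (cases "ee lam r1 = 0")
    case True
    then show ?thesis by (simp add: path_term_def)
  next
    case False
    have "reach N 1 (plus_box lam r1)" using reach_edge(1)[OF _ False] assms by (simp add: numeral_2_eq_2)
    note act_ee_coordinate[OF this, of i j mu, folded sum.cartesian_product]
    then show ?thesis by (simp add: sum_distrib_left mult_ac path_term_def)
  qed
  then show ?thesis unfolding act_after_e[OF assms linear_op_comp[OF linear_op_act linear_op_act]] by (simp only:)
qed

lemma act_fff_coordinate: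
  assumes "reach N 2 mu" "finitely_supported x"
  shows "act (Gen_f i) (act (Gen_f j) (act (Gen_f k) x)) mu
    = (\<Sum>r1\<in>row_set (Suc N). \<Sum>r2\<in>row_set (Suc N). \<Sum>r3\<in>row_set (Suc N).
        path_term ff mu r1 r2 r3 * x (plus_box (plus_box (plus_box mu r1) r2) r3)
        * (wt mu r1 powi i * wt (plus_box mu r1) r2 powi j * wt (plus_box (plus_box mu r1) r2) r3 powi k))"
proof -
  have fin: "finitely_supported (act g y)" if "finitely_supported y" for g y using V_finitely_supported[OF act_in_V[OF that]] .
  have "ff mu r1 * wt mu r1 powi i * act (Gen_f j) (act (Gen_f k) x) (plus_box mu r1)
    = (\<Sum>r2\<in>row_set (Suc N). \<Sum>r3\<in>row_set (Suc N).
        path_term ff mu r1 r2 r3 * x (plus_box (plus_box (plus_box mu r1) r2) r3)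
        * (wt mu r1 powi i * wt (plus_box mu r1) r2 powi j * wt (plus_box (plus_box mu r1) r2) r3 powi k))" for r1
  proof (cases "ff mu r1 = 0")
    case True
    then show ?thesis by (simp add: path_term_def)
  next
    case False
    have "reach N 1 (plus_box mu r1)" using reach_edge(2)[OF _ False] assms by (simp add: numeral_2_eq_2)
    note act_ff_coordinate[OF this assms(2), of j k, folded sum.cartesian_product]
    then show ?thesis by (simp add: sum_distrib_left mult_ac path_term_def)
  qed
  then show ?thesis unfolding act_f_coordinate[OF assms(1) fin[OF fin[OF assms(2)]]] by (simp only:)
qed

lemma row_set_rows: "row_set T \<subseteq> rows"
  by (auto simp: in_row_set)

lemma wt_row_set_nz: "r \<in> row_set T \<Longrightarrow> wt lam r \<noteq> 0"
  by (rule wt_nz) (simp add: in_row_set)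

lemma relation_ee:
  assumes "x \<in> V"
  shows "M.mul_g_zw (\<lambda>i j. M.e i \<circ> M.e j) i j x = - M.mul_g_wz (\<lambda>i j. M.e j \<circ> M.e i) i j x"
proof -
  have c: "linear_op (M.e i \<circ> M.e j)" for i j
    using linear_op_comp[OF linear_op_act[of "Gen_e i"] linear_op_act[of "Gen_e j"]] by (simp add: M.e_def comp_def)
  have L: "linear_op (M.mul_g_zw (\<lambda>i j. M.e i \<circ> M.e j) i j)" "linear_op (\<lambda>x. - M.mul_g_wz (\<lambda>i j. M.e j \<circ> M.e i) i j x)"
    by (rule linear_op_mul_g(1)[where A = "\<lambda>i j. M.e i \<circ> M.e j", OF c],
      rule linear_op_minus[OF linear_op_mul_g(2)[where A = "\<lambda>i j. M.e j \<circ> M.e i", OF c]])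
  show ?thesis
  proof (rule linear_op_eqI[OF L _ assms])
  fix lam
  show "M.mul_g_zw (\<lambda>i j. M.e i \<circ> M.e j) i j (delta lam) = - M.mul_g_wz (\<lambda>i j. M.e j \<circ> M.e i) i j (delta lam)"
  proof
    fix mu
    obtain N where N: "reach N 1 lam" using ex_reach by blast
    define R where "R = row_set (Suc N)"
    define K where "K = (\<lambda>(r, r'). ee lam r * ee (plus_box lam r) r' * delta (plus_box (plus_box lam r) r') mu)"
    define w where "w = (\<lambda>(r, r' :: nat \<times> nat). wt lam r)"
    define w' where "w' = (\<lambda>(r, r'). wt (plus_box lam r) r')"
    have nz: "w' t \<noteq> 0 \<and> w t \<noteq> 0" "w t \<noteq> 0 \<and> w' t \<noteq> 0" if "t \<in> R \<times> R" for t
      using that by (auto simp: w_def w'_def R_def wt_row_set_nz)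
    have A: "(M.e i \<circ> M.e j) (delta lam) mu = (\<Sum>t\<in>R \<times> R. K t * w' t powi i * w t powi j)" for i j
      unfolding M.e_def comp_def act_ee_coordinate[OF N] R_def K_def w_def w'_def by (intro sum.cong refl) auto
    have A': "(M.e j \<circ> M.e i) (delta lam) mu = (\<Sum>t\<in>R \<times> R. K t * w t powi i * w' t powi j)" for i j
      unfolding A by (simp only: mult_ac)
    have "M.mul_g_zw (\<lambda>i j. M.e i \<circ> M.e j) i j (delta lam) mu + M.mul_g_wz (\<lambda>i j. M.e j \<circ> M.e i) i j (delta lam) mu
      = (\<Sum>t\<in>R \<times> R. K t * g (w' t) (w t) * w' t powi i * w t powi j) + (\<Sum>t\<in>R \<times> R. K t * g (w' t) (w t) * w t powi i * w' t powi j)"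
      by (simp only: mul_g_zw_sum[where A = "\<lambda>i j. M.e i \<circ> M.e j" and K = K and \<alpha> = w' and \<beta> = w and S = "R \<times> R", OF A nz(1)] mul_g_wz_sum[where A = "\<lambda>i j. M.e j \<circ> M.e i" and K = K and \<alpha> = w and \<beta> = w' and S = "R \<times> R", OF A' nz(2)])
    also have "\<dots> = (\<Sum>(r, r')\<in>R \<times> R. ee lam r * ee (plus_box lam r) r' * delta (plus_box (plus_box lam r) r') mu
      * g (wt (plus_box lam r) r') (wt lam r)
      * (wt (plus_box lam r) r' powi i * wt lam r powi j + wt lam r powi i * wt (plus_box lam r) r' powi j))"
      unfolding sum.distrib[symmetric] by (intro sum.cong refl) (auto simp: K_def w_def w'_def algebra_simps)
    also have "\<dots> = 0"
      by (rule quadratic_sum_zero[OF exchange_ee, where Y = "\<lambda>nu. delta nu mu"]) (simp_all add: R_def row_set_rows)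
    finally show "M.mul_g_zw (\<lambda>i j. M.e i \<circ> M.e j) i j (delta lam) mu = (- M.mul_g_wz (\<lambda>i j. M.e j \<circ> M.e i) i j (delta lam)) mu"
      by (simp add: eq_neg_iff_add_eq_0)
  qed
  qed
qed

lemma relation_ff:
  assumes "x \<in> V"
  shows "M.mul_g_wz (\<lambda>i j. M.f i \<circ> M.f j) i j x = - M.mul_g_zw (\<lambda>i j. M.f j \<circ> M.f i) i j x"
proof
  fix mu
  obtain N where N: "reach N 1 mu" using ex_reach by blast
  define R where "R = row_set (Suc N)"
  define K where "K = (\<lambda>(r, r'). ff mu r * ff (plus_box mu r) r' * x (plus_box (plus_box mu r) r'))"
  define w where "w = (\<lambda>(r, r' :: nat \<times> nat). wt mu r)"
  define w' where "w' = (\<lambda>(r, r'). wt (plus_box mu r) r')"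
  have nz: "w' t \<noteq> 0 \<and> w t \<noteq> 0" "w t \<noteq> 0 \<and> w' t \<noteq> 0" if "t \<in> R \<times> R" for t
    using that by (auto simp: w_def w'_def R_def wt_row_set_nz)
  have A: "(M.f i \<circ> M.f j) x mu = (\<Sum>t\<in>R \<times> R. K t * w t powi i * w' t powi j)" for i j
    unfolding M.f_def comp_def act_ff_coordinate[OF N V_finitely_supported[OF assms]] R_def K_def w_def w'_def
    by (intro sum.cong refl) auto
  have A': "(M.f j \<circ> M.f i) x mu = (\<Sum>t\<in>R \<times> R. K t * w' t powi i * w t powi j)" for i j
    unfolding A by (simp only: mult_ac)
  have "M.mul_g_wz (\<lambda>i j. M.f i \<circ> M.f j) i j x mu + M.mul_g_zw (\<lambda>i j. M.f j \<circ> M.f i) i j x mu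
    = (\<Sum>t\<in>R \<times> R. K t * g (w' t) (w t) * w t powi i * w' t powi j) + (\<Sum>t\<in>R \<times> R. K t * g (w' t) (w t) * w' t powi i * w t powi j)"
    by (simp only: mul_g_zw_sum[where A = "\<lambda>i j. M.f j \<circ> M.f i" and K = K and \<alpha> = w' and \<beta> = w and S = "R \<times> R", OF A' nz(1)] mul_g_wz_sum[where A = "\<lambda>i j. M.f i \<circ> M.f j" and K = K and \<alpha> = w and \<beta> = w' and S = "R \<times> R", OF A nz(2)])
  also have "\<dots> = (\<Sum>(r, r')\<in>R \<times> R. ff mu r * ff (plus_box mu r) r' * x (plus_box (plus_box mu r) r')
    * g (wt (plus_box mu r) r') (wt mu r)
    * (wt (plus_box mu r) r' powi i * wt mu r powi j + wt mu r powi i * wt (plus_box mu r) r' powi j))"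
    unfolding sum.distrib[symmetric] by (intro sum.cong refl) (auto simp: K_def w_def w'_def algebra_simps)
  also have "\<dots> = 0"
    by (rule quadratic_sum_zero[OF exchange_ff]) (simp_all add: R_def row_set_rows)
  finally show "M.mul_g_wz (\<lambda>i j. M.f i \<circ> M.f j) i j x mu = (- M.mul_g_zw (\<lambda>i j. M.f j \<circ> M.f i) i j x) mu"
    by (simp add: eq_neg_iff_add_eq_0)
qed

lemma cubic_commutator_expand:
  assumes L: "\<And>i. linear_op (L i)" and x: "finitely_supported x"
  shows "M.commutator (L i) (M.commutator (L j) (L k)) x
    = L i (L j (L k x)) - L i (L k (L j x)) - L j (L k (L i x)) + L k (L j (L i x))"
proof -
  have "finitely_supported (L a (L b x))" for a b using L x by (simp add: linear_op_def)
  then show ?thesis unfolding M.commutator_def by (simp add: linear_op_diff_apply[OF L])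
qed

lemma powi_weights: "x powi 1 = x" "x powi (-1) = inverse x" "x powi 0 = 1" for x :: complex
  by (simp_all add: power_int_minus)

lemma relation_eee:
  assumes "x \<in> V"
  shows "M.commutator (M.e 0) (M.commutator (M.e 1) (M.e (-1))) x = 0"
proof -
  have L: "linear_op (M.e i)" for i unfolding M.e_def by (rule linear_op_act)
  let ?C = "\<lambda>x. M.e 0 (M.e 1 (M.e (-1) x)) - M.e 0 (M.e (-1) (M.e 1 x)) - M.e 1 (M.e (-1) (M.e 0 x)) + M.e (-1) (M.e 1 (M.e 0 x))"
  have "?C x = 0"
  proof (rule linear_op_eqI[OF _ linear_op_zero _ assms, of ?C])
    have "linear_op (\<lambda>x. M.e i (M.e j (M.e k x)))" for i j k
      by (rule linear_op_comp[OF L linear_op_comp[OF L L]])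
    then show "linear_op ?C" by (intro linear_op_add linear_op_diff)
    fix lam
    show "?C (delta lam) = 0"
    proof
      fix mu
      obtain N where N: "reach N 2 lam" using ex_reach by blast
      let ?R = "row_set (Suc N)"
      have "?C (delta lam) mu = (\<Sum>r1\<in>?R. \<Sum>r2\<in>?R. \<Sum>r3\<in>?R.
        serre_term ee lam r1 r2 r3 * delta (plus_box (plus_box (plus_box lam r1) r2) r3) mu)"
        unfolding plus_fun_apply minus_apply M.e_def act_eee_coordinate[OF N] sum.distrib[symmetric] sum_subtractf[symmetric]
        by (intro sum.cong refl) (simp add: powi_weights serre_term_def serre_weight_def divide_inverse algebra_simps)
      also have "\<dots> = 0"
        by (rule cubic_sum_zero[OF supported_ee exchange_ee row_set_rows, where Y = "\<lambda>nu. delta nu mu"])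
      finally show "?C (delta lam) mu = 0 mu" by simp
    qed
  qed
  then show ?thesis unfolding cubic_commutator_expand[where L = M.e, OF L V_finitely_supported[OF assms]] .
qed

lemma relation_fff:
  assumes "x \<in> V"
  shows "M.commutator (M.f 0) (M.commutator (M.f 1) (M.f (-1))) x = 0"
proof -
  have L: "linear_op (M.f i)" for i unfolding M.f_def by (rule linear_op_act)
  show ?thesis unfolding cubic_commutator_expand[where L = M.f, OF L V_finitely_supported[OF assms]]
  proof
    fix mu
    obtain N where N: "reach N 2 mu" using ex_reach by blast
    let ?R = "row_set (Suc N)"
    have "(M.f 0 (M.f 1 (M.f (-1) x)) - M.f 0 (M.f (-1) (M.f 1 x)) - M.f 1 (M.f (-1) (M.f 0 x)) + M.f (-1) (M.f 1 (M.f 0 x))) mu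
      = (\<Sum>r1\<in>?R. \<Sum>r2\<in>?R. \<Sum>r3\<in>?R. serre_term ff mu r1 r2 r3 * x (plus_box (plus_box (plus_box mu r1) r2) r3))"
      unfolding plus_fun_apply minus_apply M.f_def act_fff_coordinate[OF N V_finitely_supported[OF assms]]
        sum.distrib[symmetric] sum_subtractf[symmetric]
      by (intro sum.cong refl) (simp add: powi_weights serre_term_def serre_weight_def divide_inverse algebra_simps)
    also have "\<dots> = 0" by (rule cubic_sum_zero[OF supported_ff exchange_ff row_set_rows])
    finally show "(M.f 0 (M.f 1 (M.f (-1) x)) - M.f 0 (M.f (-1) (M.f 1 x)) - M.f 1 (M.f (-1) (M.f 0 x)) + M.f (-1) (M.f 1 (M.f 0 x))) mu = 0 mu"
      by simp
  qed
qed

definition psi_op :: "bool \<Rightarrow> int \<Rightarrow> (ptuple \<Rightarrow> complex) \<Rightarrow> ptuple \<Rightarrow> complex" where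
  "psi_op s = (if s then M.psi_plus else M.psi_minus)"

lemma psi_op:
  assumes "x \<in> V"
  shows "psi_op s i x mu = psi_mode s mu i * x mu"
proof (cases "mu \<in> B")
  case True
  then show ?thesis using act_psi(1,2)[OF assms]
    by (cases s) (simp_all add: psi_op_def M.psi_plus_def M.psi_minus_def psi_mode_eq[OF True])
next
  case False
  then have "x mu = 0" using assms by (simp add: in_V)
  then show ?thesis using act_psi(1,2)[OF assms]
    by (cases s) (simp_all add: psi_op_def M.psi_plus_def M.psi_minus_def)
qed

lemma linear_op_psi_op: "linear_op (psi_op s i)"
  unfolding psi_op_def M.psi_plus_def M.psi_minus_def using linear_op_act linear_op_zero by simp

lemma psi_op_in_V: "x \<in> V \<Longrightarrow> psi_op s i x \<in> V"
proof -
  assume x: "x \<in> V"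
  have "finitely_supported (psi_op s i x)" using linear_op_psi_op V_finitely_supported[OF x] by (simp add: linear_op_def)
  then show ?thesis using x by (simp add: in_V psi_op)
qed

lemma mul_z_minus_diag:
  assumes "\<And>i j. A i j v mu = (\<Sum>t\<in>S. c t * P t i * \<alpha> t powi j)" "\<And>t. t \<in> S \<Longrightarrow> \<alpha> t \<noteq> 0"
  shows "mul_z_minus fun_scale q A i j v mu = (\<Sum>t\<in>S. c t * z_minus (\<alpha> t) q (P t) i * \<alpha> t powi j)"
proof -
  have "mul_z_minus fun_scale q A i j v mu = A (i + 1) j v mu - q * A i (j + 1) v mu"
    by (simp add: mul_z_minus_def fun_scale_def)
  also have "\<dots> = (\<Sum>t\<in>S. c t * P t (i + 1) * \<alpha> t powi j - q * (c t * P t i * \<alpha> t powi (j + 1)))"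
    unfolding assms(1) by (simp only: sum_subtractf sum_distrib_left)
  also have "\<dots> = (\<Sum>t\<in>S. c t * z_minus (\<alpha> t) q (P t) i * \<alpha> t powi j)"
  proof (intro sum.cong refl)
    fix t assume "t \<in> S"
    then have p: "\<alpha> t powi (j + 1) = \<alpha> t powi j * \<alpha> t" using assms(2) by (simp add: power_int_add_1)
    show "c t * P t (i + 1) * \<alpha> t powi j - q * (c t * P t i * \<alpha> t powi (j + 1)) = c t * z_minus (\<alpha> t) q (P t) i * \<alpha> t powi j"
      unfolding p z_minus_def by (simp only: algebra_simps)
  qed
  finally show ?thesis .
qed

lemma mul_w_minus_diag:
  assumes "\<And>i j. A i j v mu = (\<Sum>t\<in>S. c t * P t i * \<alpha> t powi j)" "\<And>t. t \<in> S \<Longrightarrow> \<alpha> t \<noteq> 0"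
  shows "mul_w_minus fun_scale q A i j v mu = (\<Sum>t\<in>S. c t * v_minus (\<alpha> t) q (P t) i * \<alpha> t powi j)"
proof -
  have "mul_w_minus fun_scale q A i j v mu = A i (j + 1) v mu - q * A (i + 1) j v mu"
    by (simp add: mul_w_minus_def fun_scale_def)
  also have "\<dots> = (\<Sum>t\<in>S. c t * P t i * \<alpha> t powi (j + 1) - q * (c t * P t (i + 1) * \<alpha> t powi j))"
    unfolding assms(1) by (simp only: sum_subtractf sum_distrib_left)
  also have "\<dots> = (\<Sum>t\<in>S. c t * v_minus (\<alpha> t) q (P t) i * \<alpha> t powi j)"
  proof (intro sum.cong refl)
    fix t assume "t \<in> S"
    then have p: "\<alpha> t powi (j + 1) = \<alpha> t powi j * \<alpha> t" using assms(2) by (simp add: power_int_add_1)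
    show "c t * P t i * \<alpha> t powi (j + 1) - q * (c t * P t (i + 1) * \<alpha> t powi j) = c t * v_minus (\<alpha> t) q (P t) i * \<alpha> t powi j"
      unfolding p v_minus_def by (simp only: algebra_simps)
  qed
  finally show ?thesis .
qed

lemma mul_g_diag:
  assumes A: "\<And>i j. A i j v mu = (\<Sum>t\<in>S. c t * P t i * \<alpha> t powi j)" and nz: "\<And>t. t \<in> S \<Longrightarrow> \<alpha> t \<noteq> 0"
  shows "M.mul_g_zw A i j v mu
      = (\<Sum>t\<in>S. c t * z_minus (\<alpha> t) q1 (z_minus (\<alpha> t) q2 (z_minus (\<alpha> t) q3 (P t))) i * \<alpha> t powi j)"
    "M.mul_g_wz A i j v mu
      = (\<Sum>t\<in>S. c t * v_minus (\<alpha> t) q1 (v_minus (\<alpha> t) q2 (v_minus (\<alpha> t) q3 (P t))) i * \<alpha> t powi j)"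
proof -
  note z1 = mul_z_minus_diag[where A = A and c = c and P = P and \<alpha> = \<alpha> and S = S and q = q3, OF A nz]
  note z2 = mul_z_minus_diag[where A = "mul_z_minus fun_scale q3 A" and c = c and P = "\<lambda>t. z_minus (\<alpha> t) q3 (P t)" and \<alpha> = \<alpha> and S = S and q = q2, OF z1 nz]
  show "M.mul_g_zw A i j v mu
      = (\<Sum>t\<in>S. c t * z_minus (\<alpha> t) q1 (z_minus (\<alpha> t) q2 (z_minus (\<alpha> t) q3 (P t))) i * \<alpha> t powi j)"
    unfolding M.mul_g_zw_def
    by (rule mul_z_minus_diag[where P = "\<lambda>t. z_minus (\<alpha> t) q2 (z_minus (\<alpha> t) q3 (P t))" and c = c and \<alpha> = \<alpha> and S = S and q = q1
        and A = "mul_z_minus fun_scale q2 (mul_z_minus fun_scale q3 A)", OF z2 nz])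
  note w1 = mul_w_minus_diag[where A = A and c = c and P = P and \<alpha> = \<alpha> and S = S and q = q3, OF A nz]
  note w2 = mul_w_minus_diag[where A = "mul_w_minus fun_scale q3 A" and c = c and P = "\<lambda>t. v_minus (\<alpha> t) q3 (P t)" and \<alpha> = \<alpha> and S = S and q = q2, OF w1 nz]
  show "M.mul_g_wz A i j v mu
      = (\<Sum>t\<in>S. c t * v_minus (\<alpha> t) q1 (v_minus (\<alpha> t) q2 (v_minus (\<alpha> t) q3 (P t))) i * \<alpha> t powi j)"
    unfolding M.mul_g_wz_def
    by (rule mul_w_minus_diag[where P = "\<lambda>t. v_minus (\<alpha> t) q2 (v_minus (\<alpha> t) q3 (P t))" and c = c and \<alpha> = \<alpha> and S = S and q = q1
        and A = "mul_w_minus fun_scale q2 (mul_w_minus fun_scale q3 A)", OF w2 nz])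
qed

text \<open>
  Each edge contributes separately, and for a single edge this is the behaviour of the eigenvalue under
  adding a box.
\<close>

lemma psi_exchange_sum:
  assumes lam: "lam \<in> B" and R: "R \<subseteq> rows" "finite R"
    and A: "\<And>i j. A i j v mu = (\<Sum>r\<in>R. c r * psi_mode s (plus_box lam r) i * wt lam r powi j)"
    and A': "\<And>i j. A' i j v mu = (\<Sum>r\<in>R. c r * psi_mode s lam i * wt lam r powi j)"
  shows "M.mul_g_zw A i j v mu = - M.mul_g_wz A' i j v mu"
proof -
  have nz: "wt lam r \<noteq> 0" if "r \<in> R" for r by (rule wt_nz[OF subsetD[OF R(1) that]])
  \<comment> \<open>\<open>z_minus\<close> for the larger tuple, \<open>v_minus\<close> for the smaller one\<close>
  have z: "M.mul_g_zw A i j v mu = (\<Sum>t\<in>R. c t * z_minus (wt lam t) q1 (z_minus (wt lam t) q2 (z_minus (wt lam t) q3 (psi_mode s (plus_box lam t)))) i * wt lam t powi j)"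
    by (rule mul_g_diag(1)[where A = A and c = c and P = "\<lambda>t. psi_mode s (plus_box lam t)" and \<alpha> = "wt lam" and S = R, OF A nz])
  have w: "M.mul_g_wz A' i j v mu = (\<Sum>t\<in>R. c t * v_minus (wt lam t) q1 (v_minus (wt lam t) q2 (v_minus (wt lam t) q3 (psi_mode s lam))) i * wt lam t powi j)"
    by (rule mul_g_diag(2)[where A = A' and c = c and P = "\<lambda>t. psi_mode s lam" and \<alpha> = "wt lam" and S = R, OF A' nz])
  show ?thesis unfolding z w sum_negf[symmetric]
  proof (rule sum.cong[OF refl])
    fix t assume "t \<in> R"
    then have t: "t \<in> rows" by (rule subsetD[OF R(1)])
    show "c t * z_minus (wt lam t) q1 (z_minus (wt lam t) q2 (z_minus (wt lam t) q3 (psi_mode s (plus_box lam t)))) i * wt lam t powi j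
      = - (c t * v_minus (wt lam t) q1 (v_minus (wt lam t) q2 (v_minus (wt lam t) q3 (psi_mode s lam))) i * wt lam t powi j)"
      unfolding psi_mode_plus_box[OF t lam] by simp
  qed
qed

lemma psi_exchange_sum':
  assumes lam: "lam \<in> B" and R: "R \<subseteq> rows" "finite R"
    and A: "\<And>i j. A i j v mu = (\<Sum>r\<in>R. c r * psi_mode s (plus_box lam r) i * wt lam r powi j)"
    and A': "\<And>i j. A' i j v mu = (\<Sum>r\<in>R. c r * psi_mode s lam i * wt lam r powi j)"
  shows "M.mul_g_wz A' i j v mu = - M.mul_g_zw A i j v mu"
  using psi_exchange_sum[where A = A and A' = A' and c = c and R = R, OF lam R A A', of i j] by simp

lemma relation_psi_e:
  assumes "x \<in> V"
  shows "M.mul_g_zw (\<lambda>i j. psi_op s i \<circ> M.e j) i j x = - M.mul_g_wz (\<lambda>i j. M.e j \<circ> psi_op s i) i j x"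
proof -
  have c: "linear_op (psi_op s i \<circ> M.e j)" "linear_op (M.e j \<circ> psi_op s i)" for i j
    using linear_op_comp[OF linear_op_psi_op[of s i] linear_op_act[of "Gen_e j"]]
      linear_op_comp[OF linear_op_act[of "Gen_e j"] linear_op_psi_op[of s i]] by (simp_all add: M.e_def comp_def)
  have L: "linear_op (M.mul_g_zw (\<lambda>i j. psi_op s i \<circ> M.e j) i j)" "linear_op (\<lambda>x. - M.mul_g_wz (\<lambda>i j. M.e j \<circ> psi_op s i) i j x)"
    by (rule linear_op_mul_g(1)[where A = "\<lambda>i j. psi_op s i \<circ> M.e j", OF c(1)],
      rule linear_op_minus[OF linear_op_mul_g(2)[where A = "\<lambda>i j. M.e j \<circ> psi_op s i", OF c(2)]])
  show ?thesis
  proof (rule linear_op_eqI[OF L _ assms])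
    fix lam assume lam: "lam \<in> B"
    show "M.mul_g_zw (\<lambda>i j. psi_op s i \<circ> M.e j) i j (delta lam) = - M.mul_g_wz (\<lambda>i j. M.e j \<circ> psi_op s i) i j (delta lam)"
    proof
      fix mu
      obtain N where N: "reach N 0 lam" using ex_reach by blast
      let ?R = "row_set (Suc N)" and ?c = "\<lambda>r. ee lam r * delta (plus_box lam r) mu"
      have e: "act (Gen_e j) (delta lam) mu = (\<Sum>r\<in>?R. ?c r * wt lam r powi j)" for j
        unfolding act_e_basis[OF N] sum_fun_apply by (simp add: fun_scale_def mult_ac)
      have A: "(psi_op s i \<circ> M.e j) (delta lam) mu = (\<Sum>r\<in>?R. ?c r * psi_mode s (plus_box lam r) i * wt lam r powi j)" for i j
        unfolding comp_def M.e_def psi_op[OF act_in_V[OF finitely_supported_delta]] e sum_distrib_left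
        by (intro sum.cong refl) (simp add: delta_def)
      have d: "psi_op s i (delta lam) = fun_scale (psi_mode s lam i) (delta lam)" for i
        by (rule ext) (simp add: psi_op[OF delta_in_V[OF lam]] fun_scale_def, simp add: delta_def)
      have A': "(M.e j \<circ> psi_op s i) (delta lam) mu = (\<Sum>r\<in>?R. ?c r * psi_mode s lam i * wt lam r powi j)" for i j
        unfolding comp_def M.e_def d act_scale unfolding fun_scale_def e sum_distrib_left
        by (intro sum.cong refl) (simp only: mult_ac)
      show "M.mul_g_zw (\<lambda>i j. psi_op s i \<circ> M.e j) i j (delta lam) mu = (- M.mul_g_wz (\<lambda>i j. M.e j \<circ> psi_op s i) i j (delta lam)) mu"
        using psi_exchange_sum[where A = "\<lambda>i j. psi_op s i \<circ> M.e j" and A' = "\<lambda>i j. M.e j \<circ> psi_op s i" and R = ?R and c = ?c,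
          OF lam row_set_rows finite_row_set A A'] by simp
    qed
  qed
qed

lemma relation_psi_f:
  assumes "x \<in> V"
  shows "M.mul_g_wz (\<lambda>i j. psi_op s i \<circ> M.f j) i j x = - M.mul_g_zw (\<lambda>i j. M.f j \<circ> psi_op s i) i j x"
proof
  fix mu
  have fin: "finitely_supported x" "\<And>i. finitely_supported (psi_op s i x)"
    using V_finitely_supported[OF assms] V_finitely_supported[OF psi_op_in_V[OF assms]] by blast+
  show "M.mul_g_wz (\<lambda>i j. psi_op s i \<circ> M.f j) i j x mu = (- M.mul_g_zw (\<lambda>i j. M.f j \<circ> psi_op s i) i j x) mu"
  proof (cases "mu \<in> B")
    case True
    obtain N where N: "reach N 0 mu" using ex_reach by blast
    let ?R = "row_set (Suc N)" and ?c = "\<lambda>r. ff mu r * x (plus_box mu r)"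
    have A': "(psi_op s i \<circ> M.f j) x mu = (\<Sum>r\<in>?R. ?c r * psi_mode s mu i * wt mu r powi j)" for i j
      unfolding comp_def M.f_def psi_op[OF act_in_V[OF fin(1)]] act_f_coordinate[OF N fin(1)] sum_distrib_left
      by (intro sum.cong refl) (simp only: mult_ac)
    have A: "(M.f j \<circ> psi_op s i) x mu = (\<Sum>r\<in>?R. ?c r * psi_mode s (plus_box mu r) i * wt mu r powi j)" for i j
      unfolding comp_def M.f_def act_f_coordinate[OF N fin(2)] psi_op[OF assms]
      by (intro sum.cong refl) (simp only: mult_ac)
    show ?thesis
      using psi_exchange_sum'[where A' = "\<lambda>i j. psi_op s i \<circ> M.f j" and A = "\<lambda>i j. M.f j \<circ> psi_op s i" and R = ?R and c = ?c,
        OF True row_set_rows finite_row_set A A'] by simp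
  next
    case False
    have *: "(psi_op s i \<circ> M.f j) x mu = 0" "(M.f j \<circ> psi_op s i) x mu = 0" for i j
      using False unfolding comp_def M.f_def psi_op[OF act_in_V[OF fin(1)]] by (simp_all add: act_def')
    show ?thesis using * by (simp add: M.mul_g_wz_def M.mul_g_zw_def mul_w_minus_def mul_z_minus_def fun_scale_def)
  qed
qed

text \<open>
  The coordinate form of \<open>e\<close>, used where \<open>e\<close> and \<open>f\<close> have to be
  compared on the same coordinate.
\<close>

lemma act_e_coordinate:
  assumes N: "reach N k mu" and x: "finitely_supported x"
  shows "act (Gen_e i) x mu = (\<Sum>r\<in>row_set (Suc N). if row_length mu r > 0
    then ee (minus_box mu r) r * wt (minus_box mu r) r powi i * x (minus_box mu r) else 0)"
proof (cases "mu \<in> B")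
  case True
  have T: "bounded_by N mu" using reach_bounded[OF N True] .
  have supp: "finite {lam\<in>B. x lam \<noteq> 0}" using x by (simp add: finitely_supported_def)
  let ?R = "{r\<in>row_set (Suc N). row_length mu r > 0 \<and> minus_box mu r \<in> B \<and> x (minus_box mu r) \<noteq> 0}"
  have inj: "inj_on (minus_box mu) ?R"
  proof (rule inj_onI)
    fix r r' assume "r \<in> ?R" "r' \<in> ?R" "minus_box mu r = minus_box mu r'"
    then have "plus_box (minus_box mu r) r = plus_box (minus_box mu r) r'"
      using plus_minus_box[of mu r] plus_minus_box[of mu r'] by simp
    then show "r = r'" by (simp only: plus_box_inject')
  qed
  have "act (Gen_e i) x mu = (\<Sum>lam\<in>{lam\<in>B. x lam \<noteq> 0}. entry mu (Gen_e i) lam * x lam)" using True by (simp add: act_def')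
  also have "\<dots> = (\<Sum>lam\<in>minus_box mu ` ?R. entry mu (Gen_e i) lam * x lam)"
  proof (rule sum.mono_neutral_right[OF supp])
    show "minus_box mu ` ?R \<subseteq> {lam\<in>B. x lam \<noteq> 0}" by auto
    show "\<forall>lam\<in>{lam\<in>B. x lam \<noteq> 0} - minus_box mu ` ?R. entry mu (Gen_e i) lam * x lam = 0"
    proof
      fix lam assume lam: "lam \<in> {lam\<in>B. x lam \<noteq> 0} - minus_box mu ` ?R"
      have "mu \<noteq> plus_box lam r" if "r \<in> rows" for r
      proof
        assume eq: "mu = plus_box lam r"
        have m: "minus_box mu r = lam" unfolding eq
          by (cases r) (auto simp: minus_box_def plus_box_apply fun_eq_iff)
        have "snd r \<le> N" using T unfolding eq bounded_by_plus_box by simp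
        moreover have "row_length mu r > 0" unfolding eq by (cases r) (simp add: plus_box_apply)
        ultimately have "r \<in> ?R" using lam that by (simp add: in_row_set m)
        then show False using lam m by blast
      qed
      then show "entry mu (Gen_e i) lam * x lam = 0" using entry_e_0[of mu lam i] by simp
    qed
  qed
  also have "\<dots> = (\<Sum>r\<in>?R. entry mu (Gen_e i) (minus_box mu r) * x (minus_box mu r))"
    by (simp add: sum.reindex[OF inj])
  also have "\<dots> = (\<Sum>r\<in>?R. if row_length mu r > 0
    then ee (minus_box mu r) r * wt (minus_box mu r) r powi i * x (minus_box mu r) else 0)"
  proof (rule sum.cong[OF refl])
    fix r assume r: "r \<in> ?R"
    then have p: "plus_box (minus_box mu r) r = mu" "r \<in> rows" using plus_minus_box[of mu r] by (simp_all add: in_row_set)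
    show "entry mu (Gen_e i) (minus_box mu r) * x (minus_box mu r) = (if row_length mu r > 0
    then ee (minus_box mu r) r * wt (minus_box mu r) r powi i * x (minus_box mu r) else 0)"
      using entry_e[of "minus_box mu r" r i] r True by (simp add: p)
  qed
  also have "\<dots> = (\<Sum>r\<in>row_set (Suc N). if row_length mu r > 0
    then ee (minus_box mu r) r * wt (minus_box mu r) r powi i * x (minus_box mu r) else 0)"
  proof (intro sum.mono_neutral_left ballI)
    fix r assume "r \<in> row_set (Suc N) - ?R"
    moreover have "ee (minus_box mu r) r = 0" if "minus_box mu r \<notin> B"
      using supportedD[OF supported_ee, of "minus_box mu r" r] that by blast
    ultimately show "(if row_length mu r > 0 then ee (minus_box mu r) r * wt (minus_box mu r) r powi i * x (minus_box mu r) else 0) = 0"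
      by (cases "minus_box mu r \<in> B") auto
  qed auto
  finally show ?thesis .
next
  case False
  have "ee (minus_box mu r) r = 0" if "row_length mu r > 0" for r
    using supportedD[OF supported_ee, of "minus_box mu r" r] False unfolding plus_minus_box[of mu r, OF that] by blast
  then show ?thesis using False by (simp add: act_def') (rule sum.neutral, auto)
qed

lemma minus_plus_box: "minus_box (plus_box lam r) r = lam"
  by (cases r) (auto simp: minus_box_def plus_box_apply fun_eq_iff)

text \<open>
  Adding at \<open>r\<close> and removing at \<open>s\<close> leads to the same tuple in both orders; for
  \<open>r \<noteq> s\<close> the amplitudes agree by \<open>mixed_edges_commute\<close>, and the terms with
  \<open>r = s\<close> are given by \<open>diagonal_commutator\<close>.
\<close>

lemma relation_ef:
  assumes "x \<in> V"
  shows "M.commutator (M.e i) (M.f j) x = fun_scale (1 / M.g11) (M.psi_plus (i + j) x - M.psi_minus (i + j) x)"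
proof
  fix mu
  have fin: "finitely_supported x" "finitely_supported (act h x)" for h
    using V_finitely_supported[OF assms] V_finitely_supported[OF act_in_V[OF V_finitely_supported[OF assms]]] by blast+
  have psi: "fun_scale (1 / M.g11) (M.psi_plus (i + j) x - M.psi_minus (i + j) x) mu
    = 1 / g11 * (psi_mode True mu (i + j) - psi_mode False mu (i + j)) * x mu"
    using psi_op[OF assms, of True "i + j" mu] psi_op[OF assms, of False "i + j" mu]
    by (simp add: psi_op_def fun_scale_def M.g11_def g11_def left_diff_distrib)
  show "M.commutator (M.e i) (M.f j) x mu = fun_scale (1 / M.g11) (M.psi_plus (i + j) x - M.psi_minus (i + j) x) mu"
  proof (cases "mu \<in> B")
    case False
    then have "x mu = 0" using assms by (simp add: in_V)
    then show ?thesis unfolding psi using False by (simp add: M.commutator_def M.e_def M.f_def act_def')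
  next
    case True
    obtain T0 where T0: "bounded_by T0 mu" using B_bounded[OF True] by blast
    define T where "T = Suc T0"
    define R where "R = row_set (Suc T)"
    have N: "reach T 1 mu" "reach T 0 mu" unfolding reach_def T_def using T0 by (intro impI exI[of _ T0]; simp)+
    define P where "P r s = (if row_length mu r > 0 then
      ee (minus_box mu r) r * wt (minus_box mu r) r powi i *
      (ff (minus_box mu r) s * wt (minus_box mu r) s powi j * x (plus_box (minus_box mu r) s)) else 0)" for r s
    define Q where "Q r s = ff mu s * wt mu s powi j * (if row_length (plus_box mu s) r > 0 then
      ee (minus_box (plus_box mu s) r) r * wt (minus_box (plus_box mu s) r) r powi i * x (minus_box (plus_box mu s) r) else 0)" for r s
    have ef: "act (Gen_e i) (act (Gen_f j) x) mu = (\<Sum>r\<in>R. \<Sum>s\<in>R. P r s)"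
    proof -
      have "(if row_length mu r > 0 then ee (minus_box mu r) r * wt (minus_box mu r) r powi i * act (Gen_f j) x (minus_box mu r) else 0)
        = (\<Sum>s\<in>R. P r s)" for r
      proof (cases "row_length mu r > 0")
        case True
        have "bounded_by T0 (minus_box mu r)"
          using T0 plus_minus_box[of mu r, OF True] bounded_by_plus_box[of T0 "minus_box mu r" r] by simp
        then have "reach T 0 (minus_box mu r)" unfolding reach_def T_def by (intro impI exI[of _ T0]) simp
        from act_f_coordinate[OF this fin(1), of j] show ?thesis using True
          by (simp add: P_def R_def sum_distrib_left)
      qed (simp add: P_def)
      then show ?thesis unfolding act_e_coordinate[OF N(2) fin(2)] R_def by (simp only:)
    qed
    have fe: "act (Gen_f j) (act (Gen_e i) x) mu = (\<Sum>s\<in>R. \<Sum>r\<in>R. Q r s)"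
    proof -
      have "ff mu s * wt mu s powi j * act (Gen_e i) x (plus_box mu s) = (\<Sum>r\<in>R. Q r s)" for s
      proof (cases "ff mu s = 0")
        case False
        have "reach T 0 (plus_box mu s)" using reach_edge(2)[OF _ False] N(1) by simp
        from act_e_coordinate[OF this fin(1), of i] show ?thesis
          by (simp add: Q_def R_def sum_distrib_left)
      qed (simp add: Q_def)
      then show ?thesis unfolding act_f_coordinate[OF N(1) fin(2)] R_def by (simp only:)
    qed
    \<comment> \<open>removal first, then addition, agrees with addition first for different rows\<close>
    have off: "P r s = Q r s" if ne: "r \<noteq> s" and rs: "r \<in> R" "s \<in> R" for r s
    proof (cases "row_length mu r > 0")
      case True
      define nu where "nu = minus_box mu r"
      have mu: "mu = plus_box nu r" unfolding nu_def using plus_minus_box[of mu r, OF True] by simp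
      have rows: "r \<in> rows" "s \<in> rows" using rs row_set_rows unfolding R_def by blast+
      have m: "minus_box (plus_box mu s) r = plus_box nu s"
        unfolding mu plus_box_commute[of nu r s] by (rule minus_plus_box)
      have l: "row_length (plus_box mu s) r > 0" using True by (cases r; cases s) (simp add: plus_box_apply)
      have w: "wt mu s = wt nu s" "wt (plus_box nu s) r = wt nu r" unfolding mu using ne by (simp_all add: wt_plus_box)
      have key: "ff mu s * ee (plus_box nu s) r = ee nu r * ff nu s"
      proof (cases "mu \<in> B \<and> plus_box nu s \<in> B")
        case True
        then show ?thesis using mixed_edges_commute[OF ne rows, of nu] unfolding mu by (simp add: mult.commute)
      next
        case False
        then have "ff mu s = 0 \<or> ee (plus_box nu s) r = 0" "ee nu r = 0 \<or> ff nu s = 0"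
          using supportedD[OF supported_ff, of mu s] supportedD[OF supported_ee, of "plus_box nu s" r]
            supportedD[OF supported_ee, of nu r] supportedD[OF supported_ff, of nu s] unfolding mu by blast+
        then show ?thesis by auto
      qed
      have "P r s = ee nu r * ff nu s * (wt nu r powi i * wt nu s powi j * x (plus_box nu s))"
        using True by (simp add: P_def nu_def)
      moreover have "Q r s = ff mu s * ee (plus_box nu s) r * (wt nu r powi i * wt nu s powi j * x (plus_box nu s))"
        using l by (simp add: Q_def m w)
      ultimately show ?thesis by (simp only: key)
    next
      case False
      then have "row_length (plus_box mu s) r = 0" using ne by (cases r; cases s) (auto simp: plus_box_apply)
      then show ?thesis using False by (simp add: P_def Q_def)
    qed
    have P: "P r r = removal_weight mu r * (wt mu r / q1) powi (i + j) * x mu" if "r \<in> R" for r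
    proof (cases "row_length mu r > 0")
      case True
      have w: "wt (minus_box mu r) r = wt mu r / q1"
        using wt_plus_box[of "minus_box mu r" r r] plus_minus_box[of mu r, OF True] q1_nz by simp
      have "wt mu r / q1 \<noteq> 0" using wt_row_set_nz that q1_nz unfolding R_def by simp
      then show ?thesis using True
        by (simp add: P_def removal_weight_def plus_minus_box w power_int_add)
    qed (simp add: P_def removal_weight_def)
    have Q: "Q r r = ee mu r * ff mu r * wt mu r powi (i + j) * x mu" if "r \<in> R" for r
    proof -
      have "row_length (plus_box mu r) r > 0" by (cases r) (simp add: plus_box_apply)
      moreover have "wt mu r \<noteq> 0" using wt_row_set_nz that unfolding R_def by simp
      ultimately show ?thesis by (simp add: Q_def minus_plus_box power_int_add)
    qed
    have finR: "finite R" by (simp add: R_def)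
    have "M.commutator (M.e i) (M.f j) x mu = (\<Sum>r\<in>R. \<Sum>s\<in>R. P r s) - (\<Sum>r\<in>R. \<Sum>s\<in>R. Q r s)"
      unfolding M.commutator_def M.e_def M.f_def minus_apply ef fe by (simp only: sum.swap[of "\<lambda>s r. Q r s" R R])
    also have "\<dots> = (\<Sum>r\<in>R. \<Sum>s\<in>R. P r s - Q r s)" by (simp only: sum_subtractf)
    also have "\<dots> = (\<Sum>r\<in>R. \<Sum>s\<in>R. if s = r then P r r - Q r r else 0)"
      using off by (intro sum.cong refl) auto
    also have "\<dots> = (\<Sum>r\<in>R. P r r - Q r r)" using finR by (intro sum.cong refl) simp
    also have "\<dots> = (\<Sum>r\<in>R. removal_weight mu r * (wt mu r / q1) powi (i + j) * x mu)
      - (\<Sum>r\<in>R. ee mu r * ff mu r * wt mu r powi (i + j) * x mu)"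
      unfolding sum_subtractf using P Q by simp
    also have "\<dots> = ((\<Sum>r\<in>R. removal_weight mu r * (wt mu r / q1) powi (i + j))
      - (\<Sum>r\<in>R. ee mu r * ff mu r * wt mu r powi (i + j))) * x mu"
      unfolding left_diff_distrib sum_distrib_right ..
    also have "(\<Sum>r\<in>R. removal_weight mu r * (wt mu r / q1) powi (i + j))
      = (\<Sum>r\<in>row_set T. removal_weight mu r * (wt mu r / q1) powi (i + j))"
    proof (rule sum.mono_neutral_right[OF finR])
      show "row_set T \<subseteq> R" unfolding R_def by (auto simp: in_row_set)
      show "\<forall>r\<in>R - row_set T. removal_weight mu r * (wt mu r / q1) powi (i + j) = 0"
      proof
        fix r assume r: "r \<in> R - row_set T"
        then have "snd r > T0" unfolding R_def T_def by (auto simp: in_row_set)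
        then have "row_length mu r = 0" using T0 by (simp add: bounded_by_def)
        then show "removal_weight mu r * (wt mu r / q1) powi (i + j) = 0" by (simp add: removal_weight_def)
      qed
    qed
    also have "((\<Sum>r\<in>row_set T. removal_weight mu r * (wt mu r / q1) powi (i + j))
      - (\<Sum>r\<in>R. ee mu r * ff mu r * wt mu r powi (i + j))) * x mu
      = 1 / g11 * (psi_mode True mu (i + j) - psi_mode False mu (i + j)) * x mu"
      unfolding diagonal_commutator[OF True T0 T_def] R_def ..
    finally show ?thesis unfolding psi .
  qed
qed

lemma psi_op_commute: "x \<in> V \<Longrightarrow> M.commutator (psi_op s i) (psi_op s' j) x = 0"
  by (auto simp: M.commutator_def psi_op psi_op_in_V fun_eq_iff)

lemma act_psi_inverse:
  assumes "x \<in> V"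
  shows "act Gen_psip0_inv (M.psi_plus 0 x) = x" "M.psi_plus 0 (act Gen_psip0_inv x) = x"
    "act Gen_psim0_inv (M.psi_minus 0 x) = x" "M.psi_minus 0 (act Gen_psim0_inv x) = x"
proof -
  have x0: "eigenvalue s mu 0 \<noteq> 0 \<or> x mu = 0" for s mu
    using eigenvalue_0_nz assms by (auto simp: in_V)
  have p: "M.psi_plus 0 y = act (Gen_psip 0) y" "M.psi_minus 0 y = act (Gen_psim 0) y" for y
    by (simp_all add: M.psi_plus_def M.psi_minus_def)
  have V: "act h x \<in> V" for h using act_in_V V_finitely_supported[OF assms] by blast
  show "act Gen_psip0_inv (M.psi_plus 0 x) = x" "M.psi_plus 0 (act Gen_psip0_inv x) = x"
    "act Gen_psim0_inv (M.psi_minus 0 x) = x" "M.psi_minus 0 (act Gen_psim0_inv x) = x"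
    using x0 by (auto simp: fun_eq_iff p act_psi[OF V] act_psi[OF assms] field_simps)
qed

lemma subspace_V: "module.subspace fun_scale V"
proof -
  interpret vector_space "fun_scale :: complex \<Rightarrow> (ptuple \<Rightarrow> complex) \<Rightarrow> _" by (rule vector_space_fun_scale)
  show ?thesis
    by (rule subspaceI) (auto simp: in_V finitely_supported_add finitely_supported_scale, auto simp: finitely_supported_def fun_scale_def)
qed

theorem E_module_act: "M.E_module"
proof -
  have psi: "M.psi_plus = psi_op True" "M.psi_minus = psi_op False" by (simp_all add: psi_op_def)
  have "M.relations"
    unfolding M.relations_def
  proof (intro ballI conjI allI)
    fix x psi psi' i j assume x: "x \<in> V" and s: "psi \<in> {M.psi_plus, M.psi_minus}"
    obtain s where s: "psi = psi_op s" using s unfolding psi by blast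
    show "M.mul_g_zw (\<lambda>i j. psi i \<circ> M.e j) i j x = - M.mul_g_wz (\<lambda>i j. M.e j \<circ> psi i) i j x"
      unfolding s by (rule relation_psi_e[OF x])
    show "M.mul_g_wz (\<lambda>i j. psi i \<circ> M.f j) i j x = - M.mul_g_zw (\<lambda>i j. M.f j \<circ> psi i) i j x"
      unfolding s by (rule relation_psi_f[OF x])
    assume s': "psi' \<in> {M.psi_plus, M.psi_minus}"
    obtain s' where s': "psi' = psi_op s'" using s' unfolding psi by blast
    show "M.commutator (psi i) (psi' j) x = 0" unfolding s s' by (rule psi_op_commute[OF x])
  qed (simp_all only: relation_ee relation_ff relation_ef relation_eee relation_fff act_psi_inverse)
  moreover have "vector_space (fun_scale :: complex \<Rightarrow> (ptuple \<Rightarrow> complex) \<Rightarrow> _)" by (rule vector_space_fun_scale)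
  moreover have "\<forall>g. (\<forall>v\<in>V. act g v \<in> V) \<and> (\<forall>v\<in>V. \<forall>w\<in>V. act g (v + w) = act g v + act g w) \<and>
      (\<forall>c. \<forall>v\<in>V. act g (fun_scale c v) = fun_scale c (act g v))"
    using act_in_V act_add act_scale V_finitely_supported by blast
  ultimately show ?thesis unfolding M.E_module_def using subspace_V by blast
qed

end

section \<open>The joint spectrum is simple\<close>

lemma order_linear_factor:
  fixes c z :: complex
  assumes "z \<noteq> 0"
  shows "order (inverse z) [:1, - c:] = (if c = z then 1 else 0)"
proof (cases "c = z")
  case True
  have "[:1, - z:] = smult (- z) [:- inverse z, 1:]" using assms by simp
  moreover have "order (inverse z) (smult (- z) [:- inverse z, 1:]) = order (inverse z) [:- inverse z, 1:]"
    using assms by (intro order_smult) simp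
  ultimately have "order (inverse z) [:1, - z:] = order (inverse z) [:- inverse z, 1:]" by (simp only:)
  then show ?thesis using True order_power_n_n[of "inverse z" 1] by simp
next
  case False
  have "poly [:1, - c:] (inverse z) \<noteq> 0" using False assms by (simp add: field_simps)
  then show ?thesis using False order_0I[of "[:1, - c:]"] by (simp only: if_False)
qed

text \<open>
  The polynomial \<open>\<Prod>(1 - c X)\<close>; its order at \<open>1/z\<close> counts how often
  \<open>z\<close> occurs among the \<open>c\<close>.
\<close>

definition linear_factors :: "('r \<Rightarrow> complex) \<Rightarrow> 'r set \<Rightarrow> complex poly" where
  "linear_factors c R = (\<Prod>\<rho>\<in>R. [:1, - c \<rho>:])"

lemma linear_factors_nonzero: "linear_factors c R \<noteq> 0"
proof -
  have "coeff (linear_factors c R) 0 = 1"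
    unfolding linear_factors_def by (induction R rule: infinite_finite_induct) (simp_all add: coeff_mult)
  then show ?thesis by auto
qed

lemma order_linear_factors:
  assumes "finite R" "z \<noteq> 0"
  shows "order (inverse z) (linear_factors c R) = card {\<rho>\<in>R. c \<rho> = z}"
  using assms(1)
proof (induction R)
  case (insert \<rho> F)
  have "linear_factors c (insert \<rho> F) = [:1, - c \<rho>:] * linear_factors c F"
    using insert by (simp add: linear_factors_def)
  moreover have "linear_factors c (insert \<rho> F) \<noteq> 0" by (rule linear_factors_nonzero)
  ultimately have "order (inverse z) (linear_factors c (insert \<rho> F))
      = order (inverse z) [:1, - c \<rho>:] + order (inverse z) (linear_factors c F)" by (metis order_mult)
  also have "\<dots> = (if c \<rho> = z then 1 else 0) + card {\<rho>\<in>F. c \<rho> = z}"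
    using insert.IH order_linear_factor[OF assms(2)] by (simp only:)
  also have "\<dots> = card {\<sigma>\<in>insert \<rho> F. c \<sigma> = z}"
  proof (cases "c \<rho> = z")
    case True
    then have "{\<sigma>\<in>insert \<rho> F. c \<sigma> = z} = insert \<rho> {\<sigma>\<in>F. c \<sigma> = z}" by auto
    then show ?thesis using True insert by simp
  next
    case False
    then have "{\<sigma>\<in>insert \<rho> F. c \<sigma> = z} = {\<sigma>\<in>F. c \<sigma> = z}" by auto
    then show ?thesis using False by simp
  qed
  finally show ?case .
qed (simp add: linear_factors_def)

lemma fps_linear_factors: "fps_of_poly (linear_factors c R) = (\<Prod>\<rho>\<in>R. 1 - fps_const (c \<rho>) * fps_X)"
  unfolding linear_factors_def fps_of_poly_prod by (simp add: fps_of_poly_linear' fps_const_neg[symmetric] del: fps_const_neg)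

text \<open>
  The orbit of \<open>z\<close> under division by \<open>q\<close> is infinite.
\<close>

lemma periodic_finite_support:
  fixes f :: "complex \<Rightarrow> int" and q z :: complex
  assumes fin: "finite {z. z \<noteq> 0 \<and> f z \<noteq> 0}" and q: "q \<noteq> 0" "\<And>k. k > 0 \<Longrightarrow> q ^ k \<noteq> 1"
    and per: "\<And>z. z \<noteq> 0 \<Longrightarrow> f (z / q) = f z" and z: "z \<noteq> 0"
  shows "f z = 0"
proof (rule ccontr)
  assume nz: "f z \<noteq> 0"
  have "f (z / q ^ k) = f z" for k
  proof (induction k)
    case (Suc k)
    then show ?case using per[of "z / q ^ k"] z q(1) by (simp add: mult.commute)
  qed simp
  then have "range (\<lambda>k. z / q ^ k) \<subseteq> {z. z \<noteq> 0 \<and> f z \<noteq> 0}" using nz z q(1) by auto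
  then have "finite (range (\<lambda>k. z / q ^ k))" using fin finite_subset by blast
  moreover have "inj (\<lambda>k. z / q ^ k)"
  proof (rule injI, rule ccontr)
    fix j k :: nat assume "z / q ^ j = z / q ^ k" "j \<noteq> k"
    then have eq: "q ^ j = q ^ k" using z q(1) by (simp add: field_simps)
    have "q ^ (max j k - min j k) = 1"
    proof -
      have "q ^ max j k = q ^ min j k * q ^ (max j k - min j k)"
        by (simp add: power_add[symmetric])
      moreover have "q ^ max j k = q ^ min j k" using eq by (simp add: max_def min_def)
      ultimately show ?thesis using q(1) by simp
    qed
    then show False using q(2)[of "max j k - min j k"] \<open>j \<noteq> k\<close> by (simp add: max_def min_def split: if_splits)
  qed
  ultimately show False using finite_imageD infinite_UNIV_nat by blast
qed

context resonance
begin

text \<open>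
  The eigenvalue of \<open>\<psi>\<^sup>+\<close> as a quotient of polynomials, up to a factor that is the
  same for all tuples within the bound.
\<close>

lemma finite_row_product:
  assumes T: "bounded_by T lam"
  defines "W \<equiv> wt lam" and "R \<equiv> row_set T"
  shows "psi_fps True q1 q3 us n T lam * fps_of_poly (linear_factors W R * linear_factors (\<lambda>\<rho>. W \<rho> / q1) R)
    = fps_of_poly (linear_factors (\<lambda>\<rho>. q3 * W \<rho>) R * linear_factors (\<lambda>\<rho>. q2 * W \<rho>) R)
      * (\<Prod>i\<in>{1..n}. mobius_series True (q2 * (q3 powi int T * us i)) (q3 powi int T * us i))"
proof -
  have psi: "psi_fps True q1 q3 us n T lam = (\<Prod>\<rho>\<in>R. mobius_series True (q3 * W \<rho>) (W \<rho>) * mobius_series True (q2 * W \<rho>) (W \<rho> / q1))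
    * (\<Prod>i\<in>{1..n}. mobius_series True (q2 * (q3 powi int T * us i)) (q3 powi int T * us i))"
    unfolding psi_fps_def prod.distrib prod.cartesian_product R_def row_set_def W_def wt_def q2_eq
    by (simp add: case_prod_beta)
  have m: "mobius_series True d c * (1 - fps_const c * fps_X) = 1 - fps_const d * fps_X" for d c :: complex
    using geometric_mult[of c] by (simp add: mobius_series_def mult_ac)
  have row: "mobius_series True (q3 * W \<rho>) (W \<rho>) * mobius_series True (q2 * W \<rho>) (W \<rho> / q1)
      * ((1 - fps_const (W \<rho>) * fps_X) * (1 - fps_const (W \<rho> / q1) * fps_X))
      = (1 - fps_const (q3 * W \<rho>) * fps_X) * (1 - fps_const (q2 * W \<rho>) * fps_X)" for \<rho>
    using arg_cong2[OF m[of "q3 * W \<rho>" "W \<rho>"] m[of "q2 * W \<rho>" "W \<rho> / q1"], of "(*)"] by (simp only: mult_ac)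
  have A: "(\<Prod>\<rho>\<in>R. mobius_series True (q3 * W \<rho>) (W \<rho>) * mobius_series True (q2 * W \<rho>) (W \<rho> / q1))
      * fps_of_poly (linear_factors W R * linear_factors (\<lambda>\<rho>. W \<rho> / q1) R)
    = fps_of_poly (linear_factors (\<lambda>\<rho>. q3 * W \<rho>) R * linear_factors (\<lambda>\<rho>. q2 * W \<rho>) R)"
    unfolding fps_of_poly_mult fps_linear_factors prod.distrib[symmetric] using row by (simp only:)
  show ?thesis unfolding psi A[symmetric] by (simp only: mult_ac)
qed

text \<open>
  Let \<open>d(z)\<close> be the difference of the multiplicities of \<open>z\<close> among the weights of
  the two tuples. Equality of the divisors says \<open>d(z/q3) + d(z/q2) = d(z) + d(q1 z)\<close>. As
  \<open>q1 = 1/(q2 q3)\<close>, this means that \<open>d(z/q3) - d(z)\<close> is invariant under \<open>z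
  \<mapsto> z/q2\<close>; having finite support it vanishes, and then so does \<open>d\<close> by the same
  argument for \<open>q3\<close>.
\<close>

lemma weights_separated:
  assumes lam: "bounded_by T lam" and mu: "bounded_by T mu"
    and eq: "\<And>k. eigenvalue True lam k = eigenvalue True mu k"
  shows "wt lam ` row_set T = wt mu ` row_set T"
proof -
  define R where "R = row_set T"
  have fin: "finite R" by (simp add: R_def)
  define N where "N c z = card {\<rho>\<in>R. c \<rho> = z}" for c :: "nat \<times> nat \<Rightarrow> complex" and z
  define d where "d z = int (N (wt lam) z) - int (N (wt mu) z)" for z
  let ?psi = "psi_fps True q1 q3 us n T"
  let ?\<tau> = "\<Prod>i\<in>{1..n}. mobius_series True (q2 * (q3 powi int T * us i)) (q3 powi int T * us i)"
  let ?D = "\<lambda>W. linear_factors W R * linear_factors (\<lambda>\<rho>. W \<rho> / q1) R"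
  let ?E = "\<lambda>W. linear_factors (\<lambda>\<rho>. q3 * W \<rho>) R * linear_factors (\<lambda>\<rho>. q2 * W \<rho>) R"
  have psi: "?psi lam = ?psi mu" using eq by (intro fps_ext) (simp add: eigenvalue_eq[OF lam] eigenvalue_eq[OF mu])
  have L: "?psi lam * fps_of_poly (?D (wt lam)) = fps_of_poly (?E (wt lam)) * ?\<tau>"
    unfolding R_def by (rule finite_row_product[OF lam])
  have M: "?psi lam * fps_of_poly (?D (wt mu)) = fps_of_poly (?E (wt mu)) * ?\<tau>"
    unfolding R_def psi by (rule finite_row_product[OF mu])
  have "fps_nth (?psi lam) 0 \<noteq> 0" using us_nz by (intro psi_fps_nth_0 q1_nz q3_nz)
  then have psi_nz: "?psi lam \<noteq> 0" by auto
  have D_nz: "fps_of_poly (?D (wt lam)) \<noteq> 0" 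
    using fps_of_poly_eq_iff[of "?D (wt lam)" 0] by (simp add: linear_factors_nonzero)
  have tau: "?\<tau> \<noteq> 0"
  proof (rule notI)
    assume "?\<tau> = 0"
    then have "?psi lam * fps_of_poly (?D (wt lam)) = 0" unfolding L by (simp only: mult_zero_right)
    then show False using psi_nz D_nz by (simp only: mult_eq_0_iff simp_thms)
  qed
  have "?psi lam * (fps_of_poly (?E (wt lam)) * ?\<tau>) * fps_of_poly (?D (wt mu))
    = ?psi lam * (fps_of_poly (?E (wt mu)) * ?\<tau>) * fps_of_poly (?D (wt lam))"
    unfolding L[symmetric] M[symmetric] by (simp only: mult_ac)
  then have "(?psi lam * ?\<tau>) * fps_of_poly (?E (wt lam) * ?D (wt mu)) = (?psi lam * ?\<tau>) * fps_of_poly (?E (wt mu) * ?D (wt lam))"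
    unfolding fps_of_poly_mult by (simp only: mult_ac)
  then have pol: "?E (wt lam) * ?D (wt mu) = ?E (wt mu) * ?D (wt lam)"
    using mult_left_cancel[of "?psi lam * ?\<tau>"] no_zero_divisors[OF psi_nz tau] fps_of_poly_eq_iff by blast
  have ord: "order (inverse z) (?E W * ?D W') = N (\<lambda>\<rho>. q3 * W \<rho>) z + N (\<lambda>\<rho>. q2 * W \<rho>) z + (N W' z + N (\<lambda>\<rho>. W' \<rho> / q1) z)"
    if "z \<noteq> 0" for z W W'
    by (simp add: linear_factors_nonzero order_mult order_linear_factors[OF fin that] N_def)
  have scale: "N (\<lambda>\<rho>. q3 * W \<rho>) z = N W (z / q3)" "N (\<lambda>\<rho>. q2 * W \<rho>) z = N W (z / q2)" "N (\<lambda>\<rho>. W \<rho> / q1) z = N W (q1 * z)"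
    for W z unfolding N_def by (rule arg_cong[of _ _ card], use q1_nz q2_nz q3_nz in \<open>auto simp: field_simps\<close>)+
  \<comment> \<open>compare the orders of vanishing at \<open>1/z\<close>\<close>
  have four: "d (z / q3) + d (z / q2) = d z + d (q1 * z)" if "z \<noteq> 0" for z
    using arg_cong[OF pol, of "order (inverse z)"] unfolding ord[OF that] scale d_def by simp
  have supp: "finite {z. d z \<noteq> 0}"
  proof (rule finite_subset)
    show "{z. d z \<noteq> 0} \<subseteq> wt lam ` R \<union> wt mu ` R"
    proof
      fix z assume "z \<in> {z. d z \<noteq> 0}"
      then have "N (wt lam) z \<noteq> 0 \<or> N (wt mu) z \<noteq> 0" by (auto simp: d_def)
      then have "{\<rho>\<in>R. wt lam \<rho> = z} \<noteq> {} \<or> {\<rho>\<in>R. wt mu \<rho> = z} \<noteq> {}" unfolding N_def by (metis card.empty)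
      then show "z \<in> wt lam ` R \<union> wt mu ` R" by blast
    qed
  qed (simp add: fin)
  define c where "c z = d (z / q3) - d z" for z
  have c0: "c z = 0" if "z \<noteq> 0" for z
  proof (rule periodic_finite_support[OF _ q2_nz _ _ that])
    have "{z. z \<noteq> 0 \<and> c z \<noteq> 0} \<subseteq> (\<lambda>z. q3 * z) ` {z. d z \<noteq> 0} \<union> {z. d z \<noteq> 0}"
    proof
      fix z assume "z \<in> {z. z \<noteq> 0 \<and> c z \<noteq> 0}"
      then have "d (z / q3) \<noteq> 0 \<or> d z \<noteq> 0" by (auto simp: c_def)
      moreover have "z = q3 * (z / q3)" using q3_nz by simp
      ultimately show "z \<in> (\<lambda>z. q3 * z) ` {z. d z \<noteq> 0} \<union> {z. d z \<noteq> 0}" by blast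
    qed
    then show "finite {z. z \<noteq> 0 \<and> c z \<noteq> 0}" by (rule finite_subset) (use supp in simp)
    show "c (z / q2) = c z" if "z \<noteq> 0" for z
    proof -
      have "z / q2 / q3 = q1 * z" using q_prod q2_nz q3_nz by (simp add: field_simps)
      then show ?thesis using four[OF that] by (simp add: c_def)
    qed
  qed (use not_root_of_unity in blast)
  have d0: "d z = 0" if "z \<noteq> 0" for z
  proof (rule periodic_finite_support[OF _ q3_nz _ _ that])
    show "finite {z. z \<noteq> 0 \<and> d z \<noteq> 0}" by (rule finite_subset[OF _ supp]) blast
    show "d (z / q3) = d z" if "z \<noteq> 0" for z using c0[OF that] by (simp add: c_def)
  qed (use not_root_of_unity in blast)
  have pos: "z \<in> W ` R \<longleftrightarrow> N W z > 0" for z W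
    using fin by (auto simp: N_def card_gt_0_iff)
  show ?thesis
  proof (rule set_eqI)
    fix z
    show "z \<in> wt lam ` row_set T \<longleftrightarrow> z \<in> wt mu ` row_set T"
    proof (cases "z = 0")
      case False
      then have "N (wt lam) z = N (wt mu) z" using d0[of z] by (simp add: d_def)
      then show ?thesis unfolding R_def[symmetric] pos by simp
    qed (use wt_row_set_nz in force)
  qed
qed

theorem eigenvalues_separate:
  assumes lam: "lam \<in> B" and mu: "mu \<in> B" and eq: "\<And>k. eigenvalue True lam k = eigenvalue True mu k"
  shows "lam = mu"
proof (rule wt_determines_tuple[OF lam mu])
  have sub: "wt lam ` rows \<subseteq> wt mu ` rows"
    if lam: "lam \<in> B" and mu: "mu \<in> B" and eq: "\<And>k. eigenvalue True lam k = eigenvalue True mu k" for lam mu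
  proof
    fix z assume "z \<in> wt lam ` rows"
    then obtain r where r: "r \<in> rows" "z = wt lam r" by blast
    obtain T1 where T1: "bounded_by T1 lam" using B_bounded[OF lam] by blast
    obtain T2 where T2: "bounded_by T2 mu" using B_bounded[OF mu] by blast
    \<comment> \<open>a common bound that also covers the given row\<close>
    define T where "T = T1 + T2 + snd r"
    have T: "bounded_by T lam" "bounded_by T mu"
      by (rule bounded_by_mono[OF T1], simp add: T_def, rule bounded_by_mono[OF T2], simp add: T_def)
    have "z \<in> wt lam ` row_set T" using r by (auto simp: in_row_set T_def)
    then have "z \<in> wt mu ` row_set T" using weights_separated[OF T eq] by simp
    then show "z \<in> wt mu ` rows" using row_set_rows[of T] by blast
  qed
  show "wt lam ` rows = wt mu ` rows" using sub[OF lam mu eq] sub[OF mu lam eq[symmetric]] by blast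
qed

end

section \<open>Tameness, irreducibility and the highest weight\<close>

lemma mobius_series_plus: "mobius_series True (c * x) x = fps_compose (psi_empty_plus c) (fps_const x * fps_X)"
proof -
  have "psi_empty_plus c = (1 - fps_const c * fps_X) * geometric 1"
    using fps_inverse_unique[of "1 - fps_X" "geometric 1 :: complex fps"] geometric_mult[of "1 :: complex"]
    by (simp add: psi_empty_plus_def fps_divide_unit)
  moreover have "geometric x = fps_compose (geometric 1) (fps_const x * fps_X)"
    unfolding fps_compose_linear by (simp add: geometric_def)
  ultimately show ?thesis
    by (simp add: mobius_series_def fps_compose_mult_distrib fps_compose_sub_distrib mult.assoc)
qed

lemma mobius_series_minus:
  assumes "c \<noteq> 0" "x \<noteq> 0"
  shows "mobius_series False (c * x) x = fps_compose (psi_empty_minus c) (fps_const (inverse x) * fps_X)"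
proof -
  have "psi_empty_minus c = fps_const c * psi_empty_plus (inverse c)"
    by (simp add: psi_empty_minus_def psi_empty_plus_def)
  then have "fps_compose (psi_empty_minus c) (fps_const (inverse x) * fps_X)
    = fps_const c * mobius_series True (inverse c * inverse x) (inverse x)"
    by (simp only: mobius_series_plus) (simp add: fps_compose_mult_distrib)
  then show ?thesis using assms by (simp add: mobius_series_def mult.assoc)
qed

context resonance
begin

lemma empty_in_B: "(\<lambda>_ _. 0) \<in> B"
  by (simp add: B_def resonant_basis_def is_ptuple_def is_partition_def)

lemma eigenvalue_empty:
  "eigenvalue True (\<lambda>_ _. 0) k = fps_nth (hw_plus q2 us n) k"
  "eigenvalue False (\<lambda>_ _. 0) k = fps_nth (hw_minus q2 us n) k"
proof -
  have T: "bounded_by 0 (\<lambda>_ _. 0)" by (simp add: bounded_by_def)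
  show "eigenvalue True (\<lambda>_ _. 0) k = fps_nth (hw_plus q2 us n) k"
    unfolding eigenvalue_eq[OF T] psi_fps_def hw_plus_def q2_eq mobius_series_plus by simp
  have "(\<Prod>i\<in>{1..n}. mobius_series False (q2 * us i) (us i)) = hw_minus q2 us n"
    unfolding hw_minus_def using mobius_series_minus[OF q2_nz us_nz] by (intro prod.cong refl) blast
  then show "eigenvalue False (\<lambda>_ _. 0) k = fps_nth (hw_minus q2 us n) k"
    unfolding eigenvalue_eq[OF T] psi_fps_def q2_eq by simp
qed

interpretation vs: vector_space "fun_scale :: complex \<Rightarrow> (ptuple \<Rightarrow> complex) \<Rightarrow> _"
  by (rule vector_space_fun_scale)

lemma V_spanned:
  assumes "vs.subspace W" "\<And>lam. lam \<in> B \<Longrightarrow> delta lam \<in> W"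
  shows "V \<subseteq> W"
proof
  fix x assume x: "x \<in> V"
  have "lam \<in> B" if "x lam \<noteq> 0" for lam using x that by (auto simp: in_V)
  then have "(\<Sum>lam\<in>{lam. x lam \<noteq> 0}. fun_scale (x lam) (delta lam)) \<in> W"
    using assms by (intro vs.subspace_sum vs.subspace_scale) auto
  then show "x \<in> W" using V_expand[OF V_finitely_supported[OF x]] by simp
qed

lemma eigenvector_support:
  assumes "x \<in> M.joint_eigenspace cp cm" "x lam \<noteq> 0"
  shows "lam \<in> B" "eigenvalue True lam k = cp k"
proof -
  have x: "x \<in> V" "act (Gen_psip k) x = fun_scale (cp k) x" using assms(1) by (simp_all add: M.joint_eigenspace_def)
  show "lam \<in> B" using x(1) assms(2) by (auto simp: in_V)
  show "eigenvalue True lam k = cp k"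
    using fun_cong[OF x(2), of lam] assms(2) by (simp add: act_psi[OF x(1)] fun_scale_def)
qed

theorem tame_act: "M.tame"
  unfolding M.tame_def
proof (intro conjI allI ballI impI)
  have "module.span fun_scale (\<Union>cp cm. M.joint_eigenspace cp cm) \<subseteq> V"
    using subspace_V by (intro vs.span_minimal) (auto simp: M.joint_eigenspace_def)
  moreover have "V \<subseteq> module.span fun_scale (\<Union>cp cm. M.joint_eigenspace cp cm)"
  proof (rule V_spanned[OF vs.subspace_span])
    fix lam assume lam: "lam \<in> B"
    have "act (Gen_psip k) (delta lam) = fun_scale (eigenvalue True lam k) (delta lam)"
      "act (Gen_psim k) (delta lam) = fun_scale (eigenvalue False lam k) (delta lam)" for k
      by (rule ext, simp add: act_psi[OF delta_in_V[OF lam]] fun_scale_def, simp add: delta_def)+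
    then have "delta lam \<in> M.joint_eigenspace (eigenvalue True lam) (eigenvalue False lam)"
      using delta_in_V[OF lam] by (simp add: M.joint_eigenspace_def)
    then show "delta lam \<in> module.span fun_scale (\<Union>cp cm. M.joint_eigenspace cp cm)" by (intro vs.span_base) blast
  qed
  ultimately show "module.span fun_scale (\<Union>cp cm. M.joint_eigenspace cp cm) = V" by blast
next
  fix cp cm x y assume xy: "x \<in> M.joint_eigenspace cp cm" "y \<in> M.joint_eigenspace cp cm" and "x \<noteq> 0"
  then obtain lam where lam: "x lam \<noteq> 0" by (auto simp: fun_eq_iff)
  note L = eigenvector_support[where x = x and lam = lam, OF xy(1) lam]
  \<comment> \<open>an eigenvector is supported on the single tuple with the given eigenvalue\<close>
  have only: "z mu = 0" if z: "z \<in> M.joint_eigenspace cp cm" and ne: "mu \<noteq> lam" for z mu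
  proof (rule ccontr)
    assume "z mu \<noteq> 0"
    note Z = eigenvector_support[where x = z and lam = mu, OF z this]
    have "mu = lam" by (rule eigenvalues_separate[OF Z(1) L(1)]) (simp only: Z(2) L(2))
    then show False using ne by blast
  qed
  have "y = fun_scale (y lam / x lam) x"
  proof
    fix mu show "y mu = fun_scale (y lam / x lam) x mu"
      using lam only[OF xy(1), of mu] only[OF xy(2), of mu] by (cases "mu = lam") (simp_all add: fun_scale_def)
  qed
  then show "\<exists>c. y = fun_scale c x" by blast
qed

text \<open>
  Subtracting an eigenvalue of \<open>\<psi>\<^sup>+\<close> removes a basis vector from the support of
  \<open>x\<close> and keeps \<open>lam\<close>, as different basis vectors have different eigenvalues.
\<close>

lemma submodule_contains_delta:
  assumes W: "M.submodule W" and x: "x \<in> W" "x lam \<noteq> 0"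
  shows "delta lam \<in> W"
  using x
proof (induction "card {mu. x mu \<noteq> 0}" arbitrary: x rule: less_induct)
  case (less x)
  have sub: "vs.subspace W" "W \<subseteq> V" using W by (simp_all add: M.submodule_def)
  have x: "x \<in> V" "finite {mu. x mu \<noteq> 0}" using less.prems sub by (auto simp: in_V finitely_supported_def)
  show ?case
  proof (cases "\<exists>mu. mu \<noteq> lam \<and> x mu \<noteq> 0")
    case False
    then have "delta lam = fun_scale (1 / x lam) x" using less.prems(2)
      by (intro ext) (auto simp: delta_def fun_scale_def)
    then show ?thesis using vs.subspace_scale[OF sub(1) less.prems(1)] by (simp only:)
  next
    case True
    then obtain mu where mu: "mu \<noteq> lam" "x mu \<noteq> 0" by blast
    have B: "lam \<in> B" "mu \<in> B" using x(1) mu(2) less.prems(2) by (auto simp: in_V)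
    obtain k where k: "eigenvalue True lam k \<noteq> eigenvalue True mu k" using eigenvalues_separate[OF B] mu(1) by blast
    \<comment> \<open>annihilates \<open>delta mu\<close> and keeps \<open>delta lam\<close>\<close>
    define y where "y = act (Gen_psip k) x - fun_scale (eigenvalue True mu k) x"
    have y: "y nu = (eigenvalue True nu k - eigenvalue True mu k) * x nu" for nu
      by (simp add: y_def act_psi[OF x(1)] fun_scale_def left_diff_distrib)
    have "act (Gen_psip k) x \<in> W" using W less.prems(1) by (simp add: M.submodule_def)
    then have "y \<in> W" unfolding y_def using sub(1) less.prems(1) by (intro vs.subspace_diff vs.subspace_scale)
    moreover have "{nu. y nu \<noteq> 0} \<subset> {nu. x nu \<noteq> 0}" using mu(2) by (auto simp: y)
    then have "card {nu. y nu \<noteq> 0} < card {nu. x nu \<noteq> 0}" by (rule psubset_card_mono[OF x(2)])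
    moreover have "y lam \<noteq> 0" using k less.prems(2) by (simp add: y)
    ultimately show ?thesis using less.hyps by blast
  qed
qed

text \<open>
  A step along an edge in either direction, using that both of its coefficients are nonzero.
\<close>

lemma submodule_step:
  assumes W: "M.submodule W" and r: "lam \<in> B" "plus_box lam r \<in> B" "r \<in> rows"
  shows "delta lam \<in> W \<longleftrightarrow> delta (plus_box lam r) \<in> W"
proof
  have closed: "act g y \<in> W" if "y \<in> W" for g y using W that by (simp add: M.submodule_def)
  show "delta (plus_box lam r) \<in> W" if "delta lam \<in> W"
  proof (rule submodule_contains_delta[where x = "act (Gen_e 0) (delta lam)" and lam = "plus_box lam r", OF W closed[OF that]])
    show "act (Gen_e 0) (delta lam) (plus_box lam r) \<noteq> 0"
      using entry_e[OF r, of 0] ee_nonzero[OF r] r by (simp add: act_delta)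
  qed
  show "delta lam \<in> W" if "delta (plus_box lam r) \<in> W"
  proof (rule submodule_contains_delta[where x = "act (Gen_f 0) (delta (plus_box lam r))" and lam = lam, OF W closed[OF that]])
    show "act (Gen_f 0) (delta (plus_box lam r)) lam \<noteq> 0"
      using entry_f[OF r, of 0] ff_nonzero[OF r] r by (simp add: act_delta)
  qed
qed

text \<open>
  Induction on the number of boxes: every nonempty tuple in the basis is reached from a smaller one.
\<close>

lemma submodule_connected:
  assumes W: "M.submodule W" and lam: "lam \<in> B"
  shows "delta lam \<in> W \<longleftrightarrow> delta (\<lambda>_ _. 0) \<in> W"
proof -
  obtain T where T: "bounded_by T lam" using B_bounded[OF lam] by blast
  show ?thesis using lam T
  proof (induction "\<Sum>r\<in>row_set T. row_length lam r" arbitrary: lam rule: less_induct)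
    case (less lam)
    show ?case
    proof (cases "lam = (\<lambda>_ _. 0)")
      case False
      then obtain mu r where r: "r \<in> rows" "mu \<in> B" "plus_box mu r = lam" using ex_removable_row[OF less.prems(1)] by blast
      have T: "bounded_by T mu" "snd r \<le> T" using less.prems(2) bounded_by_plus_box[of T mu r] r(3) by simp_all
      then have R: "r \<in> row_set T" using r(1) by (simp add: in_row_set)
      have "(\<Sum>\<rho>\<in>row_set T. row_length mu \<rho>) < (\<Sum>\<rho>\<in>row_set T. row_length lam \<rho>)"
      proof (rule sum_strict_mono_ex1)
        show "\<forall>\<rho>\<in>row_set T. row_length mu \<rho> \<le> row_length lam \<rho>"
          unfolding r(3)[symmetric] by (cases r) (simp add: plus_box_apply)
        show "\<exists>\<rho>\<in>row_set T. row_length mu \<rho> < row_length lam \<rho>"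
          unfolding r(3)[symmetric] by (rule bexI[OF _ R]) (cases r; simp add: plus_box_apply)
      qed simp
      then have "delta mu \<in> W \<longleftrightarrow> delta (\<lambda>_ _. 0) \<in> W" using less.hyps r(2) T(1) by blast
      then show ?thesis using submodule_step[OF W r(2) _ r(1)] less.prems(1) unfolding r(3) by blast
    qed simp
  qed
qed

lemma submodule_generated:
  assumes W: "M.submodule W" and lam: "lam \<in> B" "delta lam \<in> W"
  shows "W = V"
proof -
  have "V \<subseteq> W"
  proof (rule V_spanned)
    show "vs.subspace W" using W by (simp add: M.submodule_def)
    show "delta mu \<in> W" if "mu \<in> B" for mu
      using submodule_connected[OF W lam(1)] submodule_connected[OF W that] lam(2) by blast
  qed
  then show ?thesis using W by (auto simp: M.submodule_def)
qed

theorem irreducible_act: "M.irreducible_module"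
  unfolding M.irreducible_module_def
proof (intro conjI allI impI)
  have "delta (\<lambda>_ _. 0) \<in> V" using delta_in_V[OF empty_in_B] .
  moreover have "delta (\<lambda>_ _. 0) \<noteq> 0"
  proof
    assume "delta (\<lambda>_ _. 0) = 0"
    from fun_cong[OF this, of "\<lambda>_ _. 0"] show False by (simp add: delta_def)
  qed
  ultimately show "V \<noteq> {0}" by blast
next
  fix W assume W: "M.submodule W"
  show "W = {0} \<or> W = V"
  proof (cases "W \<subseteq> {0}")
    case True
    moreover have "0 \<in> W" using W vs.subspace_0 by (simp add: M.submodule_def)
    ultimately show ?thesis by blast
  next
    case False
    then obtain x where x: "x \<in> W" "x \<noteq> 0" by blast
    then obtain lam where lam: "x lam \<noteq> 0" by (auto simp: fun_eq_iff)
    have "x \<in> V" using x W by (auto simp: M.submodule_def)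
    then have "lam \<in> B" using lam by (auto simp: in_V)
    then show ?thesis using submodule_generated[OF W] submodule_contains_delta[where x = x and lam = lam, OF W x(1) lam] by blast
  qed
qed

theorem highest_weight_act: "M.highest_weight_module (hw_plus q2 us n) (hw_minus q2 us n)"
  unfolding M.highest_weight_module_def M.highest_weight_vector_def
proof (intro exI conjI allI impI)
  let ?v = "delta (\<lambda>_ _. 0)"
  show V: "?v \<in> V" using delta_in_V[OF empty_in_B] .
  show "W = V" if "M.submodule W \<and> ?v \<in> W" for W using submodule_generated[OF _ empty_in_B] that by blast
  show "act (Gen_f i) ?v = 0" for i
  proof
    fix mu
    obtain N where N: "reach N 0 mu" using ex_reach by blast
    have "?v (plus_box mu r) = 0" for r
    proof -
      have "plus_box mu r (fst r) (snd r) \<noteq> 0" by (cases r) (simp add: plus_box_apply)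
      then have "plus_box mu r \<noteq> (\<lambda>_ _. 0)" by auto
      then show ?thesis by (simp only: delta_def if_False)
    qed
    then show "act (Gen_f i) ?v mu = 0 mu" unfolding act_f_coordinate[OF N finitely_supported_delta] by simp
  qed
  show "act (Gen_psip i) ?v = fun_scale (fps_nth (hw_plus q2 us n) i) ?v"
    "act (Gen_psim i) ?v = fun_scale (fps_nth (hw_minus q2 us n) i) ?v" for i
    unfolding eigenvalue_empty[symmetric]
    by (rule ext, simp add: act_psi[OF V] fun_scale_def, simp add: delta_def)+
qed

end

theorem theorem3p8:
  fixes q1 q2 q3 u :: complex
    and n :: nat
    and a b :: "nat \<Rightarrow> nat"
    and p' p :: int
  assumes "q1 \<noteq> 0" and "q2 \<noteq> 0" and "q3 \<noteq> 0"
    and "q1 * q2 * q3 = 1"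
    and "\<forall>q\<in>{q1, q2, q3}. \<forall>k::nat. k > 0 \<longrightarrow> q ^ k \<noteq> 1"
    and "u \<noteq> 0"
    and "n \<ge> 2"
    and "p' \<noteq> p"
    and "int (a n) = p' - 1 - (\<Sum>i = 1..n - 1. int (a i) + 1)"
    and "int (b n) = p - 1 - (\<Sum>i = 1..n - 1. int (b i) + 1)"
    and "\<forall>x y :: int. q1 powi x * q3 powi y = 1 \<longleftrightarrow> (\<exists>\<kappa>::int. x = p' * \<kappa> \<and> y = p * \<kappa>)"
    and "p > int n"
  defines "M \<equiv> resonant_space n a b"
    and "\<rho> \<equiv> resonant_action q1 q3 u n a b"
    and "us \<equiv> special_u q1 q3 a b u"
  shows "resonant_coeffs_well_defined q1 q3 u n a b
    \<and> toroidal_action.E_module q1 q2 q3 fun_scale M \<rho>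
    \<and> toroidal_action.irreducible_module fun_scale M \<rho>
    \<and> toroidal_action.tame fun_scale M \<rho>
    \<and> toroidal_action.highest_weight_module fun_scale M \<rho> (hw_plus q2 us n) (hw_minus q2 us n)"
proof -
  interpret R: resonance q1 q2 q3 u n a b p' p
    using assms(1-12) by unfold_locales auto
  have M: "M = R.V" by (simp add: M_def resonant_space_def R.B_def)
  have \<rho>: "\<rho> = R.act" by (simp add: \<rho>_def R.act_def fun_eq_iff)
  have us: "us = R.us" by (simp add: us_def R.us_def)
  have "resonant_coeffs_well_defined q1 q3 u n a b"
    unfolding resonant_coeffs_well_defined_def using R.all_coefficients_regular by (auto simp: R.B_def)
  then show ?thesis unfolding M \<rho> us
    using R.E_module_act R.irreducible_act R.tame_act R.highest_weight_act by blast
qed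

end
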